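(* Let $H$ and $U$ be separable real Hilbert spaces, $T\in(0,\infty)$, $M\in\mathbb{N}$, $\tau=T/M$, $t_m=m\tau$, and let $\{W(t)\}_{t\in[0,T]}$ be a cylindrical $I_U$-Wiener process on a probability space $(\Omega,\mathcal{F},\mathbb{P})$ with a normal filtration $\{\mathcal{F}_t\}_{t\in[0,T]}$. Let $n\in\mathbb{N}$, and let $H_n\subset H$ be a finite dimensional linear subspace with the inner product induced from $H$. Let $A_n\colon H_n\to H_n$ be a bounded linear operator generating the strongly continuous semigroup $E_n(t)=e^{tA_n}$, $t\ge 0$, in $H_n$, such that $E_n(-t)=e^{-tA_n}$ is well defined in $H_n$ and $(E_n(t))^{-1}=E_n(-t)$ for all $t\ge 0$. Let $X_0^n\in H_n$ (deterministic), $F_n\in\mathcal{C}_b^2(H_n,H_n)$ and $B_n\in\mathcal{L}_2(U,H_n)$. Let $X^n$ be the mild solution of $$\mathrm{d}X^n(t)=A_nX^n(t)\,\mathrm{d}t+F_n(X^n(t))\,\mathrm{d}t+B_n\,\mathrm{d}W(t),\quad t\in(0,T],\qquad X^n(0)=X_0^n,$$ and let $Y^n_m$, $m=0,\dots,M$, be given by the exponential Euler scheme $$Y^n_{m+1}=E_n(\tau)\big(Y^n_m+\tau F_n(Y^n_m)+B_n\Delta W_m\big),\quad Y^n_0=X_0^n,\quad m=0,1,\dots,M-1.$$ Define, for $m=0,\dots,M-1$ and $t\in[t_m,t_{m+1}]$, the continuous extension $$\tilde Y^n(t)=E_n(t-t_m)\big[Y^n_m+F_n(Y^n_m)(t-t_m)+B_n(W(t)-W(t_m))\big].$$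 Then for every $\Phi\in\mathcal{C}_b^2(H;\mathbb{R})$, with $\mu^n(t,x)=\mathbb{E}[\Phi(X^n(t,x))]$ for $t\in[0,T]$, $x\in H_n$, one has $$\mathbb{E}[\Phi(Y^n_M)]-\mathbb{E}[\Phi(X^n(T))]=\sum_{m=0}^{M-1}\bigg\{\int_{t_m}^{t_{m+1}}\mathbb{E}\Big[\Big\langle D\mu^n(T-t,\tilde Y^n(t)),\,E_n(t-t_m)F_n(Y^n_m)-F_n(\tilde Y^n(t))\Big\rangle_H\Big]\mathrm{d}t$$ $$\qquad+\tfrac12\int_{t_m}^{t_{m+1}}\mathbb{E}\Big[\mathrm{Tr}\Big\{D^2\mu^n(T-t,\tilde Y^n(t))\Big(E_n(t-t_m)B_n\big(E_n(t-t_m)B_n\big)^*-B_n(B_n)^*\Big)\Big\}\Big]\mathrm{d}t\bigg\}.$$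
   Context: $\mathcal{C}_b^k(V_1,V_2)$ (also written $\mathcal{C}_b^k(V_1;V_2)$) denotes the space of not necessarily bounded mappings from $V_1$ to $V_2$ that have continuous and bounded Fréchet derivatives up to order $k$ (so the derivatives of orders $1,\dots,k$ are bounded, not the mapping itself). $\mathcal{L}_2(U,H_n)$ is the space of Hilbert-Schmidt operators from $U$ to $H_n$. $\mathrm{Tr}$ is the trace and $*$ the adjoint. $\Delta W_m$ is the Wiener increment on $[t_m,t_{m+1}]$, with $E_n(\tau)B_n\Delta W_m:=\int_{t_m}^{t_{m+1}}E_n(\tau)B_n\,\mathrm{d}W(s)$ and $E_n(t-t_m)B_n(W(t)-W(t_m)):=\int_{t_m}^{t}E_n(t-t_m)B_n\,\mathrm{d}W(s)$. The mild solution is the process satisfying, almost surely for each $t\in[0,T]$, $X^n(t)=E_n(t)X_0^n+\int_0^tE_n(t-s)F_n(X^n(s))\,\mathrm{d}s+\int_0^tE_n(t-s)B_n\,\mathrm{d}W(s)$ (it exists and is unique under the stated hypotheses); $X^n(t,x)$ denotes the mild solution with initial value $X^n_0=x\in H_n$. $D\mu^n(t,x)$ and $D^2\mu^n(t,x)$ are the first and second derivatives of $\mu^n$ with respect to $x\in H_n$, identified through the Riesz representation theorem with an element of $H_n$ and a bounded linear operator on $H_n$, respectively. *)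

theory Defs
  imports "HOL-Probability.Probability"
begin

subsection \<open>Calculus on a linear subspace\<close>

definition bounded_linear_on :: "'a::real_normed_vector set \<Rightarrow> 'b::real_normed_vector set \<Rightarrow> ('a \<Rightarrow> 'b) \<Rightarrow> bool"
  where "bounded_linear_on V V' L \<longleftrightarrow>
    (\<forall>x\<in>V. L x \<in> V') \<and>
    (\<forall>x\<in>V. \<forall>y\<in>V. L (x + y) = L x + L y) \<and>
    (\<forall>c. \<forall>x\<in>V. L (c *\<^sub>R x) = c *\<^sub>R L x) \<and>
    (\<exists>K. \<forall>x\<in>V. norm (L x) \<le> K * norm x)"

text \<open>The class \<open>C\<^sub>b\<^sup>2(V, V')\<close> for linear subspaces \<open>V\<close>, \<open>V'\<close>: the derivatives of orders 1 and 2 exist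
  along \<open>V\<close>, are continuous and bounded in operator norm; the function itself may be unbounded.
  The operators \<open>D1 x\<close>, \<open>D2 x\<close> live on the ambient space, but only their restrictions
  to \<open>V\<close> are constrained by differentiability within \<open>V\<close>.  If \<open>V\<close> is the whole space or a
  finite-dimensional subspace of a Hilbert space, this is the intrinsic notion on \<open>V\<close>: precomposing
  with the orthogonal projection onto \<open>V\<close> extends an operator on \<open>V\<close> without changing its norm.\<close>

definition Cb2 :: "'a::real_normed_vector set \<Rightarrow> 'b::real_normed_vector set \<Rightarrow> ('a \<Rightarrow> 'b) \<Rightarrow> bool"
  where "Cb2 V V' f \<longleftrightarrow> f ` V \<subseteq> V' \<and>
    (\<exists>(D1 :: 'a \<Rightarrow> 'a \<Rightarrow>\<^sub>L 'b) (D2 :: 'a \<Rightarrow> 'a \<Rightarrow>\<^sub>L 'a \<Rightarrow>\<^sub>L 'b).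
      (\<forall>x\<in>V. (f has_derivative blinfun_apply (D1 x)) (at x within V)) \<and>
      (\<forall>x\<in>V. (D1 has_derivative blinfun_apply (D2 x)) (at x within V)) \<and>
      continuous_on V D1 \<and> continuous_on V D2 \<and>
      bounded (D1 ` V) \<and> bounded (D2 ` V))"

text \<open>First derivative along \<open>V\<close> as an element of \<open>V\<close> (Riesz), and second derivative along
  \<open>V\<close> as an operator on \<open>V\<close>; since the Riesz map is linear and isometric, the latter is the
  derivative of the gradient.  Only the values of \<open>hess_on V f x\<close> on \<open>V\<close> are meaningful.\<close>

definition grad_on :: "'a::real_inner set \<Rightarrow> ('a \<Rightarrow> real) \<Rightarrow> 'a \<Rightarrow> 'a"
  where "grad_on V f x = (THE g. g \<in> V \<and> (f has_derivative (\<lambda>h. g \<bullet> h)) (at x within V))"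

definition hess_on :: "'a::real_inner set \<Rightarrow> ('a \<Rightarrow> real) \<Rightarrow> 'a \<Rightarrow> 'a \<Rightarrow> 'a"
  where "hess_on V f x = frechet_derivative (grad_on V f) (at x within V)"


subsection \<open>Operators\<close>

definition orthonormal_basis_of :: "'a::real_inner set \<Rightarrow> 'a set \<Rightarrow> bool"
  where "orthonormal_basis_of V B \<longleftrightarrow>
    pairwise orthogonal B \<and> (\<forall>b\<in>B. norm b = 1) \<and> closure (span B) = V"

text \<open>Trace of an operator on a finite-dimensional subspace \<open>V\<close>; any orthonormal basis gives the
  same value.\<close>

definition trace_on :: "'a::real_inner set \<Rightarrow> ('a \<Rightarrow> 'a) \<Rightarrow> real"
  where "trace_on V L = (\<Sum>b\<in>(SOME B. orthonormal_basis_of V B). L b \<bullet> b)"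

text \<open>Squared Hilbert--Schmidt norm.\<close>

definition hs_norm_sq :: "('u::real_inner \<Rightarrow> 'a::real_inner) \<Rightarrow> ennreal"
  where "hs_norm_sq L =
    (\<integral>\<^sup>+ e. ennreal ((norm (L e))\<^sup>2) \<partial>count_space (SOME B. orthonormal_basis_of UNIV B))"

definition hilbert_schmidt :: "'a::real_inner set \<Rightarrow> ('u::real_inner \<Rightarrow> 'a) \<Rightarrow> bool"
  where "hilbert_schmidt V L \<longleftrightarrow> bounded_linear L \<and> range L \<subseteq> V \<and> hs_norm_sq L < \<infinity>"

definition exp_op :: "('a::real_normed_vector \<Rightarrow> 'a) \<Rightarrow> real \<Rightarrow> 'a \<Rightarrow> 'a"
  where "exp_op A t x = (\<Sum>k. (t ^ k / fact k) *\<^sub>R (A ^^ k) x)"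


subsection \<open>Cylindrical Wiener process and Wiener integral\<close>

definition normal_filtration :: "'w measure \<Rightarrow> real \<Rightarrow> (real \<Rightarrow> 'w measure) \<Rightarrow> bool"
  where "normal_filtration P T \<F> \<longleftrightarrow>
    (\<forall>t\<in>{0..T}. subalgebra P (\<F> t)) \<and>
    (\<forall>s\<in>{0..T}. \<forall>t\<in>{s..T}. sets (\<F> s) \<subseteq> sets (\<F> t)) \<and>
    null_sets P \<subseteq> sets (\<F> 0) \<and>
    (\<forall>t\<in>{0..<T}. sets (\<F> t) = (\<Inter>s\<in>{t<..T}. sets (\<F> s)))"

text \<open>A cylindrical \<open>I\<^sub>U\<close>-Wiener process does not take values in \<open>U\<close>; it is represented by the
  real random variables \<open>W t u\<close>, to be thought of as \<open>\<langle>W(t), u\<rangle>\<close>.  For every \<open>u\<close> they form a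
  Brownian motion relative to the filtration with variance \<open>t \<parallel>u\<parallel>\<^sup>2\<close>, and they are linear in \<open>u\<close>, so that
  the covariance of \<open>W s u\<close> and \<open>W t v\<close> is \<open>min s t * (u \<bullet> v)\<close>.\<close>

definition cylindrical_wiener ::
    "'w measure \<Rightarrow> real \<Rightarrow> (real \<Rightarrow> 'w measure) \<Rightarrow> (real \<Rightarrow> 'u::real_inner \<Rightarrow> 'w \<Rightarrow> real) \<Rightarrow> bool"
  where "cylindrical_wiener P T \<F> W \<longleftrightarrow>
    (\<forall>t\<in>{0..T}. \<forall>u. W t u \<in> borel_measurable (\<F> t)) \<and>
    (\<forall>t\<in>{0..T}. \<forall>a b u v. AE \<omega> in P. W t (a *\<^sub>R u + b *\<^sub>R v) \<omega> = a * W t u \<omega> + b * W t v \<omega>) \<and>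
    (\<forall>u. AE \<omega> in P. W 0 u \<omega> = 0) \<and>
    (\<forall>u. AE \<omega> in P. continuous_on {0..T} (\<lambda>t. W t u \<omega>)) \<and>
    (\<forall>s t u. 0 \<le> s \<and> s < t \<and> t \<le> T \<longrightarrow>
      prob_space.indep_set P (sets (\<F> s))
        (sets (vimage_algebra (space P) (\<lambda>\<omega>. W t u \<omega> - W s u \<omega>) borel)) \<and>
      (u \<noteq> 0 \<longrightarrow> distributed P lborel (\<lambda>\<omega>. W t u \<omega> - W s u \<omega>)
        (\<lambda>y. ennreal (normal_density 0 (sqrt (t - s) * norm u) y))))"

text \<open>A list entry \<open>(p, q, u, h)\<close> stands for the operator-valued step function
  that maps \<open>s\<close> to \<open>h \<otimes> u\<close> on \<open>(p, q]\<close> and to 0 elsewhere; its integral is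
  \<open>\<langle>W(q) - W(p), u\<rangle> h\<close>.\<close>

definition elem_integrand ::
    "(real \<times> real \<times> 'u::real_inner \<times> 'a::real_inner) list \<Rightarrow> real \<Rightarrow> 'u \<Rightarrow> 'a"
  where "elem_integrand S s v =
    (\<Sum>(p, q, u, h)\<leftarrow>S. (indicator {p<..q} s * (u \<bullet> v)) *\<^sub>R h)"

definition elem_integral :: "(real \<Rightarrow> 'u::real_inner \<Rightarrow> 'w \<Rightarrow> real) \<Rightarrow>
    (real \<times> real \<times> 'u \<times> 'a::real_inner) list \<Rightarrow> 'w \<Rightarrow> 'a"
  where "elem_integral W S \<omega> = (\<Sum>(p, q, u, h)\<leftarrow>S. (W q u \<omega> - W p u \<omega>) *\<^sub>R h)"

text \<open>\<open>I\<close> is (a version of) the integral of the deterministic integrand \<open>G\<close>, with values in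
  the Hilbert--Schmidt operators into \<open>V\<close>, over \<open>[a, b]\<close>: the \<open>L\<^sup>2(\<Omega>; V)\<close>-limit of elementary integrals
  whose integrands converge to \<open>G\<close> in \<open>L\<^sup>2([a, b]; L\<^sub>2(U, V))\<close>.\<close>

definition has_wiener_integral :: "'w measure \<Rightarrow> (real \<Rightarrow> 'u::real_inner \<Rightarrow> 'w \<Rightarrow> real) \<Rightarrow>
    'a::real_inner set \<Rightarrow> real \<Rightarrow> real \<Rightarrow> (real \<Rightarrow> 'u \<Rightarrow> 'a) \<Rightarrow> ('w \<Rightarrow> 'a) \<Rightarrow> bool"
  where "has_wiener_integral P W V a b G I \<longleftrightarrow>
    I \<in> borel_measurable P \<and> (\<forall>\<omega>\<in>space P. I \<omega> \<in> V) \<and>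
    (\<exists>S :: nat \<Rightarrow> (real \<times> real \<times> 'u \<times> 'a) list.
      (\<forall>k. \<forall>(p, q, u, h)\<in>set (S k). a \<le> p \<and> p \<le> q \<and> q \<le> b \<and> h \<in> V) \<and>
      (\<lambda>k. \<integral>\<^sup>+ s\<in>{a..b}. hs_norm_sq (\<lambda>v. G s v - elem_integrand (S k) s v) \<partial>lborel)
        \<longlonglongrightarrow> 0 \<and>
      (\<lambda>k. \<integral>\<^sup>+ \<omega>. ennreal ((norm (I \<omega> - elem_integral W (S k) \<omega>))\<^sup>2) \<partial>P) \<longlonglongrightarrow> 0)"

definition wiener_integral :: "'w measure \<Rightarrow> (real \<Rightarrow> 'u::real_inner \<Rightarrow> 'w \<Rightarrow> real) \<Rightarrow>
    'a::real_inner set \<Rightarrow> real \<Rightarrow> real \<Rightarrow> (real \<Rightarrow> 'u \<Rightarrow> 'a) \<Rightarrow> 'w \<Rightarrow> 'a"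
  where "wiener_integral P W V a b G = (SOME I. has_wiener_integral P W V a b G I)"


subsection \<open>Mild solution\<close>

definition random_variable_in :: "'w measure \<Rightarrow> 'a::topological_space set \<Rightarrow> ('w \<Rightarrow> 'a) \<Rightarrow> bool"
  where "random_variable_in P V Z \<longleftrightarrow> Z \<in> borel_measurable P \<and> (\<forall>\<omega>\<in>space P. Z \<omega> \<in> V)"

definition mild_solution ::
    "'w measure \<Rightarrow> real \<Rightarrow> (real \<Rightarrow> 'w measure) \<Rightarrow> (real \<Rightarrow> 'u::real_inner \<Rightarrow> 'w \<Rightarrow> real) \<Rightarrow>
     'a::{real_inner, banach, second_countable_topology} set \<Rightarrow>
     (real \<Rightarrow> 'a \<Rightarrow> 'a) \<Rightarrow> ('a \<Rightarrow> 'a) \<Rightarrow> ('u \<Rightarrow> 'a) \<Rightarrow> 'a \<Rightarrow> (real \<Rightarrow> 'w \<Rightarrow> 'a) \<Rightarrow> bool"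
  where "mild_solution P T \<F> W V E F B x X \<longleftrightarrow>
    (\<forall>t\<in>{0..T}. X t \<in> borel_measurable (\<F> t)) \<and>
    (\<forall>t\<in>{0..T}. \<forall>\<omega>\<in>space P. X t \<omega> \<in> V) \<and>
    (\<lambda>(t, \<omega>). X t \<omega>) \<in> borel_measurable (restrict_space borel {0..T} \<Otimes>\<^sub>M P) \<and>
    (\<forall>t\<in>{0..T}. AE \<omega> in P.
      set_integrable lborel {0..t} (\<lambda>s. E (t - s) (F (X s \<omega>))) \<and>
      X t \<omega> = E t x + (\<integral>s\<in>{0..t}. E (t - s) (F (X s \<omega>)) \<partial>lborel)
        + wiener_integral P W V 0 t (\<lambda>s u. E (t - s) (B u)) \<omega>)"

end

theory Submission
  imports Defs
begin

text \<open>The expectation \<open>\<phi>(t) = E[\<mu>(T - t, Y(t))]\<close> along the interpolated scheme is differentiated in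
  \<open>t\<close> and integrated over each step; the boundary terms telescope to the weak error.  Ito's formula and
  the Kolmogorov equation are bypassed.  Since the noise is additive, the mild solution is almost surely
  the pathwise solution of an integral equation driven by a continuous path, so it forms a \<open>C\<^sup>2\<close> flow,
  it satisfies the Markov property, and \<open>\<mu>\<close> can be differentiated twice under the expectation.  For
  \<open>s < t\<close> both \<open>\<phi>(t)\<close> and, by the Markov property, \<open>\<phi>(s)\<close> are expectations of the same function
  \<open>\<mu>(T - t, _)\<close>, evaluated at the point reached from \<open>Y(s)\<close> by the scheme and by the exact flow
  respectively.  A second order Taylor expansion around \<open>Y(s)\<close>, with the increment of the noise
  independent of \<open>Y(s)\<close>, gives the difference quotient; the second spatial derivative only needs to be
  continuous, because the remainder is controlled by the fourth moment of the increment.\<close>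

subsection \<open>Integral equations with additive forcing\<close>

text \<open>Three obstacles shape the details. \<open>Hn\<close> is a set, not a type, and
  derivatives along it are awkward; composing \<open>F\<close> and \<open>A\<close> with the
  orthogonal projection onto \<open>Hn\<close> gives a drift \<open>G\<close> that is C2 on the
  whole Hilbert space and agrees with \<open>A + F\<close> on \<open>Hn\<close>. Gradient, Hessian
  and trace along \<open>Hn\<close> are recovered only at the end. The hypotheses on
  \<open>W\<close> concern one direction \<open>u\<close> at a time; joint laws and independence of
  vector increments come from linearity in \<open>u\<close> and characteristic functions. Mild
  solution and Wiener integral are determined only almost surely, separately for each time, so each
  is compared with an explicit pathwise object built from the continuous path \<open>w\<close>.
  Pathwise solutions are themselves obtained by choice; their measurability and the Markov property
  are read off from Euler polygons, which depend on finitely many increments and converge along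
  every path. In the difference of the two Taylor expansions the contribution of \<open>A\<close>
  cancels, which leaves exactly the drift defect and the difference of the two covariances.\<close>

lemma gronwall:
 fixes g :: "real => real"
 assumes g: "continuous_on {0..T} g" and L: "0 \<le> L"
  and le: "!!t. t \<in> {0..T} ==> g t \<le> a + L * integral {0..t} g"
  and t: "t \<in> {0..T}"
 shows "g t \<le> a * exp (L * t)"
proof -
 define I where "I t = integral {0..t} g" for t
 have dI: "(I has_real_derivative g s) (at s within {0..T})" if "s \<in> {0..T}" for s
  unfolding I_def using integral_has_real_derivative[OF g that] .
 \<comment> \<open>Integrating factor: the derivative of \<open>h\<close> is a nonnegative multiple
   of \<open>g s - (a + L * I s)\<close>, which the hypothesis makes nonpositive.\<close>
 define h where "h s = exp (- L * s) * (a + L * I s)" for s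
 have dh: "(h has_real_derivative (L * exp (- L * s) * (g s - (a + L * I s)))) (at s within {0..T})"
  if "s \<in> {0..T}" for s
  unfolding h_def using dI[OF that]
  by (auto intro!: derivative_eq_intros simp: algebra_simps)
 have "h t \<le> h 0"
 proof (rule DERIV_nonpos_imp_decreasing_open[of 0 t h])
  show "0 \<le> t" using t by auto
  show "\<exists>y. DERIV h x :> y \<and> y \<le> 0" if x: "0 < x" "x < t" for x
  proof -
   have xT: "x \<in> {0..T}" using x t by auto
   have "at x within {0..T} = at x"
    by (rule at_within_interior) (use x t in auto)
   then have "DERIV h x :> L * exp (- L * x) * (g x - (a + L * I x))"
    using dh[OF xT] by simp
   moreover have "L * exp (- L * x) * (g x - (a + L * I x)) \<le> 0"
    using le[OF xT] L unfolding I_def by (intro mult_nonneg_nonpos) auto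
   ultimately show ?thesis by blast
  qed
  have "continuous_on {0..T} h"
   by (rule DERIV_continuous_on[OF dh])
  then show "continuous_on {0..t} h"
   by (rule continuous_on_subset) (use t in auto)
 qed
 then have "a + L * I t \<le> a * exp (L * t)"
  by (simp add: h_def I_def exp_minus field_simps)
 then show ?thesis using le[OF t] unfolding I_def by simp
qed

lemma continuous_on_compose_pair:
 assumes "continuous_on (A \<times> UNIV) (%(s, y). f s y)" and "continuous_on A y"
 shows "continuous_on A (%s. f s (y s))"
proof -
 have "continuous_on A (%s. (s, y s))"
  by (intro continuous_intros assms)
 from continuous_on_compose2[OF assms(1) this] show ?thesis by auto
qed

text \<open>Picard's contraction in a single global step. The unknown is \<open>u = y / w\<close>
  with the exponential weight \<open>w t = exp (2 * K * t)\<close>; in the sup norm of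
  \<open>u\<close> the Picard map has contraction factor 1/2 whatever the length \<open>T\<close>,
  so no local solutions have to be glued.\<close>

lemma ode_exists:
 fixes f :: "real => 'a::banach => 'a"
 assumes T: "0 \<le> T" and f: "continuous_on ({0..T} \<times> UNIV) (%(s, y). f s y)"
  and lip: "!!s y z. s \<in> {0..T} ==> norm (f s y - f s z) \<le> L * norm (y - z)"
 shows "\<exists>y. continuous_on {0..T} y \<and> (\<forall>t\<in>{0..T}. y t = y0 + integral {0..t} (%s. f s (y s)))"
proof -
 \<comment> \<open>No sign is assumed for \<open>L\<close>; this constant is positive and still a
   Lipschitz constant.\<close>
 define K where "K = \<bar>L\<bar> + 1"
 have K: "K > 0" by (simp add: K_def)
 have lipK: "norm (f s y - f s z) \<le> K * norm (y - z)" if "s \<in> {0..T}" for s y z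
  using lip[OF that, of y z] mult_right_mono[of L K "norm (y - z)"] norm_ge_zero[of "y - z"] unfolding K_def by linarith
 \<comment> \<open>Clamping time to [0, T] turns functions on the interval into bounded continuous
   functions on the whole line, which form a complete space as a type.\<close>
 define c where "c t = max 0 (min t T)" for t
 have c: "c t \<in> {0..T}" for t using T by (auto simp: c_def)
 have c_id: "c t = t" if "t \<in> {0..T}" for t using that by (auto simp: c_def)
 have contc: "continuous_on UNIV c" unfolding c_def by (intro continuous_intros)
 define w where "w t = exp (2 * K * t)" for t
 have contw: "continuous_on S w" for S unfolding w_def by (intro continuous_intros)
 have contfu: "continuous_on {0..T} (%s. f s (w s *\<^sub>R apply_bcontfun u s))" for u :: "real \<Rightarrow>\<^sub>C 'a"
  by (rule continuous_on_compose_pair[OF f]) (intro continuous_intros contw continuous_on_apply_bcontfun)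
 define \<Gamma>0 where "\<Gamma>0 u t = (1 / w (c t)) *\<^sub>R (y0 + integral {0..c t} (%s. f s (w s *\<^sub>R apply_bcontfun u s)))" for u t
 have mem: "\<Gamma>0 u \<in> bcontfun" for u
 proof -
  have c1: "continuous_on {0..T} (%t. (1 / w t) *\<^sub>R (y0 + integral {0..t} (%s. f s (w s *\<^sub>R apply_bcontfun u s))))"
   by (intro continuous_intros contw indefinite_integral_continuous_1 integrable_continuous_real contfu)
    (simp add: w_def)
  have c2: "continuous_on UNIV (\<Gamma>0 u)"
   unfolding \<Gamma>0_def by (rule continuous_on_compose2[OF c1 contc]) (use c in blast)
  have "range (\<Gamma>0 u) \<subseteq> (%t. (1 / w t) *\<^sub>R (y0 + integral {0..t} (%s. f s (w s *\<^sub>R apply_bcontfun u s)))) ` {0..T}"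
   unfolding \<Gamma>0_def by (intro image_subsetI) (rule image_eqI[OF refl c])
  then have "bounded (range (\<Gamma>0 u))"
   using compact_imp_bounded[OF compact_continuous_image[OF c1 compact_Icc]] bounded_subset by blast
  with c2 show ?thesis by (simp add: bcontfun_def)
 qed
 define \<Gamma> where "\<Gamma> u = Bcontfun (\<Gamma>0 u)" for u
 have ap: "apply_bcontfun (\<Gamma> u) t = \<Gamma>0 u t" for u t
  unfolding \<Gamma>_def using Bcontfun_inverse[OF mem] by simp
 have "\<exists>!u. \<Gamma> u = u"
 proof (rule banach_fix_type[of "1/2"])
  show "\<forall>u v. dist (\<Gamma> u) (\<Gamma> v) \<le> 1/2 * dist u v"
  proof (intro allI dist_bound)
   fix u v :: "real \<Rightarrow>\<^sub>C 'a" and t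
   let ?d = "dist u v"
   let ?F = "%u s. f s (w s *\<^sub>R apply_bcontfun u s)"
   have sub: "{0..c t} \<subseteq> {0..T}" using c[of t] by auto
   have int: "?F u integrable_on {0..c t}" for u
    by (intro integrable_continuous_real continuous_on_subset[OF contfu sub])
   have d0: "0 \<le> c t" using c[of t] by auto
   \<comment> \<open>Source of the factor 1/2: the integral of \<open>K * w\<close> up to
     \<open>t\<close> is \<open>(w t - w 0) / 2\<close>, and division by the weight
     \<open>w t\<close> leaves at most 1/2.\<close>
   have hi: "((%s. K * w s * ?d) has_integral (w (c t) * ?d / 2 - w 0 * ?d / 2)) {0..c t}"
    by (rule fundamental_theorem_of_calculus[OF d0])
     (auto intro!: derivative_eq_intros simp: w_def has_real_derivative_iff_has_vector_derivative[symmetric])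
   have "norm (integral {0..c t} (%s. ?F u s - ?F v s)) \<le> integral {0..c t} (%s. K * w s * ?d)"
   proof (rule integral_norm_bound_integral)
    show "(%s. ?F u s - ?F v s) integrable_on {0..c t}" by (intro integrable_diff int)
    show "(%s. K * w s * ?d) integrable_on {0..c t}" using hi by blast
    fix s assume s: "s \<in> {0..c t}"
    have "norm (?F u s - ?F v s) \<le> K * norm (w s *\<^sub>R apply_bcontfun u s - w s *\<^sub>R apply_bcontfun v s)"
     using lipK s sub by blast
    also have "\<dots> = K * w s * dist (apply_bcontfun u s) (apply_bcontfun v s)"
     by (simp add: w_def dist_norm flip: scaleR_diff_right)
    also have "\<dots> \<le> K * w s * ?d"
     using K by (intro mult_left_mono dist_bounded) (auto simp: w_def)
    finally show "norm (?F u s - ?F v s) \<le> K * w s * ?d" .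
   qed
   also have "\<dots> \<le> w (c t) * ?d / 2"
    using integral_unique[OF hi] by (simp add: w_def)
   finally have I: "norm (integral {0..c t} (?F u) - integral {0..c t} (?F v)) \<le> w (c t) * ?d / 2"
    by (simp add: integral_diff int)
   have "dist (apply_bcontfun (\<Gamma> u) t) (apply_bcontfun (\<Gamma> v) t)
     = (1 / w (c t)) * norm (integral {0..c t} (?F u) - integral {0..c t} (?F v))"
    unfolding ap \<Gamma>0_def dist_norm scaleR_diff_right[symmetric] by (simp add: w_def)
   also have "\<dots> \<le> (1 / w (c t)) * (w (c t) * ?d / 2)"
    by (rule mult_left_mono[OF I]) (simp add: w_def)
   also have "\<dots> = 1/2 * ?d" by (simp add: w_def)
   finally show "dist (apply_bcontfun (\<Gamma> u) t) (apply_bcontfun (\<Gamma> v) t) \<le> 1/2 * ?d" .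
  qed
 qed auto
 then obtain u where u: "\<Gamma> u = u" by blast
 define y where "y t = w t *\<^sub>R apply_bcontfun u t" for t
 have "continuous_on {0..T} y"
  unfolding y_def by (intro continuous_intros contw continuous_on_apply_bcontfun)
 moreover have "y t = y0 + integral {0..t} (%s. f s (y s))" if "t \<in> {0..T}" for t
 proof -
  have "y t = w t *\<^sub>R \<Gamma>0 u t" unfolding y_def using ap[of u t] u by simp
  then show ?thesis by (simp add: \<Gamma>0_def c_id[OF that] y_def w_def)
 qed
 ultimately show ?thesis by blast
qed

text \<open>Only one of the two points has to lie in \<open>K\<close>. Neighbourhoods of
  \<open>K\<close> need not be relatively compact here, so the radius is a Lebesgue number for the
  cover of \<open>K\<close> by open sets on which \<open>g\<close> oscillates by less than
  \<open>e\<close>.\<close>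

lemma uniform_continuity_near_compact:
 fixes g :: "'a::metric_space => 'b::metric_space"
 assumes g: "continuous_on UNIV g" and K: "compact K" and e: "0 < e"
 shows "\<exists>d>0. \<forall>p\<in>K. \<forall>q. dist p q < d \<longrightarrow> dist (g p) (g q) < e"
proof -
 let ?C = "{U. open U \<and> (\<forall>a\<in>U. \<forall>b\<in>U. dist (g a) (g b) < e)}"
 have "K \<subseteq> \<Union> ?C"
 proof
  fix x assume "x \<in> K"
  let ?U = "g -` ball (g x) (e / 2)"
  have "open ?U" by (rule open_vimage[OF open_ball g])
  moreover have "\<forall>a\<in>?U. \<forall>b\<in>?U. dist (g a) (g b) < e"
   by (auto intro: dist_triangle_half_r)
  moreover have "x \<in> ?U" using e by auto
  ultimately show "x \<in> \<Union> ?C" by blast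
 qed
 then obtain d where d: "d > 0" and sub: "!!x. x \<in> K ==> \<exists>U\<in>?C. ball x d \<subseteq> U"
  by (rule Heine_Borel_lemma[OF K]) auto
 have "dist (g p) (g q) < e" if pq: "p \<in> K" "dist p q < d" for p q
 proof -
  obtain U where "U \<in> ?C" "ball p d \<subseteq> U" using sub[OF pq(1)] by blast
  moreover have "p \<in> ball p d" "q \<in> ball p d" using pq d by auto
  ultimately show ?thesis by blast
 qed
 with d show ?thesis by blast
qed

text \<open>Integral form of "dz = G(z) dt + dm" for a forcing path \<open>m\<close> without any
  differentiability. \<open>m 0 = 0\<close> is not part of it, so in general
  \<open>z 0 = x + m 0\<close>.\<close>

definition solves :: "real => ('a::banach => 'a) => (real => 'a) => 'a => (real => 'a) => bool"
 where "solves T G m x z \<longleftrightarrow> continuous_on {0..T} z \<and>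
  (\<forall>t\<in>{0..T}. z t = x + integral {0..t} (%s. G (z s)) + m t)"

lemma integral_bound_within:
 fixes f :: "real => 'a::banach"
 assumes t: "t \<in> {0..T}" and f: "continuous_on {0..T} f" and g: "continuous_on {0..T} g"
  and le: "!!s. s \<in> {0..T} ==> norm (f s) \<le> a + L * g s" and a: "0 \<le> a"
 shows "norm (integral {0..t} f) \<le> a * T + L * integral {0..t} g"
proof -
 have sub: "{0..t} \<subseteq> {0..T}" using t by auto
 have gi: "g integrable_on {0..t}"
  by (intro integrable_continuous_real continuous_on_subset[OF g sub])
 have gi': "(%s. L * g s) integrable_on {0..t}"
  by (rule integrable_on_mult_right[OF gi])
 have "norm (integral {0..t} f) \<le> integral {0..t} (%s. a + L * g s)"
 proof (rule integral_norm_bound_integral)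
  show "f integrable_on {0..t}"
   by (intro integrable_continuous_real continuous_on_subset[OF f sub])
  show "(%s. a + L * g s) integrable_on {0..t}"
   by (intro integrable_add integrable_const_ivl gi')
 qed (use le sub in auto)
 also have "\<dots> = a * t + L * integral {0..t} g"
  using t integral_add[OF integrable_const_ivl gi', of a] by (simp add: mult.commute)
 also have "a * t \<le> a * T" using t a by (intro mult_left_mono) auto
 finally show ?thesis by simp
qed

text \<open>The shape in which Gronwall is applied to differences of solutions and to Taylor
  defects: \<open>a\<close> is the size of a source term (a linearization error), \<open>L\<close>
  the Lipschitz constant of the homogeneous part.\<close>

lemma gronwall_integral:
 fixes r f :: "real => 'a::banach"
 assumes r: "continuous_on {0..T} r" and f: "continuous_on {0..T} f"
  and eq: "!!t. t \<in> {0..T} ==> r t = y0 + integral {0..t} f"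
  and le: "!!s. s \<in> {0..T} ==> norm (f s) \<le> a + L * norm (r s)" and a: "0 \<le> a" and L: "0 \<le> L"
  and t: "t \<in> {0..T}"
 shows "norm (r t) \<le> (norm y0 + a * T) * exp (L * t)"
proof (rule gronwall[where g="%t. norm (r t)", OF _ L _ t])
 show cr: "continuous_on {0..T} (%t. norm (r t))" by (intro continuous_intros r)
 fix t assume t: "t \<in> {0..T}"
 have "norm (r t) \<le> norm y0 + norm (integral {0..t} f)"
  using eq[OF t] norm_triangle_ineq by metis
 also have "norm (integral {0..t} f) \<le> a * T + L * integral {0..t} (%s. norm (r s))"
  by (rule integral_bound_within[OF t f cr le a])
 finally show "norm (r t) \<le> norm y0 + a * T + L * integral {0..t} (%t. norm (r t))" by simp
qed

lemma gronwall_integral_T: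
 fixes r f :: "real => 'a::banach"
 assumes r: "continuous_on {0..T} r" and f: "continuous_on {0..T} f"
  and eq: "!!t. t \<in> {0..T} ==> r t = y0 + integral {0..t} f"
  and le: "!!s. s \<in> {0..T} ==> norm (f s) \<le> a + L * norm (r s)" and a: "0 \<le> a" and L: "0 \<le> L"
  and t: "t \<in> {0..T}"
 shows "norm (r t) \<le> (norm y0 + a * T) * exp (L * T)"
proof -
 have "0 \<le> T" using t by auto
 have "norm (r t) \<le> (norm y0 + a * T) * exp (L * t)"
  by (rule gronwall_integral[OF r f eq le a L t])
 also have "\<dots> \<le> (norm y0 + a * T) * exp (L * T)"
  using t L a \<open>0 \<le> T\<close> by (intro mult_left_mono) (auto intro: mult_left_mono)
 finally show ?thesis .
qed

lemma linearization_bound: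
 fixes f :: "'a::real_normed_vector => 'b::real_normed_vector"
 assumes df: "!!x. (f has_derivative blinfun_apply (Df x)) (at x)"
  and le: "!!q. q \<in> closed_segment a b ==> norm (Df q - Df a) \<le> e"
 shows "norm (f b - f a - Df a (b - a)) \<le> e * norm (b - a)"
proof -
 have "norm (f b - f a - Df a (b - a)) \<le> norm (b - a) * e"
 proof (rule differentiable_bound_linearization[where S="closed_segment a b" and f'="%x. blinfun_apply (Df x)"])
  show "a + t *\<^sub>R (b - a) \<in> closed_segment a b" if "t \<in> {0..1}" for t
   using that unfolding in_segment by (intro exI[of _ t]) (auto simp: algebra_simps)
  show "(f has_derivative blinfun_apply (Df x)) (at x within closed_segment a b)" for x
   by (rule has_derivative_at_withinI[OF df])
  show "onorm (blinfun_apply (Df x) - blinfun_apply (Df a)) \<le> e" if "x \<in> closed_segment a b" for x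
   using le[OF that] by (simp add: norm_blinfun.rep_eq minus_blinfun.rep_eq fun_diff_def)
 qed auto
 then show ?thesis by (simp add: mult.commute)
qed

lemma lipschitz_from_derivative:
 fixes f :: "'a::real_normed_vector => 'b::real_normed_vector"
 assumes df: "!!x. (f has_derivative blinfun_apply (Df x)) (at x)" and le: "!!x. norm (Df x) \<le> L"
 shows "norm (f y - f x) \<le> L * norm (y - x)"
proof (rule differentiable_bound[of UNIV])
 show "onorm (blinfun_apply (Df x)) \<le> L" for x using le by (simp add: norm_blinfun.rep_eq)
qed (use df in auto)

text \<open>Subtracting the forcing leaves for \<open>y = z - m\<close> an ordinary equation with
  right-hand side \<open>G (y + m s)\<close>, continuous in \<open>s\<close> and Lipschitz in
  \<open>y\<close>.\<close>

lemma solves_exists: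
 fixes G :: "'a::banach => 'a"
 assumes T: "0 \<le> T" and m: "continuous_on {0..T} m" and lip: "!!x y. norm (G x - G y) \<le> L * norm (x - y)"
 shows "\<exists>z. solves T G m x z"
proof -
 have cG: "continuous_on UNIV G"
 proof (rule lipschitz_on_continuous_on)
  have "norm (G x - G y) \<le> \<bar>L\<bar> * norm (x - y)" for x y
   using lip[of x y] by (rule order_trans) (intro mult_right_mono, auto)
  then show "\<bar>L\<bar>-lipschitz_on UNIV G" by (intro lipschitz_onI) (auto simp: dist_norm)
 qed
 have "continuous_on ({0..T} \<times> UNIV) (%(s, y). G (y + m s))"
  unfolding split_def
  by (intro continuous_on_compose2[OF cG] continuous_intros continuous_on_compose2[OF m]) auto
 moreover have "norm (G (y + m s) - G (z + m s)) \<le> L * norm (y - z)" for s y z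
  using lip[of "y + m s" "z + m s"] by simp
 ultimately obtain y where y: "continuous_on {0..T} y"
   "!!t. t \<in> {0..T} ==> y t = x + integral {0..t} (%s. G (y s + m s))"
  using ode_exists[OF T, of "%s y. G (y + m s)" L x] by blast
 have "solves T G m x (%t. y t + m t)"
  unfolding solves_def using y(2) by (auto intro!: continuous_intros y(1) m)
 then show ?thesis by blast
qed

lemma solves_lipschitz:
 fixes G :: "'a::banach => 'a"
 assumes G: "continuous_on UNIV G" and lip: "!!x y. norm (G x - G y) \<le> L * norm (x - y)" and L: "0 \<le> L"
  and z: "solves T G m x z" and z': "solves T G m x' z'" and t: "t \<in> {0..T}"
 shows "norm (z t - z' t) \<le> norm (x - x') * exp (L * T)"
proof -
 have c: "continuous_on {0..T} z" "continuous_on {0..T} z'" using z z' by (auto simp: solves_def)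
 have cG: "continuous_on {0..T} (%s. G (z s))" "continuous_on {0..T} (%s. G (z' s))"
  using c by (auto intro: continuous_on_compose2[OF G])
 have "norm (z t - z' t) \<le> (norm (x - x') + 0 * T) * exp (L * T)"
 proof (rule gronwall_integral_T[where f="%s. G (z s) - G (z' s)", OF _ _ _ _ order_refl L t])
  fix t assume t: "t \<in> {0..T}"
  then have sub: "{0..t} \<subseteq> {0..T}" by auto
  show "z t - z' t = x - x' + integral {0..t} (%s. G (z s) - G (z' s))"
   using z z' t
   by (simp add: solves_def integral_diff integrable_continuous_real continuous_on_subset[OF cG(1) sub]
     continuous_on_subset[OF cG(2) sub])
 qed (use lip in \<open>auto intro!: continuous_intros c cG\<close>)
 then show ?thesis by simp
qed

text \<open>Removing both \<open>x\<close> and \<open>m t\<close> isolates the contribution of the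
  drift, which is small with \<open>t\<close>; this is what later makes the drift part of an
  increment of order \<open>h\<close> although the noise part is larger.\<close>

lemma solves_growth:
 fixes G :: "'a::banach => 'a"
 assumes G: "continuous_on UNIV G" and lip: "!!x y. norm (G x - G y) \<le> L * norm (x - y)" and L: "0 \<le> L"
  and m: "continuous_on {0..T} m" and z: "solves T G m x z" and t: "t \<in> {0..T}"
 shows "norm (z t - x - m t) \<le> (t * norm (G x) + L * integral {0..t} (%s. norm (m s))) * exp (L * t)"
proof -
 have sub: "{0..t} \<subseteq> {0..T}" using t by auto
 have c: "continuous_on {0..T} z" using z by (auto simp: solves_def)
 have cG: "continuous_on {0..T} (%s. G (z s))"
  using c by (auto intro: continuous_on_compose2[OF G])
 let ?r = "%s. norm (z s - x - m s)"
 have cr: "continuous_on {0..t} ?r"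
  by (intro continuous_intros continuous_on_subset[OF c sub] continuous_on_subset[OF m sub])
 have cm: "continuous_on {0..t} (%s. norm (m s))"
  by (intro continuous_intros continuous_on_subset[OF m sub])
 show ?thesis
 \<comment> \<open>Gronwall is applied on [0, t] rather than [0, T], so that the constants shrink
   with \<open>t\<close>.\<close>
 proof (rule gronwall[OF cr L])
  show "t \<in> {0..t}" using t by auto
  fix u assume u: "u \<in> {0..t}"
  then have subu: "{0..u} \<subseteq> {0..t}" and uT: "u \<in> {0..T}" using t by auto
  have ii: "?r integrable_on {0..u}" "(%s. norm (m s)) integrable_on {0..u}"
   by (intro integrable_continuous_real continuous_on_subset[OF cr subu] continuous_on_subset[OF cm subu])+
  have i1: "(%s. L * norm (m s)) integrable_on {0..u}" and i2: "(%s. L * ?r s) integrable_on {0..u}"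
   by (intro integrable_on_mult_right ii)+
  have "?r u = norm (integral {0..u} (%s. G (z s)))"
   using z uT by (simp add: solves_def)
  also have "\<dots> \<le> integral {0..u} (%s. norm (G x) + L * norm (m s) + L * ?r s)"
  proof (rule integral_norm_bound_integral)
   show "(%s. G (z s)) integrable_on {0..u}"
    using uT by (intro integrable_continuous_real continuous_on_subset[OF cG]) auto
   show "(%s. norm (G x) + L * norm (m s) + L * ?r s) integrable_on {0..u}"
    by (intro integrable_add integrable_const_ivl i1 i2)
   fix s
   have "norm (G (z s)) \<le> norm (G x) + norm (G (z s) - G x)" by (rule norm_triangle_sub)
   also have "norm (G (z s) - G x) \<le> L * norm (z s - x)" by (rule lip)
   also have "\<dots> \<le> L * (norm (m s) + ?r s)"
    using L norm_triangle_ineq[of "m s" "z s - x - m s"] by (intro mult_left_mono) auto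
   finally show "norm (G (z s)) \<le> norm (G x) + L * norm (m s) + L * ?r s" by (simp add: algebra_simps)
  qed
  also have "\<dots> = u * norm (G x) + L * integral {0..u} (%s. norm (m s)) + L * integral {0..u} ?r"
   using u by (simp add: integral_add integrable_add integrable_const_ivl i1 i2)
  also have "\<dots> \<le> t * norm (G x) + L * integral {0..t} (%s. norm (m s)) + L * integral {0..u} ?r"
   using u L integral_subset_le[OF subu ii(2) integrable_continuous_real[OF cm]]
   by (intro add_mono mult_right_mono mult_left_mono) auto
  finally show "?r u \<le> t * norm (G x) + L * integral {0..t} (%s. norm (m s)) + L * integral {0..u} ?r" .
 qed
qed

text \<open>Restarting at time \<open>h\<close> only replaces the forcing by its increments after
  \<open>h\<close>. With uniqueness this becomes the flow property \<open>Z_flow\<close>.\<close>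

lemma solves_shift:
 fixes G :: "'a::banach => 'a"
 assumes G: "continuous_on UNIV G" and z: "solves T G m x z" and h: "h \<in> {0..T}"
 shows "solves (T - h) G (%r. m (h + r) - m h) (z h) (%r. z (h + r))"
proof -
 have c: "continuous_on {0..T} z" using z by (auto simp: solves_def)
 have cG: "continuous_on {0..T} (%s. G (z s))"
  using c by (auto intro: continuous_on_compose2[OF G])
 have 1: "continuous_on {0..T - h} (%r. z (h + r))"
  by (rule continuous_on_compose2[OF c]) (use h in \<open>auto intro!: continuous_intros\<close>)
 have 2: "z (h + r) = z h + integral {0..r} (%s. G (z (h + s))) + (m (h + r) - m h)" if r: "r \<in> {0..T - h}" for r
 proof -
  have hr: "h + r \<in> {0..T}" using r h by auto
  have ci: "(%s. G (z s)) integrable_on {0..h + r}"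
   by (intro integrable_continuous_real continuous_on_subset[OF cG]) (use hr in auto)
  have "integral {0..h} (%s. G (z s)) + integral {h..h + r} (%s. G (z s)) = integral {0..h + r} (%s. G (z s))"
   by (rule Henstock_Kurzweil_Integration.integral_combine[OF _ _ ci]) (use h r in auto)
  moreover have "integral {h..h + r} (%s. G (z s)) = integral {0..r} (%s. G (z (h + s)))"
  proof -
   show ?thesis
    using integral_shift_Icc_real[of 0 r "%s. G (z s)" h] by (simp add: o_def add.commute)
  qed
  ultimately show ?thesis using z h hr unfolding solves_def
   by (simp add: algebra_simps)
 qed
 show ?thesis unfolding solves_def using 1 2 by auto
qed

lemma solves_mono: "solves T G m x z ==> S \<le> T ==> solves S G m x z"
 unfolding solves_def by (auto intro: continuous_on_subset)

subsection \<open>Twice differentiable flows\<close>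

text \<open>Left and right multiplication by a fixed operator as bounded operators themselves: the
  second variation equation is then a linear equation in the Banach space of second derivatives, and
  its solution fits the nested type in which \<open>eta\<close> is differentiated.\<close>

definition compose_left :: "('b::real_normed_vector \<Rightarrow>\<^sub>L 'c::real_normed_vector) => ('a::real_normed_vector \<Rightarrow>\<^sub>L 'b) \<Rightarrow>\<^sub>L ('a \<Rightarrow>\<^sub>L 'c)"
 where "compose_left A = Blinfun (%w. A o\<^sub>L w)"

definition compose_right :: "('a::real_normed_vector \<Rightarrow>\<^sub>L 'b::real_normed_vector) => ('b \<Rightarrow>\<^sub>L 'c::real_normed_vector) \<Rightarrow>\<^sub>L ('a \<Rightarrow>\<^sub>L 'c)"
 where "compose_right A = Blinfun (%w. w o\<^sub>L A)"

lemma compose_left_apply [simp]: "blinfun_apply (compose_left A) w = A o\<^sub>L w"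
 unfolding compose_left_def
 by (simp add: bounded_linear_Blinfun_apply bounded_bilinear.bounded_linear_right[OF bounded_bilinear_blinfun_compose])

lemma compose_right_apply [simp]: "blinfun_apply (compose_right A) w = w o\<^sub>L A"
 unfolding compose_right_def
 by (simp add: bounded_linear_Blinfun_apply bounded_bilinear.bounded_linear_left[OF bounded_bilinear_blinfun_compose])

lemma norm_compose_left: "norm (compose_left A) \<le> norm A"
 by (rule norm_blinfun_bound) (auto intro: norm_blinfun_compose)

lemma norm_compose_right: "norm (compose_right A) \<le> norm A"
 by (rule norm_blinfun_bound) (auto intro: order_trans[OF norm_blinfun_compose] simp: mult.commute)

lemma bounded_linear_compose_left: "bounded_linear compose_left"
 by (rule bounded_linear_intro[where K=1])
  (auto intro!: blinfun_eqI simp: blinfun.add_left blinfun.scaleR_left norm_compose_left)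

lemma bounded_linear_compose_right: "bounded_linear compose_right"
 by (rule bounded_linear_intro[where K=1])
  (auto intro!: blinfun_eqI simp: blinfun.add_left blinfun.scaleR_left blinfun.add_right blinfun.scaleR_right norm_compose_right)

lemmas continuous_on_compose_left [continuous_intros] = bounded_linear.continuous_on[OF bounded_linear_compose_left]
lemmas continuous_on_compose_right [continuous_intros] = bounded_linear.continuous_on[OF bounded_linear_compose_right]

lemmas compose_diff_right = bounded_bilinear.diff_right[OF bounded_bilinear_blinfun_compose]
lemmas compose_diff_left = bounded_bilinear.diff_left[OF bounded_bilinear_blinfun_compose]

lemma joint_continuity_from_uniform:
 fixes f :: "real => 'a::metric_space => 'b::metric_space"
 assumes c: "!!x. continuous_on S (%t. f t x)"
  and u: "!!x e. 0 < e ==> \<exists>d>0. \<forall>y. dist y x < d \<longrightarrow> (\<forall>t\<in>S. dist (f t y) (f t x) \<le> e)"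
 shows "continuous_on (S \<times> UNIV) (%(t, x). f t x)"
 unfolding continuous_on_iff
proof (intro ballI allI impI)
 fix p e assume p: "p \<in> S \<times> (UNIV :: 'a set)" and e: "(0::real) < e"
 obtain t x where px: "p = (t, x)" "t \<in> S" using p by auto
 obtain d1 where d1: "d1 > 0" "!!y t. dist y x < d1 ==> t \<in> S ==> dist (f t y) (f t x) \<le> e / 3"
  using u[of "e / 3" x] e by auto
 obtain d2 where d2: "d2 > 0" "!!s. s \<in> S ==> dist s t < d2 ==> dist (f s x) (f t x) < e / 3"
  using c[of x] px(2) e unfolding continuous_on_iff by (metis divide_pos_pos zero_less_numeral)
 show "\<exists>d>0. \<forall>q\<in>S \<times> UNIV. dist q p < d \<longrightarrow> dist (case q of (t, x) => f t x) (case p of (t, x) => f t x) < e"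
 proof (intro exI[of _ "min d1 d2"] conjI ballI impI)
  fix q assume q: "q \<in> S \<times> (UNIV :: 'a set)" and qd: "dist q p < min d1 d2"
  obtain s y where qy: "q = (s, y)" "s \<in> S" using q by auto
  have "dist s t < d2" "dist y x < d1"
   using qd dist_fst_le[of q p] dist_snd_le[of q p] by (auto simp: qy px)
  then have "dist (f s y) (f s x) \<le> e / 3" "dist (f s x) (f t x) < e / 3"
   using d1 d2 qy by auto
  then have "dist (f s y) (f t x) < e"
   using dist_triangle[of "f s y" "f t x" "f s x"] e by linarith
  then show "dist (case q of (t, x) => f t x) (case p of (t, x) => f t x) < e" by (simp add: qy px)
 qed (use d1 d2 in auto)
qed

lemma has_derivative_from_bound:
 fixes f :: "'a::real_normed_vector => 'b::real_normed_vector"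
 assumes "!!e. 0 < e ==> \<exists>d>0. \<forall>v. norm v < d \<longrightarrow> norm (f (x + v) - f x - blinfun_apply D v) \<le> e * norm v"
 shows "(f has_derivative blinfun_apply D) (at x)"
 unfolding has_derivative_at_alt
proof (intro conjI allI impI blinfun.bounded_linear_right)
 fix e :: real assume "0 < e"
 then obtain d where d: "d > 0" "!!v. norm v < d ==> norm (f (x + v) - f x - blinfun_apply D v) \<le> e * norm v"
  using assms by blast
 show "\<exists>d>0. \<forall>y. norm (y - x) < d \<longrightarrow> norm (f y - f x - blinfun_apply D (y - x)) \<le> e * norm (y - x)"
  using d(1) d(2)[of "y - x" for y] by (intro exI[of _ d]) auto
qed

locale C2_field =
 fixes G :: "'a::banach => 'a" and DG :: "'a => 'a \<Rightarrow>\<^sub>L 'a" and D2G :: "'a => 'a \<Rightarrow>\<^sub>L 'a \<Rightarrow>\<^sub>L 'a" and L K :: real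
 assumes dG: "(G has_derivative blinfun_apply (DG x)) (at x)"
  and dDG: "(DG has_derivative blinfun_apply (D2G x)) (at x)"
  and cD2G: "continuous_on UNIV D2G"
  and nDG: "norm (DG x) \<le> L" and nD2G: "norm (D2G x) \<le> K"
begin

lemma L0: "0 \<le> L" using nDG[of undefined] norm_ge_zero order_trans by blast
lemma K0: "0 \<le> K" using nD2G[of undefined] norm_ge_zero order_trans by blast

lemma cG: "continuous_on UNIV G"
 by (rule has_derivative_continuous_on[OF has_derivative_at_withinI[OF dG]])

lemma cDG: "continuous_on UNIV DG"
 by (rule has_derivative_continuous_on[OF has_derivative_at_withinI[OF dDG]])

lemma lipG: "norm (G x - G y) \<le> L * norm (x - y)"
 by (rule lipschitz_from_derivative[OF dG nDG])

lemma lipDG: "norm (DG x - DG y) \<le> K * norm (x - y)"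
 by (rule lipschitz_from_derivative[OF dDG nD2G])

end

text \<open>One forcing path is fixed. Because it enters additively, it drops out of every
  difference of solutions, and differentiability in the initial value is deterministic ODE
  theory.\<close>

locale C2_flow = C2_field G DG D2G L K for G :: "'a::banach => 'a" and DG D2G L K +
 fixes T :: real and m :: "real => 'a" and Z :: "'a => real => 'a"
 assumes T: "0 \<le> T" and Z: "!!x. solves T G m x (Z x)"
begin

lemma cZ: "continuous_on {0..T} (Z x)" using Z[of x] unfolding solves_def by blast

lemma cGZ: "continuous_on {0..T} (%s. G (Z x s))"
 by (rule continuous_on_compose2[OF cG cZ subset_UNIV])

lemma cDGZ: "continuous_on {0..T} (%s. DG (Z x s))"
 by (rule continuous_on_compose2[OF cDG cZ subset_UNIV])

lemma cD2GZ: "continuous_on {0..T} (%s. D2G (Z x s))"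
 by (rule continuous_on_compose2[OF cD2G cZ subset_UNIV])

lemma Zeq: "t \<in> {0..T} ==> Z x t = x + integral {0..t} (%s. G (Z x s)) + m t"
 using Z[of x] unfolding solves_def by blast

definition "EL = exp (L * T)"

lemma EL0: "0 < EL" by (simp add: EL_def)

lemma Zlip: "t \<in> {0..T} ==> norm (Z x t - Z y t) \<le> EL * norm (x - y)"
 using solves_lipschitz[OF cG lipG L0 Z Z, of t x y] by (simp add: EL_def mult.commute)

lemma int_sub: "continuous_on {0..T} f ==> t \<in> {0..T} ==> f integrable_on {0..t}" for f :: "real => 'c::banach"
 by (intro integrable_continuous_real) (auto intro: continuous_on_subset)

lemma continuous_on_fst_compose: "continuous_on {0..T} f ==> continuous_on ({0..T} \<times> A) (%p. f (fst p))"
 for f :: "real => 'c::topological_space"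
 by (rule continuous_on_compose2[OF _ continuous_on_fst[OF continuous_on_id]]) auto

text \<open>First variation equation: the formal derivative of the integral equation with respect to
  \<open>x\<close>, started at the identity and free of \<open>m\<close>.\<close>

lemma eta_exists: "\<exists>y. continuous_on {0..T} y \<and> (\<forall>t\<in>{0..T}. y t = id_blinfun + integral {0..t} (%s. DG (Z x s) o\<^sub>L y s))"
proof (rule ode_exists[OF T, where f="%s y. DG (Z x s) o\<^sub>L y"])
 have "continuous_on ({0..T} \<times> UNIV) (%p :: real \<times> ('a \<Rightarrow>\<^sub>L 'a). DG (Z x (fst p)))"
  by (rule continuous_on_fst_compose[OF cDGZ])
 moreover have "continuous_on ({0..T} \<times> UNIV) (%p :: real \<times> ('a \<Rightarrow>\<^sub>L 'a). snd p)"
  by (rule continuous_on_snd[OF continuous_on_id])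
 ultimately have "continuous_on ({0..T} \<times> UNIV) (%p :: real \<times> ('a \<Rightarrow>\<^sub>L 'a). DG (Z x (fst p)) o\<^sub>L snd p)"
  by (rule bounded_bilinear.continuous_on[OF bounded_bilinear_blinfun_compose])
 then show "continuous_on ({0..T} \<times> UNIV) (%(s, y :: 'a \<Rightarrow>\<^sub>L 'a). DG (Z x s) o\<^sub>L y)"
  by (simp only: case_prod_beta')
 fix s and y z :: "'a \<Rightarrow>\<^sub>L 'a"
 have "(DG (Z x s) o\<^sub>L y) - (DG (Z x s) o\<^sub>L z) = DG (Z x s) o\<^sub>L (y - z)"
  by (rule compose_diff_right[symmetric])
 then show "norm ((DG (Z x s) o\<^sub>L y) - (DG (Z x s) o\<^sub>L z)) \<le> L * norm (y - z)"
  by (simp only: order_trans[OF norm_blinfun_compose mult_right_mono[OF nDG norm_ge_zero]])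
qed

definition "eta x = (SOME y. continuous_on {0..T} y \<and> (\<forall>t\<in>{0..T}. y t = id_blinfun + integral {0..t} (%s. DG (Z x s) o\<^sub>L y s)))"

lemma ceta: "continuous_on {0..T} (eta x)"
 and etaeq: "t \<in> {0..T} ==> eta x t = id_blinfun + integral {0..t} (%s. DG (Z x s) o\<^sub>L eta x s)"
 unfolding eta_def using someI_ex[OF eta_exists] by blast+

lemma neta: assumes t: "t \<in> {0..T}" shows "norm (eta x t) \<le> EL"
proof -
 have "norm (eta x t) \<le> (norm (id_blinfun :: 'a \<Rightarrow>\<^sub>L 'a) + 0 * T) * exp (L * T)"
 proof (rule gronwall_integral_T[OF ceta _ etaeq _ order_refl L0 t])
  show "continuous_on {0..T} (%s. DG (Z x s) o\<^sub>L eta x s)" by (intro continuous_intros cDGZ ceta)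
  show "norm (DG (Z x s) o\<^sub>L eta x s) \<le> 0 + L * norm (eta x s)" for s
   using order_trans[OF norm_blinfun_compose mult_right_mono[OF nDG norm_ge_zero]] by simp
 qed
 also have "\<dots> \<le> EL" using norm_blinfun_id_le EL0 by (simp add: EL_def)
 finally show ?thesis .
qed

text \<open>\<open>D2G\<close> is merely continuous, so it has no global modulus of continuity. The
  trajectory of \<open>x\<close> over [0, T] is compact, though, and by \<open>Zlip\<close> nearby
  trajectories stay within \<open>EL * norm v\<close> of it; this yields estimates uniform in
  time.\<close>

lemma linearization_along:
 assumes e: "0 < e"
 shows "\<exists>d>0. \<forall>v. norm v < d \<longrightarrow> (\<forall>s\<in>{0..T}. norm (DG (Z (x + v) s) - DG (Z x s)) \<le> e
  \<and> norm (G (Z (x + v) s) - G (Z x s) - DG (Z x s) (Z (x + v) s - Z x s)) \<le> e * norm (Z (x + v) s - Z x s)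
  \<and> norm (D2G (Z (x + v) s) - D2G (Z x s)) \<le> e
  \<and> norm (DG (Z (x + v) s) - DG (Z x s) - D2G (Z x s) (Z (x + v) s - Z x s)) \<le> e * norm (Z (x + v) s - Z x s))"
proof -
 have comp: "compact (Z x ` {0..T})" by (intro compact_continuous_image cZ compact_Icc)
 obtain d1 where d1: "d1 > 0" "!!p q. p \<in> Z x ` {0..T} ==> dist p q < d1 ==> dist (DG p) (DG q) < e"
  using uniform_continuity_near_compact[OF cDG comp e] by blast
 obtain d2 where d2: "d2 > 0" "!!p q. p \<in> Z x ` {0..T} ==> dist p q < d2 ==> dist (D2G p) (D2G q) < e"
  using uniform_continuity_near_compact[OF cD2G comp e] by blast
 define d where "d = min d1 d2 / EL"
 have d: "d > 0" using d1 d2 EL0 by (simp add: d_def)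
 have *: "norm (DG q - DG (Z x s)) \<le> e" "norm (D2G q - D2G (Z x s)) \<le> e"
  if v: "norm v < d" and s: "s \<in> {0..T}" and q: "q \<in> closed_segment (Z x s) (Z (x + v) s)" for v s q
 proof -
  have "dist (Z x s) q \<le> dist (Z x s) (Z (x + v) s)"
   using segment_bound1[OF q] by (simp add: dist_norm norm_minus_commute)
  also have "\<dots> \<le> EL * norm v" using Zlip[OF s, of x "x + v"] by (simp add: dist_norm)
  also have "\<dots> < min d1 d2" using v EL0 by (simp add: d_def field_simps)
  finally show "norm (DG q - DG (Z x s)) \<le> e" "norm (D2G q - D2G (Z x s)) \<le> e"
   using d1(2)[of "Z x s" q] d2(2)[of "Z x s" q] s by (auto simp: dist_norm norm_minus_commute)
 qed
 show ?thesis
 proof (intro exI[of _ d] conjI d allI impI ballI)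
  fix v :: 'a and s assume v: "norm v < d" and s: "s \<in> {0..T}"
  show "norm (DG (Z (x + v) s) - DG (Z x s)) \<le> e" "norm (D2G (Z (x + v) s) - D2G (Z x s)) \<le> e"
   using *[OF v s] by auto
  show "norm (G (Z (x + v) s) - G (Z x s) - DG (Z x s) (Z (x + v) s - Z x s)) \<le> e * norm (Z (x + v) s - Z x s)"
   by (rule linearization_bound[OF dG *(1)[OF v s]])
  show "norm (DG (Z (x + v) s) - DG (Z x s) - D2G (Z x s) (Z (x + v) s - Z x s)) \<le> e * norm (Z (x + v) s - Z x s)"
   by (rule linearization_bound[OF dDG *(2)[OF v s]])
 qed
qed

text \<open>The defect solves the linearized equation with the linearization error of
  \<open>G\<close> as a source. That source is small relative to \<open>norm v\<close>, uniformly in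
  time, and Gronwall transfers this to the defect.\<close>

lemma Z_expansion:
 assumes e: "0 < e"
 shows "\<exists>d>0. \<forall>v. norm v < d \<longrightarrow> (\<forall>t\<in>{0..T}. norm (Z (x + v) t - Z x t - eta x t v) \<le> e * norm v)"
proof -
 \<comment> \<open>One factor \<open>EL\<close> comes from \<open>Zlip\<close>, the other from
   Gronwall; \<open>T + 1\<close> replaces \<open>T\<close> to keep the denominator
   positive.\<close>
 define e' where "e' = e / (EL * EL * (T + 1))"
 have e': "0 < e'" using e EL0 T by (simp add: e'_def)
 obtain d where d: "d > 0" and dd: "!!v s. norm v < d ==> s \<in> {0..T} ==>
   norm (G (Z (x + v) s) - G (Z x s) - DG (Z x s) (Z (x + v) s - Z x s)) \<le> e' * norm (Z (x + v) s - Z x s)"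
  using linearization_along[OF e', of x] by blast
 have "norm (Z (x + v) t - Z x t - eta x t v) \<le> e * norm v" if v: "norm v < d" and t: "t \<in> {0..T}" for v t
 proof -
  let ?r = "%t. Z (x + v) t - Z x t - eta x t v"
  let ?f = "%s. G (Z (x + v) s) - G (Z x s) - DG (Z x s) (eta x s v)"
  have ce: "continuous_on {0..T} (%s. DG (Z x s) o\<^sub>L eta x s)" by (intro continuous_intros cDGZ ceta)
  have cf: "continuous_on {0..T} ?f" by (intro continuous_intros cGZ cDGZ ceta)
  have "norm (?r t) \<le> (norm (0::'a) + e' * (EL * norm v) * T) * exp (L * T)"
  proof (rule gronwall_integral_T[OF _ cf _ _ _ L0 t])
   show "continuous_on {0..T} ?r" by (intro continuous_intros cZ ceta)
   show "0 \<le> e' * (EL * norm v)" using e' EL0 by simp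
   fix t assume t: "t \<in> {0..T}"
   have "eta x t v = v + integral {0..t} (%s. DG (Z x s) (eta x s v))"
    unfolding etaeq[OF t] using blinfun_apply_integral[OF int_sub[OF ce t], of v]
    by (simp add: blinfun.add_left)
   moreover have "(%s. DG (Z x s) (eta x s v)) integrable_on {0..t}"
    by (intro int_sub[OF _ t] continuous_intros cDGZ ceta)
   ultimately show "?r t = 0 + integral {0..t} ?f"
    using Zeq[OF t, of x] Zeq[OF t, of "x + v"] int_sub[OF cGZ t]
    by (simp add: integral_diff integrable_diff)
  next
   fix s assume s: "s \<in> {0..T}"
   have eq: "?f s = (G (Z (x + v) s) - G (Z x s) - DG (Z x s) (Z (x + v) s - Z x s)) + DG (Z x s) (?r s)"
    by (simp add: blinfun.diff_right)
   have "norm (?f s) \<le> norm (G (Z (x + v) s) - G (Z x s) - DG (Z x s) (Z (x + v) s - Z x s)) + norm (DG (Z x s) (?r s))"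
    by (rule ord_eq_le_trans[OF arg_cong[where f=norm, OF eq] norm_triangle_ineq])
   also have "norm (DG (Z x s) (?r s)) \<le> L * norm (?r s)"
    by (rule order_trans[OF norm_blinfun mult_right_mono[OF nDG norm_ge_zero]])
   also have "norm (G (Z (x + v) s) - G (Z x s) - DG (Z x s) (Z (x + v) s - Z x s)) \<le> e' * norm (Z (x + v) s - Z x s)"
    by (rule dd[OF v s])
   also have "e' * norm (Z (x + v) s - Z x s) \<le> e' * (EL * norm v)"
    using Zlip[OF s, of "x + v" x] e' by (intro mult_left_mono) auto
   finally show "norm (?f s) \<le> e' * (EL * norm v) + L * norm (?r s)" by simp
  qed
  also have "\<dots> = e' * (EL * EL * T) * norm v" by (simp add: EL_def)
  also have "e' * (EL * EL * T) \<le> e' * (EL * EL * (T + 1))"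
   using e' EL0 by (intro mult_left_mono) auto
  also have "\<dots> = e" using EL0 T by (simp add: e'_def)
  finally show ?thesis by (simp add: mult_right_mono)
 qed
 with d show ?thesis by blast
qed

lemma Z_has_derivative: "t \<in> {0..T} ==> ((%x. Z x t) has_derivative blinfun_apply (eta x t)) (at x)"
 by (rule has_derivative_from_bound) (use Z_expansion[of _ x] in blast)

text \<open>Gronwall constant of the second variation: a source of size \<open>K * EL * EL\<close>
  over time \<open>T\<close>, amplified by \<open>EL\<close>. It serves both as Lipschitz constant
  of \<open>eta\<close> and as bound for \<open>zeta\<close>.\<close>

definition "Leta = K * EL * EL * T * EL"

lemma Leta0: "0 \<le> Leta" using K0 EL0 T by (simp add: Leta_def)

lemma eta_lip: assumes t: "t \<in> {0..T}" shows "norm (eta x t - eta y t) \<le> Leta * norm (x - y)"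
proof -
 let ?f = "%s. (DG (Z x s) o\<^sub>L eta x s) - (DG (Z y s) o\<^sub>L eta y s)"
 have ce: "continuous_on {0..T} (%s. DG (Z x s) o\<^sub>L eta x s)" for x by (intro continuous_intros cDGZ ceta)
 have "norm (eta x t - eta y t) \<le> (norm (0 :: 'a \<Rightarrow>\<^sub>L 'a) + K * EL * norm (x - y) * EL * T) * exp (L * T)"
 proof (rule gronwall_integral_T[OF _ _ _ _ _ L0 t])
  show "continuous_on {0..T} (%t. eta x t - eta y t)" by (intro continuous_intros ceta)
  show "continuous_on {0..T} ?f" by (intro continuous_intros ce)
  show "0 \<le> K * EL * norm (x - y) * EL" using K0 EL0 by simp
  show "eta x t - eta y t = 0 + integral {0..t} ?f" if t: "t \<in> {0..T}" for t
   unfolding etaeq[OF t] by (simp add: integral_diff int_sub[OF ce t])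
  fix s assume s: "s \<in> {0..T}"
  have "?f s = ((DG (Z x s) - DG (Z y s)) o\<^sub>L eta x s) + (DG (Z y s) o\<^sub>L (eta x s - eta y s))"
   by (simp add: compose_diff_left compose_diff_right)
  also have "norm \<dots> \<le> norm ((DG (Z x s) - DG (Z y s)) o\<^sub>L eta x s) + norm (DG (Z y s) o\<^sub>L (eta x s - eta y s))"
   by (rule norm_triangle_ineq)
  also have "norm (DG (Z y s) o\<^sub>L (eta x s - eta y s)) \<le> L * norm (eta x s - eta y s)"
   by (rule order_trans[OF norm_blinfun_compose mult_right_mono[OF nDG norm_ge_zero]])
  also have "norm ((DG (Z x s) - DG (Z y s)) o\<^sub>L eta x s) \<le> (K * (EL * norm (x - y))) * EL"
   by (rule order_trans[OF norm_blinfun_compose])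
    (intro mult_mono neta[OF s] order_trans[OF lipDG mult_left_mono[OF Zlip[OF s] K0]] norm_ge_zero
     mult_nonneg_nonneg K0 order_less_imp_le[OF EL0])
  finally show "norm (?f s) \<le> K * EL * norm (x - y) * EL + L * norm (eta x s - eta y s)" by (simp add: mult.assoc)
 qed
 then show ?thesis by (simp add: Leta_def EL_def mult_ac)
qed

text \<open>Second variation equation: applied to \<open>v\<close> and \<open>u\<close>,
  \<open>quad\<close> gives \<open>D2G\<close> at the trajectory evaluated at \<open>eta v\<close>
  and \<open>eta u\<close>; \<open>zrhs\<close> adds \<open>DG\<close> acting on the
  unknown.\<close>

abbreviation "quad x s \<equiv> compose_right (eta x s) o\<^sub>L (D2G (Z x s) o\<^sub>L eta x s)"
abbreviation "zrhs x s y \<equiv> quad x s + (compose_left (DG (Z x s)) o\<^sub>L y)"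

lemma cquad: "continuous_on {0..T} (%s. quad x s)"
 by (intro continuous_intros ceta cD2GZ)

lemma zeta_exists: "\<exists>y. continuous_on {0..T} y \<and> (\<forall>t\<in>{0..T}. y t = 0 + integral {0..t} (%s. zrhs x s (y s)))"
proof (rule ode_exists[OF T, where f="%s y. zrhs x s y"])
 have "continuous_on ({0..T} \<times> UNIV) (%p :: real \<times> ('a \<Rightarrow>\<^sub>L 'a \<Rightarrow>\<^sub>L 'a). compose_left (DG (Z x (fst p))) :: ('a \<Rightarrow>\<^sub>L 'a) \<Rightarrow>\<^sub>L ('a \<Rightarrow>\<^sub>L 'a))"
  by (rule continuous_on_compose_left[OF continuous_on_fst_compose[OF cDGZ]])
 moreover have "continuous_on ({0..T} \<times> UNIV) (%p :: real \<times> ('a \<Rightarrow>\<^sub>L 'a \<Rightarrow>\<^sub>L 'a). snd p)"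
  by (rule continuous_on_snd[OF continuous_on_id])
 ultimately have "continuous_on ({0..T} \<times> UNIV) (%p :: real \<times> ('a \<Rightarrow>\<^sub>L 'a \<Rightarrow>\<^sub>L 'a). compose_left (DG (Z x (fst p))) o\<^sub>L snd p)"
  by (rule bounded_bilinear.continuous_on[OF bounded_bilinear_blinfun_compose])
 with continuous_on_fst_compose[OF cquad]
 have "continuous_on ({0..T} \<times> UNIV) (%p. zrhs x (fst p) (snd p))"
  by (rule continuous_on_add)
 then show "continuous_on ({0..T} \<times> UNIV) (%(s, y). zrhs x s y)"
  by (simp only: case_prod_beta')
 show "norm (zrhs x s y - zrhs x s z) \<le> L * norm (y - z)" for s y z
 proof -
  have "zrhs x s y - zrhs x s z = compose_left (DG (Z x s)) o\<^sub>L (y - z)"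
   by (simp add: compose_diff_right)
  also have "norm \<dots> \<le> norm (compose_left (DG (Z x s)) :: ('a \<Rightarrow>\<^sub>L 'a) \<Rightarrow>\<^sub>L ('a \<Rightarrow>\<^sub>L 'a)) * norm (y - z)"
   by (rule norm_blinfun_compose)
  also have "\<dots> \<le> L * norm (y - z)"
   by (intro mult_right_mono order_trans[OF norm_compose_left nDG] norm_ge_zero)
  finally show ?thesis .
 qed
qed

definition "zeta x = (SOME y. continuous_on {0..T} y \<and> (\<forall>t\<in>{0..T}. y t = 0 + integral {0..t} (%s. zrhs x s (y s))))"

lemma czeta: "continuous_on {0..T} (zeta x)"
 and zetaeq: "t \<in> {0..T} ==> zeta x t = 0 + integral {0..t} (%s. zrhs x s (zeta x s))"
 unfolding zeta_def using someI_ex[OF zeta_exists] by blast+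

lemma czrhs: "continuous_on {0..T} (%s. zrhs x s (zeta x s))"
 by (intro continuous_intros cquad cDGZ czeta)

lemma nquad: assumes s: "s \<in> {0..T}" shows "norm (quad x s) \<le> K * EL * EL"
proof -
 have "norm (quad x s) \<le> norm (compose_right (eta x s) :: ('a \<Rightarrow>\<^sub>L 'a) \<Rightarrow>\<^sub>L ('a \<Rightarrow>\<^sub>L 'a)) * norm (D2G (Z x s) o\<^sub>L eta x s)"
  by (rule norm_blinfun_compose)
 also have "\<dots> \<le> EL * (K * EL)"
  by (intro mult_mono order_trans[OF norm_compose_right neta[OF s]]
    order_trans[OF norm_blinfun_compose mult_mono[OF nD2G neta[OF s]]] K0 norm_ge_zero order_less_imp_le[OF EL0])
 finally show ?thesis by (simp add: mult_ac)
qed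

lemma ncompL: "norm (compose_left (DG (Z x s)) o\<^sub>L y) \<le> L * norm y" for y :: "'c::real_normed_vector \<Rightarrow>\<^sub>L ('d::real_normed_vector \<Rightarrow>\<^sub>L 'a)"
 by (rule order_trans[OF norm_blinfun_compose mult_right_mono[OF order_trans[OF norm_compose_left nDG] norm_ge_zero]])

lemma nzeta: assumes t: "t \<in> {0..T}" shows "norm (zeta x t) \<le> Leta"
proof -
 have "norm (zeta x t) \<le> (norm (0 :: 'a \<Rightarrow>\<^sub>L 'a \<Rightarrow>\<^sub>L 'a) + (K * EL * EL) * T) * exp (L * T)"
 proof (rule gronwall_integral_T[OF czeta czrhs zetaeq _ _ L0 t])
  show "0 \<le> K * EL * EL" using K0 EL0 by simp
  show "norm (zrhs x s (zeta x s)) \<le> K * EL * EL + L * norm (zeta x s)" if "s \<in> {0..T}" for s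
   by (rule order_trans[OF norm_triangle_ineq add_mono[OF nquad[OF that] ncompL]])
 qed
 then show ?thesis by (simp add: Leta_def EL_def mult_ac)
qed

text \<open>Same scheme as \<open>Z_expansion\<close>, one order higher. The source splits into the
  linearization error of \<open>DG\<close> (\<open>?A\<close>), the first-order error of
  \<open>Z\<close> (\<open>?B\<close>) and a product of two increments (\<open>?C\<close>), which is
  quadratic in \<open>v\<close>.\<close>

lemma eta_expansion:
 assumes e: "0 < e"
 shows "\<exists>d>0. \<forall>v. norm v < d \<longrightarrow> (\<forall>t\<in>{0..T}. norm (eta (x + v) t - eta x t - zeta x t v) \<le> e * norm v)"
proof -
 \<comment> \<open>The summands are the constants obtained for \<open>?A\<close>, \<open>?B\<close>
   and \<open>?C\<close>, in this order.\<close>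
 define c where "c = EL * EL + K * EL + K * EL * Leta"
 have c: "0 \<le> c" using EL0 K0 Leta0 by (simp add: c_def)
 define e' where "e' = e / ((c + 1) * (T + 1) * EL)"
 have e': "0 < e'" using e EL0 T c by (simp add: e'_def)
 obtain d1 where d1: "d1 > 0" and dd1: "!!v s. norm v < d1 ==> s \<in> {0..T} ==>
   norm (DG (Z (x + v) s) - DG (Z x s) - D2G (Z x s) (Z (x + v) s - Z x s)) \<le> e' * norm (Z (x + v) s - Z x s)"
  using linearization_along[OF e', of x] by blast
 obtain d2 where d2: "d2 > 0" and dd2: "!!v s. norm v < d2 ==> s \<in> {0..T} ==>
   norm (Z (x + v) s - Z x s - eta x s v) \<le> e' * norm v"
  using Z_expansion[OF e', of x] by blast
 \<comment> \<open>Keeping \<open>norm v\<close> below \<open>e'\<close> turns the quadratic term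
   \<open>?C\<close> into one of size \<open>e' * norm v\<close>.\<close>
 define d where "d = min (min d1 d2) e'"
 have d: "d > 0" using d1 d2 e' by (simp add: d_def)
 have "norm (eta (x + v) t - eta x t - zeta x t v) \<le> e * norm v" if v: "norm v < d" and t: "t \<in> {0..T}" for v t
 proof -
  have v1: "norm v < d1" and v2: "norm v < d2" and v3: "norm v \<le> e'" using v by (auto simp: d_def)
  let ?r = "%t. eta (x + v) t - eta x t - zeta x t v"
  let ?h = "%x s. DG (Z x s) o\<^sub>L eta x s"
  let ?g = "%s. (D2G (Z x s) (eta x s v) o\<^sub>L eta x s) + (DG (Z x s) o\<^sub>L zeta x s v)"
  let ?f = "%s. ?h (x + v) s - ?h x s - ?g s"
  have ch: "continuous_on {0..T} (?h x)" for x by (intro continuous_intros cDGZ ceta)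
  have cg: "continuous_on {0..T} ?g" by (intro continuous_intros cDGZ ceta cD2GZ czeta)
  have "norm (?r t) \<le> (norm (0::'a \<Rightarrow>\<^sub>L 'a) + e' * c * norm v * T) * exp (L * T)"
  proof (rule gronwall_integral_T[OF _ _ _ _ _ L0 t])
   show "continuous_on {0..T} ?f" by (intro continuous_on_diff ch cg)
   show "continuous_on {0..T} ?r" by (intro continuous_intros czeta ceta)
   show "0 \<le> e' * c * norm v" using e' c by simp
   fix t assume t: "t \<in> {0..T}"
   have "zeta x t v = integral {0..t} (%s. zrhs x s (zeta x s) v)"
    unfolding zetaeq[OF t] using blinfun_apply_integral[OF int_sub[OF czrhs t], of x v] by simp
   also have "\<dots> = integral {0..t} ?g"
    by (rule arg_cong[where f="integral {0..t}"]) (auto simp: blinfun.add_left)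
   finally have "zeta x t v = integral {0..t} ?g" .
   then show "?r t = 0 + integral {0..t} ?f"
    unfolding etaeq[OF t] using int_sub[OF ch t, of x] int_sub[OF ch t, of "x + v"] int_sub[OF cg t]
    by (simp add: integral_diff integrable_diff)
  next
   fix s assume s: "s \<in> {0..T}"
   let ?z = "Z x s" and ?z' = "Z (x + v) s"
   let ?A = "(DG ?z' - DG ?z - D2G ?z (?z' - ?z)) o\<^sub>L eta x s"
   let ?B = "D2G ?z (?z' - ?z - eta x s v) o\<^sub>L eta x s"
   let ?C = "(DG ?z' - DG ?z) o\<^sub>L (eta (x + v) s - eta x s)"
   let ?D = "DG ?z o\<^sub>L ?r s"
   have "?f s = ?A + ?B + ?C + ?D"
    by (intro blinfun_eqI)
     (simp add: blinfun.diff_right blinfun.diff_left blinfun.add_left blinfun.add_right)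
   then have "norm (?f s) \<le> norm ?A + norm ?B + norm ?C + norm ?D"
    by (metis (no_types, lifting) norm_triangle_le add_mono order_refl)
   also have "norm ?D \<le> L * norm (?r s)"
    by (rule order_trans[OF norm_blinfun_compose mult_right_mono[OF nDG norm_ge_zero]])
   also have "norm ?A \<le> (e' * (EL * norm v)) * EL"
   proof (rule order_trans[OF norm_blinfun_compose], intro mult_mono neta[OF s] norm_ge_zero)
    have "e' * norm (?z' - ?z) \<le> e' * (EL * norm v)"
     using Zlip[OF s, of "x + v" x] e' by (intro mult_left_mono) auto
    with dd1[OF v1 s] show "norm (DG ?z' - DG ?z - D2G ?z (?z' - ?z)) \<le> e' * (EL * norm v)" by simp
   qed (use e' EL0 in auto)
   also have "norm ?B \<le> (K * (e' * norm v)) * EL"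
   proof (rule order_trans[OF norm_blinfun_compose], intro mult_mono neta[OF s] norm_ge_zero)
    show "norm (D2G ?z (?z' - ?z - eta x s v)) \<le> K * (e' * norm v)"
     by (rule order_trans[OF norm_blinfun mult_mono[OF nD2G dd2[OF v2 s]]]) (use K0 in auto)
   qed (use e' K0 in auto)
   also have "norm ?C \<le> (K * (EL * e')) * (Leta * norm v)"
   proof (rule order_trans[OF norm_blinfun_compose], intro mult_mono norm_ge_zero)
    have "norm (?z' - ?z) \<le> EL * norm v" using Zlip[OF s, of "x + v" x] by simp
    also have "\<dots> \<le> EL * e'" using v3 EL0 by (intro mult_left_mono) auto
    finally show "norm (DG ?z' - DG ?z) \<le> K * (EL * e')"
     by (intro order_trans[OF lipDG] mult_left_mono K0)
    show "norm (eta (x + v) s - eta x s) \<le> Leta * norm v" using eta_lip[OF s, of "x + v" x] by simp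
   qed (use e' K0 EL0 in auto)
   finally show "norm (?f s) \<le> e' * c * norm v + L * norm (?r s)"
    by (simp add: c_def algebra_simps)
  qed
  also have "\<dots> = (e' * (c * T * EL)) * norm v" by (simp add: EL_def)
  also have "e' * (c * T * EL) \<le> e' * ((c + 1) * (T + 1) * EL)"
   using e' EL0 c T by (intro mult_left_mono mult_right_mono mult_mono) auto
  also have "\<dots> = e" using EL0 T c by (simp add: e'_def)
  finally show ?thesis by (simp add: mult_right_mono)
 qed
 with d show ?thesis by blast
qed

lemma eta_has_derivative: "t \<in> {0..T} ==> ((%x. eta x t) has_derivative blinfun_apply (zeta x t)) (at x)"
 by (rule has_derivative_from_bound) (use eta_expansion[of _ x] in blast)

text \<open>No modulus of continuity is available for \<open>D2G\<close>, so a Lipschitz bound as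
  for \<open>eta\<close> cannot be expected. Continuity in \<open>x\<close> uniform in time follows
  from \<open>linearization_along\<close> and Gronwall, and is what joint continuity in
  \<open>(t, x)\<close> requires.\<close>

lemma zeta_uniform:
 assumes e: "0 < e"
 shows "\<exists>d>0. \<forall>v. norm v < d \<longrightarrow> (\<forall>t\<in>{0..T}. norm (zeta (x + v) t - zeta x t) \<le> e)"
proof -
 define c where "c = EL * EL + K * Leta * EL + K * EL * Leta + K * EL * Leta"
 have c: "0 \<le> c" using EL0 K0 Leta0 by (simp add: c_def)
 define e' where "e' = e / ((c + 1) * (T + 1) * EL)"
 have e': "0 < e'" using e EL0 T c by (simp add: e'_def)
 obtain d1 where d1: "d1 > 0" and dd1: "!!v s. norm v < d1 ==> s \<in> {0..T} ==>
   norm (D2G (Z (x + v) s) - D2G (Z x s)) \<le> e'"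
  using linearization_along[OF e', of x] by blast
 define d where "d = min d1 e'"
 have d: "d > 0" using d1 e' by (simp add: d_def)
 have "norm (zeta (x + v) t - zeta x t) \<le> e" if v: "norm v < d" and t: "t \<in> {0..T}" for v t
 proof -
  have v1: "norm v < d1" and v3: "norm v \<le> e'" using v by (auto simp: d_def)
  let ?r = "%t. zeta (x + v) t - zeta x t"
  let ?f = "%s. zrhs (x + v) s (zeta (x + v) s) - zrhs x s (zeta x s)"
  have "norm (?r t) \<le> (norm (0::'a \<Rightarrow>\<^sub>L 'a \<Rightarrow>\<^sub>L 'a) + e' * c * T) * exp (L * T)"
  proof (rule gronwall_integral_T[OF _ _ _ _ _ L0 t])
   show "continuous_on {0..T} ?f" by (intro continuous_on_diff czrhs)
   show "continuous_on {0..T} ?r" by (intro continuous_intros czeta)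
   show "0 \<le> e' * c" using e' c by simp
   show "?r t = 0 + integral {0..t} ?f" if t: "t \<in> {0..T}" for t
    unfolding zetaeq[OF t] by (simp only: integral_diff[OF int_sub[OF czrhs t] int_sub[OF czrhs t]] add_0)
  next
   fix s assume s: "s \<in> {0..T}"
   let ?z = "Z x s" and ?z' = "Z (x + v) s" and ?n = "eta x s" and ?n' = "eta (x + v) s"
   let ?A = "compose_right ?n' o\<^sub>L ((D2G ?z' - D2G ?z) o\<^sub>L ?n')"
   let ?B = "compose_right ?n' o\<^sub>L (D2G ?z o\<^sub>L (?n' - ?n))"
   let ?B' = "compose_right (?n' - ?n) o\<^sub>L (D2G ?z o\<^sub>L ?n)"
   let ?C = "compose_left (DG ?z' - DG ?z) o\<^sub>L zeta (x + v) s"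
   let ?D = "compose_left (DG ?z) o\<^sub>L ?r s"
   have "?f s = ?A + ?B + ?B' + ?C + ?D"
    by (intro blinfun_eqI)
     (simp add: blinfun.diff_right blinfun.diff_left blinfun.add_left blinfun.add_right)
   then have "norm (?f s) \<le> norm ?A + norm ?B + norm ?B' + norm ?C + norm ?D"
    by (metis (no_types, lifting) norm_triangle_le add_mono order_refl)
   also have "norm ?D \<le> L * norm (?r s)" by (rule ncompL)
   also have "norm ?A \<le> EL * (e' * EL)"
    by (rule order_trans[OF norm_blinfun_compose])
     (intro mult_mono order_trans[OF norm_compose_right neta[OF s]] dd1[OF v1 s] neta[OF s]
      order_trans[OF norm_blinfun_compose] norm_ge_zero less_imp_le[OF EL0] less_imp_le[OF e'] mult_nonneg_nonneg)
   also have "norm ?B \<le> EL * (K * (Leta * e'))"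
   proof (rule order_trans[OF norm_blinfun_compose], intro mult_mono order_trans[OF norm_compose_right neta[OF s]])
    have "norm (?n' - ?n) \<le> Leta * norm v" using eta_lip[OF s, of "x + v" x] by simp
    also have "\<dots> \<le> Leta * e'" by (rule mult_left_mono[OF v3 Leta0])
    finally show "norm (D2G ?z o\<^sub>L (?n' - ?n)) \<le> K * (Leta * e')"
     by (intro order_trans[OF norm_blinfun_compose] mult_mono nD2G K0 norm_ge_zero)
   qed (use EL0 in auto)
   also have "norm ?B' \<le> (Leta * e') * (K * EL)"
   proof (rule order_trans[OF norm_blinfun_compose], intro mult_mono)
    have "norm (?n' - ?n) \<le> Leta * norm v" using eta_lip[OF s, of "x + v" x] by simp
    also have "\<dots> \<le> Leta * e'" by (rule mult_left_mono[OF v3 Leta0])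
    finally show "norm (compose_right (?n' - ?n)) \<le> Leta * e'"
     by (rule order_trans[OF norm_compose_right])
    show "norm (D2G ?z o\<^sub>L ?n) \<le> K * EL"
     by (intro order_trans[OF norm_blinfun_compose] mult_mono nD2G K0 norm_ge_zero neta[OF s])
   qed (use Leta0 e' in auto)
   also have "norm ?C \<le> (K * (EL * e')) * Leta"
   proof (rule order_trans[OF norm_blinfun_compose], intro mult_mono norm_ge_zero nzeta[OF s] order_trans[OF norm_compose_left])
    have "norm (?z' - ?z) \<le> EL * norm v" using Zlip[OF s, of "x + v" x] by simp
    also have "\<dots> \<le> EL * e'" using v3 EL0 by (intro mult_left_mono) auto
    finally show "norm (DG ?z' - DG ?z) \<le> K * (EL * e')"
     by (intro order_trans[OF lipDG] mult_left_mono K0)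
   qed (use e' K0 EL0 in auto)
   finally show "norm (?f s) \<le> e' * c + L * norm (?r s)"
    by (simp add: c_def algebra_simps)
  qed
  also have "\<dots> = e' * (c * T * EL)" by (simp add: EL_def)
  also have "e' * (c * T * EL) \<le> e' * ((c + 1) * (T + 1) * EL)"
   using e' EL0 c T by (intro mult_left_mono mult_right_mono mult_mono) auto
  also have "\<dots> = e" using EL0 T c by (simp add: e'_def)
  finally show ?thesis .
 qed
 with d show ?thesis by blast
qed

lemma Z_joint: "continuous_on ({0..T} \<times> UNIV) (%(t, x). Z x t)"
proof (rule joint_continuity_from_uniform[OF cZ])
 fix x :: 'a and e :: real assume e: "0 < e"
 have "dist (Z y t) (Z x t) \<le> e" if y: "dist y x < e / EL" and t: "t \<in> {0..T}" for y t
 proof -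
  have "dist (Z y t) (Z x t) \<le> EL * dist y x" using Zlip[OF t, of y x] by (simp add: dist_norm)
  also have "\<dots> \<le> e" using y EL0 by (simp add: field_simps)
  finally show ?thesis .
 qed
 moreover have "e / EL > 0" using e EL0 by simp
 ultimately show "\<exists>d>0. \<forall>y. dist y x < d \<longrightarrow> (\<forall>t\<in>{0..T}. dist (Z y t) (Z x t) \<le> e)" by blast
qed

lemma eta_joint: "continuous_on ({0..T} \<times> UNIV) (%(t, x). eta x t)"
proof (rule joint_continuity_from_uniform[OF ceta])
 fix x :: 'a and e :: real assume e: "0 < e"
 have M: "Leta + 1 > 0" using Leta0 by simp
 have "dist (eta y t) (eta x t) \<le> e" if y: "dist y x < e / (Leta + 1)" and t: "t \<in> {0..T}" for y t
 proof -
  have "dist (eta y t) (eta x t) \<le> Leta * dist y x" using eta_lip[OF t, of y x] by (simp add: dist_norm)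
  also have "\<dots> \<le> (Leta + 1) * dist y x" by (intro mult_right_mono) auto
  also have "\<dots> \<le> e" using y M by (simp add: field_simps)
  finally show ?thesis .
 qed
 moreover have "e / (Leta + 1) > 0" using e M by simp
 ultimately show "\<exists>d>0. \<forall>y. dist y x < d \<longrightarrow> (\<forall>t\<in>{0..T}. dist (eta y t) (eta x t) \<le> e)" by blast
qed

lemma zeta_joint: "continuous_on ({0..T} \<times> UNIV) (%(t, x). zeta x t)"
proof (rule joint_continuity_from_uniform[OF czeta])
 fix x :: 'a and e :: real assume e: "0 < e"
 obtain d where "d > 0" "!!v t. norm v < d ==> t \<in> {0..T} ==> norm (zeta (x + v) t - zeta x t) \<le> e"
  using zeta_uniform[OF e, of x] by blast
 then have "\<forall>y. dist y x < d \<longrightarrow> (\<forall>t\<in>{0..T}. dist (zeta y t) (zeta x t) \<le> e)"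
  by (metis add.commute diff_add_cancel dist_norm)
 with \<open>d > 0\<close> show "\<exists>d>0. \<forall>y. dist y x < d \<longrightarrow> (\<forall>t\<in>{0..T}. dist (zeta y t) (zeta x t) \<le> e)" by blast
qed

end

subsection \<open>Hilbert spaces\<close>

lemma inner_add_add:
 fixes a b :: "'a::real_inner"
 shows "(a + b) \<bullet> (a + b) = a \<bullet> a + 2 * (a \<bullet> b) + b \<bullet> b"
 by (simp add: inner_add_left inner_add_right inner_commute)

lemma parallelogram:
 fixes a b :: "'a::real_inner"
 shows "(norm (a - b))^2 = 2 * (norm a)^2 + 2 * (norm b)^2 - (norm (a + b))^2"
 using inner_add_add[of a b] inner_add_add[of a "- b"] by (simp add: power2_norm_eq_inner)

text \<open>A minimizing sequence for the distance to \<open>C\<close> is Cauchy by the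
  parallelogram law, since midpoints stay in \<open>C\<close>; minimality of the limit against
  perturbations along \<open>v\<close> gives orthogonality.\<close>

lemma hilbert_projection:
 fixes C :: "'a::{real_inner, banach} set"
 assumes C: "subspace C" "closed C"
 shows "\<exists>p\<in>C. \<forall>c\<in>C. (x - p) \<bullet> c = 0"
proof -
 define f where "f c = (norm (x - c))^2" for c
 define d where "d = (INF c\<in>C. f c)"
 have ne: "C \<noteq> {}" using subspace_0[OF C(1)] by blast
 have bdd: "bdd_below (f ` C)" by (intro bdd_belowI[of _ 0]) (auto simp: f_def)
 have dle: "d \<le> f c" if "c \<in> C" for c
  unfolding d_def by (rule cINF_lower[OF bdd that])
 have "\<exists>c\<in>C. f c < d + 1 / real (Suc n)" for n
  using cINF_less_iff[OF ne bdd, of "d + 1 / real (Suc n)"] unfolding d_def by simp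
 then obtain c where c: "!!n. c n \<in> C" "!!n. f (c n) < d + 1 / real (Suc n)" by metis
 have close: "(norm (c n - c m))^2 \<le> 2 / real (Suc n) + 2 / real (Suc m)" for n m
 proof -
  have mid: "(1/2) *\<^sub>R (c n + c m) \<in> C" using c(1) C(1) by (simp add: subspace_add subspace_scale)
  have "(x - c m) + (x - c n) = 2 *\<^sub>R (x - (1/2) *\<^sub>R (c n + c m))" by (simp add: algebra_simps scaleR_2)
  then have "(norm ((x - c m) + (x - c n)))^2 = 4 * f ((1/2) *\<^sub>R (c n + c m))" by (simp add: f_def power_mult_distrib)
  moreover have "(norm (c n - c m))^2 = 2 * f (c m) + 2 * f (c n) - (norm ((x - c m) + (x - c n)))^2"
   using parallelogram[of "x - c m" "x - c n"] by (simp add: f_def)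
  ultimately show ?thesis using dle[OF mid] c(2)[of n] c(2)[of m] by simp
 qed
 have "Cauchy c"
 proof (rule CauchyI)
  fix e :: real assume e: "0 < e"
  obtain N where N: "4 / e^2 < real N" using reals_Archimedean2 by blast
  have "norm (c m - c n) < e" if "m \<ge> N" "n \<ge> N" for m n
  proof -
   have N0: "0 < real N" using N e by (meson divide_pos_pos less_trans zero_less_numeral zero_less_power)
   have "(norm (c m - c n))^2 \<le> 2 / real (Suc m) + 2 / real (Suc n)" by (rule close)
   also have "\<dots> \<le> 2 / real N + 2 / real N"
    using that N0 by (intro add_mono divide_left_mono) auto
   also have "\<dots> = 4 / real N" by simp
   also have "\<dots> < e^2" using N e N0 by (simp add: field_simps)
   finally show ?thesis using e by (simp add: power_less_imp_less_base)
  qed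
  then show "\<exists>M. \<forall>m\<ge>M. \<forall>n\<ge>M. norm (c m - c n) < e" by blast
 qed
 then obtain p where p: "c \<longlonglongrightarrow> p" using Cauchy_convergent convergent_def by blast
 have pC: "p \<in> C" using closed_sequentially[OF C(2) c(1) p] by simp
 have "f p \<le> d"
 proof (rule LIMSEQ_le)
  show "(%n. f (c n)) \<longlonglongrightarrow> f p" unfolding f_def by (intro tendsto_intros p)
  show "(%n. d + 1 / real (Suc n)) \<longlonglongrightarrow> d"
   using tendsto_add[OF tendsto_const LIMSEQ_inverse_real_of_nat, of d] by (simp add: divide_inverse)
  show "\<exists>N. \<forall>n\<ge>N. f (c n) \<le> d + 1 / real (Suc n)" using c(2) less_imp_le by blast
 qed
 have "(x - p) \<bullet> v = 0" if v: "v \<in> C" for v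
 proof (cases "v = 0")
  case False
  \<comment> \<open>The minimizer of the quadratic polynomial \<open>t\<close> maps to
    \<open>f (p + t *\<^sub>R v)\<close>.\<close>
  define t where "t = ((x - p) \<bullet> v) / (v \<bullet> v)"
  have "p + t *\<^sub>R v \<in> C" using pC v C(1) by (simp add: subspace_add subspace_scale)
  then have "f p \<le> f (p + t *\<^sub>R v)" using dle \<open>f p \<le> d\<close> order_trans by blast
  also have "f (p + t *\<^sub>R v) = f p - 2 * t * ((x - p) \<bullet> v) + t^2 * (v \<bullet> v)"
   unfolding f_def power2_norm_eq_inner by (simp add: algebra_simps inner_commute power2_eq_square)
  also have "\<dots> = f p - ((x - p) \<bullet> v)^2 / (v \<bullet> v)"
   using False by (simp add: t_def power2_eq_square field_simps)
  finally have "((x - p) \<bullet> v)^2 / (v \<bullet> v) \<le> 0" by simp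
  moreover have "v \<bullet> v > 0" using False by simp
  ultimately have "((x - p) \<bullet> v)^2 \<le> 0" by (simp add: divide_le_0_iff)
  then show ?thesis by simp
 qed simp
 with pC show ?thesis by blast
qed

text \<open>The kernel is closed; the component \<open>q\<close> of a point outside it that is
  orthogonal to the kernel represents \<open>f\<close> up to a scalar.\<close>

lemma riesz_representation:
 fixes f :: "'a::{real_inner, banach} => real"
 assumes f: "bounded_linear f"
 shows "\<exists>b. \<forall>u. f u = u \<bullet> b"
proof (cases "\<forall>u. f u = 0")
 case True then show ?thesis by (intro exI[of _ 0]) simp
next
 case False
 interpret bounded_linear f by fact
 obtain x where x: "f x \<noteq> 0" using False by blast
 let ?C = "{u. f u = 0}"
 have "subspace ?C" by (rule subspaceI) (auto simp: zero add scaleR)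
 moreover have "closed ?C"
  by (intro closed_Collect_eq continuous_on continuous_on_id continuous_on_const)
 ultimately obtain p where p: "f p = 0" "!!c. f c = 0 ==> (x - p) \<bullet> c = 0"
  using hilbert_projection[of ?C x] by blast
 define q where "q = x - p"
 have fq: "f q = f x" using p(1) by (simp add: q_def diff)
 then have q0: "q \<bullet> q \<noteq> 0" using x zero by auto
 have "f u = u \<bullet> ((f q / (q \<bullet> q)) *\<^sub>R q)" for u
 proof -
  have "f (u - (f u / f q) *\<^sub>R q) = 0" using x fq by (simp add: diff scaleR)
  then have "q \<bullet> (u - (f u / f q) *\<^sub>R q) = 0" using p(2) by (simp add: q_def)
  then have "q \<bullet> u = (f u / f q) * (q \<bullet> q)" by (simp add: inner_diff_right)
  then show ?thesis using q0 x fq by (simp add: inner_commute field_simps)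
 qed
 then show ?thesis by blast
qed

text \<open>\<open>adjoint\<close> is a choice. Riesz supplies a witness also for
  infinite-dimensional \<open>U\<close>, so the chosen operator satisfies the defining
  identity.\<close>

lemma adjoint_exists:
 fixes B :: "'u::{real_inner, banach} => 'a::real_inner"
 assumes B: "bounded_linear B"
 shows "B u \<bullet> y = u \<bullet> adjoint B y"
proof -
 have "\<exists>b. \<forall>u. B u \<bullet> y = u \<bullet> b" for y
  by (rule riesz_representation) (rule bounded_linear_compose[OF bounded_linear_inner_left B])
 then have "\<exists>f'. \<forall>x y. B x \<bullet> y = x \<bullet> f' y" by metis
 then show ?thesis unfolding adjoint_def by (rule someI2_ex) blast
qed

section \<open>Orthonormal bases and Parseval's identity\<close>

lemma orthonormal_inner:
 assumes "pairwise orthogonal S" "\<forall>b\<in>S. norm b = 1" "a \<in> S" "b \<in> S"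
 shows "a \<bullet> b = (if a = b then 1 else 0)"
proof (cases "a = b")
 case True then show ?thesis using assms(2,3) by (simp add: norm_eq_1)
next
 case False then show ?thesis using pairwiseD[OF assms(1,3,4)] by (simp add: orthogonal_def)
qed

text \<open>Distinct unit vectors of \<open>S\<close> are at distance at least 1, so the balls of
  radius 1/2 around them are disjoint open sets, of which a second countable space admits only
  countably many.\<close>

lemma orthonormal_countable:
 fixes S :: "'a::{real_inner, second_countable_topology} set"
 assumes S: "pairwise orthogonal S" "\<forall>b\<in>S. norm b = 1"
 shows "countable S"
proof -
 have dist: "dist a b \<ge> 1" if "a \<in> S" "b \<in> S" "a \<noteq> b" for a b
 proof -
  have "(norm (a - b))^2 = a \<bullet> a + b \<bullet> b - 2 * (a \<bullet> b)"
   by (simp add: power2_norm_eq_inner inner_diff_left inner_diff_right inner_commute)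
  then have "(norm (a - b))^2 = 2" using that by (simp add: orthonormal_inner[OF S])
  then have "1 \<le> norm (a - b)" by (intro power2_le_imp_le[of 1]) auto
  then show ?thesis by (simp add: dist_norm)
 qed
 let ?F = "(%a. ball a (1/2)) ` S"
 have "countable ?F"
 proof (rule countable_disjoint_open_subsets)
  show "disjoint ?F"
  proof (rule disjointI)
   fix P Q assume "P \<in> ?F" "Q \<in> ?F" and ne: "P \<noteq> Q"
   then obtain a b where ab: "a \<in> S" "b \<in> S" "P = ball a (1/2)" "Q = ball b (1/2)" by blast
   then have "1 \<le> dist a b" using dist ne by blast
   then show "P \<inter> Q = {}" unfolding ab by (intro disjoint_ballI) simp
  qed
 qed auto
 moreover have "inj_on (%a. ball a (1/2)) S"
 proof (rule inj_onI)
  fix a b assume ab: "a \<in> S" "b \<in> S" "ball a (1/2) = ball b (1/2)"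
  then have "a \<in> ball b (1/2)" by (metis centre_in_ball half_gt_zero_iff zero_less_one)
  then show "a = b" using dist[OF ab(1,2)] by (auto simp: dist_commute)
 qed
 ultimately show ?thesis by (simp add: countable_image_inj_eq)
qed

lemma subspace_closure:
 fixes S :: "'a::real_normed_vector set"
 assumes "subspace S"
 shows "subspace (closure S)"
proof (rule subspaceI)
 show "0 \<in> closure S" using subspace_0[OF assms] closure_subset by blast
 fix x y c assume "x \<in> closure S"
 then obtain f where f: "!!n. f n \<in> S" "f \<longlonglongrightarrow> x" unfolding closure_sequential by blast
 show "c *\<^sub>R x \<in> closure S"
  unfolding closure_sequential using f subspace_scale[OF assms]
  by (intro exI[of _ "%n. c *\<^sub>R f n"]) (auto intro!: tendsto_intros)
 assume "y \<in> closure S"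
 then obtain g where g: "!!n. g n \<in> S" "g \<longlonglongrightarrow> y" unfolding closure_sequential by blast
 show "x + y \<in> closure S"
  unfolding closure_sequential using f g subspace_add[OF assms]
  by (intro exI[of _ "%n. f n + g n"]) (auto intro!: tendsto_intros)
qed

text \<open>Zorn gives a maximal orthonormal set; a point outside its closed span would, after
  subtraction of its projection and normalization, enlarge it. Thus the choice inside
  \<open>hs_norm_sq\<close> does denote a basis.\<close>

lemma orthonormal_basis_exists:
 "\<exists>S. orthonormal_basis_of (UNIV :: 'a::{real_inner, banach} set) S"
proof -
 let ?A = "{S :: 'a set. pairwise orthogonal S \<and> (\<forall>b\<in>S. norm b = 1)}"
 have "\<exists>M\<in>?A. \<forall>X\<in>?A. M \<subseteq> X \<longrightarrow> X = M"
 proof (rule subset_Zorn')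
  fix C assume C: "subset.chain ?A C"
  have "pairwise orthogonal (\<Union>C)"
  proof (rule pairwiseI)
   fix x y assume "x \<in> \<Union>C" "y \<in> \<Union>C" and ne: "x \<noteq> y"
   then obtain P Q where "x \<in> P" "P \<in> C" "y \<in> Q" "Q \<in> C" by blast
   moreover from this have "P \<subseteq> Q \<or> Q \<subseteq> P" using C unfolding subset.chain_def by blast
   ultimately obtain R where "R \<in> C" "x \<in> R" "y \<in> R" by blast
   moreover have "pairwise orthogonal R" using C \<open>R \<in> C\<close> unfolding subset.chain_def by blast
   ultimately show "orthogonal x y" using ne by (simp add: pairwise_def)
  qed
  then show "\<Union>C \<in> ?A" using C unfolding subset.chain_def by blast
 qed
 then obtain S where SA: "S \<in> ?A" and max: "\<forall>X\<in>?A. S \<subseteq> X \<longrightarrow> X = S" by (elim bexE)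
 have S: "pairwise orthogonal S" "\<forall>b\<in>S. norm b = 1" using SA by auto
 have sub: "subspace (closure (span S))" by (rule subspace_closure[OF subspace_span])
 have "x \<in> closure (span S)" for x
 proof (rule ccontr)
  assume x: "x \<notin> closure (span S)"
  obtain p where p: "p \<in> closure (span S)" "!!c. c \<in> closure (span S) ==> (x - p) \<bullet> c = 0"
   using hilbert_projection[OF sub closed_closure] by blast
  define q where "q = (1 / norm (x - p)) *\<^sub>R (x - p)"
  have np: "norm (x - p) \<noteq> 0" using p(1) x by auto
  have q1: "norm q = 1" using np by (simp add: q_def)
  have qS: "q \<bullet> b = 0" if "b \<in> S" for b
   using p(2)[of b] span_base[OF that] closure_subset by (auto simp: q_def)
  have "insert q S \<in> ?A"
   using S q1 qS by (auto simp: pairwise_insert orthogonal_def inner_commute)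
  then have "insert q S = S" using max by (simp add: subset_insertI)
  then have "q \<in> S" by blast
  then show False using qS[of q] q1 by (simp add: norm_eq_1)
 qed
 then show ?thesis using S unfolding orthonormal_basis_of_def by blast
qed

lemma orthonormal_sum_inner:
 assumes F: "finite F" and S: "pairwise orthogonal F" "\<forall>b\<in>F. norm b = 1" and a: "a \<in> F"
 shows "(\<Sum>e\<in>F. c e *\<^sub>R e) \<bullet> a = c a"
proof -
 have "(\<Sum>e\<in>F. c e *\<^sub>R e) \<bullet> a = (\<Sum>e\<in>F. if e = a then c e else 0)"
  unfolding inner_sum_left by (intro sum.cong refl) (simp add: orthonormal_inner[OF S _ a])
 also have "\<dots> = c a" using F a by simp
 finally show ?thesis .
qed

text \<open>Pythagoras with arbitrary coefficients. \<open>c e = u \<bullet> e\<close> gives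
  Bessel's inequality, \<open>u = 0\<close> the norm of a linear combination, and general
  \<open>c\<close> the best approximation property.\<close>

lemma orthonormal_approx:
 assumes F: "finite F" and S: "pairwise orthogonal F" "\<forall>b\<in>F. norm b = 1"
 shows "(norm (u - (\<Sum>e\<in>F. c e *\<^sub>R e)))^2 = (norm u)^2 - (\<Sum>e\<in>F. (u \<bullet> e)^2) + (\<Sum>e\<in>F. (u \<bullet> e - c e)^2)"
proof -
 let ?s = "\<Sum>e\<in>F. c e *\<^sub>R e"
 have "?s \<bullet> ?s = (\<Sum>e\<in>F. c e * c e)"
  unfolding inner_sum_right[of ?s] by (intro sum.cong refl) (simp add: orthonormal_sum_inner[OF F S])
 moreover have "u \<bullet> ?s = (\<Sum>e\<in>F. c e * (u \<bullet> e))" by (simp add: inner_sum_right)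
 moreover have "(norm (u - ?s))^2 = (norm u)^2 - 2 * (u \<bullet> ?s) + ?s \<bullet> ?s"
  unfolding power2_norm_eq_inner by (simp add: inner_diff_left inner_diff_right inner_commute[of ?s u])
 moreover have "(\<Sum>e\<in>F. (u \<bullet> e - c e)^2) = (\<Sum>e\<in>F. (u \<bullet> e)^2) - 2 * (\<Sum>e\<in>F. c e * (u \<bullet> e)) + (\<Sum>e\<in>F. c e * c e)"
  by (simp add: power2_eq_square algebra_simps sum.distrib sum_subtractf sum_distrib_left)
 ultimately show ?thesis by simp
qed

text \<open>Some \<open>v\<close> in the span is close to \<open>u\<close>; for every finite
  \<open>Y\<close> containing the support of \<open>v\<close>, best approximation makes the Bessel
  defect over \<open>Y\<close> at most the squared distance of \<open>u\<close> and
  \<open>v\<close>.\<close>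

lemma parseval_square:
 fixes u :: "'a::real_inner"
 assumes "orthonormal_basis_of UNIV S"
 shows "((%e. (u \<bullet> e)^2) has_sum (norm u)^2) S"
 unfolding has_sum_def tendsto_iff eventually_finite_subsets_at_top
proof (intro allI impI)
 fix r :: real assume r: "0 < r"
 have S: "pairwise orthogonal S" "\<forall>b\<in>S. norm b = 1" and cl: "closure (span S) = UNIV"
  using assms by (auto simp: orthonormal_basis_of_def)
 obtain v where v: "v \<in> span S" "dist v u < sqrt r"
  using cl r closure_approachable[of u "span S"] by (metis UNIV_I real_sqrt_gt_0_iff)
 obtain X c where X: "finite X" "X \<subseteq> S" "v = (\<Sum>e\<in>X. c e *\<^sub>R e)"
  using v(1) unfolding span_explicit by blast
 have "dist (\<Sum>e\<in>Y. (u \<bullet> e)^2) ((norm u)^2) < r" if Y: "finite Y" "X \<subseteq> Y" "Y \<subseteq> S" for Y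
 proof -
  have SY: "pairwise orthogonal Y" "\<forall>b\<in>Y. norm b = 1"
   using S Y by (auto intro: pairwise_subset)
  let ?c = "%e. if e \<in> X then c e else 0"
  have vY: "v = (\<Sum>e\<in>Y. ?c e *\<^sub>R e)"
   unfolding X(3) using Y by (intro sum.mono_neutral_cong_left) auto
  have "(norm (u - v))^2 = (norm u)^2 - (\<Sum>e\<in>Y. (u \<bullet> e)^2) + (\<Sum>e\<in>Y. (u \<bullet> e - ?c e)^2)"
   unfolding vY by (rule orthonormal_approx[OF Y(1) SY])
  moreover have "(norm (u - v))^2 < r"
  proof -
   have "(norm (u - v))^2 < (sqrt r)^2"
    using v(2) by (intro power_strict_mono) (auto simp: dist_norm norm_minus_commute)
   then show ?thesis using r by simp
  qed
  moreover have "(\<Sum>e\<in>Y. (u \<bullet> e - ?c e)^2) \<ge> 0" by (intro sum_nonneg) simp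
  moreover have "0 \<le> (norm u)^2 - (\<Sum>e\<in>Y. (u \<bullet> e)^2)"
   using orthonormal_approx[OF Y(1) SY, of u "%e. u \<bullet> e"]
    zero_le_power2[of "norm (u - (\<Sum>e\<in>Y. (u \<bullet> e) *\<^sub>R e))"] by simp
  ultimately show ?thesis by (simp add: dist_real_def)
 qed
 then show "\<exists>X. finite X \<and> X \<subseteq> S \<and> (\<forall>Y. finite Y \<and> X \<subseteq> Y \<and> Y \<subseteq> S \<longrightarrow> dist (\<Sum>e\<in>Y. (u \<bullet> e)^2) ((norm u)^2) < r)"
  using X by blast
qed

text \<open>Polarization of \<open>parseval_square\<close>.\<close>

lemma parseval:
 fixes u v :: "'a::real_inner"
 assumes S: "orthonormal_basis_of UNIV S"
 shows "((%e. (u \<bullet> e) * (v \<bullet> e)) has_sum (u \<bullet> v)) S"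
proof -
 have "((%e. (1/4) * (((u + v) \<bullet> e)^2 + (-1) * ((u - v) \<bullet> e)^2)) has_sum ((1/4) * ((norm (u + v))^2 + (-1) * (norm (u - v))^2))) S"
  by (intro has_sum_cmult_right has_sum_add parseval_square[OF S])
 moreover have "(1/4) * ((norm (u + v))^2 + (-1) * (norm (u - v))^2) = u \<bullet> v"
  unfolding power2_norm_eq_inner by (simp add: inner_add_left inner_diff_left inner_add_right inner_diff_right inner_commute)
 moreover have "(1/4) * (((u + v) \<bullet> e)^2 + (-1) * ((u - v) \<bullet> e)^2) = (u \<bullet> e) * (v \<bullet> e)" for e
  by (simp add: inner_add_left inner_diff_left power2_eq_square algebra_simps)
 ultimately show ?thesis by simp
qed

lemma nn_integral_count_space_has_sum:
 assumes f: "(f has_sum x) S" and nn: "!!e. e \<in> S ==> 0 \<le> f e"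
 shows "(\<integral>\<^sup>+e. ennreal (f e) \<partial>count_space S) = ennreal x"
proof -
 have "f summable_on S" using f by (auto simp: summable_on_def)
 then have "(%e. norm (f e)) summable_on S"
  by (rule summable_on_cong[THEN iffD1, rotated]) (use nn in auto)
 note s' = abs_summable_equivalent[THEN iffD1, OF this]
 have "(\<integral>\<^sup>+e. ennreal (f e) \<partial>count_space S) = ennreal (infsetsum f S)"
  by (rule nn_integral_conv_infsetsum[OF s' nn])
 also have "infsetsum f S = x"
  using infsetsum_infsum[OF s'] infsumI[OF f] by simp
 finally show ?thesis .
qed

section \<open>Finite-dimensional subspaces of an inner product space\<close>

lemma finite_orthonormal_basis:
 fixes V :: "'a::real_inner set"
 assumes V: "finite S" "span S = V"
 shows "\<exists>B. finite B \<and> pairwise orthogonal B \<and> (\<forall>b\<in>B. norm b = 1) \<and> span B = V"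
proof -
 obtain C where C: "finite C" "span C = span S" "pairwise orthogonal C"
  using basis_orthogonal[OF V(1)] by blast
 let ?n = "%c. (1 / norm c) *\<^sub>R c"
 let ?B = "?n ` (C - {0})"
 have sp: "span ?B = span C"
 proof (rule span_eq[THEN iffD2], intro conjI subsetI)
  fix x assume "x \<in> ?B" then show "x \<in> span C" by (auto intro: span_scale span_base)
 next
  fix c assume c: "c \<in> C"
  show "c \<in> span ?B"
  proof (cases "c = 0")
   case False
   then have "norm c *\<^sub>R ?n c \<in> span ?B" using c by (intro span_scale span_base) auto
   with False show ?thesis by simp
  qed (simp add: span_zero)
 qed
 have "pairwise orthogonal ?B"
  using C(3) by (auto simp: pairwise_def orthogonal_def)
 moreover have "\<forall>b\<in>?B. norm b = 1" by auto
 moreover have "finite ?B" using C(1) by simp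
 moreover have "span ?B = V" using sp C(2) V(2) by simp
 ultimately show ?thesis by blast
qed

text \<open>Membership is being a fixed point of the orthogonal projection, a closed condition; the
  ambient space may have infinite dimension.\<close>

lemma closed_finite_span:
 fixes B :: "'a::real_inner set"
 assumes B: "finite B" "pairwise orthogonal B" "\<forall>b\<in>B. norm b = 1"
 shows "x \<in> span B \<longleftrightarrow> (\<Sum>e\<in>B. (x \<bullet> e) *\<^sub>R e) = x" and "closed (span B)"
proof -
 have 1: "x \<in> span B \<longleftrightarrow> (\<Sum>e\<in>B. (x \<bullet> e) *\<^sub>R e) = x" for x
 proof
  assume "x \<in> span B"
  then obtain c where "x = (\<Sum>e\<in>B. c e *\<^sub>R e)" using span_finite[OF B(1)] by blast
  then show "(\<Sum>e\<in>B. (x \<bullet> e) *\<^sub>R e) = x" using orthonormal_sum_inner[OF B] by (metis (no_types, lifting) sum.cong)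
 next
  assume "(\<Sum>e\<in>B. (x \<bullet> e) *\<^sub>R e) = x"
  then show "x \<in> span B" by (metis (no_types, lifting) span_base span_scale span_sum)
 qed
 show "x \<in> span B \<longleftrightarrow> (\<Sum>e\<in>B. (x \<bullet> e) *\<^sub>R e) = x" by (rule 1)
 have "span B = {x. (\<Sum>e\<in>B. (x \<bullet> e) *\<^sub>R e) = x}" using 1 by blast
 moreover have "closed {x. (\<Sum>e\<in>B. (x \<bullet> e) *\<^sub>R e) = x}"
  by (intro closed_Collect_eq continuous_intros)
 ultimately show "closed (span B)" by simp
qed

lemma orthonormal_basis_finite_dimensional:
 fixes V :: "'a::real_inner set"
 assumes V: "finite S" "span S = V" and B: "orthonormal_basis_of V B"
 shows "finite B" "span B = V"
proof -
 have o: "pairwise orthogonal B" "\<forall>b\<in>B. norm b = 1" "closure (span B) = V"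
  using B by (auto simp: orthonormal_basis_of_def)
 have "independent B"
  by (rule pairwise_orthogonal_independent[OF o(1)]) (use o(2) in auto)
 moreover have "B \<subseteq> span S" using o(3) V closure_subset span_superset by blast
 ultimately show fB: "finite B" using independent_span_bound[OF V(1)] by blast
 show "span B = V" using closed_finite_span(2)[OF fB o(1,2)] o(3) by simp
qed

lemma orthonormal_basis_finite_dimensional_exists:
 fixes V :: "'a::real_inner set"
 assumes V: "finite S" "span S = V"
 shows "\<exists>B. orthonormal_basis_of V B"
proof -
 obtain B where B: "finite B" "pairwise orthogonal B" "\<forall>b\<in>B. norm b = 1" "span B = V"
  using finite_orthonormal_basis[OF V] by blast
 then show ?thesis using closed_finite_span(2)[OF B(1-3)]
  unfolding orthonormal_basis_of_def by (intro exI[of _ B]) simp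
qed

subsection \<open>Operator exponentials\<close>

locale exp_operator =
 fixes A :: "'a::{real_inner, banach} \<Rightarrow>\<^sub>L 'a"
begin

abbreviation "E \<equiv> exp_op (blinfun_apply A)"
abbreviation "k \<equiv> norm A"

lemma power_bound: "norm ((blinfun_apply A ^^ n) x) \<le> k ^ n * norm x"
proof (induction n)
 case (Suc n)
 have "norm ((blinfun_apply A ^^ Suc n) x) \<le> k * norm ((blinfun_apply A ^^ n) x)" by (simp add: norm_blinfun)
 also have "\<dots> \<le> k * (k ^ n * norm x)" by (intro mult_left_mono Suc norm_ge_zero)
 finally show ?case by (simp add: mult.assoc)
qed simp

lemma power_linear:
 "(blinfun_apply A ^^ n) (x + y) = (blinfun_apply A ^^ n) x + (blinfun_apply A ^^ n) y"
 "(blinfun_apply A ^^ n) (c *\<^sub>R x) = c *\<^sub>R (blinfun_apply A ^^ n) x"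
 by (induction n) (simp_all add: blinfun.add_right blinfun.scaleR_right)

lemma term_bound: "norm ((t ^ n / fact n) *\<^sub>R (blinfun_apply A ^^ n) x) \<le> (\<bar>t\<bar> * k) ^ n /\<^sub>R fact n * norm x"
proof -
 have "norm ((t ^ n / fact n) *\<^sub>R (blinfun_apply A ^^ n) x) = \<bar>t\<bar> ^ n / fact n * norm ((blinfun_apply A ^^ n) x)"
  by (simp add: power_abs)
 also have "\<dots> \<le> \<bar>t\<bar> ^ n / fact n * (k ^ n * norm x)" by (intro mult_left_mono power_bound) auto
 finally show ?thesis by (simp add: power_mult_distrib divide_inverse mult_ac)
qed

lemma summable_bound: "summable (%n. (\<bar>t\<bar> * k) ^ n /\<^sub>R fact n * norm x)"
 by (intro summable_mult2 summable_exp_generic)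

lemma summable_norm_terms: "summable (%n. norm ((t ^ n / fact n) *\<^sub>R (blinfun_apply A ^^ n) x))"
 by (rule summable_comparison_test'[OF summable_bound[of t x], of 0]) (use term_bound in simp)

lemma summable_terms: "summable (%n. (t ^ n / fact n) *\<^sub>R (blinfun_apply A ^^ n) x)"
 by (rule summable_norm_cancel[OF summable_norm_terms])

lemma exp_sums: "(%n. (t ^ n / fact n) *\<^sub>R (blinfun_apply A ^^ n) x) sums E t x"
 unfolding exp_op_def by (rule summable_sums[OF summable_terms])

lemma exp_bound: "norm (E t x) \<le> exp (\<bar>t\<bar> * k) * norm x"
proof -
 have "norm (E t x) \<le> (\<Sum>n. norm ((t ^ n / fact n) *\<^sub>R (blinfun_apply A ^^ n) x))"
  unfolding exp_op_def by (rule summable_norm[OF summable_norm_terms])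
 also have "\<dots> \<le> (\<Sum>n. (\<bar>t\<bar> * k) ^ n /\<^sub>R fact n * norm x)"
  by (rule suminf_le[OF term_bound summable_norm_terms summable_bound])
 also have "\<dots> = exp (\<bar>t\<bar> * k) * norm x"
  unfolding exp_def by (rule suminf_mult2[symmetric]) (rule summable_exp_generic)
 finally show ?thesis .
qed

lemma exp_add: "E t (x + y) = E t x + E t y"
proof (rule sums_unique2[OF exp_sums])
 show "(%n. (t ^ n / fact n) *\<^sub>R (blinfun_apply A ^^ n) (x + y)) sums (E t x + E t y)"
  using sums_add[OF exp_sums[of t x] exp_sums[of t y]] by (simp add: power_linear scaleR_add_right)
qed

lemma exp_scaleR: "E t (c *\<^sub>R x) = c *\<^sub>R E t x"
proof (rule sums_unique2[OF exp_sums])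
 show "(%n. (t ^ n / fact n) *\<^sub>R (blinfun_apply A ^^ n) (c *\<^sub>R x)) sums (c *\<^sub>R E t x)"
  using sums_scaleR_right[OF exp_sums[of t x], of c] by (simp add: power_linear mult.commute)
qed

lemma bounded_linear_exp: "bounded_linear (E t)"
 by (rule bounded_linear_intro[where K="exp (\<bar>t\<bar> * k)"])
  (use exp_add exp_scaleR exp_bound in \<open>auto simp: mult.commute\<close>)

lemma exp_0: "E 0 x = x"
proof (rule sums_unique2[OF exp_sums])
 have "(%n. if n = 0 then x else 0) sums x" using sums_single[of 0 "%_. x"] by simp
 then show "(%n. (0 ^ n / fact n) *\<^sub>R (blinfun_apply A ^^ n) x) sums x"
  by (rule sums_cong[THEN iffD1, rotated]) (simp add: power_0_left)
qed

lemma exp_commute: "E t (A x) = A (E t x)"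
proof (rule sums_unique2[OF exp_sums])
 show "(%n. (t ^ n / fact n) *\<^sub>R (blinfun_apply A ^^ n) (A x)) sums A (E t x)"
  using bounded_linear.sums[OF blinfun.bounded_linear_right exp_sums[of t x], of A]
  by (simp add: blinfun.scaleR_right funpow_swap1)
qed

text \<open>Paired with a fixed vector, the exponential is a scalar power series and can be
  differentiated termwise.\<close>

lemma exp_weak_derivative: "((%t. E t x \<bullet> a) has_real_derivative (E t (A x) \<bullet> a)) (at t)"
proof -
 define c where "c n = ((blinfun_apply A ^^ n) x \<bullet> a) / fact n" for n
 have s: "(%n. c n * y ^ n) sums (E y x \<bullet> a)" for y
  using bounded_linear.sums[OF bounded_linear_inner_left exp_sums[of y x], of a] by (simp add: c_def mult_ac)
 have d: "diffs c n * y ^ n = ((y ^ n / fact n) *\<^sub>R (blinfun_apply A ^^ n) (A x)) \<bullet> a" for n y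
  by (simp add: diffs_def c_def funpow_swap1 field_simps del: of_nat_Suc)
 have "((%t. \<Sum>n. c n * t ^ n) has_real_derivative (\<Sum>n. diffs c n * t ^ n)) (at t)"
  by (rule termdiffs_strong_converges_everywhere) (rule sums_summable[OF s])
 moreover have "(\<Sum>n. c n * y ^ n) = E y x \<bullet> a" for y using s sums_unique by metis
 moreover have "(\<Sum>n. diffs c n * t ^ n) = E t (A x) \<bullet> a"
  unfolding d using bounded_linear.sums[OF bounded_linear_inner_left exp_sums[of t "A x"], of a] sums_unique by metis
 ultimately show ?thesis by simp
qed

definition "Eb t = Blinfun (E t)"

lemma Eb_apply [simp]: "blinfun_apply (Eb t) x = E t x"
 unfolding Eb_def by (simp add: bounded_linear_Blinfun_apply[OF bounded_linear_exp])

text \<open>Scalar Taylor expansion of the exponential paired with its own remainder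
  \<open>v\<close>: the result bounds the square of \<open>norm v\<close> by a multiple of
  \<open>norm v\<close>, and one factor cancels.\<close>

lemma exp_taylor:
 assumes h: "\<bar>h\<bar> \<le> 1"
 shows "norm (E (t + h) x - E t x - h *\<^sub>R E t (A x)) \<le> h^2 * (exp ((\<bar>t\<bar> + 1) * k) * k^2) * norm x"
proof (cases "h = 0")
 case False
 define v where "v = E (t + h) x - E t x - h *\<^sub>R E t (A x)"
 define df where "df n s = E s ((blinfun_apply A ^^ n) x) \<bullet> v" for n s
 have "\<exists>s. (if t + h < t then t + h < s \<and> s < t else t < s \<and> s < t + h) \<and>
   df 0 (t + h) = (\<Sum>m<2. df m t / fact m * (t + h - t) ^ m) + df 2 s / fact 2 * (t + h - t) ^ 2"
 proof (rule Taylor[where a="t - 1" and b="t + 1" and f="df 0"])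
  show "\<forall>m s. m < 2 \<and> t - 1 \<le> s \<and> s \<le> t + 1 \<longrightarrow> DERIV (df m) s :> df (Suc m) s"
   unfolding df_def using exp_weak_derivative by simp
 qed (use h False in auto)
 then obtain s where s': "if t + h < t then t + h < s \<and> s < t else t < s \<and> s < t + h" and
  eq': "df 0 (t + h) = (\<Sum>m<2. df m t / fact m * (t + h - t) ^ m) + df 2 s / fact 2 * (t + h - t) ^ 2" by blast
 have s: "\<bar>s\<bar> \<le> \<bar>t\<bar> + 1" using s' h by (simp add: abs_if split: if_splits)
 have eq: "df 0 (t + h) = df 0 t + df 1 t * h + df 2 s / 2 * h^2"
  using eq' by (simp add: numeral_2_eq_2)
 have "norm (E s ((blinfun_apply A ^^ 2) x)) \<le> exp ((\<bar>t\<bar> + 1) * k) * (k^2 * norm x)"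
 proof (rule order_trans[OF exp_bound], rule mult_mono)
  show "exp (\<bar>s\<bar> * k) \<le> exp ((\<bar>t\<bar> + 1) * k)" using s by (simp add: mult_right_mono)
  show "norm ((blinfun_apply A ^^ 2) x) \<le> k^2 * norm x" by (rule power_bound)
 qed auto
 from mult_right_mono[OF this norm_ge_zero[of v]] Cauchy_Schwarz_ineq2
 have df2: "\<bar>df 2 s\<bar> \<le> exp ((\<bar>t\<bar> + 1) * k) * (k^2 * norm x) * norm v"
  unfolding df_def by (rule order_trans[rotated])
 have "norm v * norm v = df 2 s / 2 * h^2"
  using eq by (simp add: df_def v_def power2_norm_eq_inner inner_diff_left flip: power2_eq_square)
 also have "\<dots> \<le> \<bar>df 2 s\<bar> * h^2" by (intro mult_right_mono) auto
 also have "\<dots> \<le> exp ((\<bar>t\<bar> + 1) * k) * (k^2 * norm x) * norm v * h^2"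
  by (rule mult_right_mono[OF df2]) simp
 also have "\<dots> = (h^2 * (exp ((\<bar>t\<bar> + 1) * k) * k^2) * norm x) * norm v" by (simp only: mult_ac)
 finally have "norm v * norm v \<le> (h^2 * (exp ((\<bar>t\<bar> + 1) * k) * k^2) * norm x) * norm v" .
 then show ?thesis
  using norm_ge_zero[of v] unfolding v_def[symmetric]
  by (cases "norm v = 0") (auto simp: mult_le_cancel_right)
qed simp

text \<open>The bound in \<open>exp_taylor\<close> is proportional to \<open>norm x\<close> with a
  constant independent of \<open>x\<close>, hence the derivative exists in operator norm.\<close>

lemma Eb_has_vector_derivative: "(Eb has_vector_derivative (Eb t o\<^sub>L A)) (at t within S)"
proof -
 define C where "C = exp ((\<bar>t\<bar> + 1) * k) * k^2"
 have C0: "0 \<le> C" by (simp add: C_def)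
 have bd: "norm (Eb (t + h) - Eb t - h *\<^sub>R (Eb t o\<^sub>L A)) \<le> h^2 * C" if "\<bar>h\<bar> \<le> 1" for h
 proof (rule norm_blinfun_bound)
  show "norm (blinfun_apply (Eb (t + h) - Eb t - h *\<^sub>R (Eb t o\<^sub>L A)) x) \<le> h^2 * C * norm x" for x
   using exp_taylor[OF that, of t x] by (simp add: blinfun.diff_left blinfun.scaleR_left C_def)
 qed (use C0 in simp)
 have "(Eb has_derivative (%h. h *\<^sub>R (Eb t o\<^sub>L A))) (at t)"
  unfolding has_derivative_at_alt
 proof (intro conjI allI impI bounded_linear_scaleR_left)
  fix e :: real assume e: "0 < e"
  define d where "d = min 1 (e / (C + 1))"
  have "norm (Eb y - Eb t - (y - t) *\<^sub>R (Eb t o\<^sub>L A)) \<le> e * norm (y - t)" if y: "norm (y - t) < d" for y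
  proof -
   have y1: "\<bar>y - t\<bar> \<le> 1" and y2: "\<bar>y - t\<bar> \<le> e / (C + 1)" using y by (auto simp: d_def)
   have "norm (Eb y - Eb t - (y - t) *\<^sub>R (Eb t o\<^sub>L A)) \<le> (y - t)^2 * C" using bd[OF y1] by simp
   also have "\<dots> = \<bar>y - t\<bar> * (\<bar>y - t\<bar> * C)" by (simp add: power2_eq_square)
   also have "\<dots> \<le> \<bar>y - t\<bar> * (e / (C + 1) * (C + 1))"
    using y2 C0 by (intro mult_left_mono mult_mono) (auto intro: order_trans[OF abs_ge_zero])
   also have "\<dots> = e * norm (y - t)" using C0 by simp
   finally show ?thesis .
  qed
  moreover have "d > 0" using e C0 by (simp add: d_def)
  ultimately show "\<exists>d>0. \<forall>y. norm (y - t) < d \<longrightarrow> norm (Eb y - Eb t - (y - t) *\<^sub>R (Eb t o\<^sub>L A)) \<le> e * norm (y - t)" by blast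
 qed
 then have "(Eb has_derivative (%h. h *\<^sub>R (Eb t o\<^sub>L A))) (at t within S)" by (rule has_derivative_at_withinI)
 then show ?thesis by (simp add: has_vector_derivative_def)
qed

lemma continuous_on_Eb [continuous_intros]: "continuous_on S f ==> continuous_on S (%x. Eb (f x))"
 by (rule continuous_on_compose2[of UNIV Eb, OF _ _ subset_UNIV])
  (rule has_derivative_continuous_on[OF Eb_has_vector_derivative[unfolded has_vector_derivative_def]])

text \<open>Product rule behind variation of constants. It yields the semigroup law, the mild form
  of the pathwise equation and the summation by parts for the stochastic convolution.\<close>

lemma exp_convolution_derivative:
 assumes y: "(y has_vector_derivative y') (at s within S)"
 shows "((%s. E (t - s) (y s)) has_vector_derivative (E (t - s) y' - E (t - s) (A (y s)))) (at s within S)"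
proof -
 have "((%s. t - s) has_vector_derivative (0 - 1)) (at s within S)"
  by (intro has_vector_derivative_diff has_vector_derivative_const has_vector_derivative_id)
 then have "((%s. Eb (t - s)) has_vector_derivative ((0 - 1) *\<^sub>R (Eb (t - s) o\<^sub>L A))) (at s within S)"
  using vector_diff_chain_within[of "%s. t - s" "0 - 1" s S Eb "Eb (t - s) o\<^sub>L A"] Eb_has_vector_derivative
  by (simp add: o_def)
 from bounded_bilinear.has_vector_derivative[OF bounded_bilinear_blinfun_apply this y]
 show ?thesis by (simp add: blinfun.scaleR_left blinfun.minus_left)
qed

text \<open>The map sending \<open>r\<close> to \<open>E (t + s - r) (E r x)\<close> has derivative
  zero on [0, s]. The sign of \<open>t\<close> is free, so \<open>t = - s\<close> shows that
  \<open>E (- s)\<close> undoes \<open>E s\<close>.\<close>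

lemma exp_semigroup: assumes "0 \<le> s" shows "E (t + s) x = E t (E s x)"
proof -
 have d: "((%r. E (t + s - r) (E r x)) has_vector_derivative 0) (at r within {0..s})" for r
 proof -
  have "((%r. Eb r x) has_vector_derivative ((Eb r o\<^sub>L A) x)) (at r within {0..s})"
   by (rule bounded_linear.has_vector_derivative[OF blinfun.bounded_linear_left Eb_has_vector_derivative])
  then have "((%r. E r x) has_vector_derivative (A (E r x))) (at r within {0..s})" by (simp add: exp_commute)
  from exp_convolution_derivative[OF this, of "t + s"] show ?thesis by simp
 qed
 have "((%r. 0) has_integral (E (t + s - s) (E s x) - E (t + s - 0) (E 0 x))) {0..s}"
  by (rule fundamental_theorem_of_calculus[OF assms d])
 then have "E (t + s - s) (E s x) - E (t + s - 0) (E 0 x) = 0"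
  using has_integral_unique has_integral_0 by blast
 then show ?thesis by (simp add: exp_0)
qed

end

text \<open>Carries the subspace as a set with an orthonormal basis; \<open>proj\<close> transports
  maps given on \<open>V\<close> to the ambient space.\<close>

locale finite_dim_subspace =
 fixes V :: "'a::{real_inner, banach} set" and Bs :: "'a set"
 assumes fB: "finite Bs" and oB: "pairwise orthogonal Bs" and nB: "\<forall>b\<in>Bs. norm b = 1" and spanB: "span Bs = V"
begin

definition "proj x = (\<Sum>e\<in>Bs. (x \<bullet> e) *\<^sub>R e)"

lemma subspaceV: "subspace V" using subspace_span[of Bs] by (simp add: spanB)

lemma closedV: "closed V" using closed_finite_span(2)[OF fB oB nB] by (simp add: spanB)

lemma BsV: "e \<in> Bs ==> e \<in> V" using span_base spanB by blast

lemma sumV: "(\<Sum>e\<in>Bs. c e *\<^sub>R e) \<in> V"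
 by (intro subspace_sum[OF subspaceV] subspace_scale[OF subspaceV] BsV)

lemma projV: "proj x \<in> V" unfolding proj_def by (rule sumV)

lemma proj_id: "x \<in> V \<longleftrightarrow> proj x = x"
 using closed_finite_span(1)[OF fB oB nB, of x] by (simp add: spanB proj_def)

lemma proj_proj [simp]: "proj (proj x) = proj x" using projV proj_id by blast

lemma bounded_linear_proj: "bounded_linear proj"
 unfolding proj_def by (intro bounded_linear_sum bounded_linear_scaleR_const bounded_linear_inner_left)

lemma norm_proj: "norm (proj x) \<le> norm x"
proof -
 have 1: "0 \<le> (norm x)^2 - (\<Sum>e\<in>Bs. (x \<bullet> e)^2)"
  using orthonormal_approx[OF fB oB nB, of x "%e. x \<bullet> e"]
   zero_le_power2[of "norm (x - (\<Sum>e\<in>Bs. (x \<bullet> e) *\<^sub>R e))"] by simp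
 have 2: "(norm (proj x))^2 = (\<Sum>e\<in>Bs. (x \<bullet> e)^2)"
  using orthonormal_approx[OF fB oB nB, of 0 "%e. x \<bullet> e"] by (simp add: proj_def)
 show ?thesis by (rule power2_le_imp_le) (use 1 2 in auto)
qed

lemma inner_sum_basis: "e \<in> Bs ==> (\<Sum>b\<in>Bs. c b *\<^sub>R b) \<bullet> e = c e"
 by (rule orthonormal_sum_inner[OF fB oB nB])

lemma expand: "x \<in> V ==> x = (\<Sum>e\<in>Bs. (x \<bullet> e) *\<^sub>R e)"
 using proj_id unfolding proj_def by metis

lemma norm_basis: "x \<in> V ==> (norm x)^2 = (\<Sum>e\<in>Bs. (x \<bullet> e)^2)"
 using orthonormal_approx[OF fB oB nB, of 0 "%e. x \<bullet> e"] expand by simp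

lemma continuous_on_proj [continuous_intros]: "continuous_on S f ==> continuous_on S (%x. proj (f x))"
 by (rule bounded_linear.continuous_on[OF bounded_linear_proj])

definition "projb = Blinfun proj"

lemma projb_apply [simp]: "blinfun_apply projb x = proj x"
 unfolding projb_def by (simp add: bounded_linear_Blinfun_apply[OF bounded_linear_proj])

lemma norm_projb: "norm projb \<le> 1" by (rule norm_blinfun_bound) (use norm_proj in auto)

lemma bounded_linear_on_proj:
 assumes L: "bounded_linear_on V V' L"
 shows "bounded_linear (%x. L (proj x))"
proof -
 obtain K where K: "!!x. x \<in> V ==> norm (L x) \<le> K * norm x" using L unfolding bounded_linear_on_def by blast
 have pl: "proj (x + y) = proj x + proj y" "proj (c *\<^sub>R x) = c *\<^sub>R proj x" for x y c
  using bounded_linear_proj by (simp_all add: linear_simps)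
 show ?thesis
 proof (rule bounded_linear_intro[where K="\<bar>K\<bar>"])
  show "L (proj (x + y)) = L (proj x) + L (proj y)" "L (proj (c *\<^sub>R x)) = c *\<^sub>R L (proj x)" for x y c
   using L projV unfolding bounded_linear_on_def pl by auto
  fix x
  have "norm (L (proj x)) \<le> K * norm (proj x)" by (rule K[OF projV])
  also have "\<dots> \<le> \<bar>K\<bar> * norm x" by (intro mult_mono norm_proj) auto
  finally show "norm (L (proj x)) \<le> norm x * \<bar>K\<bar>" by (simp add: mult.commute)
 qed
qed

end

locale exp_subspace = finite_dim_subspace V Bs
 for V :: "'a::{real_inner, banach} set" and Bs +
 fixes A0 :: "'a => 'a"
 assumes A0: "bounded_linear_on V V A0"
begin

text \<open>Extension by the projection makes \<open>A0\<close> a bounded operator on the ambient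
  space. It maps into \<open>V\<close>, and on \<open>V\<close> its powers, hence the exponential
  series, agree with those of \<open>A0\<close> (\<open>exp_op_eq\<close>).\<close>

definition "AL = Blinfun (%x. A0 (proj x))"

lemma AL_apply: "blinfun_apply AL x = A0 (proj x)"
 unfolding AL_def by (simp add: bounded_linear_Blinfun_apply[OF bounded_linear_on_proj[OF A0]])

lemma AL_V: "blinfun_apply AL x \<in> V"
 using A0 projV unfolding AL_apply bounded_linear_on_def by blast

sublocale exp_operator AL .

lemma exp_power_V: "x \<in> V ==> (blinfun_apply AL ^^ n) x \<in> V"
 by (induction n) (auto simp: AL_V)

lemma exp_V: assumes "x \<in> V" shows "E t x \<in> V"
proof (rule closed_sequentially[OF closedV])
 show "(%n. \<Sum>i<n. (t ^ i / fact i) *\<^sub>R (blinfun_apply AL ^^ i) x) \<longlonglongrightarrow> E t x"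
  using exp_sums[of t x] by (simp add: sums_def)
 show "(\<Sum>i<n. (t ^ i / fact i) *\<^sub>R (blinfun_apply AL ^^ i) x) \<in> V" for n
  by (intro subspace_sum[OF subspaceV] subspace_scale[OF subspaceV] exp_power_V assms)
qed

lemma exp_op_eq: assumes x: "x \<in> V" shows "exp_op A0 t x = E t x"
proof -
 have "(A0 ^^ n) x = (blinfun_apply AL ^^ n) x" for n
 proof (induction n)
  case (Suc n)
  have "proj ((blinfun_apply AL ^^ n) x) = (blinfun_apply AL ^^ n) x"
   using exp_power_V[OF x] proj_id by blast
  then show ?case using Suc AL_apply[of "(blinfun_apply AL ^^ n) x"] by simp
 qed simp
 then show ?thesis unfolding exp_op_def by simp
qed

end

subsection \<open>Wiener increments and Wiener integrals\<close>

locale wiener = prob_space P for P :: "'w measure" +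
 fixes T :: real and \<F> :: "real => 'w measure"
  and W :: "real => 'u::{real_inner, banach, second_countable_topology} => 'w => real"
 assumes T: "0 < T" and filtration: "normal_filtration P T \<F>" and wiener: "cylindrical_wiener P T \<F> W"
begin

lemma sub: "t \<in> {0..T} ==> subalgebra P (\<F> t)"
 using filtration[unfolded normal_filtration_def, THEN conjunct1] by blast

lemma filtration_mono: assumes "0 \<le> s" "s \<le> t" "t \<le> T" shows "sets (\<F> s) \<subseteq> sets (\<F> t)"
 using filtration[unfolded normal_filtration_def, THEN conjunct2, THEN conjunct1] assms by auto

lemma space_filtration: "t \<in> {0..T} ==> space (\<F> t) = space P"
 using sub unfolding subalgebra_def by blast

lemma measurable_filtration_P: "t \<in> {0..T} ==> f \<in> measurable (\<F> t) M ==> f \<in> measurable P M"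
 using measurable_from_subalg[OF sub] by blast

lemma measurable_filtration_mono:
 assumes "0 \<le> s" "s \<le> t" "t \<le> T" "f \<in> measurable (\<F> s) M" shows "f \<in> measurable (\<F> t) M"
 using assms filtration_mono[OF assms(1-3)] space_filtration[of s] space_filtration[of t]
 unfolding measurable_def by auto

lemma W_measurable_filtration: "t \<in> {0..T} ==> W t u \<in> borel_measurable (\<F> t)"
 using wiener[unfolded cylindrical_wiener_def, THEN conjunct1] by blast

lemma W_linear: "t \<in> {0..T} ==> AE om in P. W t (a *\<^sub>R u + b *\<^sub>R v) om = a * W t u om + b * W t v om"
 using wiener[unfolded cylindrical_wiener_def, THEN conjunct2, THEN conjunct1] by blast

lemma W_at_0: "AE om in P. W 0 u om = 0"
 using wiener[unfolded cylindrical_wiener_def, THEN conjunct2, THEN conjunct2, THEN conjunct1] by blast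

lemma W_continuous: "AE om in P. continuous_on {0..T} (%t. W t u om)"
 using wiener[unfolded cylindrical_wiener_def, THEN conjunct2, THEN conjunct2, THEN conjunct2, THEN conjunct1] by blast

lemma W_zero: "t \<in> {0..T} ==> AE om in P. W t 0 om = 0"
 using W_linear[of t 0 0 0 0] by simp

lemma W_sum: assumes t: "t \<in> {0..T}" and I: "finite I"
 shows "AE om in P. W t (\<Sum>i\<in>I. c i *\<^sub>R u i) om = (\<Sum>i\<in>I. c i * W t (u i) om)"
 using I
proof (induction I rule: finite_induct)
 case empty then show ?case using W_zero[OF t] by simp
next
 case (insert j I)
 have "AE om in P. W t (c j *\<^sub>R u j + 1 *\<^sub>R (\<Sum>i\<in>I. c i *\<^sub>R u i)) om = c j * W t (u j) om + 1 * W t (\<Sum>i\<in>I. c i *\<^sub>R u i) om"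
  by (rule W_linear[OF t])
 with insert.IH show ?case by eventually_elim (use insert.hyps in simp)
qed

definition "inc s t u om = W t u om - W s u om"

lemma inc_measurable_filtration: assumes "0 \<le> s" "s \<le> t" "t \<le> T" shows "inc s t u \<in> borel_measurable (\<F> t)"
 unfolding inc_def using assms measurable_filtration_mono[OF assms W_measurable_filtration] W_measurable_filtration[of t]
 by (intro borel_measurable_diff) auto

lemma inc_measurable: assumes "0 \<le> s" "s \<le> t" "t \<le> T" shows "inc s t u \<in> borel_measurable P"
 by (rule measurable_filtration_P[OF _ inc_measurable_filtration[OF assms]]) (use assms in auto)

lemma inc_zero: assumes "0 \<le> s" "s \<le> t" "t \<le> T" shows "AE om in P. inc s t 0 om = 0"
 using W_zero[of s] W_zero[of t] assms unfolding inc_def by auto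

lemma inc_linear: assumes "0 \<le> s" "s \<le> t" "t \<le> T"
 shows "AE om in P. inc s t (a *\<^sub>R u + b *\<^sub>R v) om = a * inc s t u om + b * inc s t v om"
proof -
 have "s \<in> {0..T}" "t \<in> {0..T}" using assms by auto
 from W_linear[OF this(1), of a u b v] W_linear[OF this(2), of a u b v] show ?thesis
  by eventually_elim (simp add: inc_def algebra_simps)
qed

lemma W_increments: assumes "0 \<le> s" "s < t" "t \<le> T"
 shows "indep_set (sets (\<F> s)) (sets (vimage_algebra (space P) (%om. W t u om - W s u om) borel))"
  "u \<noteq> 0 ==> distributed P lborel (%om. W t u om - W s u om) (%y. ennreal (normal_density 0 (sqrt (t - s) * norm u) y))"
 using wiener[unfolded cylindrical_wiener_def, THEN conjunct2, THEN conjunct2, THEN conjunct2, THEN conjunct2, rule_format, of s t u] assms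
 by blast+

lemma inc_distributed: assumes "0 \<le> s" "s < t" "t \<le> T" "u \<noteq> 0"
 shows "distributed P lborel (inc s t u) (%y. ennreal (normal_density 0 (sqrt (t - s) * norm u) y))"
proof -
 have "distributed P lborel (%om. W t u om - W s u om) (%y. ennreal (normal_density 0 (sqrt (t - s) * norm u) y))"
  using W_increments(2) assms by blast
 then show ?thesis by (simp add: inc_def[abs_def])
qed

text \<open>The Wiener hypothesis covers \<open>s < t\<close>; for \<open>s = t\<close> the
  increment is constantly zero and the generated events are trivial.\<close>

lemma inc_indep_set: assumes "0 \<le> s" "s \<le> t" "t \<le> T"
  and A: "A \<in> sets (\<F> s)" and C: "C \<in> sets borel"
 shows "prob (A \<inter> (inc s t u -` C \<inter> space P)) = prob A * prob (inc s t u -` C \<inter> space P)"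
proof (cases "s = t")
 case False
 then have "indep_set (sets (\<F> s)) (sets (vimage_algebra (space P) (%om. W t u om - W s u om) borel))"
  using W_increments(1) assms by simp
 then have "indep_set (sets (\<F> s)) (sets (vimage_algebra (space P) (inc s t u) borel))"
  by (simp add: inc_def[abs_def])
 moreover have "inc s t u -` C \<inter> space P \<in> sets (vimage_algebra (space P) (inc s t u) borel)"
  using C by (subst sets_vimage_algebra2) auto
 ultimately show ?thesis using A unfolding indep_sets2_eq by blast
next
 case True
 then have "inc s t u -` C \<inter> space P = (if 0 \<in> C then space P else {})" by (auto simp: inc_def[abs_def])
 moreover have "A \<subseteq> space P" using sets.sets_into_space[OF A] space_filtration[of s] assms by auto
 ultimately show ?thesis by (simp add: Int_absorb2 prob_space)
qed

lemma inc_indep_var: assumes st: "0 \<le> s" "s \<le> t" "t \<le> T" and X: "X \<in> measurable (\<F> s) N"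
 shows "indep_var N X borel (inc s t u)"
proof -
 have Xs: "{X -` A \<inter> space P |A. A \<in> sets N} \<subseteq> sets (\<F> s)"
  using measurable_sets[OF X] space_filtration[of s] st by auto
 have sF: "sigma_algebra (space P) (sets (\<F> s))" using sets.sigma_algebra_axioms[of "\<F> s"] space_filtration[of s] st by simp
 have 1: "sigma_sets (space P) {X -` A \<inter> space P |A. A \<in> sets N} \<subseteq> sets (\<F> s)"
  by (rule sigma_algebra.sigma_sets_subset[OF sF Xs])
 have 2: "sigma_sets (space P) {inc s t u -` A \<inter> space P |A. A \<in> sets borel} = {inc s t u -` A \<inter> space P |A. A \<in> sets borel}"
  using sets_vimage_algebra[of "space P" "inc s t u" borel]
   sets_vimage_algebra2[of "inc s t u" "space P" borel] by simp
 have sP: "sets (\<F> s) \<subseteq> events" using sub[of s] st unfolding subalgebra_def by auto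
 show ?thesis unfolding indep_var_eq indep_sets2_eq 2
 proof (intro conjI ballI)
  show "random_variable N X" by (rule measurable_filtration_P[OF _ X]) (use st in auto)
  show "random_variable borel (inc s t u)" by (rule inc_measurable[OF st])
  show "sigma_sets (space P) {X -` A \<inter> space P |A. A \<in> sets N} \<subseteq> events" using 1 sP by blast
  show "{inc s t u -` A \<inter> space P |A. A \<in> sets borel} \<subseteq> events"
   using measurable_sets[OF inc_measurable[OF st]] by blast
  fix a b assume "a \<in> sigma_sets (space P) {X -` A \<inter> space P |A. A \<in> sets N}"
   and "b \<in> {inc s t u -` A \<inter> space P |A. A \<in> sets borel}"
  then show "prob (a \<inter> b) = prob a * prob b" using 1 inc_indep_set[OF st] by blast
 qed
qed

lemma inc_power_integrable: assumes st: "0 \<le> s" "s \<le> t" "t \<le> T"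
 shows "integrable P (%om. (inc s t u om) ^ k)"
\<comment> \<open>In these two cases the increment vanishes almost surely and has no
  density.\<close>
proof (cases "s = t \<or> u = 0")
 case True
 then have "AE om in P. inc s t u om = 0" using inc_zero[OF st] by (auto simp: inc_def)
 then have "AE om in P. (inc s t u om) ^ k = 0 ^ k" by eventually_elim simp
 then show ?thesis
  using integrable_cong_AE[of "%om. (inc s t u om) ^ k" P "%_. 0 ^ k"] inc_measurable[OF st] by simp
next
 case False
 then have "sqrt (t - s) * norm u > 0" using st by simp
 then have "integrable lborel (%x. normal_density 0 (sqrt (t - s) * norm u) x * x ^ k)"
  using integrable_normal_moment[of "sqrt (t - s) * norm u" 0 k] by simp
 then show ?thesis
  using distributed_integrable[OF inc_distributed, of s t u "%x. x ^ k"] False st by simp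
qed

lemma inc_moments: assumes st: "0 \<le> s" "s \<le> t" "t \<le> T"
 shows "(\<integral>om. inc s t u om \<partial>P) = 0" "(\<integral>om. (inc s t u om)^2 \<partial>P) = (t - s) * (norm u)^2"
  "(\<integral>om. (inc s t u om) ^ 4 \<partial>P) = 3 * ((t - s) * (norm u)^2)^2"
proof -
 have *: "(\<integral>om. inc s t u om \<partial>P) = 0 \<and> (\<integral>om. (inc s t u om)^2 \<partial>P) = (t - s) * (norm u)^2
  \<and> (\<integral>om. (inc s t u om) ^ 4 \<partial>P) = 3 * ((t - s) * (norm u)^2)^2"
 proof (cases "s = t \<or> u = 0")
  case True
  then have z: "AE om in P. inc s t u om = 0" using inc_zero[OF st] by (auto simp: inc_def)
  have "(\<integral>om. (inc s t u om) ^ Suc k \<partial>P) = 0" for k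
  proof -
   have "(\<integral>om. (inc s t u om) ^ Suc k \<partial>P) = (\<integral>om. 0 \<partial>P)"
   proof (rule integral_cong_AE)
    show "AE om in P. inc s t u om ^ Suc k = 0" using z by eventually_elim simp
   qed (use inc_measurable[OF st] in simp_all)
   then show ?thesis by simp
  qed
  from this[of 0] this[of 1] this[of 3] show ?thesis using True by (auto simp: numeral_2_eq_2 eval_nat_numeral)
 next
  case False
  define \<sigma> where "\<sigma> = sqrt (t - s) * norm u"
  have \<sigma>: "\<sigma> > 0" and \<sigma>2: "\<sigma>^2 = (t - s) * (norm u)^2" using False st by (auto simp: \<sigma>_def power_mult_distrib)
  have D: "distributed P lborel (inc s t u) (%y. ennreal (normal_density 0 \<sigma> y))"
   using inc_distributed[of s t u] False st by (simp add: \<sigma>_def)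
  have m: "(\<integral>om. (inc s t u om) ^ k \<partial>P) = (\<integral>x. normal_density 0 \<sigma> x * x ^ k \<partial>lborel)" for k
   using distributed_integral[OF D, of "%x. x ^ k"] by simp
  have "(\<integral>om. inc s t u om \<partial>P) = 0" using m[of 1] integral_normal_moment_odd[OF \<sigma>, of 0 0] by simp
  moreover have "(\<integral>om. (inc s t u om)^2 \<partial>P) = \<sigma>^2"
   using m[of 2] integral_normal_moment_even[OF \<sigma>, of 0 1] by (simp add: fact_2)
  moreover have "(\<integral>om. (inc s t u om) ^ 4 \<partial>P) = 3 * (\<sigma>^2)^2"
   using m[of 4] integral_normal_moment_even[OF \<sigma>, of 0 2] \<sigma> by (simp add: fact_numeral power2_eq_square field_simps)
  ultimately show ?thesis by (simp add: \<sigma>2)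
 qed
 then show "(\<integral>om. inc s t u om \<partial>P) = 0" "(\<integral>om. (inc s t u om)^2 \<partial>P) = (t - s) * (norm u)^2"
  "(\<integral>om. (inc s t u om) ^ 4 \<partial>P) = 3 * ((t - s) * (norm u)^2)^2" by auto
qed

lemma inc_integrable: assumes st: "0 \<le> s" "s \<le> t" "t \<le> T" shows "integrable P (inc s t u)"
 using inc_power_integrable[OF st, of u 1] by simp

lemma square_integrable_mult:
 fixes f g :: "'w => real"
 assumes "f \<in> borel_measurable P" "g \<in> borel_measurable P" "integrable P (%x. (f x)^2)" "integrable P (%x. (g x)^2)"
 shows "integrable P (%x. f x * g x)"
proof (rule Bochner_Integration.integrable_bound[of P "%x. (f x)^2 + (g x)^2"])
 show "integrable P (%x. (f x)^2 + (g x)^2)" using assms by simp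
 show "(%x. f x * g x) \<in> borel_measurable P" using assms by simp
 have "\<bar>a * b\<bar> \<le> a^2 + b^2" for a b :: real
 proof -
  have "2 * (\<bar>a\<bar> * \<bar>b\<bar>) \<le> a^2 + b^2" using sum_squares_bound[of "\<bar>a\<bar>" "\<bar>b\<bar>"] by (simp add: mult.assoc)
  moreover have "0 \<le> \<bar>a\<bar> * \<bar>b\<bar>" by simp
  ultimately show ?thesis unfolding abs_mult by linarith
 qed
 then show "AE x in P. norm (f x * g x) \<le> norm ((f x)^2 + (g x)^2)" by simp
qed

lemma inc_mult_integrable: assumes "0 \<le> s" "s \<le> t" "t \<le> T" "0 \<le> s'" "s' \<le> t'" "t' \<le> T"
 shows "integrable P (%om. inc s t u om * inc s' t' v om)"
 by (intro square_integrable_mult inc_measurable inc_power_integrable assms)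

text \<open>Polarization: almost sure linearity in the direction makes the variance along
  \<open>u + v\<close> available for comparison with those along \<open>u\<close> and
  \<open>v\<close>.\<close>

lemma inc_covariance_same: assumes st: "0 \<le> s" "s \<le> t" "t \<le> T"
 shows "(\<integral>om. inc s t u om * inc s t v om \<partial>P) = (t - s) * (u \<bullet> v)"
proof -
 have i: "integrable P (%om. (inc s t w om)^2)" for w by (rule inc_power_integrable[OF st])
 note m = inc_mult_integrable[OF st st]
 have "(\<integral>om. (inc s t (1 *\<^sub>R u + 1 *\<^sub>R v) om)^2 \<partial>P) = (\<integral>om. (inc s t u om)^2 + (inc s t v om)^2 + 2 * (inc s t u om * inc s t v om) \<partial>P)"
 proof (rule integral_cong_AE)
  show "AE om in P. (inc s t (1 *\<^sub>R u + 1 *\<^sub>R v) om)^2 = (inc s t u om)^2 + (inc s t v om)^2 + 2 * (inc s t u om * inc s t v om)"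
   using inc_linear[OF st, of 1 u 1 v] by eventually_elim (simp add: power2_eq_square algebra_simps)
 qed (use inc_measurable[OF st] in \<open>auto intro!: borel_measurable_power borel_measurable_add borel_measurable_times\<close>)
 also have "\<dots> = (t - s) * (norm u)^2 + (t - s) * (norm v)^2 + 2 * (\<integral>om. inc s t u om * inc s t v om \<partial>P)"
  using i m by (simp add: inc_moments[OF st])
 finally have "(t - s) * (norm (u + v))^2 = (t - s) * (norm u)^2 + (t - s) * (norm v)^2 + 2 * (\<integral>om. inc s t u om * inc s t v om \<partial>P)"
  by (simp add: inc_moments[OF st])
 moreover have "(norm (u + v))^2 = (norm u)^2 + 2 * (u \<bullet> v) + (norm v)^2"
  unfolding power2_norm_eq_inner by (rule inner_add_add)
 ultimately show ?thesis by (simp add: algebra_simps)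
qed

lemma inc_orthogonal: assumes st: "0 \<le> s" "s \<le> t" "t \<le> T" and X: "X \<in> borel_measurable (\<F> s)" "integrable P X"
 shows "(\<integral>om. X om * inc s t v om \<partial>P) = 0"
 using indep_var_lebesgue_integral[OF inc_indep_var[OF st X(1)] X(2) inc_integrable[OF st, of v]]
 by (simp add: inc_moments[OF st])

lemma covariance_from_0: assumes s: "0 \<le> s" "s \<le> t" "t \<le> T"
 shows "(\<integral>om. inc 0 s u om * inc 0 t v om \<partial>P) = s * (u \<bullet> v)"
proof -
 have s0: "0 \<le> (0::real)" "0 \<le> s" "s \<le> T" and t0: "0 \<le> (0::real)" "0 \<le> t" "t \<le> T" using s by auto
 have "(\<integral>om. inc 0 s u om * inc 0 t v om \<partial>P) = (\<integral>om. inc 0 s u om * inc 0 s v om + inc 0 s u om * inc s t v om \<partial>P)"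
  by (intro Bochner_Integration.integral_cong refl) (simp add: inc_def algebra_simps)
 also have "\<dots> = s * (u \<bullet> v)"
  using inc_mult_integrable[OF s0 s0, of u v] inc_mult_integrable[OF s0 s, of u v]
   inc_covariance_same[OF s0, of u v] inc_orthogonal[OF s inc_measurable_filtration[OF s0] inc_integrable[OF s0], of u v]
  by simp
 finally show ?thesis .
qed

lemma covariance_0: assumes "s \<in> {0..T}" "t \<in> {0..T}"
 shows "(\<integral>om. inc 0 s u om * inc 0 t v om \<partial>P) = min s t * (u \<bullet> v)"
proof (cases "s \<le> t")
 case True then show ?thesis using covariance_from_0[of s t u v] assms by simp
next
 case False
 then have "t \<le> s" by simp
 have "(\<integral>om. inc 0 s u om * inc 0 t v om \<partial>P) = (\<integral>om. inc 0 t v om * inc 0 s u om \<partial>P)"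
  by (simp add: mult.commute)
 then show ?thesis using covariance_from_0[of t s v u] assms \<open>t \<le> s\<close> by (simp add: inner_commute)
qed

text \<open>The mixed second difference of the Brownian covariance \<open>min\<close>. For ordered
  end points it is the length of the intersection of the two intervals
  (\<open>overlap_integral\<close>), which is the source of the isometry.\<close>

definition "overlap p q p' q' = min q q' - min q p' - min p q' + min p (p'::real)"

lemma inc_covariance: assumes p: "0 \<le> p" "p \<le> q" "q \<le> T" and p': "0 \<le> p'" "p' \<le> q'" "q' \<le> T"
 shows "(\<integral>om. inc p q u om * inc p' q' v om \<partial>P) = overlap p q p' q' * (u \<bullet> v)"
proof -
 have i: "p \<in> {0..T}" "q \<in> {0..T}" "p' \<in> {0..T}" "q' \<in> {0..T}" using p p' by auto
 have int: "integrable P (%om. inc 0 s u om * inc 0 t v om)" if "s \<in> {0..T}" "t \<in> {0..T}" for s t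
  using that by (intro inc_mult_integrable) auto
 have "(\<integral>om. inc p q u om * inc p' q' v om \<partial>P) = (\<integral>om. inc 0 q u om * inc 0 q' v om - inc 0 q u om * inc 0 p' v om
   - inc 0 p u om * inc 0 q' v om + inc 0 p u om * inc 0 p' v om \<partial>P)"
  by (intro Bochner_Integration.integral_cong refl) (simp add: inc_def algebra_simps)
 also have "\<dots> = overlap p q p' q' * (u \<bullet> v)"
  using int[OF i(2,4)] int[OF i(2,3)] int[OF i(1,4)] int[OF i(1,3)]
   covariance_0[OF i(2,4), of u v] covariance_0[OF i(2,3), of u v] covariance_0[OF i(1,4), of u v] covariance_0[OF i(1,3), of u v]
  by (simp add: overlap_def algebra_simps)
 finally show ?thesis .
qed

lemma overlap_integral: assumes "p \<le> q" "p' \<le> q'"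
 shows "integrable lborel (%s. indicator {p<..q} s * indicator {p'<..q'} s :: real)"
  "(\<integral>s. indicator {p<..q} s * indicator {p'<..q'} s \<partial>lborel) = overlap p q p' q'"
proof -
 have e: "indicator {p<..q} s * indicator {p'<..q'} s = (indicator {max p p'<..min q q'} s :: real)" for s
  by (auto simp: indicator_def)
 show "integrable lborel (%s. indicator {p<..q} s * indicator {p'<..q'} s :: real)"
  unfolding e by (intro integrable_real_indicator emeasure_bounded_finite bounded_subset[OF bounded_closed_interval[of "max p p'" "min q q'"]]) auto
 have "(\<integral>s. indicator {p<..q} s * indicator {p'<..q'} s \<partial>lborel) = measure lborel {max p p'<..min q q'}"
  unfolding e by simp
 also have "\<dots> = max 0 (min q q' - max p p')"
  by (cases "max p p' \<le> min q q'") (auto simp: measure_lborel_Ioc)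
 also have "\<dots> = overlap p q p' q'"
  using assms unfolding overlap_def by (auto simp: min_def max_def)
 finally show "(\<integral>s. indicator {p<..q} s * indicator {p'<..q'} s \<partial>lborel) = overlap p q p' q'" .
qed

end

section \<open>Isometry and uniqueness of the Wiener integral\<close>

lemma has_sum_finite_sum:
 fixes f :: "'i => 'e => real"
 assumes "finite I" "!!i. i \<in> I ==> (f i has_sum x i) A"
 shows "((%e. \<Sum>i\<in>I. f i e) has_sum (\<Sum>i\<in>I. x i)) A"
 using assms
proof (induction I rule: finite_induct)
 case (insert j I)
 have "((%e. f j e + (\<Sum>i\<in>I. f i e)) has_sum (x j + (\<Sum>i\<in>I. x i))) A"
  by (intro has_sum_add insert.IH insert.prems) auto
 then show ?case using insert.hyps by simp
qed (simp add: has_sum_0)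

lemma integral_double_sum:
 fixes f :: "'i => 'j => 'b => real"
 assumes "!!i j. i \<in> I ==> j \<in> J ==> integrable M (f i j)"
 shows "(\<integral>x. (\<Sum>i\<in>I. \<Sum>j\<in>J. f i j x) \<partial>M) = (\<Sum>i\<in>I. \<Sum>j\<in>J. \<integral>x. f i j x \<partial>M)"
 using assms by (simp add: Bochner_Integration.integral_sum Bochner_Integration.integrable_sum)

lemma norm_sum_scaleR_square:
 fixes h :: "'i => 'a::real_inner"
 shows "(norm (\<Sum>i\<in>I. c i *\<^sub>R h i))^2 = (\<Sum>i\<in>I. \<Sum>j\<in>I. c i * c j * (h i \<bullet> h j))"
 unfolding power2_norm_eq_inner inner_sum_left
 by (simp add: inner_sum_right sum_distrib_left mult_ac)

lemma norm_add_square_le: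
 fixes a b :: "'a::real_inner"
 shows "(norm (a + b))^2 \<le> 2 * (norm a)^2 + 2 * (norm b)^2"
 using parallelogram[of a "- b"] zero_le_power2[of "norm (a - b)"] by simp

lemma norm_diff_square_le:
 fixes a b :: "'a::real_inner"
 shows "(norm (a - b))^2 \<le> 2 * (norm a)^2 + 2 * (norm b)^2"
 using norm_add_square_le[of a "- b"] by simp

lemma measurable_compose_real_norm:
 fixes f g :: "'w => 'a::{real_normed_vector, second_countable_topology}"
 assumes "f \<in> borel_measurable M" "g \<in> borel_measurable M"
 shows "(%x. ennreal ((norm (f x - g x))^2)) \<in> borel_measurable M"
 using assms by measurable

text \<open>The very choice term that occurs in \<open>hs_norm_sq\<close>, given a name so that
  facts about the chosen basis can be stated.\<close>

definition hs_basis :: "'u::{real_inner, banach, second_countable_topology} set"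
 where "hs_basis = (SOME B. orthonormal_basis_of UNIV B)"

lemma hs_basis: "orthonormal_basis_of UNIV (hs_basis :: 'u::{real_inner, banach, second_countable_topology} set)"
 unfolding hs_basis_def by (rule someI_ex[OF orthonormal_basis_exists])

lemma countable_hs_basis: "countable (hs_basis :: 'u::{real_inner, banach, second_countable_topology} set)"
 using hs_basis unfolding orthonormal_basis_of_def by (intro orthonormal_countable) auto

lemma hs_norm_sq_basis: "hs_norm_sq L = (\<integral>\<^sup>+ e. ennreal ((norm (L e))^2) \<partial>count_space (hs_basis))"
 for L :: "'u::{real_inner, banach, second_countable_topology} => 'a::real_inner"
 unfolding hs_norm_sq_def hs_basis_def ..

text \<open>Countability of the basis enters twice: counting measure on it is sigma-finite, and
  joint measurability reduces to that of \<open>G s u\<close> in \<open>s\<close> for each fixed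
  basis vector \<open>u\<close>.\<close>

lemma hs_norm_sq_measurable:
 fixes G :: "real => 'u::{real_inner, banach, second_countable_topology} => 'a::{real_inner, second_countable_topology}"
 assumes "!!u. (%s. G s u) \<in> borel_measurable borel"
 shows "(%s. hs_norm_sq (G s)) \<in> borel_measurable borel"
proof -
 let ?M = "count_space (hs_basis :: 'u set)"
 interpret sigma_finite_measure ?M
  by (rule sigma_finite_measure_count_space_countable[OF countable_hs_basis])
 have "(%p. ennreal ((norm (G (snd p) (fst p)))^2)) \<in> borel_measurable (?M \<Otimes>\<^sub>M borel)"
 proof (rule measurable_pair_measure_countable1[OF countable_hs_basis])
  fix u :: 'u show "(%y. ennreal ((norm (G (snd (u, y)) (fst (u, y))))^2)) \<in> borel_measurable borel"
   using assms[of u] by simp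
 qed
 from measurable_compose[OF measurable_pair_swap'[of borel ?M] this]
 have "(%(s, e). ennreal ((norm (G s e))^2)) \<in> borel_measurable (borel \<Otimes>\<^sub>M ?M)"
  by (simp only: split_def fst_conv snd_conv)
 from borel_measurable_nn_integral[OF this] show ?thesis by (simp add: hs_norm_sq_basis)
qed

lemma hs_norm_sq_diff_le:
 fixes G H :: "'u::{real_inner, banach, second_countable_topology} => 'a::real_inner"
 shows "hs_norm_sq (%v. G v - H v) \<le> 2 * hs_norm_sq G + 2 * hs_norm_sq H"
proof -
 have "hs_norm_sq (%v. G v - H v) \<le> (\<integral>\<^sup>+ e. 2 * ennreal ((norm (G e))^2) + 2 * ennreal ((norm (H e))^2) \<partial>count_space hs_basis)"
  unfolding hs_norm_sq_basis
 proof (rule nn_integral_mono)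
  fix e
  have "ennreal ((norm (G e - H e))^2) \<le> ennreal (2 * (norm (G e))^2 + 2 * (norm (H e))^2)"
   by (rule ennreal_leI[OF norm_diff_square_le])
  then show "ennreal ((norm (G e - H e))^2) \<le> 2 * ennreal ((norm (G e))^2) + 2 * ennreal ((norm (H e))^2)"
   by (simp add: ennreal_plus ennreal_mult)
 qed
 also have "\<dots> = 2 * hs_norm_sq G + 2 * hs_norm_sq H"
  unfolding hs_norm_sq_basis by (subst nn_integral_add) (simp_all add: nn_integral_cmult)
 finally show ?thesis .
qed

lemma hs_norm_sq_compose_le:
 fixes B :: "'u::{real_inner, banach, second_countable_topology} => 'a::real_inner" and L :: "'a => 'b::real_inner"
 assumes "!!u. norm (L (B u)) \<le> c * norm (B u)"
 shows "hs_norm_sq (%u. L (B u)) \<le> ennreal (c^2) * hs_norm_sq B"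
proof -
 have "hs_norm_sq (%u. L (B u)) \<le> (\<integral>\<^sup>+ e. ennreal (c^2) * ennreal ((norm (B e))^2) \<partial>count_space hs_basis)"
  unfolding hs_norm_sq_basis
 proof (rule nn_integral_mono)
  fix e
  have "(norm (L (B e)))^2 \<le> (c * norm (B e))^2" by (intro power_mono assms) simp
  then show "ennreal ((norm (L (B e)))^2) \<le> ennreal (c^2) * ennreal ((norm (B e))^2)"
   by (simp add: power_mult_distrib flip: ennreal_mult)
 qed
 then show ?thesis unfolding hs_norm_sq_basis by (simp add: nn_integral_cmult)
qed

text \<open>Access by index turns the list sums into sums over \<open>i\<close>, whose squared norms
  are double sums over \<open>i\<close> and \<open>j\<close>.\<close>

definition "sp S i = fst (S ! i)"
definition "sq S i = fst (snd (S ! i))"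
definition "su S i = fst (snd (snd (S ! i)))"
definition "sh S i = snd (snd (snd (S ! i)))"

lemma elem_integrand_nth:
 "elem_integrand S s v = (\<Sum>i<length S. (indicator {sp S i<..sq S i} s * (su S i \<bullet> v)) *\<^sub>R sh S i)"
 unfolding elem_integrand_def sum_list_sum_nth sp_def sq_def su_def sh_def
 by (simp add: split_def atLeast0LessThan)

text \<open>Expanding the square gives a double sum; Parseval removes the sum over the basis and
  leaves the inner products of the directions in \<open>U\<close>.\<close>

lemma hs_norm_sq_elem:
 fixes S :: "(real \<times> real \<times> 'u::{real_inner, banach, second_countable_topology} \<times> 'a::real_inner) list" and s :: real
 defines "r \<equiv> \<Sum>i<length S. \<Sum>j<length S. (indicator {sp S i<..sq S i} s * indicator {sp S j<..sq S j} s) * ((su S i \<bullet> su S j) * (sh S i \<bullet> sh S j))"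
 shows "hs_norm_sq (elem_integrand S s) = ennreal r" "0 \<le> r"
proof -
 let ?I = "%i. indicator {sp S i<..sq S i} s :: real"
 have "((%e. \<Sum>i<length S. \<Sum>j<length S. (?I i * ?I j * (sh S i \<bullet> sh S j)) * ((su S i \<bullet> e) * (su S j \<bullet> e))) has_sum
   (\<Sum>i<length S. \<Sum>j<length S. (?I i * ?I j * (sh S i \<bullet> sh S j)) * (su S i \<bullet> su S j))) hs_basis"
  by (intro has_sum_finite_sum has_sum_cmult_right parseval[OF hs_basis] finite_lessThan)
 moreover have "(\<Sum>i<length S. \<Sum>j<length S. (?I i * ?I j * (sh S i \<bullet> sh S j)) * ((su S i \<bullet> e) * (su S j \<bullet> e))) = (norm (elem_integrand S s e))^2" for e
  unfolding elem_integrand_nth norm_sum_scaleR_square by (intro sum.cong refl) (simp only: mult_ac)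
 moreover have "(\<Sum>i<length S. \<Sum>j<length S. (?I i * ?I j * (sh S i \<bullet> sh S j)) * (su S i \<bullet> su S j)) = r"
  unfolding r_def by (intro sum.cong refl) (simp only: mult_ac)
 ultimately have hs: "((%e. (norm (elem_integrand S s e))^2) has_sum r) hs_basis" by simp
 show "hs_norm_sq (elem_integrand S s) = ennreal r"
  unfolding hs_norm_sq_basis by (rule nn_integral_count_space_has_sum[OF hs]) simp
 show "0 \<le> r" by (rule has_sum_nonneg[OF hs]) simp
qed

text \<open>Appending the negated list represents the difference of two elementary integrands as a
  single one, to which the isometry applies.\<close>

definition elem_neg :: "(real \<times> real \<times> 'u \<times> 'a::real_inner) list => (real \<times> real \<times> 'u \<times> 'a) list"
 where "elem_neg S = map (%(p, q, u, h). (p, q, u, - h)) S"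

lemma elem_integrand_append: "elem_integrand (S @ S') s v = elem_integrand S s v + elem_integrand S' s v"
 unfolding elem_integrand_def by simp

lemma elem_integrand_neg: "elem_integrand (elem_neg S) s v = - elem_integrand S s v"
 unfolding elem_integrand_def elem_neg_def by (induction S) auto

lemma elem_integral_append: "elem_integral W (S @ S') om = elem_integral W S om + elem_integral W S' om"
 unfolding elem_integral_def by simp

lemma elem_integral_neg: "elem_integral W (elem_neg S) om = - elem_integral W S om"
 unfolding elem_integral_def elem_neg_def by (induction S) auto

definition valid_elem :: "real => real => 'a set => (real \<times> real \<times> 'u \<times> 'a) list => bool"
 where "valid_elem a b V S \<longleftrightarrow> (\<forall>(p, q, u, h)\<in>set S. a \<le> p \<and> p \<le> q \<and> q \<le> b \<and> h \<in> V)"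

lemma valid_elem_diff: "subspace V ==> valid_elem a b V S ==> valid_elem a b V S' ==> valid_elem a b V (S @ elem_neg S')"
 unfolding valid_elem_def elem_neg_def by (auto simp: subspace_neg)

lemma valid_elem_nth: assumes "valid_elem a b V S" "i < length S"
 shows "a \<le> sp S i" "sp S i \<le> sq S i" "sq S i \<le> b" "sh S i \<in> V"
proof -
 have "S ! i \<in> set S" using assms by simp
 moreover have "S ! i = (sp S i, sq S i, su S i, sh S i)" by (simp add: sp_def sq_def su_def sh_def)
 ultimately have "(sp S i, sq S i, su S i, sh S i) \<in> set S" by simp
 then show "a \<le> sp S i" "sp S i \<le> sq S i" "sq S i \<le> b" "sh S i \<in> V"
  using assms(1) unfolding valid_elem_def by auto
qed

lemma elem_integrand_measurable: "(%s. elem_integrand S s v) \<in> borel_measurable borel"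
 for S :: "(real \<times> real \<times> 'u::real_inner \<times> 'a::{real_inner, second_countable_topology}) list"
 unfolding elem_integrand_nth by measurable

context wiener
begin

lemma elem_integral_nth:
 "elem_integral W S om = (\<Sum>i<length S. inc (sp S i) (sq S i) (su S i) om *\<^sub>R sh S i)"
 unfolding elem_integral_def sum_list_sum_nth sp_def sq_def su_def sh_def inc_def
 by (simp add: split_def atLeast0LessThan)

lemma elem_integral_measurable:
 fixes S :: "(real \<times> real \<times> 'u \<times> 'a::{real_inner, second_countable_topology}) list"
 assumes S: "valid_elem a b V S" and ab: "0 \<le> a" "b \<le> T"
 shows "elem_integral W S \<in> borel_measurable P"
proof -
 have "(%om. \<Sum>i<length S. inc (sp S i) (sq S i) (su S i) om *\<^sub>R sh S i) \<in> borel_measurable P"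
 proof (intro borel_measurable_sum borel_measurable_scaleR borel_measurable_const inc_measurable)
  fix i assume "i \<in> {..<length S}"
  then have "i < length S" by simp
  from valid_elem_nth[OF S this] ab show "0 \<le> sp S i" "sp S i \<le> sq S i" "sq S i \<le> T" by auto
 qed
 then show ?thesis by (simp add: elem_integral_nth[abs_def])
qed

text \<open>Both sides are the double sum over \<open>i\<close> and \<open>j\<close> of the overlap
  of the two intervals times \<open>su S i \<bullet> su S j\<close> times
  \<open>sh S i \<bullet> sh S j\<close>: on the left through the covariance of increments, on the
  right through the integral of a product of indicators.\<close>

lemma elem_isometry:
 fixes S :: "(real \<times> real \<times> 'u \<times> 'a::{real_inner, second_countable_topology}) list"
 assumes S: "valid_elem a b V S" and ab: "0 \<le> a" "b \<le> T"
 shows "(\<integral>\<^sup>+om. ennreal ((norm (elem_integral W S om))^2) \<partial>P) = (\<integral>\<^sup>+s\<in>{a..b}. hs_norm_sq (elem_integrand S s) \<partial>lborel)"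
proof -
 let ?N = "{..<length S}"
 let ?I = "%i s. indicator {sp S i<..sq S i} s :: real"
 let ?g = "%i j. (su S i \<bullet> su S j) * (sh S i \<bullet> sh S j)"
 let ?r = "%s. \<Sum>i<length S. \<Sum>j<length S. (?I i s * ?I j s) * ?g i j"
 let ?o = "%i j. overlap (sp S i) (sq S i) (sp S j) (sq S j)"
 have v: "0 \<le> sp S i" "sp S i \<le> sq S i" "sq S i \<le> T" if "i < length S" for i
  using valid_elem_nth[OF S that] ab by auto
 have sq: "(norm (elem_integral W S om))^2 = (\<Sum>i<length S. \<Sum>j<length S. (inc (sp S i) (sq S i) (su S i) om * inc (sp S j) (sq S j) (su S j) om) * (sh S i \<bullet> sh S j))" for om
  unfolding elem_integral_nth norm_sum_scaleR_square ..
 have i1: "integrable P (%om. (inc (sp S i) (sq S i) (su S i) om * inc (sp S j) (sq S j) (su S j) om) * (sh S i \<bullet> sh S j))"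
  if "i < length S" "j < length S" for i j
  using that by (intro integrable_mult_left inc_mult_integrable v)
 have i2: "integrable lborel (%s. (?I i s * ?I j s) * ?g i j)" if "i < length S" "j < length S" for i j
  using that by (intro integrable_mult_left overlap_integral v)
 have "(\<integral>om. (norm (elem_integral W S om))^2 \<partial>P) = (\<Sum>i<length S. \<Sum>j<length S. (?o i j * (su S i \<bullet> su S j)) * (sh S i \<bullet> sh S j))"
  unfolding sq by (subst integral_double_sum) (use i1 in \<open>simp_all add: inc_covariance v\<close>)
 also have "\<dots> = (\<Sum>i<length S. \<Sum>j<length S. \<integral>s. (?I i s * ?I j s) * ?g i j \<partial>lborel)"
 proof (intro sum.cong refl)
  fix i j assume "i \<in> ?N" "j \<in> ?N"
  then have ij: "i < length S" "j < length S" by auto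
  have "(\<integral>s. (?I i s * ?I j s) * ?g i j \<partial>lborel) = ?o i j * ?g i j"
   unfolding integral_mult_left_zero overlap_integral(2)[OF v(2)[OF ij(1)] v(2)[OF ij(2)]] ..
  then show "(?o i j * (su S i \<bullet> su S j)) * (sh S i \<bullet> sh S j) = (\<integral>s. (?I i s * ?I j s) * ?g i j \<partial>lborel)"
   by (simp only: mult.assoc)
 qed
 also have "\<dots> = (\<integral>s. ?r s \<partial>lborel)"
  by (rule integral_double_sum[symmetric]) (use i2 in simp)
 finally have eq: "(\<integral>om. (norm (elem_integral W S om))^2 \<partial>P) = (\<integral>s. ?r s \<partial>lborel)" .
 have "integrable P (%om. (norm (elem_integral W S om))^2)"
  unfolding sq using i1 by (intro Bochner_Integration.integrable_sum) auto
 then have 1: "(\<integral>\<^sup>+om. ennreal ((norm (elem_integral W S om))^2) \<partial>P) = ennreal (\<integral>om. (norm (elem_integral W S om))^2 \<partial>P)"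
  by (rule nn_integral_eq_integral) simp
 have "integrable lborel ?r"
  using i2 by (intro Bochner_Integration.integrable_sum) auto
 then have 2: "(\<integral>\<^sup>+s. ennreal (?r s) \<partial>lborel) = ennreal (\<integral>s. ?r s \<partial>lborel)"
  by (rule nn_integral_eq_integral) (simp add: hs_norm_sq_elem(2))
 have "(\<integral>\<^sup>+s\<in>{a..b}. hs_norm_sq (elem_integrand S s) \<partial>lborel) = (\<integral>\<^sup>+s. ennreal (?r s) \<partial>lborel)"
 proof (rule nn_integral_cong)
  fix s
  show "hs_norm_sq (elem_integrand S s) * indicator {a..b} s = ennreal (?r s)"
  proof (cases "s \<in> {a..b}")
   case False
   have "?I i s = 0" if "i < length S" for i
    using False valid_elem_nth[OF S that] by (auto simp: indicator_def)
   then have "?r s = 0" by (intro sum.neutral) simp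
   with False show ?thesis by simp
  qed (simp add: hs_norm_sq_elem(1))
 qed
 with 1 2 eq show ?thesis by simp
qed

text \<open>Isometry for the difference of the two integrands, followed by the triangle inequality
  through \<open>G\<close>.\<close>

lemma elem_diff_bound:
 fixes G :: "real => 'u => 'a::{real_inner, second_countable_topology}"
 assumes V: "subspace V" and S: "valid_elem a b V S" "valid_elem a b V S'" and ab: "0 \<le> a" "b \<le> T"
  and G: "!!u. (%s. G s u) \<in> borel_measurable borel"
 shows "(\<integral>\<^sup>+om. ennreal ((norm (elem_integral W S om - elem_integral W S' om))^2) \<partial>P)
  \<le> 2 * (\<integral>\<^sup>+s\<in>{a..b}. hs_norm_sq (%v. G s v - elem_integrand S s v) \<partial>lborel)
   + 2 * (\<integral>\<^sup>+s\<in>{a..b}. hs_norm_sq (%v. G s v - elem_integrand S' s v) \<partial>lborel)"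
proof -
 let ?D = "%S s. hs_norm_sq (%v. G s v - elem_integrand S s v)"
 have m: "(%s. ?D S s) \<in> borel_measurable borel" for S
  by (intro hs_norm_sq_measurable borel_measurable_diff G elem_integrand_measurable)
 have "(\<integral>\<^sup>+om. ennreal ((norm (elem_integral W S om - elem_integral W S' om))^2) \<partial>P)
   = (\<integral>\<^sup>+om. ennreal ((norm (elem_integral W (S @ elem_neg S') om))^2) \<partial>P)"
  by (simp add: elem_integral_append elem_integral_neg)
 also have "\<dots> = (\<integral>\<^sup>+s\<in>{a..b}. hs_norm_sq (elem_integrand (S @ elem_neg S') s) \<partial>lborel)"
  by (rule elem_isometry[OF valid_elem_diff[OF V S] ab])
 also have "\<dots> \<le> (\<integral>\<^sup>+s. 2 * (?D S s * indicator {a..b} s) + 2 * (?D S' s * indicator {a..b} s) \<partial>lborel)"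
 proof (rule nn_integral_mono)
  fix s
  have "hs_norm_sq (elem_integrand (S @ elem_neg S') s) = hs_norm_sq (%v. (G s v - elem_integrand S' s v) - (G s v - elem_integrand S s v))"
   by (intro arg_cong[where f=hs_norm_sq] ext) (simp add: elem_integrand_append elem_integrand_neg)
  also have "\<dots> \<le> 2 * ?D S' s + 2 * ?D S s" by (rule hs_norm_sq_diff_le)
  finally show "hs_norm_sq (elem_integrand (S @ elem_neg S') s) * indicator {a..b} s
    \<le> 2 * (?D S s * indicator {a..b} s) + 2 * (?D S' s * indicator {a..b} s)"
   by (auto simp: indicator_def add.commute)
 qed
 also have "\<dots> = 2 * (\<integral>\<^sup>+s\<in>{a..b}. ?D S s \<partial>lborel) + 2 * (\<integral>\<^sup>+s\<in>{a..b}. ?D S' s \<partial>lborel)"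
  using m by (subst nn_integral_add) (simp_all add: nn_integral_cmult)
 finally show ?thesis .
qed

text \<open>Makes the choice in \<open>wiener_integral\<close> harmless. The factors 4 and 2 come
  from applying the inequality for the square of a sum twice, on the path from \<open>I\<close> to
  \<open>I'\<close> through the two elementary approximations.\<close>

lemma has_wiener_integral_unique:
 fixes G :: "real => 'u => 'a::{real_inner, second_countable_topology}"
 assumes V: "subspace V" and ab: "0 \<le> a" "b \<le> T"
  and G: "!!u. (%s. G s u) \<in> borel_measurable borel"
  and I: "has_wiener_integral P W V a b G I" and I': "has_wiener_integral P W V a b G I'"
 shows "AE om in P. I om = I' om"
proof -
 let ?D = "%S. \<integral>\<^sup>+s\<in>{a..b}. hs_norm_sq (%v. G s v - elem_integrand S s v) \<partial>lborel"
 let ?e = "%f. \<integral>\<^sup>+om. ennreal ((norm (f om))^2) \<partial>P"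
 obtain S where S: "!!k. valid_elem a b V (S k)" "(%k. ?D (S k)) \<longlonglongrightarrow> 0"
   "(%k. ?e (%om. I om - elem_integral W (S k) om)) \<longlonglongrightarrow> 0" and mI: "I \<in> borel_measurable P"
  using I unfolding has_wiener_integral_def valid_elem_def by blast
 obtain S' where S': "!!k. valid_elem a b V (S' k)" "(%k. ?D (S' k)) \<longlonglongrightarrow> 0"
   "(%k. ?e (%om. I' om - elem_integral W (S' k) om)) \<longlonglongrightarrow> 0" and mI': "I' \<in> borel_measurable P"
  using I' unfolding has_wiener_integral_def valid_elem_def by blast
 note mS = elem_integral_measurable[OF S(1) ab] and mS' = elem_integral_measurable[OF S'(1) ab]
 have le: "?e (%om. I om - I' om) \<le> 4 * ?e (%om. I om - elem_integral W (S k) om) + 4 * ?e (%om. I' om - elem_integral W (S' k) om)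
   + 2 * (2 * ?D (S k) + 2 * ?D (S' k))" for k
 proof -
  let ?J = "elem_integral W (S k)" and ?J' = "elem_integral W (S' k)"
  have "?e (%om. I om - I' om) \<le> (\<integral>\<^sup>+om. 4 * ennreal ((norm (I om - ?J om))^2) + 4 * ennreal ((norm (I' om - ?J' om))^2)
    + 2 * ennreal ((norm (?J om - ?J' om))^2) \<partial>P)"
  proof (rule nn_integral_mono)
   fix om
   have "I om - I' om = ((I om - ?J om) - (I' om - ?J' om)) + (?J om - ?J' om)" by simp
   then have "(norm (I om - I' om))^2 \<le> 2 * (norm ((I om - ?J om) - (I' om - ?J' om)))^2 + 2 * (norm (?J om - ?J' om))^2"
    using norm_add_square_le by metis
   also have "\<dots> \<le> 4 * (norm (I om - ?J om))^2 + 4 * (norm (I' om - ?J' om))^2 + 2 * (norm (?J om - ?J' om))^2"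
    using norm_diff_square_le[of "I om - ?J om" "I' om - ?J' om"] by linarith
   finally have "ennreal ((norm (I om - I' om))^2) \<le> ennreal (4 * (norm (I om - ?J om))^2 + 4 * (norm (I' om - ?J' om))^2 + 2 * (norm (?J om - ?J' om))^2)"
    by (rule ennreal_leI)
   then show "ennreal ((norm (I om - I' om))^2) \<le> 4 * ennreal ((norm (I om - ?J om))^2) + 4 * ennreal ((norm (I' om - ?J' om))^2)
    + 2 * ennreal ((norm (?J om - ?J' om))^2)"
    by (simp add: ennreal_plus ennreal_mult)
  qed
  also have "\<dots> = 4 * ?e (%om. I om - ?J om) + 4 * ?e (%om. I' om - ?J' om) + 2 * ?e (%om. ?J om - ?J' om)"
   using measurable_compose_real_norm[OF mI mS, of k] measurable_compose_real_norm[OF mI' mS', of k] measurable_compose_real_norm[OF mS mS', of k k]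
   by (simp add: nn_integral_add nn_integral_cmult)
  also have "\<dots> \<le> 4 * ?e (%om. I om - ?J om) + 4 * ?e (%om. I' om - ?J' om) + 2 * (2 * ?D (S k) + 2 * ?D (S' k))"
   by (intro add_left_mono mult_left_mono elem_diff_bound[OF V S(1) S'(1) ab G]) simp
  finally show ?thesis .
 qed
 have "(%k. 4 * ?e (%om. I om - elem_integral W (S k) om) + 4 * ?e (%om. I' om - elem_integral W (S' k) om)
   + 2 * (2 * ?D (S k) + 2 * ?D (S' k))) \<longlonglongrightarrow> 4 * 0 + 4 * 0 + 2 * (2 * 0 + 2 * 0)"
  by (intro tendsto_add tendsto_mult_ennreal S S' tendsto_const) auto
 then have "?e (%om. I om - I' om) \<le> 0"
  using le by (intro LIMSEQ_le_const[of _ 0]) auto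
 then have "AE om in P. ennreal ((norm (I om - I' om))^2) = 0"
  by (subst nn_integral_0_iff_AE[symmetric]) (use measurable_compose_real_norm[OF mI mI'] in auto)
 then show ?thesis by eventually_elim simp
qed

text \<open>Almost sure convergence of the elementary integrals is enough to identify the limit:
  Fatou in the second index of the Cauchy estimate \<open>elem_diff_bound\<close> upgrades it to
  mean square convergence.\<close>

lemma has_wiener_integralI:
 fixes G :: "real => 'u => 'a::{real_inner, second_countable_topology}"
 assumes V: "subspace V" and ab: "0 \<le> a" "b \<le> T"
  and G: "!!u. (%s. G s u) \<in> borel_measurable borel"
  and S: "!!k. valid_elem a b V (S k)"
  and lim: "(%k. \<integral>\<^sup>+s\<in>{a..b}. hs_norm_sq (%v. G s v - elem_integrand (S k) s v) \<partial>lborel) \<longlonglongrightarrow> 0"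
  and I: "I \<in> borel_measurable P" "!!om. om \<in> space P ==> I om \<in> V"
  and conv: "AE om in P. (%k. elem_integral W (S k) om) \<longlonglongrightarrow> I om"
 shows "has_wiener_integral P W V a b G I"
proof -
 let ?D = "%S. \<integral>\<^sup>+s\<in>{a..b}. hs_norm_sq (%v. G s v - elem_integrand S s v) \<partial>lborel"
 let ?e = "%f. \<integral>\<^sup>+om. ennreal ((norm (f om))^2) \<partial>P"
 note mS = elem_integral_measurable[OF S(1) ab]
 have le: "?e (%om. I om - elem_integral W (S k) om) \<le> 2 * ?D (S k)" for k
 proof -
  let ?J = "elem_integral W (S k)"
  have "?e (%om. I om - ?J om) = (\<integral>\<^sup>+om. liminf (%l. ennreal ((norm (elem_integral W (S l) om - ?J om))^2)) \<partial>P)"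
  proof (rule nn_integral_cong_AE)
   show "AE om in P. ennreal ((norm (I om - ?J om))^2) = liminf (%l. ennreal ((norm (elem_integral W (S l) om - ?J om))^2))"
    using conv
   proof eventually_elim
    fix om assume c: "(%k. elem_integral W (S k) om) \<longlonglongrightarrow> I om"
    have "(%l. ennreal ((norm (elem_integral W (S l) om - ?J om))^2)) \<longlonglongrightarrow> ennreal ((norm (I om - ?J om))^2)"
     by (intro tendsto_intros c)
    from lim_imp_Liminf[OF _ this] show "ennreal ((norm (I om - ?J om))^2) = liminf (%l. ennreal ((norm (elem_integral W (S l) om - ?J om))^2))"
     by simp
   qed
  qed
  also have "\<dots> \<le> liminf (%l. ?e (%om. elem_integral W (S l) om - ?J om))"
   by (rule nn_integral_liminf) (rule measurable_compose_real_norm[OF mS mS])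
  also have "\<dots> \<le> liminf (%l. 2 * ?D (S l) + 2 * ?D (S k))"
   by (intro Liminf_mono always_eventually allI elem_diff_bound[OF V S S ab G])
  also have "\<dots> = 2 * 0 + 2 * ?D (S k)"
  proof (rule lim_imp_Liminf)
   show "(%l. 2 * ?D (S l) + 2 * ?D (S k)) \<longlonglongrightarrow> 2 * 0 + 2 * ?D (S k)"
    by (intro tendsto_add tendsto_mult_ennreal lim tendsto_const) auto
  qed simp
  finally show ?thesis by simp
 qed
 have "(%k. 2 * ?D (S k)) \<longlonglongrightarrow> 2 * 0"
  by (intro tendsto_mult_ennreal lim tendsto_const) auto
 then have D0: "(%k. 2 * ?D (S k)) \<longlonglongrightarrow> 0" by simp
 have e0: "(%k. ?e (%om. I om - elem_integral W (S k) om)) \<longlonglongrightarrow> 0"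
  by (rule tendsto_sandwich[OF always_eventually always_eventually tendsto_const D0]) (use le in auto)
 show ?thesis unfolding has_wiener_integral_def
 proof (intro conjI I(1) ballI I(2) exI[of _ S])
  show "\<forall>k. \<forall>(p, q, u, h)\<in>set (S k). a \<le> p \<and> p \<le> q \<and> q \<le> b \<and> h \<in> V"
   using S unfolding valid_elem_def by blast
 qed (assumption | rule lim e0)+
qed

lemma wiener_integral_eq:
 fixes G :: "real => 'u => 'a::{real_inner, second_countable_topology}"
 assumes V: "subspace V" and ab: "0 \<le> a" "b \<le> T"
  and G: "!!u. (%s. G s u) \<in> borel_measurable borel"
  and I: "has_wiener_integral P W V a b G I"
 shows "AE om in P. wiener_integral P W V a b G om = I om"
proof (rule has_wiener_integral_unique[OF V ab G _ I])
 show "has_wiener_integral P W V a b G (wiener_integral P W V a b G)"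
  unfolding wiener_integral_def using I by (rule someI[where P="has_wiener_integral P W V a b G"])
qed

end

subsection \<open>Vector-valued increments\<close>

lemma integral_scaleR_density:
 fixes f :: "'a => 'b::{banach, second_countable_topology}"
 assumes "f \<in> borel_measurable M" "g \<in> borel_measurable M" "!!x. 0 \<le> g x"
 shows "(\<integral>x. f x \<partial>density M (%x. ennreal (g x))) = (\<integral>x. g x *\<^sub>R f x \<partial>M)"
 using assms by (intro integral_density) auto

lemma finite_measure_density_bounded:
 assumes "finite_measure M" "g \<in> borel_measurable M" "!!x. 0 \<le> g x" "!!x. g x \<le> (c::real)"
 shows "finite_measure (density M (%x. ennreal (g x)))"
proof
 interpret finite_measure M by fact
 have "emeasure (density M (%x. ennreal (g x))) (space M) = (\<integral>\<^sup>+x. ennreal (g x) * indicator (space M) x \<partial>M)"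
  using assms(2) by (intro emeasure_density) auto
 also have "\<dots> \<le> (\<integral>\<^sup>+x. ennreal c \<partial>M)"
  using assms(3,4) by (intro nn_integral_mono) (auto simp: indicator_def intro: ennreal_leI)
 also have "\<dots> < \<infinity>" by (auto simp: less_top[symmetric] ennreal_mult_eq_top_iff emeasure_finite)
 finally show "emeasure (density M (%x. ennreal (g x))) (space (density M (%x. ennreal (g x)))) \<noteq> \<infinity>" by simp
qed

text \<open>The transform at 0 is the total mass, so both measures can be normalized by the same
  constant and Levy uniqueness applies; mass zero is separate.\<close>

lemma char_unique_finite_measure:
 fixes M N :: "real measure"
 assumes fM: "finite_measure M" and fN: "finite_measure N" and sM: "sets M = sets borel" and sN: "sets N = sets borel"
  and char: "!!t. char M t = char N t"
 shows "M = N"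
proof -
 interpret M: finite_measure M by fact
 interpret N: finite_measure N by fact
 have spM: "space M = UNIV" and spN: "space N = UNIV" using sets_eq_imp_space_eq[OF sM] sets_eq_imp_space_eq[OF sN] by auto
 define c where "c = measure M UNIV"
 have c0: "0 \<le> c" by (simp add: c_def)
 have cN: "measure N UNIV = c"
  using char[of 0] by (simp add: char_def c_def spM spN)
 show ?thesis
 proof (cases "c = 0")
  case True
  have "emeasure M A = 0 \<and> emeasure N A = 0" for A
  proof -
   have "emeasure M A \<le> emeasure M UNIV" "emeasure N A \<le> emeasure N UNIV"
    using emeasure_space[of M A] emeasure_space[of N A] by (auto simp: spM spN)
   then show ?thesis using True cN by (simp add: M.emeasure_eq_measure N.emeasure_eq_measure c_def measure_le_0_iff)
  qed
  then show ?thesis using sM sN by (intro measure_eqI) auto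
 next
  case False
  then have c: "0 < c" using c0 by simp
  let ?D = "%M. density M (%_. ennreal (1 / c))"
  have rd: "real_distribution (?D K)" if K: "finite_measure K" "sets K = sets borel" "measure K UNIV = c" for K
  proof -
   interpret K: finite_measure K by fact
   have "space K = UNIV" using sets_eq_imp_space_eq[OF K(2)] by simp
   moreover have "UNIV \<in> sets K" using K(2) by simp
   ultimately have "emeasure (?D K) (space (?D K)) = ennreal (1 / c) * ennreal c"
    using K(3) by (simp add: emeasure_density nn_integral_cmult K.emeasure_eq_measure)
   also have "\<dots> = 1" using c by (simp flip: ennreal_mult)
   finally have "prob_space (?D K)" by (rule prob_spaceI)
   then show ?thesis using K(2) by (simp add: real_distribution_def real_distribution_axioms_def)
  qed
  have "char (?D M) t = char (?D N) t" for t
  proof -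
   have "char (?D K) t = (1 / c) *\<^sub>R char K t" if "sets K = sets borel" for K
    unfolding char_def using c that
    by (subst integral_scaleR_density) (auto simp: measurable_cong_sets[OF that refl])
   then show ?thesis using char sM sN by simp
  qed
  then have eq: "?D M = ?D N"
   by (intro Levy_uniqueness rd fM fN sM sN cN ext) (auto simp: c_def)
  show ?thesis
  proof (rule measure_eqI)
   fix A assume A: "A \<in> sets M"
   then have AN: "A \<in> sets N" using sM sN by simp
   have "emeasure (?D M) A = ennreal (1 / c) * emeasure M A" using A by (simp add: emeasure_density nn_integral_cmult)
   moreover have "emeasure (?D N) A = ennreal (1 / c) * emeasure N A" using AN by (simp add: emeasure_density nn_integral_cmult)
   ultimately have "ennreal (1 / c) * emeasure M A = ennreal (1 / c) * emeasure N A" using eq by simp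
   then have "ennreal c * (ennreal (1 / c) * emeasure M A) = ennreal c * (ennreal (1 / c) * emeasure N A)" by simp
   then show "emeasure M A = emeasure N A"
    using c by (simp add: mult.assoc[symmetric] flip: ennreal_mult)
  qed (use sM sN in simp)
 qed
qed

lemma iexp_real: "iexp x = Complex (cos x) (sin x)"
 by (simp add: complex_eq_iff exp_eq_polar cis.ctr)

text \<open>The weights act as densities of finite measures whose images under \<open>X\<close> and
  \<open>Y\<close> have equal characteristic functions. The range [0, 2] accommodates 1 + cos and 1
  + sin.\<close>

lemma weighted_char_unique:
 fixes g :: "'a => real" and h :: "'b => real"
 assumes fM: "finite_measure M" and fN: "finite_measure N"
  and X: "X \<in> borel_measurable M" and Y: "Y \<in> borel_measurable N" and C: "C \<in> sets borel"
  and g: "g \<in> borel_measurable M" "!!x. 0 \<le> g x" "!!x. g x \<le> 2"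
  and h: "h \<in> borel_measurable N" "!!x. 0 \<le> h x" "!!x. h x \<le> 2"
  and eq: "!!t. (CLINT x|M. g x *\<^sub>R iexp (t * X x)) = (CLINT x|N. h x *\<^sub>R iexp (t * Y x))"
 shows "(\<integral>x. indicator C (X x) * g x \<partial>M) = (\<integral>x. indicator C (Y x) * h x \<partial>N)"
proof -
 let ?M = "density M (%x. ennreal (g x))" and ?N = "density N (%x. ennreal (h x))"
 have f: "finite_measure ?M" "finite_measure ?N"
  by (rule finite_measure_density_bounded[OF fM g] finite_measure_density_bounded[OF fN h])+
 have XM: "X \<in> borel_measurable ?M" and YN: "Y \<in> borel_measurable ?N" using X Y by auto
 have D: "distr ?M borel X = distr ?N borel Y"
 proof (rule char_unique_finite_measure)
  show "finite_measure (distr ?M borel X)" "finite_measure (distr ?N borel Y)"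
   by (rule finite_measure.finite_measure_distr[OF f(1) XM] finite_measure.finite_measure_distr[OF f(2) YN])+
  show "char (distr ?M borel X) t = char (distr ?N borel Y) t" for t
  proof -
   have "char (distr ?M borel X) t = (CLINT x|M. g x *\<^sub>R iexp (t * X x))"
    unfolding char_def using X g by (subst integral_distr[OF XM]) (auto simp: integral_scaleR_density)
   moreover have "char (distr ?N borel Y) t = (CLINT x|N. h x *\<^sub>R iexp (t * Y x))"
    unfolding char_def using Y h by (subst integral_distr[OF YN]) (auto simp: integral_scaleR_density)
   ultimately show ?thesis using eq by simp
  qed
 qed auto
 have "(\<integral>x. indicator C (X x) * g x \<partial>M) = (\<integral>x. indicator C x \<partial>distr ?M borel X)"
  using X g C by (subst integral_distr[OF XM]) (auto simp: integral_scaleR_density mult.commute)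
 moreover have "(\<integral>x. indicator C (Y x) * h x \<partial>N) = (\<integral>x. indicator C x \<partial>distr ?N borel Y)"
  using Y h C by (subst integral_distr[OF YN]) (auto simp: integral_scaleR_density mult.commute)
 ultimately show ?thesis using D by simp
qed

lemma iexp_cos: "cos r *\<^sub>R iexp a = (1/2) *\<^sub>R (iexp (a + r) + iexp (a - r))"
 unfolding iexp_real by (simp add: complex_eq_iff cos_add sin_add cos_diff sin_diff)

lemma iexp_sin: "sin r *\<^sub>R iexp a = (- \<i> / 2) * (iexp (a + r) - iexp (a - r))"
 unfolding iexp_real by (simp add: complex_eq_iff cos_add sin_add cos_diff sin_diff)

lemma iexp_measurable: "f \<in> borel_measurable M ==> (%x. iexp (f x)) \<in> borel_measurable M"
 by measurable

lemma (in finite_measure) integrable_iexp_compose: "f \<in> borel_measurable M ==> integrable M (%x. iexp (f x))"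
 by (rule integrable_const_bound[where B=1]) (auto simp: norm_exp_i_times)

text \<open>A complex weight \<open>iexp (\<theta> x)\<close> is no density, so it is recovered from
  the nonnegative weights 1, 1 + cos and 1 + sin; product formulas write their transforms through
  the joint characteristic function at \<open>r\<close> = 0, 1 and -1.\<close>

lemma conditional_char_eq:
 assumes fM: "finite_measure M" and fN: "finite_measure N"
  and X: "X \<in> borel_measurable M" and Y: "Y \<in> borel_measurable N"
  and \<theta>: "\<theta> \<in> borel_measurable M" and \<phi>: "\<phi> \<in> borel_measurable N"
  and eq: "!!s r. (CLINT x|M. iexp (s * X x + r * \<theta> x)) = (CLINT x|N. iexp (s * Y x + r * \<phi> x))"
  and C: "C \<in> sets borel"
 shows "(CLINT x|M. indicator C (X x) *\<^sub>R iexp (\<theta> x)) = (CLINT x|N. indicator C (Y x) *\<^sub>R iexp (\<phi> x))"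
proof -
 interpret M: finite_measure M by fact
 interpret N: finite_measure N by fact
 have iM: "integrable M (%x. iexp (s * X x + r * \<theta> x))" for s r
  using X \<theta> by (intro M.integrable_iexp_compose) auto
 have iN: "integrable N (%x. iexp (s * Y x + r * \<phi> x))" for s r
  using Y \<phi> by (intro N.integrable_iexp_compose) auto
 have exM: "(CLINT x|M. iexp (t * X x)) = (CLINT x|N. iexp (t * Y x))" for t using eq[of t 0] by simp
 have 0: "(\<integral>x. indicator C (X x) * (1::real) \<partial>M) = (\<integral>x. indicator C (Y x) * (1::real) \<partial>N)"
  by (rule weighted_char_unique[OF fM fN X Y C]) (use exM in auto)
 have 1: "(\<integral>x. indicator C (X x) * (1 + cos (\<theta> x)) \<partial>M) = (\<integral>x. indicator C (Y x) * (1 + cos (\<phi> x)) \<partial>N)"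
 proof (rule weighted_char_unique[OF fM fN X Y C])
  show "(CLINT x|M. (1 + cos (\<theta> x)) *\<^sub>R iexp (t * X x)) = (CLINT x|N. (1 + cos (\<phi> x)) *\<^sub>R iexp (t * Y x))" for t
  proof -
   have "(CLINT x|M. (1 + cos (\<theta> x)) *\<^sub>R iexp (t * X x)) = (CLINT x|M. iexp (t * X x + 0 * \<theta> x) + (1/2) *\<^sub>R (iexp (t * X x + 1 * \<theta> x) + iexp (t * X x + (-1) * \<theta> x)))"
    by (simp only: scaleR_add_left scaleR_one iexp_cos mult_zero_left add_0_right mult_1_left mult_minus_left diff_conv_add_uminus)
   also have "\<dots> = (CLINT x|N. iexp (t * Y x + 0 * \<phi> x) + (1/2) *\<^sub>R (iexp (t * Y x + 1 * \<phi> x) + iexp (t * Y x + (-1) * \<phi> x)))"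
    using iM[of t 0] iM[of t 1] iM[of t "-1"] iN[of t 0] iN[of t 1] iN[of t "-1"] eq[of t 0] eq[of t 1] eq[of t "-1"] by simp
   also have "\<dots> = (CLINT x|N. (1 + cos (\<phi> x)) *\<^sub>R iexp (t * Y x))"
    by (simp only: scaleR_add_left scaleR_one iexp_cos mult_zero_left add_0_right mult_1_left mult_minus_left diff_conv_add_uminus)
   finally show ?thesis .
  qed
  show "0 \<le> 1 + cos (\<theta> x)" for x using cos_ge_minus_one[of "\<theta> x"] by linarith
  show "0 \<le> 1 + cos (\<phi> x)" for x using cos_ge_minus_one[of "\<phi> x"] by linarith
 qed (use \<theta> \<phi> in \<open>auto simp: cos_le_one\<close>)
 have 2: "(\<integral>x. indicator C (X x) * (1 + sin (\<theta> x)) \<partial>M) = (\<integral>x. indicator C (Y x) * (1 + sin (\<phi> x)) \<partial>N)"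
 proof (rule weighted_char_unique[OF fM fN X Y C])
  show "(CLINT x|M. (1 + sin (\<theta> x)) *\<^sub>R iexp (t * X x)) = (CLINT x|N. (1 + sin (\<phi> x)) *\<^sub>R iexp (t * Y x))" for t
  proof -
   have "(CLINT x|M. (1 + sin (\<theta> x)) *\<^sub>R iexp (t * X x)) = (CLINT x|M. iexp (t * X x + 0 * \<theta> x) + (- \<i> / 2) * (iexp (t * X x + 1 * \<theta> x) - iexp (t * X x + (-1) * \<theta> x)))"
    by (simp only: scaleR_add_left scaleR_one iexp_sin mult_zero_left add_0_right mult_1_left mult_minus_left diff_conv_add_uminus)
   also have "\<dots> = (CLINT x|N. iexp (t * Y x + 0 * \<phi> x) + (- \<i> / 2) * (iexp (t * Y x + 1 * \<phi> x) - iexp (t * Y x + (-1) * \<phi> x)))"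
    using iM[of t 0] iM[of t 1] iM[of t "-1"] iN[of t 0] iN[of t 1] iN[of t "-1"] eq[of t 0] eq[of t 1] eq[of t "-1"] by simp
   also have "\<dots> = (CLINT x|N. (1 + sin (\<phi> x)) *\<^sub>R iexp (t * Y x))"
    by (simp only: scaleR_add_left scaleR_one iexp_sin mult_zero_left add_0_right mult_1_left mult_minus_left diff_conv_add_uminus)
   finally show ?thesis .
  qed
  show "0 \<le> 1 + sin (\<theta> x)" for x using sin_ge_minus_one[of "\<theta> x"] by linarith
  show "0 \<le> 1 + sin (\<phi> x)" for x using sin_ge_minus_one[of "\<phi> x"] by linarith
 qed (use \<theta> \<phi> in \<open>auto simp: sin_le_one\<close>)
 have split: "(CLINT x|K. indicator C (Z x) *\<^sub>R iexp (\<psi> x)) =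
   complex_of_real ((\<integral>x. indicator C (Z x) * (1 + cos (\<psi> x)) \<partial>K) - (\<integral>x. indicator C (Z x) * 1 \<partial>K))
   + \<i> * complex_of_real ((\<integral>x. indicator C (Z x) * (1 + sin (\<psi> x)) \<partial>K) - (\<integral>x. indicator C (Z x) * 1 \<partial>K))"
  if K: "finite_measure K" and Z: "Z \<in> borel_measurable K" and \<psi>: "\<psi> \<in> borel_measurable K" for K :: "'c measure" and Z \<psi> :: "'c => real"
 proof -
  interpret K: finite_measure K by fact
  have iC: "(%x. indicator C (Z x) :: real) \<in> borel_measurable K"
   using measurable_compose[OF Z borel_measurable_indicator[OF C]] by simp
  have b: "integrable K (%x. indicator C (Z x) * u x)" if "u \<in> borel_measurable K" "!!x. \<bar>u x\<bar> \<le> 2" for u :: "'c => real"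
   by (rule K.integrable_const_bound[where B=2]) (use that iC in \<open>auto simp: indicator_def\<close>)
  have b1: "integrable K (%x. indicator C (Z x) * 1 :: real)" by (rule b) auto
  have b2: "integrable K (%x. indicator C (Z x) * cos (\<psi> x))"
   by (rule b) (use \<psi> order_trans[OF abs_cos_le_one] in auto)
  have b3: "integrable K (%x. indicator C (Z x) * sin (\<psi> x))"
   by (rule b) (use \<psi> order_trans[OF abs_sin_le_one] in auto)
  have "(CLINT x|K. indicator C (Z x) *\<^sub>R iexp (\<psi> x)) = (CLINT x|K. complex_of_real (indicator C (Z x) * cos (\<psi> x)) + \<i> * complex_of_real (indicator C (Z x) * sin (\<psi> x)))"
   unfolding iexp_real by (intro Bochner_Integration.integral_cong refl) (simp add: complex_eq_iff)
  also have "\<dots> = complex_of_real (\<integral>x. indicator C (Z x) * cos (\<psi> x) \<partial>K) + \<i> * complex_of_real (\<integral>x. indicator C (Z x) * sin (\<psi> x) \<partial>K)"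
   unfolding Bochner_Integration.integral_add[OF integrable_of_real[OF b2] integrable_mult_right[OF integrable_of_real[OF b3]]]
    integral_mult_right_zero integral_complex_of_real ..
  finally show ?thesis using b1 b2 b3 by (simp add: distrib_left)
 qed
 show ?thesis
  unfolding split[OF fM X \<theta>] split[OF fN Y \<phi>] using 0 1 2 by simp
qed

text \<open>Induction on the number of coordinates: the event for coordinate \<open>j\<close>
  becomes an indicator density, and \<open>conditional_char_eq\<close> supplies the hypothesis for
  the remaining coordinates. The new measures are no longer probabilities, hence finite measures
  that vary in the induction.\<close>

lemma cramer_wold:
 fixes M N :: "'a measure" and X Y :: "'i => 'a => real"
 assumes "finite I" "finite_measure M" "finite_measure N"
  and "!!i. i \<in> I ==> X i \<in> borel_measurable M" "!!i. i \<in> I ==> Y i \<in> borel_measurable N"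
  and "!!b. (CLINT x|M. iexp (\<Sum>i\<in>I. b i * X i x)) = (CLINT x|N. iexp (\<Sum>i\<in>I. b i * Y i x))"
  and "!!i. i \<in> I ==> C i \<in> sets borel"
 shows "measure M {x\<in>space M. \<forall>i\<in>I. X i x \<in> C i} = measure N {x\<in>space N. \<forall>i\<in>I. Y i x \<in> C i}"
 using assms
proof (induction I arbitrary: M N rule: finite_induct)
 case empty
 then show ?case by simp
next
 case (insert j I M N)
 let ?g = "%x. indicator (C j) (X j x) :: real" and ?h = "%x. indicator (C j) (Y j x) :: real"
 let ?M = "density M (%x. ennreal (?g x))" and ?N = "density N (%x. ennreal (?h x))"
 have Cj: "C j \<in> sets borel" using insert.prems by auto
 have X: "X i \<in> borel_measurable M" and Y: "Y i \<in> borel_measurable N" if "i \<in> insert j I" for i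
  using insert.prems that by auto
 have g: "?g \<in> borel_measurable M" "?h \<in> borel_measurable N"
  using measurable_compose[OF X borel_measurable_indicator[OF Cj], of j] measurable_compose[OF Y borel_measurable_indicator[OF Cj], of j] by auto
 have f: "finite_measure ?M" "finite_measure ?N"
  by (rule finite_measure_density_bounded[OF insert.prems(1) g(1), where c=1] finite_measure_density_bounded[OF insert.prems(2) g(2), where c=1];
   simp add: indicator_def)+
 have sX: "(%x. \<Sum>i\<in>I. b i * X i x) \<in> borel_measurable M" and sY: "(%x. \<Sum>i\<in>I. b i * Y i x) \<in> borel_measurable N" for b
  using X Y by (auto intro!: borel_measurable_sum borel_measurable_times)
 have ch: "(CLINT x|?M. iexp (\<Sum>i\<in>I. b i * X i x)) = (CLINT x|?N. iexp (\<Sum>i\<in>I. b i * Y i x))" for b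
 proof -
  have "(CLINT x|M. ?g x *\<^sub>R iexp (\<Sum>i\<in>I. b i * X i x)) = (CLINT x|N. ?h x *\<^sub>R iexp (\<Sum>i\<in>I. b i * Y i x))"
  proof (rule conditional_char_eq[OF insert.prems(1,2) X Y sX sY _ Cj])
   fix s r
   let ?b = "%i. if i = j then s else r * b i"
   have "(\<Sum>i\<in>insert j I. ?b i * Z i) = s * Z j + r * (\<Sum>i\<in>I. b i * Z i)" for Z :: "'i => real"
   proof -
    have "(\<Sum>i\<in>I. ?b i * Z i) = (\<Sum>i\<in>I. r * (b i * Z i))"
     using insert.hyps by (intro sum.cong) auto
    then show ?thesis using insert.hyps by (simp add: sum_distrib_left)
   qed
   then show "(CLINT x|M. iexp (s * X j x + r * (\<Sum>i\<in>I. b i * X i x))) = (CLINT x|N. iexp (s * Y j x + r * (\<Sum>i\<in>I. b i * Y i x)))"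
    using insert.prems(5)[of ?b] by simp
  qed auto
  moreover have "(CLINT x|?M. iexp (\<Sum>i\<in>I. b i * X i x)) = (CLINT x|M. ?g x *\<^sub>R iexp (\<Sum>i\<in>I. b i * X i x))"
   by (rule integral_scaleR_density[OF iexp_measurable[OF sX] g(1)]) simp
  moreover have "(CLINT x|?N. iexp (\<Sum>i\<in>I. b i * Y i x)) = (CLINT x|N. ?h x *\<^sub>R iexp (\<Sum>i\<in>I. b i * Y i x))"
   by (rule integral_scaleR_density[OF iexp_measurable[OF sY] g(2)]) simp
  ultimately show ?thesis by (simp only:)
 qed
 have mC: "{x \<in> space M. \<forall>i\<in>I. X i x \<in> C i} \<in> sets M" "{x \<in> space N. \<forall>i\<in>I. Y i x \<in> C i} \<in> sets N"
  using X Y insert.prems(6) insert.hyps(1) by (auto intro!: sets.sets_Collect_finite_All' pred_sets2)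
 have m: "emeasure (density K (%x. ennreal (indicator (C j) (Z j x)))) {x \<in> space K. \<forall>i\<in>I. Z i x \<in> C i} = emeasure K {x \<in> space K. \<forall>i\<in>insert j I. Z i x \<in> C i}"
  if m1: "{x \<in> space K. \<forall>i\<in>I. Z i x \<in> C i} \<in> sets K" and m2: "(%x. indicator (C j) (Z j x) :: real) \<in> borel_measurable K" and Zj: "Z j \<in> borel_measurable K" for K Z
 proof -
  have "Z j -` C j \<inter> space K \<in> sets K" by (rule measurable_sets[OF Zj Cj])
  moreover have "{x \<in> space K. \<forall>i\<in>insert j I. Z i x \<in> C i} = (Z j -` C j \<inter> space K) \<inter> {x \<in> space K. \<forall>i\<in>I. Z i x \<in> C i}" by auto
  ultimately have m3: "{x \<in> space K. \<forall>i\<in>insert j I. Z i x \<in> C i} \<in> sets K" using m1 by simp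
  have "emeasure (density K (%x. ennreal (indicator (C j) (Z j x)))) {x \<in> space K. \<forall>i\<in>I. Z i x \<in> C i}
    = (\<integral>\<^sup>+x. ennreal (indicator (C j) (Z j x)) * indicator {x \<in> space K. \<forall>i\<in>I. Z i x \<in> C i} x \<partial>K)"
   using m1 m2 by (intro emeasure_density) auto
  also have "\<dots> = (\<integral>\<^sup>+x. indicator {x \<in> space K. \<forall>i\<in>insert j I. Z i x \<in> C i} x \<partial>K)"
   by (intro nn_integral_cong) (auto simp: indicator_def)
  finally show ?thesis using m3 by simp
 qed
 have "measure ?M {x \<in> space ?M. \<forall>i\<in>I. X i x \<in> C i} = measure ?N {x \<in> space ?N. \<forall>i\<in>I. Y i x \<in> C i}"
  by (rule insert.IH[OF f]) (use X Y ch insert.prems(6) in auto)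
 then show ?case
  using m[of M X, OF mC(1) g(1) X] m[of N Y, OF mC(2) g(2) Y] by (simp add: measure_def)
qed

context wiener
begin

lemma inc_distr_stationary: assumes st: "0 \<le> s" "s \<le> t" "t \<le> T"
 shows "distr P borel (inc s t u) = distr P borel (inc 0 (t - s) u)"
proof (cases "s = t \<or> u = 0")
 case True
 have m: "inc s t u \<in> borel_measurable P" "inc 0 (t - s) u \<in> borel_measurable P"
  using st by (auto intro!: inc_measurable)
 have "AE om in P. inc s t u om = 0" "AE om in P. inc 0 (t - s) u om = 0"
  using True inc_zero[OF st] inc_zero[of 0 "t - s"] st by (auto simp: inc_def)
 then have "AE om in P. inc s t u om = inc 0 (t - s) u om" by eventually_elim simp
 then show ?thesis by (intro distr_cong_AE m refl)
next
 case False
 have "distr P lborel (inc s t u) = distr P lborel (inc 0 (t - s) u)"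
  using distributed_distr_eq_density[OF inc_distributed[of s t u]]
   distributed_distr_eq_density[OF inc_distributed[of 0 "t - s" u]] False st by simp
 moreover have "distr P lborel f = distr P borel f" for f :: "'w => real"
  by (intro distr_cong) auto
 ultimately show ?thesis by simp
qed

end

locale noise = wiener P T \<F> W + finite_dim_subspace V Bs
 for P :: "'w measure" and T \<F> and W :: "real => 'u::{real_inner, banach, second_countable_topology} => 'w => real"
  and V :: "'h::{real_inner, banach, second_countable_topology} set" and Bs +
 fixes B :: "'u => 'h"
 assumes B: "bounded_linear B" and BV: "range B \<subseteq> V" and hsB: "hs_norm_sq B < \<infinity>"
begin

text \<open>The coordinate of the noise term along \<open>e\<close> is the scalar process
  \<open>W t (uB e)\<close>; since \<open>B\<close> has range in \<open>V\<close>, finitely many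
  such processes describe the whole noise.\<close>

definition "uB e = adjoint B e"

lemma B_inner: "B v \<bullet> e = v \<bullet> uB e"
 unfolding uB_def by (rule adjoint_exists[OF B])

lemma B_expand: "B v = (\<Sum>e\<in>Bs. (v \<bullet> uB e) *\<^sub>R e)"
 using expand[of "B v"] BV by (simp add: B_inner range_subsetD)

definition "good om \<longleftrightarrow> (\<forall>e\<in>Bs. continuous_on {0..T} (%t. W t (uB e) om) \<and> W 0 (uB e) om = 0)"

lemma good_AE: "AE om in P. good om"
 unfolding good_def
proof (intro AE_finite_allI fB)
 fix e show "AE om in P. continuous_on {0..T} (%t. W t (uB e) om) \<and> W 0 (uB e) om = 0"
  using W_continuous W_at_0 by (rule AE_conjI)
qed

text \<open>The set of bad paths need not be measurable, so a null set containing it is chosen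
  instead.\<close>

definition "badN = (SOME N. N \<in> null_sets P \<and> {om \<in> space P. \<not> good om} \<subseteq> N)"

lemma badN: "badN \<in> null_sets P" "om \<in> space P ==> om \<notin> badN ==> good om"
proof -
 have "\<exists>N. N \<in> null_sets P \<and> {om \<in> space P. \<not> good om} \<subseteq> N"
  using good_AE unfolding eventually_ae_filter by auto
 from someI_ex[OF this] show "badN \<in> null_sets P" "om \<in> space P ==> om \<notin> badN ==> good om"
  unfolding badN_def by auto
qed

definition "cl t = max 0 (min t T)"

lemma cl: "cl t \<in> {0..T}" "t \<in> {0..T} ==> cl t = t" using T by (auto simp: cl_def)

text \<open>Discarding a null set and freezing time outside \<open>[0, T]\<close> makes every path continuous on the
 whole line; \<open>badN\<close> belongs to \<open>\<F> 0\<close> because the filtration is normal, so adaptedness survives.\<close>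

definition "w t om = (if om \<in> space P - badN then (\<Sum>e\<in>Bs. W (cl t) (uB e) om *\<^sub>R e) else 0)"

lemma w_V: "w t om \<in> V"
 unfolding w_def using sumV subspace_0[OF subspaceV] by auto

lemma w_continuous: "continuous_on S (%t. w t om)"
proof -
 have cc: "continuous_on S cl" for S unfolding cl_def by (intro continuous_intros)
 have "continuous_on S (%t. \<Sum>e\<in>Bs. W (cl t) (uB e) om *\<^sub>R e)" if "good om"
 proof (intro continuous_on_sum continuous_on_scaleR continuous_on_const)
  fix e assume "e \<in> Bs"
  then have "continuous_on {0..T} (%t. W t (uB e) om)" using that unfolding good_def by blast
  then show "continuous_on S (%t. W (cl t) (uB e) om)"
   by (rule continuous_on_compose2[OF _ cc]) (use cl in auto)
 qed
 then show ?thesis unfolding w_def using badN(2) by (cases "om \<in> space P - badN") auto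
qed

lemma w_0: "w 0 om = 0"
proof -
 have "W (cl 0) (uB e) om = 0" if "good om" "e \<in> Bs" for e
  using that T cl(2)[of 0] unfolding good_def by auto
 then show ?thesis unfolding w_def using badN(2) by (auto intro!: sum.neutral)
qed

lemma w_measurable_filtration: assumes t: "t \<in> {0..T}" shows "w t \<in> borel_measurable (\<F> t)"
proof -
 have "badN \<in> sets (\<F> 0)"
  using badN(1) filtration[unfolded normal_filtration_def, THEN conjunct2, THEN conjunct2, THEN conjunct1] by blast
 then have "space (\<F> t) - badN \<in> sets (\<F> t)"
  using filtration_mono[of 0 t] t by auto
 then have s: "space P - badN \<in> sets (\<F> t)" using space_filtration[OF t] by simp
 have m: "(%om. \<Sum>e\<in>Bs. W (cl t) (uB e) om *\<^sub>R e) \<in> borel_measurable (\<F> t)"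
  using W_measurable_filtration[OF t] cl(2)[OF t]
  by (intro borel_measurable_sum borel_measurable_scaleR borel_measurable_const) auto
 have "(%om. if om \<in> space P - badN then (\<Sum>e\<in>Bs. W (cl t) (uB e) om *\<^sub>R e) else 0) \<in> borel_measurable (\<F> t)"
  using sets.sets_into_space[OF s] by (intro measurable_If_set m borel_measurable_const) (use s in \<open>auto simp: Int_absorb1\<close>)
 then show ?thesis by (simp add: w_def[abs_def])
qed

lemma w_measurable: "t \<in> {0..T} ==> w t \<in> borel_measurable P"
 using measurable_filtration_P[OF _ w_measurable_filtration] by blast

lemma w_AE: "AE om in P. \<forall>t\<in>{0..T}. w t om = (\<Sum>e\<in>Bs. W t (uB e) om *\<^sub>R e)"
 using AE_not_in[OF badN(1)] AE_space by eventually_elim (simp add: w_def cl)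

lemma w_inc_AE: assumes st: "0 \<le> s" "s \<le> t" "t \<le> T"
 shows "AE om in P. w t om - w s om = (\<Sum>e\<in>Bs. inc s t (uB e) om *\<^sub>R e)"
 using w_AE by eventually_elim (use st in \<open>simp add: inc_def scaleR_diff_left sum_subtractf\<close>)

lemma w_inc_measurable: assumes st: "0 \<le> s" "s \<le> t" "t \<le> T"
 shows "(%om. w t om - w s om) \<in> borel_measurable P"
 using w_measurable[of s] w_measurable[of t] st by auto

text \<open>By linearity in the direction a combination of the coordinate increments is almost
  surely one scalar increment along the combined direction, for which independence of the past and
  stationarity are known.\<close>

lemma inc_char: assumes st: "0 \<le> s" "s \<le> t" "t \<le> T" and A: "A \<in> sets (\<F> s)"
 shows "(CLINT om|P. indicator A om *\<^sub>R iexp (\<Sum>e\<in>Bs. b e * inc s t (uB e) om))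
  = (CLINT om|P. prob A *\<^sub>R iexp (\<Sum>e\<in>Bs. b e * inc 0 (t - s) (uB e) om))"
proof -
 let ?u = "\<Sum>e\<in>Bs. b e *\<^sub>R uB e"
 have st': "0 \<le> (0::real)" "0 \<le> t - s" "t - s \<le> T" using st by auto
 have AP: "A \<in> sets P" using A sub[of s] st unfolding subalgebra_def by auto
 have lin: "AE om in P. (\<Sum>e\<in>Bs. b e * inc p q (uB e) om) = inc p q ?u om" if "0 \<le> p" "p \<le> q" "q \<le> T" for p q
 proof -
  have "p \<in> {0..T}" "q \<in> {0..T}" using that by auto
  from W_sum[OF this(1) fB, of b uB] W_sum[OF this(2) fB, of b uB]
  show ?thesis by eventually_elim (simp add: inc_def right_diff_distrib sum_subtractf)
 qed
 have mi: "inc p q u \<in> borel_measurable P" if "0 \<le> p" "p \<le> q" "q \<le> T" for p q u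
  using inc_measurable that by blast
 have mA: "(%om. indicator A om :: real) \<in> borel_measurable (\<F> s)" using A by simp
 have ind: "indep_var borel (%om. indicator A om :: complex) borel (iexp \<circ> inc s t ?u)"
 proof -
  have "indep_var borel (complex_of_real \<circ> (%om. indicator A om)) borel (iexp \<circ> inc s t ?u)"
   by (rule indep_var_compose[OF inc_indep_var[OF st mA]]) auto
  moreover have "complex_of_real \<circ> (%om. indicator A om) = (%om. indicator A om)"
   by (auto simp: indicator_def fun_eq_iff)
  ultimately show ?thesis by simp
 qed
 have iA: "integrable P (%om. indicator A om :: complex)" by (rule integrable_const_bound[where B=1]) (use AP in \<open>auto simp: indicator_def\<close>)
 have ii: "integrable P (iexp \<circ> inc s t ?u)" unfolding o_def by (rule integrable_iexp_compose[OF mi[OF st]])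
 have "(CLINT om|P. indicator A om *\<^sub>R iexp (\<Sum>e\<in>Bs. b e * inc s t (uB e) om)) = (CLINT om|P. indicator A om * (iexp \<circ> inc s t ?u) om)"
 proof (rule integral_cong_AE)
  show "(%om. indicator A om *\<^sub>R iexp (\<Sum>e\<in>Bs. b e * inc s t (uB e) om)) \<in> borel_measurable P"
   using AP by (intro borel_measurable_scaleR borel_measurable_indicator iexp_measurable borel_measurable_sum borel_measurable_times borel_measurable_const mi[OF st])
  show "(%om. indicator A om * (iexp \<circ> inc s t ?u) om) \<in> borel_measurable P"
   using indep_var_integrable[OF ind iA ii] by (rule borel_measurable_integrable)
  show "AE om in P. indicator A om *\<^sub>R iexp (\<Sum>e\<in>Bs. b e * inc s t (uB e) om) = indicator A om * (iexp \<circ> inc s t ?u) om"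
   using lin[OF st] by eventually_elim (simp only: o_def scaleR_conv_of_real, simp add: indicator_def)
 qed
 also have "\<dots> = (\<integral>om. indicator A om \<partial>P) * (\<integral>om. (iexp \<circ> inc s t ?u) om \<partial>P)"
  by (rule indep_var_lebesgue_integral[OF ind iA ii])
 also have "(\<integral>om. (indicator A om :: complex) \<partial>P) = complex_of_real (prob A)"
 proof -
  have "(%om. indicator A om :: complex) = (%om. complex_of_real (indicator A om))" by (auto simp: indicator_def)
  then show ?thesis using AP sets.sets_into_space[OF AP] by (simp only: integral_complex_of_real) (simp add: Int_absorb2)
 qed
 also have "(\<integral>om. (iexp \<circ> inc s t ?u) om \<partial>P) = (\<integral>x. iexp x \<partial>distr P borel (inc s t ?u))"
  using mi[OF st] by (subst integral_distr) (auto simp: o_def)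
 also have "\<dots> = (\<integral>x. iexp x \<partial>distr P borel (inc 0 (t - s) ?u))" unfolding inc_distr_stationary[OF st] ..
 also have "\<dots> = (\<integral>om. iexp (inc 0 (t - s) ?u om) \<partial>P)"
  using mi[OF st'] by (subst integral_distr) auto
 also have "\<dots> = (\<integral>om. iexp (\<Sum>e\<in>Bs. b e * inc 0 (t - s) (uB e) om) \<partial>P)"
 proof (rule integral_cong_AE)
  show "AE om in P. iexp (inc 0 (t - s) ?u om) = iexp (\<Sum>e\<in>Bs. b e * inc 0 (t - s) (uB e) om)"
   using lin[OF st'] by eventually_elim (simp only:)
 qed (intro iexp_measurable borel_measurable_sum borel_measurable_times borel_measurable_const mi[OF st'])+
 also have "complex_of_real (prob A) * \<dots> = (CLINT om|P. prob A *\<^sub>R iexp (\<Sum>e\<in>Bs. b e * inc 0 (t - s) (uB e) om))"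
  unfolding scaleR_conv_of_real by (rule integral_mult_right_zero[symmetric])
 finally show ?thesis .
qed

text \<open>Independence and stationarity at once: weighting \<open>P\<close> by the indicator of
  \<open>A\<close> on one side and by the constant \<open>prob A\<close> on the other, the
  coordinate vectors of the increments over [s, t] and over [0, t - s] have the same law.
  \<open>cramer_wold\<close> settles rectangles, and these determine the law.\<close>

lemma w_inc_indep_prob: assumes st: "0 \<le> s" "s \<le> t" "t \<le> T" and A: "A \<in> sets (\<F> s)" and C: "C \<in> sets borel"
 shows "prob (A \<inter> {om\<in>space P. w t om - w s om \<in> C}) = prob A * prob {om\<in>space P. w (t - s) om \<in> C}"
proof -
 have st': "0 \<le> (0::real)" "0 \<le> t - s" "t - s \<le> T" using st by auto
 have AP: "A \<in> sets P" using A sub[of s] st unfolding subalgebra_def by auto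
 let ?M = "density P (%om. ennreal (indicator A om))" and ?N = "density P (%om. ennreal (prob A))"
 let ?X = "%e. inc s t (uB e)" and ?Y = "%e. inc 0 (t - s) (uB e)"
 let ?I = "PiM Bs (%_. borel :: real measure)"
 let ?cX = "%om. \<lambda>e\<in>Bs. ?X e om" and ?cY = "%om. \<lambda>e\<in>Bs. ?Y e om"
 have mX: "?X e \<in> borel_measurable P" and mY: "?Y e \<in> borel_measurable P" for e
  using inc_measurable[OF st] inc_measurable[OF st'] by auto
 have mcX: "?cX \<in> measurable P ?I" and mcY: "?cY \<in> measurable P ?I"
  using mX mY by (auto intro!: measurable_restrict)
 have mA: "(%om. indicator A om :: real) \<in> borel_measurable P" using AP by simp
 have fM: "finite_measure ?M"
  by (rule finite_measure_density_bounded[OF finite_measure_axioms mA, where c=1]) (auto simp: indicator_def)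
 have fN: "finite_measure ?N"
  by (rule finite_measure_density_bounded[OF finite_measure_axioms, where c=1]) auto
 interpret M: finite_measure ?M by fact
 interpret N: finite_measure ?N by fact
 have "distr ?M ?I ?cX = distr ?N ?I ?cY"
 proof (rule measure_eqI_PiM_finite[OF fB])
  fix C :: "'h => real set" assume C: "!!i. i \<in> Bs ==> C i \<in> sets borel"
  have PE: "Pi\<^sub>E Bs C \<in> sets ?I" using C fB by (intro sets_PiM_I_finite) auto
  have "measure ?M {x\<in>space ?M. \<forall>i\<in>Bs. ?X i x \<in> C i} = measure ?N {x\<in>space ?N. \<forall>i\<in>Bs. ?Y i x \<in> C i}"
  proof (rule cramer_wold[OF fB fM fN])
   fix b
   have sm: "(%x. iexp (\<Sum>i\<in>Bs. b i * ?X i x)) \<in> borel_measurable P" "(%x. iexp (\<Sum>i\<in>Bs. b i * ?Y i x)) \<in> borel_measurable P"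
    by (intro iexp_measurable borel_measurable_sum borel_measurable_times borel_measurable_const mX mY)+
   have "(CLINT x|?M. iexp (\<Sum>i\<in>Bs. b i * ?X i x)) = (CLINT om|P. indicator A om *\<^sub>R iexp (\<Sum>e\<in>Bs. b e * ?X e om))"
    by (rule integral_scaleR_density[OF sm(1) mA]) simp
   moreover have "(CLINT x|?N. iexp (\<Sum>i\<in>Bs. b i * ?Y i x)) = (CLINT om|P. prob A *\<^sub>R iexp (\<Sum>e\<in>Bs. b e * ?Y e om))"
    by (rule integral_scaleR_density[OF sm(2)]) auto
   ultimately show "(CLINT x|?M. iexp (\<Sum>i\<in>Bs. b i * ?X i x)) = (CLINT x|?N. iexp (\<Sum>i\<in>Bs. b i * ?Y i x))"
    using inc_char[OF st A, of b] by (simp only:)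
  qed (use mX mY C in auto)
  moreover have "?cX -` Pi\<^sub>E Bs C \<inter> space ?M = {x\<in>space ?M. \<forall>i\<in>Bs. ?X i x \<in> C i}"
   "?cY -` Pi\<^sub>E Bs C \<inter> space ?N = {x\<in>space ?N. \<forall>i\<in>Bs. ?Y i x \<in> C i}"
   by (auto simp: PiE_iff restrict_def extensional_def)
  ultimately show "emeasure (distr ?M ?I ?cX) (Pi\<^sub>E Bs C) = emeasure (distr ?N ?I ?cY) (Pi\<^sub>E Bs C)"
   using mcX mcY PE by (simp add: emeasure_distr M.emeasure_eq_measure N.emeasure_eq_measure)
 next
  show "range (%_::nat. Pi\<^sub>E Bs (%_. UNIV)) \<subseteq> prod_algebra Bs (%_. borel :: real measure)"
   using fB by (auto intro!: prod_algebraI_finite)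
  show "(\<Union>i::nat. Pi\<^sub>E Bs (%_. UNIV)) = space ?I" by (simp add: space_PiM)
  fix i :: nat
  have "finite_measure (distr ?M ?I ?cX)" by (rule M.finite_measure_distr) (use mcX in simp)
  then show "emeasure (distr ?M ?I ?cX) (Pi\<^sub>E Bs (%_. UNIV)) \<noteq> \<infinity>" by (simp add: finite_measure.emeasure_finite)
 qed auto
 then have D: "distr ?M ?I ?cX = distr ?N ?I ?cY" .
 let ?R = "%f. \<Sum>e\<in>Bs. f e *\<^sub>R e"
 have mR: "?R \<in> borel_measurable ?I" by measurable
 have RC: "{f\<in>space ?I. ?R f \<in> C} \<in> sets ?I" using measurable_sets[OF mR C] by (simp add: vimage_def Int_def conj_commute)
 have eX: "{om\<in>space P. ?R (?cX om) \<in> C} \<in> sets P" and eY: "{om\<in>space P. ?R (?cY om) \<in> C} \<in> sets P"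
  using measurable_sets[OF measurable_compose[OF mcX mR] C] measurable_sets[OF measurable_compose[OF mcY mR] C]
  by (auto simp: vimage_def Int_def conj_commute)
 have "emeasure (distr ?M ?I ?cX) {f\<in>space ?I. ?R f \<in> C} = emeasure ?M {om\<in>space P. ?R (?cX om) \<in> C}"
  using mcX RC by (subst emeasure_distr) (auto intro!: arg_cong2[where f=emeasure] simp: space_PiM)
 also have "\<dots> = (\<integral>\<^sup>+om. indicator A om * indicator {om\<in>space P. ?R (?cX om) \<in> C} om \<partial>P)"
  using AP eX by (subst emeasure_density) (auto simp: ennreal_indicator)
 also have "\<dots> = (\<integral>\<^sup>+om. indicator (A \<inter> {om\<in>space P. ?R (?cX om) \<in> C}) om \<partial>P)"
  by (intro nn_integral_cong) (auto simp: indicator_def)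
 also have "\<dots> = emeasure P (A \<inter> {om\<in>space P. ?R (?cX om) \<in> C})" using AP eX by simp
 also have "\<dots> = emeasure P (A \<inter> {om\<in>space P. w t om - w s om \<in> C})"
 proof (rule emeasure_eq_AE)
  show "AE om in P. (om \<in> A \<inter> {om\<in>space P. ?R (?cX om) \<in> C}) = (om \<in> A \<inter> {om\<in>space P. w t om - w s om \<in> C})"
   using w_inc_AE[OF st] by eventually_elim simp
  show "A \<inter> {om \<in> space P. w t om - w s om \<in> C} \<in> events"
   using AP measurable_sets[OF w_inc_measurable[OF st] C] by (auto simp: vimage_def Int_def conj_commute)
 qed (use AP eX in auto)
 finally have 1: "emeasure (distr ?M ?I ?cX) {f\<in>space ?I. ?R f \<in> C} = emeasure P (A \<inter> {om\<in>space P. w t om - w s om \<in> C})" .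
 have "emeasure (distr ?N ?I ?cY) {f\<in>space ?I. ?R f \<in> C} = emeasure ?N {om\<in>space P. ?R (?cY om) \<in> C}"
  using mcY RC by (subst emeasure_distr) (auto intro!: arg_cong2[where f=emeasure] simp: space_PiM)
 also have "\<dots> = ennreal (prob A) * emeasure P {om\<in>space P. ?R (?cY om) \<in> C}"
  using eY by (simp add: emeasure_density nn_integral_cmult)
 also have "emeasure P {om\<in>space P. ?R (?cY om) \<in> C} = emeasure P {om\<in>space P. w (t - s) om \<in> C}"
 proof (rule emeasure_eq_AE)
  show "AE om in P. (om \<in> {om\<in>space P. ?R (?cY om) \<in> C}) = (om \<in> {om\<in>space P. w (t - s) om \<in> C})"
   using w_inc_AE[OF st'] by eventually_elim (simp add: w_0)
  show "{om \<in> space P. w (t - s) om \<in> C} \<in> events"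
   using measurable_sets[OF w_measurable[of "t - s"] C] st by (auto simp: vimage_def Int_def conj_commute)
 qed (use eY in auto)
 finally have "emeasure (distr ?N ?I ?cY) {f\<in>space ?I. ?R f \<in> C} = ennreal (prob A) * emeasure P {om\<in>space P. w (t - s) om \<in> C}" .
 with 1 D have "emeasure P (A \<inter> {om\<in>space P. w t om - w s om \<in> C}) = ennreal (prob A) * emeasure P {om\<in>space P. w (t - s) om \<in> C}"
  by simp
 then show ?thesis by (simp add: emeasure_eq_measure flip: ennreal_mult)
qed

lemma w_inc_stationary: assumes st: "0 \<le> s" "s \<le> t" "t \<le> T"
 shows "distr P borel (%om. w t om - w s om) = distr P borel (w (t - s))"
proof (rule measure_eqI)
 fix C assume "C \<in> sets (distr P borel (%om. w t om - w s om))"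
 then have C: "C \<in> sets borel" by simp
 have "space P \<in> sets (\<F> s)" using sets.top[of "\<F> s"] space_filtration[of s] st by simp
 from w_inc_indep_prob[OF st this C]
 have "prob {om\<in>space P. w t om - w s om \<in> C} = prob {om\<in>space P. w (t - s) om \<in> C}"
  by (simp add: prob_space Int_def)
 moreover have "(%om. w t om - w s om) -` C \<inter> space P = {om\<in>space P. w t om - w s om \<in> C}"
   "w (t - s) -` C \<inter> space P = {om\<in>space P. w (t - s) om \<in> C}" by auto
 ultimately show "emeasure (distr P borel (%om. w t om - w s om)) C = emeasure (distr P borel (w (t - s))) C"
  using C w_inc_measurable[OF st] w_measurable[of "t - s"] st by (simp add: emeasure_distr emeasure_eq_measure)
qed simp

lemma w_inc_indep:
 assumes st: "0 \<le> s" "s \<le> t" "t \<le> T" and X: "X \<in> measurable (\<F> s) N" and g: "g \<in> measurable borel N'"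
 shows "indep_var N X N' (%om. g (w t om - w s om))"
proof -
 let ?D = "%om. g (w t om - w s om)"
 have sP: "space (\<F> s) = space P" using space_filtration[of s] st by simp
 have mD: "?D \<in> measurable P N'" by (rule measurable_compose[OF w_inc_measurable[OF st] g])
 have mX: "X \<in> measurable P N" using measurable_filtration_P[OF _ X] st by simp
 have 1: "sigma_sets (space P) {X -` A \<inter> space P |A. A \<in> sets N} \<subseteq> sets (\<F> s)"
 proof -
  have "{X -` A \<inter> space P |A. A \<in> sets N} \<subseteq> sets (\<F> s)" using measurable_sets[OF X] sP by auto
  from sigma_algebra.sigma_sets_subset[OF sets.sigma_algebra_axioms[of "\<F> s"] this] show ?thesis unfolding sP .
 qed
 have DN: "?D \<in> space P \<rightarrow> space N'" using mD by (simp add: measurable_def)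
 have 2: "sigma_sets (space P) {?D -` A \<inter> space P |A. A \<in> sets N'} = {?D -` A \<inter> space P |A. A \<in> sets N'}"
  using sets_vimage_algebra[of "space P" ?D N'] sets_vimage_algebra2[OF DN] by simp
 have 3: "sets (\<F> s) \<subseteq> events" using sub[of s] st unfolding subalgebra_def by auto
 have 4: "prob (a \<inter> b) = prob a * prob b" if a: "a \<in> sets (\<F> s)" and b: "b \<in> {?D -` A \<inter> space P |A. A \<in> sets N'}" for a b
 proof -
  obtain C' where C': "C' \<in> sets N'" "b = ?D -` C' \<inter> space P" using b by blast
  define C where "C = g -` C'"
  have C: "C \<in> sets borel" "b = {om\<in>space P. w t om - w s om \<in> C}"
   using measurable_sets[OF g C'(1)] C'(2) by (auto simp: C_def)
  have S: "space P \<in> sets (\<F> s)" using sets.top[of "\<F> s"] sP by simp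
  have "{om\<in>space P. w t om - w s om \<in> C} = space P \<inter> {om\<in>space P. w t om - w s om \<in> C}" by auto
  then have "prob b = prob {om\<in>space P. w (t - s) om \<in> C}"
   using w_inc_indep_prob[OF st S C(1)] C(2) prob_space by simp
  then show ?thesis using w_inc_indep_prob[OF st a C(1)] C(2) by simp
 qed
 show ?thesis unfolding indep_var_eq indep_sets2_eq 2
 proof (intro conjI ballI mX mD)
  show "sigma_sets (space P) {X -` A \<inter> space P |A. A \<in> sets N} \<subseteq> events" using 1 3 by blast
  show "{?D -` A \<inter> space P |A. A \<in> sets N'} \<subseteq> events" using measurable_sets[OF mD] by blast
 qed (use 1 4 in blast)
qed

end

subsection \<open>Euler polygons\<close>

text \<open>An auxiliary explicit polygon for \<open>solves\<close>, distinct from the exponential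
  scheme of the theorem. It uses only finitely many increments of the forcing, so measurability and
  expectations can be treated step by step.\<close>

primrec euler :: "('a::real_vector => 'a) => (real => 'a) => 'a => real => nat => 'a" where
 "euler G m x d 0 = x"
| "euler G m x d (Suc k) = euler G m x d k + d *\<^sub>R G (euler G m x d k) + (m (real (Suc k) * d) - m (real k * d))"

text \<open>Each step multiplies the old error by at most \<open>1 + L * d\<close>, bounded by
  \<open>exp (L * d)\<close>, and adds a local error \<open>d * L * a\<close> from freezing the
  drift, where \<open>a\<close> bounds the oscillation of the exact solution over one step.\<close>

lemma euler_error:
 fixes G :: "'a::banach => 'a"
 assumes G: "continuous_on UNIV G" and lip: "!!x y. norm (G x - G y) \<le> L * norm (x - y)" and L: "0 \<le> L"
  and m0: "m 0 = 0" and z: "solves r G m x z" and d: "0 \<le> d"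
  and osc: "!!s t. s \<in> {0..r} ==> t \<in> {0..r} ==> \<bar>s - t\<bar> \<le> d ==> norm (z s - z t) \<le> a" and a: "0 \<le> a"
  and k: "real k * d \<le> r"
 shows "norm (z (real k * d) - euler G m x d k) \<le> real k * d * L * a * exp (L * d * real k)"
 using k
proof (induction k)
 case 0
 have "0 \<le> r" using 0 by simp
 then have "z 0 = x" using z m0 unfolding solves_def by auto
 then show ?case by simp
next
 case (Suc k)
 let ?t = "real k * d" and ?t' = "real (Suc k) * d" and ?e = "euler G m x d k"
 have tt: "0 \<le> ?t" "?t \<le> ?t'" "?t' \<le> r" "?t' - ?t = d" using Suc.prems d by (auto simp: algebra_simps)
 have cz: "continuous_on {0..r} z" using z by (auto simp: solves_def)
 have cG: "continuous_on {0..r} (%s. G (z s))" by (rule continuous_on_compose2[OF G cz subset_UNIV])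
 have i1: "(%s. G (z s)) integrable_on {0..?t'}"
  by (intro integrable_continuous_real continuous_on_subset[OF cG]) (use tt in auto)
 have i2: "(%s. G (z s)) integrable_on {?t..?t'}"
  by (intro integrable_continuous_real continuous_on_subset[OF cG]) (use tt in auto)
 have zt: "z ?t = x + integral {0..?t} (%s. G (z s)) + m ?t" and zt': "z ?t' = x + integral {0..?t'} (%s. G (z s)) + m ?t'"
  using z tt unfolding solves_def by auto
 have "integral {0..?t} (%s. G (z s)) + integral {?t..?t'} (%s. G (z s)) = integral {0..?t'} (%s. G (z s))"
  by (rule Henstock_Kurzweil_Integration.integral_combine[OF _ _ i1]) (use tt in auto)
 then have eq: "z ?t' = z ?t + integral {?t..?t'} (%s. G (z s)) + (m ?t' - m ?t)"
  unfolding zt zt' by (simp add: algebra_simps)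
 have ic: "integral {?t..?t'} (%s. G (z ?t)) = d *\<^sub>R G (z ?t)" using tt by simp
 have "norm (integral {?t..?t'} (%s. G (z s) - G (z ?t))) \<le> integral {?t..?t'} (%s. L * a)"
 proof (rule integral_norm_bound_integral)
  show "(%s. G (z s) - G (z ?t)) integrable_on {?t..?t'}" by (intro integrable_diff i2 integrable_const_ivl)
  fix s assume s: "s \<in> {?t..?t'}"
  have "norm (G (z s) - G (z ?t)) \<le> L * norm (z s - z ?t)" by (rule lip)
  also have "\<dots> \<le> L * a"
  proof (intro mult_left_mono osc L)
   show "s \<in> {0..r}" "?t \<in> {0..r}" "\<bar>s - ?t\<bar> \<le> d"
    using s tt unfolding atLeastAtMost_iff by linarith+
  qed
  finally show "norm (G (z s) - G (z ?t)) \<le> L * a" .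
 qed (rule integrable_const_ivl)
 also have "\<dots> = d * (L * a)" using tt by simp
 finally have I: "norm (integral {?t..?t'} (%s. G (z s)) - d *\<^sub>R G (z ?t)) \<le> d * (L * a)"
  by (simp only: integral_diff[OF i2 integrable_const_ivl] ic)
 have "z ?t' - euler G m x d (Suc k) = (z ?t - ?e) + (integral {?t..?t'} (%s. G (z s)) - d *\<^sub>R G (z ?t)) + d *\<^sub>R (G (z ?t) - G ?e)"
  unfolding eq euler.simps by (simp add: algebra_simps)
 then have "norm (z ?t' - euler G m x d (Suc k)) \<le> norm (z ?t - ?e) + norm (integral {?t..?t'} (%s. G (z s)) - d *\<^sub>R G (z ?t)) + norm (d *\<^sub>R (G (z ?t) - G ?e))"
  using norm_triangle_le[OF add_mono[OF norm_triangle_ineq order_refl]] by (simp only:)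
 also have "\<dots> \<le> norm (z ?t - ?e) + d * (L * a) + d * (L * norm (z ?t - ?e))"
  using d lip[of "z ?t" ?e] by (intro add_mono order_refl I) (simp add: mult_left_mono)
 also have "\<dots> = (1 + L * d) * norm (z ?t - ?e) + d * L * a" by (simp add: algebra_simps)
 also have "\<dots> \<le> exp (L * d) * (real k * d * L * a * exp (L * d * real k)) + d * L * a * exp (L * d * real (Suc k))"
 proof (rule add_mono)
  have "1 + L * d \<le> exp (L * d)" by (rule exp_ge_add_one_self)
  moreover have "norm (z ?t - ?e) \<le> real k * d * L * a * exp (L * d * real k)"
   by (rule Suc.IH) (use tt in linarith)
  ultimately show "(1 + L * d) * norm (z ?t - ?e) \<le> exp (L * d) * (real k * d * L * a * exp (L * d * real k))"
   by (intro mult_mono) auto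
  have "1 \<le> exp (L * d * real (Suc k))" using d L by simp
  then show "d * L * a \<le> d * L * a * exp (L * d * real (Suc k))"
   using mult_left_mono[of 1 "exp (L * d * real (Suc k))" "d * L * a"] d L a by simp
 qed
 also have "exp (L * d) * (real k * d * L * a * exp (L * d * real k)) = real k * d * L * a * exp (L * d * real (Suc k))"
 proof -
  have "exp (L * d * real (Suc k)) = exp (L * d) * exp (L * d * real k)" by (simp add: exp_add[symmetric] algebra_simps)
  then show ?thesis by simp
 qed
 also have "real k * d * L * a * exp (L * d * real (Suc k)) + d * L * a * exp (L * d * real (Suc k)) = real (Suc k) * d * L * a * exp (L * d * real (Suc k))"
  by (simp add: algebra_simps)
 finally show ?case .
qed

lemma euler_converges:
 fixes G :: "'a::banach => 'a"
 assumes G: "continuous_on UNIV G" and lip: "!!x y. norm (G x - G y) \<le> L * norm (x - y)" and L: "0 \<le> L"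
  and m0: "m 0 = 0" and z: "solves r G m x z" and r: "0 \<le> r"
 shows "(%n. euler G m x (r / real (Suc n)) (Suc n)) \<longlonglongrightarrow> z r"
proof (rule LIMSEQ_I)
 fix e :: real assume e: "0 < e"
 \<comment> \<open>The error bound of \<open>euler_error\<close> at total time \<open>r\<close>,
   plus 1 to make it positive; half of \<open>e\<close> then remains as slack for the strict
   inequality.\<close>
 define c where "c = r * L * exp (L * r) + 1"
 define a where "a = e / (2 * c)"
 have p: "0 < c" unfolding c_def using r L by (intro add_nonneg_pos mult_nonneg_nonneg) auto
 have a: "0 < a" using e p by (simp add: a_def)
 have cz: "continuous_on {0..r} z" using z by (auto simp: solves_def)
 obtain \<delta> where \<delta>: "\<delta> > 0" "!!s t. s \<in> {0..r} ==> t \<in> {0..r} ==> dist s t < \<delta> ==> dist (z s) (z t) < a"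
  using compact_uniformly_continuous[OF cz compact_Icc] a unfolding uniformly_continuous_on_def by metis
 obtain n0 where n0: "r / \<delta> < real n0" using reals_Archimedean2 by blast
 have "norm (euler G m x (r / real (Suc n)) (Suc n) - z r) < e" if n: "n \<ge> n0" for n
 proof -
  let ?d = "r / real (Suc n)"
  have "r < real n0 * \<delta>" using n0 \<delta>(1) by (simp add: field_simps)
  also have "\<dots> \<le> real (Suc n) * \<delta>" using n \<delta>(1) by (intro mult_right_mono) auto
  finally have d\<delta>: "?d < \<delta>" by (simp add: field_simps)
  have "norm (z (real (Suc n) * ?d) - euler G m x ?d (Suc n)) \<le> real (Suc n) * ?d * L * a * exp (L * ?d * real (Suc n))"
  proof (rule euler_error[OF G lip L m0 z])
   show "norm (z s - z t) \<le> a" if "s \<in> {0..r}" "t \<in> {0..r}" "\<bar>s - t\<bar> \<le> ?d" for s t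
    using \<delta>(2)[of s t] that d\<delta> by (auto simp: dist_norm)
  qed (use r a in auto)
  also have "real (Suc n) * ?d = r" by simp
  also have "L * ?d * real (Suc n) = L * r" by simp
  finally have "norm (z r - euler G m x ?d (Suc n)) \<le> (r * L * exp (L * r)) * a" by (simp add: mult_ac)
  also have "\<dots> \<le> c * a" unfolding c_def using a by (intro mult_right_mono) auto
  also have "\<dots> = e / 2" using p by (simp add: a_def)
  also have "\<dots> < e" using e by simp
  finally show ?thesis by (simp add: norm_minus_commute)
 qed
 then show "\<exists>no. \<forall>n\<ge>no. norm (euler G m x (r / real (Suc n)) (Suc n) - z r) < e" by blast
qed

context noise
begin

abbreviation sq_integrable :: "('w => 'b::real_normed_vector) => bool"
 where "sq_integrable X \<equiv> integrable P (%om. (norm (X om))^2)"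

lemma w_inc_inner: assumes st: "0 \<le> s" "s \<le> t" "t \<le> T" and e: "e \<in> Bs"
 shows "AE om in P. (w t om - w s om) \<bullet> e = inc s t (uB e) om"
 using w_inc_AE[OF st] by eventually_elim (simp add: inner_sum_basis[OF e])

text \<open>\<open>q2\<close> is the trace of the covariance of the noise per unit time.
  \<open>q4\<close> combines the Gaussian fourth moment (factor 3) with the bound of the square of a
  sum by the number of terms times the sum of squares.\<close>

definition "q2 = (\<Sum>e\<in>Bs. (norm (uB e))^2)"
definition "q4 = real (card Bs) * (\<Sum>e\<in>Bs. 3 * (norm (uB e)) ^ 4)"

lemma q2_nonneg: "0 \<le> q2" unfolding q2_def by (intro sum_nonneg) simp

lemma w_inc_inner_mult: assumes st: "0 \<le> s" "s \<le> t" "t \<le> T" and e: "e \<in> Bs" "e' \<in> Bs"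
 shows "integrable P (%om. ((w t om - w s om) \<bullet> e) * ((w t om - w s om) \<bullet> e'))" (is "integrable P ?f")
  "(\<integral>om. ((w t om - w s om) \<bullet> e) * ((w t om - w s om) \<bullet> e') \<partial>P) = (t - s) * (uB e \<bullet> uB e')"
proof -
 have ae: "AE om in P. ?f om = inc s t (uB e) om * inc s t (uB e') om"
  using w_inc_inner[OF st e(1)] w_inc_inner[OF st e(2)] by eventually_elim simp
 have m: "?f \<in> borel_measurable P" using w_inc_measurable[OF st] by simp
 have m2: "(%om. inc s t (uB e) om * inc s t (uB e') om) \<in> borel_measurable P"
  by (intro borel_measurable_times inc_measurable[OF st])
 show "integrable P ?f"
  using integrable_cong_AE[OF m m2 ae] inc_mult_integrable[OF st st] by simp
 show "(\<integral>om. ?f om \<partial>P) = (t - s) * (uB e \<bullet> uB e')"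
  using integral_cong_AE[OF m m2 ae] inc_covariance_same[OF st] by simp
qed

lemma w_inc_inner_mean: assumes st: "0 \<le> s" "s \<le> t" "t \<le> T" and e: "e \<in> Bs"
 shows "integrable P (%om. (w t om - w s om) \<bullet> e)" "(\<integral>om. (w t om - w s om) \<bullet> e \<partial>P) = 0"
proof -
 have m: "(%om. (w t om - w s om) \<bullet> e) \<in> borel_measurable P" using w_inc_measurable[OF st] by simp
 show "integrable P (%om. (w t om - w s om) \<bullet> e)"
  using integrable_cong_AE[OF m inc_measurable[OF st] w_inc_inner[OF st e]] inc_integrable[OF st] by simp
 show "(\<integral>om. (w t om - w s om) \<bullet> e \<partial>P) = 0"
  using integral_cong_AE[OF m inc_measurable[OF st] w_inc_inner[OF st e]] inc_moments(1)[OF st] by simp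
qed

lemma w_inc_norm_square: "(norm (w t om - w s om))^2 = (\<Sum>e\<in>Bs. ((w t om - w s om) \<bullet> e)^2)"
 by (rule norm_basis) (intro subspace_diff[OF subspaceV] w_V)

lemma w_inc_second_moment: assumes st: "0 \<le> s" "s \<le> t" "t \<le> T"
 shows "integrable P (%om. (norm (w t om - w s om))^2)" "(\<integral>om. (norm (w t om - w s om))^2 \<partial>P) = (t - s) * q2"
proof -
 have i: "integrable P (%om. ((w t om - w s om) \<bullet> e)^2)" "(\<integral>om. ((w t om - w s om) \<bullet> e)^2 \<partial>P) = (t - s) * (norm (uB e))^2"
  if "e \<in> Bs" for e
  using w_inc_inner_mult[OF st that that] by (simp_all add: power2_eq_square dot_square_norm[symmetric] flip: power2_norm_eq_inner)
 show "integrable P (%om. (norm (w t om - w s om))^2)"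
  unfolding w_inc_norm_square by (intro Bochner_Integration.integrable_sum i)
 show "(\<integral>om. (norm (w t om - w s om))^2 \<partial>P) = (t - s) * q2"
  unfolding w_inc_norm_square q2_def by (simp add: i sum_distrib_left)
qed

lemma w_inc_fourth_moment: assumes st: "0 \<le> s" "s \<le> t" "t \<le> T"
 shows "integrable P (%om. (norm (w t om - w s om)) ^ 4)" "(\<integral>om. (norm (w t om - w s om)) ^ 4 \<partial>P) \<le> (t - s)^2 * q4"
proof -
 let ?D = "%om. w t om - w s om"
 let ?g = "%om. (\<Sum>e\<in>Bs. (?D om \<bullet> e) ^ 4) * real (card Bs)"
 have m: "(%om. (?D om \<bullet> e) ^ 4) \<in> borel_measurable P" for e using w_inc_measurable[OF st] by simp
 have ae: "AE om in P. (?D om \<bullet> e) ^ 4 = (inc s t (uB e) om) ^ 4" if "e \<in> Bs" for e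
  using w_inc_inner[OF st that] by eventually_elim simp
 have m2: "(%om. (inc s t (uB e) om) ^ 4) \<in> borel_measurable P" for e using inc_measurable[OF st] by simp
 have i: "integrable P (%om. (?D om \<bullet> e) ^ 4)" if "e \<in> Bs" for e
  using integrable_cong_AE[OF m m2 ae[OF that]] inc_power_integrable[OF st] by simp
 have v: "(\<integral>om. (?D om \<bullet> e) ^ 4 \<partial>P) = 3 * ((t - s) * (norm (uB e))^2)^2" if "e \<in> Bs" for e
  using integral_cong_AE[OF m m2 ae[OF that]] inc_moments(3)[OF st] by simp
 have le: "(norm (?D om)) ^ 4 \<le> ?g om" for om
 proof -
  have "(norm (?D om)) ^ 4 = ((norm (?D om))^2)^2" by (simp flip: power_mult)
  also have "\<dots> \<le> (\<Sum>e\<in>Bs. ((?D om \<bullet> e)^2)^2) * real (card Bs)"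
   unfolding w_inc_norm_square by (rule sum_squared_le_sum_of_squares) 
  also have "\<dots> = ?g om" by (simp flip: power_mult)
  finally show ?thesis .
 qed
 have ig: "integrable P ?g" by (intro integrable_mult_left Bochner_Integration.integrable_sum i)
 show I: "integrable P (%om. (norm (?D om)) ^ 4)"
 proof (rule Bochner_Integration.integrable_bound[OF ig])
  show "AE om in P. norm (norm (?D om) ^ 4) \<le> norm (?g om)"
   using le by (auto intro!: AE_I2 order_trans[OF le abs_ge_self])
 qed (use w_inc_measurable[OF st] in simp)
 have "(\<integral>om. (norm (?D om)) ^ 4 \<partial>P) \<le> (\<integral>om. ?g om \<partial>P)" by (rule integral_mono[OF I ig le])
 also have "\<dots> = (\<Sum>e\<in>Bs. 3 * ((t - s) * (norm (uB e))^2)^2) * real (card Bs)"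
  by (simp add: i v Bochner_Integration.integral_sum)
 also have "\<dots> = (t - s)^2 * q4"
  unfolding q4_def by (simp add: power_mult_distrib sum_distrib_left sum_distrib_right mult_ac flip: power_mult)
 finally show "(\<integral>om. (norm (?D om)) ^ 4 \<partial>P) \<le> (t - s)^2 * q4" .
qed

text \<open>Freezing: the joint law of \<open>X\<close> and the increment is a product, so Fubini
  integrates the increment out with \<open>X\<close> held fixed; by stationarity the increment may
  be replaced by \<open>w (t - s)\<close>.\<close>

lemma independent_integral:
 fixes f :: "'h \<times> 'h => real"
 assumes st: "0 \<le> s" "s \<le> t" "t \<le> T" and X: "X \<in> borel_measurable (\<F> s)"
  and f: "f \<in> borel_measurable (borel \<Otimes>\<^sub>M borel)" and bd: "!!p. \<bar>f p\<bar> \<le> c"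
 shows "(\<integral>om. f (X om, w t om - w s om) \<partial>P) = (\<integral>om. (\<integral>om'. f (X om, w (t - s) om') \<partial>P) \<partial>P)"
proof -
 let ?D = "%om. w t om - w s om"
 have mX: "X \<in> borel_measurable P" using measurable_filtration_P[OF _ X] st by simp
 have mD: "?D \<in> borel_measurable P" by (rule w_inc_measurable[OF st])
 have mw: "w (t - s) \<in> borel_measurable P" using w_measurable[of "t - s"] st by simp
 have "indep_var borel X borel (%om. id (?D om))" by (rule w_inc_indep[OF st X]) simp
 then have "indep_var borel X borel ?D" by simp
 then have D: "distr P borel X \<Otimes>\<^sub>M distr P borel ?D = distr P (borel \<Otimes>\<^sub>M borel) (%om. (X om, ?D om))"
  unfolding indep_var_distribution_eq by blast
 interpret X: prob_space "distr P borel X" by (rule prob_space_distr[OF mX])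
 interpret D: prob_space "distr P borel ?D" by (rule prob_space_distr[OF mD])
 interpret XD: pair_prob_space "distr P borel X" "distr P borel ?D" ..
 have mf: "f \<in> borel_measurable (distr P borel X \<Otimes>\<^sub>M distr P borel ?D)"
  using f by (simp add: measurable_cong_sets[OF sets_pair_measure_cong[OF sets_distr sets_distr] refl])
 have int: "integrable (distr P borel X \<Otimes>\<^sub>M distr P borel ?D) f"
  by (rule XD.P.integrable_const_bound[where B=c]) (use bd mf in auto)
 have mi: "(%x. \<integral>om'. f (x, w (t - s) om') \<partial>P) \<in> borel_measurable borel"
  by (rule borel_measurable_lebesgue_integral) (use f mw in measurable)
 have fx: "(%y. f (x, y)) \<in> borel_measurable borel" for x using f by measurable
 have "(\<integral>om. f (X om, ?D om) \<partial>P) = (\<integral>p. f p \<partial>distr P (borel \<Otimes>\<^sub>M borel) (%om. (X om, ?D om)))"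
  using mX mD f by (subst integral_distr) auto
 also have "\<dots> = (\<integral>x. (\<integral>y. f (x, y) \<partial>distr P borel ?D) \<partial>distr P borel X)"
  unfolding D[symmetric] by (rule XD.integral_fst'[OF int, symmetric])
 also have "\<dots> = (\<integral>x. (\<integral>om'. f (x, w (t - s) om') \<partial>P) \<partial>distr P borel X)"
  unfolding w_inc_stationary[OF st] using fx mw by (intro Bochner_Integration.integral_cong refl) (simp add: integral_distr)
 also have "\<dots> = (\<integral>om. (\<integral>om'. f (X om, w (t - s) om') \<partial>P) \<partial>P)"
  by (rule integral_distr[OF mX mi])
 finally show ?thesis .
qed

end

subsection \<open>The Markov property\<close>

text \<open>Rounding time down to multiples of \<open>1 / (n + 1)\<close> leaves countably many time
  values, hence a jointly measurable function; continuity of the paths gives the limit.\<close>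

lemma caratheodory_measurable:
 fixes f :: "real => 'w => 'a::{metric_space, second_countable_topology}"
 assumes m: "!!t. f t \<in> borel_measurable M" and c: "!!om. om \<in> space M ==> continuous_on UNIV (%t. f t om)"
 shows "(%(t, om). f t om) \<in> borel_measurable (borel \<Otimes>\<^sub>M M)"
proof -
 let ?g = "%n p. f (real_of_int \<lfloor>real (Suc n) * fst p\<rfloor> / real (Suc n)) (snd p)"
 have "(%p. f (fst p) (snd p)) \<in> borel_measurable (borel \<Otimes>\<^sub>M M)"
 proof (rule borel_measurable_LIMSEQ_metric)
  show "?g n \<in> borel_measurable (borel \<Otimes>\<^sub>M M)" for n
  proof -
   have "(%p. (%i p. f (real_of_int i / real (Suc n)) (snd p)) ((%p. \<lfloor>real (Suc n) * fst p\<rfloor>) p) p) \<in> borel_measurable (borel \<Otimes>\<^sub>M M)"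
    by (rule measurable_compose_countable) (use measurable_compose[OF measurable_snd m] in measurable)
   then show ?thesis by simp
  qed
  fix p :: "real \<times> 'w" assume p: "p \<in> space (borel \<Otimes>\<^sub>M M)"
  then have "snd p \<in> space M" by (auto simp: space_pair_measure)
  then have cc: "isCont (%t. f t (snd p)) (fst p)" using c by (simp add: continuous_on_eq_continuous_at)
  have "(%n. real_of_int \<lfloor>real (Suc n) * fst p\<rfloor> / real (Suc n)) \<longlonglongrightarrow> fst p"
  proof (rule tendsto_sandwich)
   have "fst p - inverse (real (Suc n)) \<le> real_of_int \<lfloor>real (Suc n) * fst p\<rfloor> / real (Suc n)" for n
   proof -
    have "real (Suc n) * fst p - 1 \<le> real_of_int \<lfloor>real (Suc n) * fst p\<rfloor>" by linarith
    then have "(real (Suc n) * fst p - 1) / real (Suc n) \<le> real_of_int \<lfloor>real (Suc n) * fst p\<rfloor> / real (Suc n)"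
     by (intro divide_right_mono) auto
    moreover have "(real (Suc n) * fst p - 1) / real (Suc n) = fst p - inverse (real (Suc n))"
     by (simp add: field_simps)
    ultimately show ?thesis by simp
   qed
   then show "\<forall>\<^sub>F n in sequentially. fst p - inverse (real (Suc n)) \<le> real_of_int \<lfloor>real (Suc n) * fst p\<rfloor> / real (Suc n)" by simp
   have "real_of_int \<lfloor>real (Suc n) * fst p\<rfloor> / real (Suc n) \<le> fst p" for n
   proof -
    have "real_of_int \<lfloor>real (Suc n) * fst p\<rfloor> \<le> real (Suc n) * fst p" by linarith
    then have "real_of_int \<lfloor>real (Suc n) * fst p\<rfloor> / real (Suc n) \<le> (real (Suc n) * fst p) / real (Suc n)"
     by (intro divide_right_mono) auto
    then show ?thesis by simp
   qed
   then show "\<forall>\<^sub>F n in sequentially. real_of_int \<lfloor>real (Suc n) * fst p\<rfloor> / real (Suc n) \<le> fst p" by simp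
   show "(%n. fst p - inverse (real (Suc n))) \<longlonglongrightarrow> fst p"
    using tendsto_diff[OF tendsto_const LIMSEQ_inverse_real_of_nat, of "fst p"] by simp
  qed simp
  from isCont_tendsto_compose[OF cc this] show "(%n. ?g n p) \<longlonglongrightarrow> f (fst p) (snd p)" .
 qed
 then show ?thesis by (simp add: split_def)
qed

lemma nn_integral_eq_integral_continuous:
 fixes f :: "real => real"
 assumes f: "continuous_on {a..b} f" and nn: "!!x. x \<in> {a..b} ==> 0 \<le> f x"
 shows "(\<integral>\<^sup>+x\<in>{a..b}. ennreal (f x) \<partial>lborel) = ennreal (integral {a..b} f)"
proof -
 have i: "set_integrable lborel {a..b} f" by (rule borel_integrable_atLeastAtMost'[OF f])
 have "(\<integral>\<^sup>+x\<in>{a..b}. ennreal (f x) \<partial>lborel) = (\<integral>\<^sup>+x. ennreal (indicator {a..b} x *\<^sub>R f x) \<partial>lborel)"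
  by (intro nn_integral_cong) (auto simp: indicator_def)
 also have "\<dots> = ennreal (\<integral>x. indicator {a..b} x *\<^sub>R f x \<partial>lborel)"
  by (rule nn_integral_eq_integral) (use i nn in \<open>auto simp: set_integrable_def indicator_def\<close>)
 also have "(\<integral>x. indicator {a..b} x *\<^sub>R f x \<partial>lborel) = integral {a..b} f"
  using set_borel_integral_eq_integral(2)[OF i] by (simp add: set_lebesgue_integral_def)
 finally show ?thesis .
qed

text \<open>Cauchy-Schwarz against the constant 1, obtained by expanding the integral of
  \<open>(f x - c)^2\<close> with \<open>c\<close> the mean of \<open>f\<close>.\<close>

lemma integral_square_le:
 fixes f :: "real => real"
 assumes h: "0 \<le> h" and f: "continuous_on {0..h} f"
 shows "(integral {0..h} f)^2 \<le> h * integral {0..h} (%x. (f x)^2)"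
proof (cases "h = 0")
 case False
 then have h: "0 < h" using h by simp
 define c where "c = integral {0..h} f / h"
 have i: "f integrable_on {0..h}" "(%x. (f x)^2) integrable_on {0..h}"
  by (intro integrable_continuous_real continuous_intros f)+
 have j: "(%x. (f x)^2 - 2 * c * f x) integrable_on {0..h}"
  by (intro integrable_diff i integrable_on_mult_right)
 have "0 \<le> integral {0..h} (%x. (f x - c)^2)"
  by (rule integral_nonneg) (auto intro!: integrable_continuous_real continuous_intros f)
 also have "integral {0..h} (%x. (f x - c)^2) = integral {0..h} (%x. ((f x)^2 - 2 * c * f x) + c^2)"
  by (rule arg_cong[where f="integral {0..h}"]) (auto simp: power2_diff algebra_simps)
 also have "\<dots> = integral {0..h} (%x. (f x)^2) - 2 * c * integral {0..h} f + c^2 * h"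
  unfolding integral_add[OF j integrable_const_ivl] integral_diff[OF i(2) integrable_on_mult_right[OF i(1)]]
  using h by simp
 also have "\<dots> = integral {0..h} (%x. (f x)^2) - (integral {0..h} f)^2 / h"
  using h by (simp add: c_def power2_eq_square field_simps)
 finally show ?thesis using h by (simp add: field_simps)
qed (use f in simp)

locale sde = noise P T \<F> W V Bs B + C2_field G DG D2G L K
 for P :: "'w measure" and T \<F> and W :: "real => 'u::{real_inner, banach, second_countable_topology} => 'w => real"
  and V :: "'h::{real_inner, banach, second_countable_topology} set" and Bs and B :: "'u => 'h"
  and G :: "'h => 'h" and DG D2G L K
begin

lemma T0: "0 \<le> T" using T by simp

definition "sol m x = (SOME z. solves T G m x z)"

lemma sol: "continuous_on {0..T} m ==> solves T G m x (sol m x)"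
 unfolding sol_def using solves_exists[OF T0 _ lipG, of m x] by (intro someI_ex[where P="solves T G m x"]) blast

lemma solves_unique: assumes "solves S G m x z" "solves S G m x z'" "t \<in> {0..S}" shows "z t = z' t"
 using solves_lipschitz[OF cG lipG L0 assms] by simp

text \<open>Forcing for a start at time \<open>s\<close>. Since \<open>w\<close> is frozen after
  \<open>T\<close>, it is a continuous path on the whole line, so \<open>Z s\<close> is defined on
  all of [0, T] for every \<open>s\<close>.\<close>

definition "wp s om r = w (s + r) om - w s om"

lemma wp_continuous: "continuous_on S (wp s om)"
 unfolding wp_def by (intro continuous_intros continuous_on_compose2[OF w_continuous[of UNIV]]) auto

lemma wp_0 [simp]: "wp s om 0 = 0" by (simp add: wp_def)

lemma wp_from_0: "wp 0 om r = w r om" by (simp add: wp_def w_0)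

definition "Z s om x = sol (wp s om) x"

lemma Z_solves: "solves T G (wp s om) x (Z s om x)" unfolding Z_def by (rule sol[OF wp_continuous])

lemma Z_continuous: "continuous_on {0..T} (Z s om x)" using Z_solves unfolding solves_def by blast

lemma Z_at_0: "Z s om x 0 = x" using Z_solves[of s om x] T unfolding solves_def by auto

text \<open>Both sides solve the equation restarted at \<open>h\<close> with the same forcing and
  initial value, and solutions are unique.\<close>

lemma Z_flow: assumes h: "h \<in> {0..T}" and r: "r \<in> {0..T - h}"
 shows "Z s om x (h + r) = Z (s + h) om (Z s om x h) r"
proof -
 have "(%r. wp s om (h + r) - wp s om h) = wp (s + h) om" by (simp add: wp_def fun_eq_iff add.assoc)
 with solves_shift[OF cG Z_solves h, of s om x]
 have "solves (T - h) G (wp (s + h) om) (Z s om x h) (%r. Z s om x (h + r))" by simp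
 moreover have "solves (T - h) G (wp (s + h) om) (Z s om x h) (Z (s + h) om (Z s om x h))"
  by (rule solves_mono[OF Z_solves]) (use h in auto)
 ultimately show ?thesis using r by (rule solves_unique)
qed

lemma wp_measurable_filtration: assumes "0 \<le> s" "0 \<le> r" "s + r \<le> T"
 shows "(%om. wp s om r) \<in> borel_measurable (\<F> (s + r))"
proof -
 have "w s \<in> borel_measurable (\<F> (s + r))"
  by (rule measurable_filtration_mono[OF _ _ _ w_measurable_filtration]) (use assms in auto)
 moreover have "w (s + r) \<in> borel_measurable (\<F> (s + r))" by (rule w_measurable_filtration) (use assms in auto)
 ultimately show ?thesis unfolding wp_def by (intro borel_measurable_diff) auto
qed

lemma euler_measurable:
 assumes s: "0 \<le> s" and d: "0 \<le> d" and k: "s + real k * d \<le> T" and X: "X \<in> borel_measurable (\<F> s)"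
 shows "(%om. euler G (wp s om) (X om) d k) \<in> borel_measurable (\<F> (s + real k * d))"
 using k
proof (induction k)
 case 0 then show ?case using X by simp
next
 case (Suc k)
 have kd: "real k * d \<le> real (Suc k) * d" using d by (intro mult_right_mono) auto
 have k0: "0 \<le> real k * d" using d by simp
 let ?F = "\<F> (s + real (Suc k) * d)"
 have e: "(%om. euler G (wp s om) (X om) d k) \<in> borel_measurable ?F"
  by (rule measurable_filtration_mono[OF _ _ _ Suc.IH]) (use s d k0 kd Suc.prems in linarith)+
 have w1: "(%om. wp s om (real (Suc k) * d)) \<in> borel_measurable ?F"
  by (rule wp_measurable_filtration) (use s k0 kd Suc.prems in linarith)+
 have w2: "(%om. wp s om (real k * d)) \<in> borel_measurable ?F"
  by (rule measurable_filtration_mono[OF _ _ _ wp_measurable_filtration]) (use s k0 kd Suc.prems in linarith)+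
 have "(%om. G (euler G (wp s om) (X om) d k)) \<in> borel_measurable ?F"
  by (rule measurable_compose[OF e borel_measurable_continuous_onI[OF cG]])
 with e w1 w2 show ?case by (simp del: of_nat_Suc)
qed

text \<open>\<open>Z\<close> is picked by choice for each path, so measurability is inherited from
  the Euler polygons, which converge for every path and are adapted step by step.\<close>

lemma Z_measurable_filtration:
 assumes s: "0 \<le> s" and r: "0 \<le> r" "s + r \<le> T" and X: "X \<in> borel_measurable (\<F> s)"
 shows "(%om. Z s om (X om) r) \<in> borel_measurable (\<F> (s + r))"
proof (rule borel_measurable_LIMSEQ_metric)
 fix n
 have "real (Suc n) * (r / real (Suc n)) = r" by simp
 then show "(%om. euler G (wp s om) (X om) (r / real (Suc n)) (Suc n)) \<in> borel_measurable (\<F> (s + r))"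
  using euler_measurable[OF s _ _ X, of "r / real (Suc n)" "Suc n"] r by (simp del: euler.simps of_nat_Suc)
next
 fix om
 show "(%n. euler G (wp s om) (X om) (r / real (Suc n)) (Suc n)) \<longlonglongrightarrow> Z s om (X om) r"
  by (rule euler_converges[OF cG lipG L0 wp_0 solves_mono[OF Z_solves] r(1)]) (use s r in auto)
qed

lemma Z_measurable:
 assumes "0 \<le> s" "0 \<le> r" "s + r \<le> T" "X \<in> borel_measurable (\<F> s)"
 shows "(%om. Z s om (X om) r) \<in> borel_measurable P"
 by (rule measurable_filtration_P[OF _ Z_measurable_filtration[OF assms]]) (use assms in auto)

text \<open>One-step transition operator of the Euler polygon; by stationarity \<open>w d\<close>
  represents the law of any increment over a time span \<open>d\<close>.\<close>

definition step :: "real => ('h => real) => 'h => real" where "step d f x = (\<integral>om. f (x + d *\<^sub>R G x + w d om) \<partial>P)"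

lemma euler_step_measurable: "(%p. fst p + d *\<^sub>R G (fst p) + snd p) \<in> borel_measurable (borel \<Otimes>\<^sub>M borel)"
 using borel_measurable_continuous_onI[OF cG] by measurable

lemma step_measurable: assumes d: "d \<in> {0..T}" and f: "f \<in> borel_measurable borel"
 shows "step d f \<in> borel_measurable borel"
proof -
 have w: "w d \<in> borel_measurable P" by (rule w_measurable[OF d])
 have "(%(x, om). f (x + d *\<^sub>R G x + w d om)) \<in> borel_measurable (borel \<Otimes>\<^sub>M P)"
  using borel_measurable_continuous_onI[OF cG] w f by measurable
 from borel_measurable_lebesgue_integral[OF this] show ?thesis by (simp add: step_def[abs_def])
qed

lemma step_bound: assumes d: "d \<in> {0..T}" and f: "f \<in> borel_measurable borel" and c: "!!x. \<bar>f x\<bar> \<le> c"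
 shows "\<bar>step d f x\<bar> \<le> c"
proof -
 have c0: "0 \<le> c" using c[of 0] by linarith
 have "norm (step d f x) \<le> (\<integral>om. norm (f (x + d *\<^sub>R G x + w d om)) \<partial>P)"
  unfolding step_def by (rule integral_norm_bound)
 also have "\<dots> \<le> (\<integral>om. c \<partial>P)"
  using c c0 by (intro integral_mono') auto
 finally show ?thesis by (simp add: prob_space)
qed

lemma step_power: assumes d: "d \<in> {0..T}" and f: "f \<in> borel_measurable borel" and c: "!!x. \<bar>f x\<bar> \<le> c"
 shows "(step d ^^ k) f \<in> borel_measurable borel \<and> (\<forall>x. \<bar>(step d ^^ k) f x\<bar> \<le> c)"
proof (induction k)
 case 0 show ?case using f c by simp
next
 case (Suc k)
 then show ?case using step_measurable[OF d] step_bound[OF d] by simp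
qed

text \<open>The last increment is independent of the polygon before it and is integrated out first.
  The resulting iterate involves \<open>s\<close> only through \<open>X\<close>, which is the reason
  for the Markov property.\<close>

lemma euler_expectation:
 fixes f :: "'h => real"
 assumes s: "0 \<le> s" and d: "0 \<le> d" and k: "s + real k * d \<le> T" and X: "X \<in> borel_measurable (\<F> s)"
  and f: "f \<in> borel_measurable borel" and c: "!!x. \<bar>f x\<bar> \<le> c"
 shows "(\<integral>om. f (euler G (wp s om) (X om) d k) \<partial>P) = (\<integral>om. (step d ^^ k) f (X om) \<partial>P)"
 using k f c
proof (induction k arbitrary: f)
 case 0 then show ?case by simp
next
 case (Suc k)
 let ?e = "%om. euler G (wp s om) (X om) d k"
 have kd: "real k * d \<le> real (Suc k) * d" using d by (intro mult_right_mono) auto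
 have k0: "0 \<le> real k * d" using d by simp
 have dk: "real (Suc k) * d = real k * d + d" by (simp add: algebra_simps)
 have dT: "d \<in> {0..T}" using d k0 dk Suc.prems(1) s unfolding atLeastAtMost_iff by linarith
 have me: "?e \<in> borel_measurable (\<F> (s + real k * d))"
  by (rule euler_measurable[OF s d _ X]) (use kd Suc.prems in linarith)
 have "(\<integral>om. f (euler G (wp s om) (X om) d (Suc k)) \<partial>P)
   = (\<integral>om. (%p. f (fst p + d *\<^sub>R G (fst p) + snd p)) (?e om, w (s + real (Suc k) * d) om - w (s + real k * d) om) \<partial>P)"
  by (simp add: wp_def)
 also have "\<dots> = (\<integral>om. (\<integral>om'. (%p. f (fst p + d *\<^sub>R G (fst p) + snd p)) (?e om, w ((s + real (Suc k) * d) - (s + real k * d)) om') \<partial>P) \<partial>P)"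
 proof (rule independent_integral[OF _ _ _ me])
  show "(%p. f (fst p + d *\<^sub>R G (fst p) + snd p)) \<in> borel_measurable (borel \<Otimes>\<^sub>M borel)"
   by (rule measurable_compose[OF euler_step_measurable Suc.prems(2)])
 qed (use s k0 kd Suc.prems in auto)
 also have "(s + real (Suc k) * d) - (s + real k * d) = d" using dk by simp
 also have "(\<integral>om. (\<integral>om'. (%p. f (fst p + d *\<^sub>R G (fst p) + snd p)) (?e om, w d om') \<partial>P) \<partial>P) = (\<integral>om. step d f (?e om) \<partial>P)"
  by (simp add: step_def)
 also have "\<dots> = (\<integral>om. (step d ^^ k) (step d f) (X om) \<partial>P)"
  by (rule Suc.IH) (use kd Suc.prems step_measurable[OF dT] step_bound[OF dT] in \<open>auto intro: order_trans\<close>)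
 finally show ?case by (simp add: funpow_swap1)
qed

lemma euler_stationary:
 fixes f :: "'h => real"
 assumes s: "0 \<le> s" and d: "0 \<le> d" and k: "s + real k * d \<le> T" and X: "X \<in> borel_measurable (\<F> s)"
  and f: "f \<in> borel_measurable borel" and c: "!!x. \<bar>f x\<bar> \<le> c"
 shows "(\<integral>om. f (euler G (wp s om) (X om) d k) \<partial>P) = (\<integral>om. (\<integral>om'. f (euler G (wp 0 om') (X om) d k) \<partial>P) \<partial>P)"
proof -
 have "(\<integral>om'. f (euler G (wp 0 om') x d k) \<partial>P) = (step d ^^ k) f x" for x
  using euler_expectation[OF order_refl d _ _ f c, of k "%_. x"] k s by (simp add: prob_space)
 then show ?thesis using euler_expectation[OF s d k X f c] by simp
qed

text \<open>The polygon version passes to the limit by bounded convergence, once for the inner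
  expectation at each fixed starting point and once for the outer one. Measurability of the inner
  expectation comes from the iterates of \<open>step\<close>.\<close>

lemma markov_bounded:
 fixes f :: "'h => real"
 assumes s: "0 \<le> s" and r: "0 \<le> r" "s + r \<le> T" and X: "X \<in> borel_measurable (\<F> s)"
  and f: "continuous_on UNIV f" and c: "!!x. \<bar>f x\<bar> \<le> c"
 shows "(\<integral>om. f (Z s om (X om) r) \<partial>P) = (\<integral>om. (\<integral>om'. f (Z 0 om' (X om) r) \<partial>P) \<partial>P)"
proof -
 let ?d = "%n. r / real (Suc n)"
 let ?e = "%s om x n. euler G (wp s om) x (?d n) (Suc n)"
 have fm: "f \<in> borel_measurable borel" by (rule borel_measurable_continuous_onI[OF f])
 have dd: "real (Suc n) * ?d n = r" "0 \<le> ?d n" for n using r by (auto simp del: of_nat_Suc)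
 have conv: "(%n. f (?e s om x n)) \<longlonglongrightarrow> f (Z s om x r)" if "0 \<le> s" "s + r \<le> T" for s om x
 proof -
  have "(%n. ?e s om x n) \<longlonglongrightarrow> Z s om x r"
   by (rule euler_converges[OF cG lipG L0 wp_0 solves_mono[OF Z_solves] r(1)]) (use that r in auto)
  then show ?thesis using f by (auto simp: continuous_on_eq_continuous_at intro: isCont_tendsto_compose)
 qed
 have me: "(%om. f (?e s om (X om) n)) \<in> borel_measurable P" if "0 \<le> s" "s + r \<le> T" "X \<in> borel_measurable (\<F> s)" for s X n
 proof (rule measurable_compose[OF _ fm])
  have "(%om. ?e s om (X om) n) \<in> borel_measurable (\<F> (s + real (Suc n) * ?d n))"
   by (rule euler_measurable) (use that dd r in \<open>auto simp del: of_nat_Suc\<close>)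
  then show "(%om. ?e s om (X om) n) \<in> borel_measurable P"
   by (rule measurable_filtration_P[rotated]) (use that r dd in \<open>auto simp del: of_nat_Suc\<close>)
 qed
 have mZ: "(%om. f (Z s om (X om) r)) \<in> borel_measurable P" if "0 \<le> s" "s + r \<le> T" "X \<in> borel_measurable (\<F> s)" for s X
  by (rule measurable_compose[OF Z_measurable fm]) (use that r in auto)
 have L1: "(%n. \<integral>om. f (?e s om (X om) n) \<partial>P) \<longlonglongrightarrow> (\<integral>om. f (Z s om (X om) r) \<partial>P)" if "0 \<le> s" "s + r \<le> T" "X \<in> borel_measurable (\<F> s)" for s X
 proof (rule integral_dominated_convergence[where w="%_. c"])
  show "AE om in P. (%n. f (?e s om (X om) n)) \<longlonglongrightarrow> f (Z s om (X om) r)" using conv that by simp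
  show "AE om in P. norm (f (?e s om (X om) n)) \<le> c" for n using c by simp
 qed (use me[OF that] mZ[OF that] in auto)
 let ?p = "%n x. \<integral>om'. f (?e 0 om' x n) \<partial>P"
 have pc: "(%n. ?p n x) \<longlonglongrightarrow> (\<integral>om'. f (Z 0 om' x r) \<partial>P)" for x
  by (rule L1) (use s r in auto)
 have c0: "0 \<le> c" using c[of 0] by linarith
 have ps: "?p n x = (step (?d n) ^^ Suc n) f x" for n x
 proof -
  have "?p n x = (\<integral>om. (step (?d n) ^^ Suc n) f x \<partial>P)"
   by (rule euler_expectation[OF order_refl dd(2) _ _ fm c]) (use dd(1)[of n] s r in \<open>simp_all del: of_nat_Suc\<close>)
  then show ?thesis by (simp only: lebesgue_integral_const prob_space scaleR_one)
 qed
 have dT: "?d n \<in> {0..T}" for n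
 proof -
  have "?d n \<le> r" using r by (simp add: field_simps)
  then show ?thesis using dd(2)[of n] s r by simp
 qed
 have mX: "X \<in> borel_measurable P" using measurable_filtration_P[OF _ X] s r by simp
 have mp: "(%om. ?p n (X om)) \<in> borel_measurable P" for n
  unfolding ps using measurable_compose[OF mX] step_power[OF dT fm c] by blast
 have bp: "\<bar>?p n x\<bar> \<le> c" for n x unfolding ps using step_power[OF dT fm c] by blast
 have mlim: "(%om. \<integral>om'. f (Z 0 om' (X om) r) \<partial>P) \<in> borel_measurable P"
  by (rule borel_measurable_LIMSEQ_metric[OF mp]) (rule pc)
 have L2: "(%n. \<integral>om. ?p n (X om) \<partial>P) \<longlonglongrightarrow> (\<integral>om. (\<integral>om'. f (Z 0 om' (X om) r) \<partial>P) \<partial>P)"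
  by (rule integral_dominated_convergence[where w="%_. c", OF mlim mp]) (use pc bp in auto)
 have "(\<integral>om. f (?e s om (X om) n) \<partial>P) = (\<integral>om. ?p n (X om) \<partial>P)" for n
  by (rule euler_stationary[OF s dd(2) _ X fm c]) (use dd r in \<open>simp del: of_nat_Suc\<close>)
 with L1[OF s r(2) X] have "(%n. \<integral>om. ?p n (X om) \<partial>P) \<longlonglongrightarrow> (\<integral>om. f (Z s om (X om) r) \<partial>P)" by simp
 from LIMSEQ_unique[OF this L2] show ?thesis .
qed

end

section \<open>Moment bounds for the flow and the Markov property for Lipschitz functions\<close>

lemma square_sum4_le: "(a + b + c + d)^2 \<le> 4 * (a^2 + b^2 + c^2 + d^2)" for a b c d :: real
proof -
 have "4 * (a^2 + b^2 + c^2 + d^2) - (a + b + c + d)^2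
   = (a - b)^2 + (a - c)^2 + (a - d)^2 + (b - c)^2 + (b - d)^2 + (c - d)^2"
  by (simp add: power2_eq_square algebra_simps)
 moreover have "0 \<le> (a - b)^2 + (a - c)^2 + (a - d)^2 + (b - c)^2 + (b - d)^2 + (c - d)^2" by simp
 ultimately show ?thesis by linarith
qed

lemma le_one_add_square: "x \<le> 1 + x^2" for x :: real
proof -
 have "0 \<le> (x - 1)^2 + x^2 + 1" by simp
 then show ?thesis by (simp add: power2_eq_square algebra_simps)
qed

context sde
begin

lemma w_measurable_all: "w t \<in> borel_measurable P"
proof -
 have c: "cl (cl t) = cl t" by (rule cl(2)[OF cl(1)])
 have "w t = w (cl t)" unfolding w_def[abs_def] c ..
 then show ?thesis using w_measurable[OF cl(1)] by metis
qed

lemma wp_measurable: "(%om. wp s om r) \<in> borel_measurable P"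
 unfolding wp_def by (intro borel_measurable_diff w_measurable_all)

lemma wp_joint: "(%(r, om). wp s om r) \<in> borel_measurable (borel \<Otimes>\<^sub>M P)"
 by (rule caratheodory_measurable[OF wp_measurable wp_continuous])

text \<open>\<open>I1\<close> appears in the pathwise growth bound, \<open>I2\<close> has an
  explicitly bounded expectation; \<open>I1_I2\<close> connects the two.\<close>

definition "I1 s h om = integral {0..h} (%r. norm (wp s om r))"
definition "I2 s h om = integral {0..h} (%r. (norm (wp s om r))^2)"

lemma I1_nonneg: "0 \<le> I1 s h om"
 unfolding I1_def by (intro integral_nonneg integrable_continuous_real continuous_intros wp_continuous) auto

lemma I2_nonneg: "0 \<le> I2 s h om"
 unfolding I2_def by (intro integral_nonneg integrable_continuous_real continuous_intros wp_continuous) auto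

lemma I1_I2: "0 \<le> h ==> (I1 s h om)^2 \<le> h * I2 s h om"
 unfolding I1_def I2_def by (rule integral_square_le) (auto intro!: continuous_intros wp_continuous)

lemma I2_nn: "(\<integral>\<^sup>+r\<in>{0..h}. ennreal ((norm (wp s om r))^2) \<partial>lborel) = ennreal (I2 s h om)"
 unfolding I2_def by (rule nn_integral_eq_integral_continuous) (auto intro!: continuous_intros wp_continuous)

lemma I2_measurable: "I2 s h \<in> borel_measurable P"
proof -
 have "(%(om, r). wp s om r) \<in> borel_measurable (P \<Otimes>\<^sub>M borel)"
  using measurable_compose[OF measurable_pair_swap' wp_joint] by (simp add: split_def)
 then have "(%(om, r). wp s om r) \<in> borel_measurable (P \<Otimes>\<^sub>M lborel)"
  by (simp add: measurable_cong_sets[OF sets_pair_measure_cong[OF refl sets_lborel] refl])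
 then have "(%(om, r). ennreal ((norm (wp s om r))^2) * indicator {0..h} r) \<in> borel_measurable (P \<Otimes>\<^sub>M lborel)"
  by measurable
 from lborel.borel_measurable_nn_integral[OF this]
 have "(%om. ennreal (I2 s h om)) \<in> borel_measurable P" by (simp add: I2_nn)
 then have "(%om. enn2real (ennreal (I2 s h om))) \<in> borel_measurable P" by measurable
 then show ?thesis by (simp add: I2_nonneg)
qed

lemma I2_expectation: assumes s: "0 \<le> s" and h: "0 \<le> h" "s + h \<le> T"
 shows "integrable P (I2 s h)" "(\<integral>om. I2 s h om \<partial>P) \<le> h^2 * q2"
proof -
 interpret pair_sigma_finite lborel P ..
 have "(%(r, om). wp s om r) \<in> borel_measurable (lborel \<Otimes>\<^sub>M P)"
  using wp_joint by (simp add: measurable_cong_sets[OF sets_pair_measure_cong[OF sets_lborel refl] refl])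
 then have m: "(%(r, om). ennreal ((norm (wp s om r))^2) * indicator {0..h} r) \<in> borel_measurable (lborel \<Otimes>\<^sub>M P)"
  by measurable
 have "(\<integral>\<^sup>+om. ennreal (I2 s h om) \<partial>P) = (\<integral>\<^sup>+om. (\<integral>\<^sup>+r. ennreal ((norm (wp s om r))^2) * indicator {0..h} r \<partial>lborel) \<partial>P)"
  by (simp add: I2_nn)
 also have "\<dots> = (\<integral>\<^sup>+r. (\<integral>\<^sup>+om. ennreal ((norm (wp s om r))^2) * indicator {0..h} r \<partial>P) \<partial>lborel)"
  using Fubini[OF m] by simp
 also have "\<dots> \<le> (\<integral>\<^sup>+r. ennreal (h * q2) * indicator {0..h} r \<partial>lborel)"
 proof (rule nn_integral_mono)
  fix r
  show "(\<integral>\<^sup>+om. ennreal ((norm (wp s om r))^2) * indicator {0..h} r \<partial>P) \<le> ennreal (h * q2) * indicator {0..h} r"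
  proof (cases "r \<in> {0..h}")
   case True
   then have r: "0 \<le> s" "s \<le> s + r" "s + r \<le> T" using s h by auto
   have "(\<integral>\<^sup>+om. ennreal ((norm (wp s om r))^2) \<partial>P) = ennreal (r * q2)"
    unfolding wp_def using w_inc_second_moment[OF r] by (subst nn_integral_eq_integral) auto
   also have "\<dots> \<le> ennreal (h * q2)" using True q2_nonneg by (intro ennreal_leI mult_right_mono) auto
   finally show ?thesis using True by simp
  qed simp
 qed
 also have "\<dots> = ennreal (h * q2) * ennreal h" using h by (subst nn_integral_cmult_indicator) auto
 also have "\<dots> = ennreal (h^2 * q2)"
  using h q2_nonneg by (simp add: power2_eq_square mult_ac flip: ennreal_mult)
 finally have le: "(\<integral>\<^sup>+om. ennreal (I2 s h om) \<partial>P) \<le> ennreal (h^2 * q2)" .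
 show i: "integrable P (I2 s h)"
  by (rule integrableI_bounded[OF I2_measurable]) (use le in \<open>auto simp: I2_nonneg intro: le_less_trans\<close>)
 show "(\<integral>om. I2 s h om \<partial>P) \<le> h^2 * q2"
  using le nn_integral_eq_integral[OF i] q2_nonneg by (simp add: I2_nonneg)
qed

definition "ET = exp (L * T)"

lemma ET: "1 \<le> ET" "0 < ET" using L0 T by (simp_all add: ET_def)

lemma Z_growth: assumes h: "h \<in> {0..T}"
 shows "norm (Z s om x h - x - wp s om h) \<le> ET * (h * norm (G x) + L * I1 s h om)"
proof -
 have "norm (Z s om x h - x - wp s om h) \<le> (h * norm (G x) + L * I1 s h om) * exp (L * h)"
  unfolding I1_def by (rule solves_growth[OF cG lipG L0 wp_continuous Z_solves h])
 also have "\<dots> \<le> (h * norm (G x) + L * I1 s h om) * ET"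
  using h L0 I1_nonneg unfolding ET_def by (intro mult_left_mono) (auto intro: mult_left_mono)
 finally show ?thesis by (simp add: mult.commute)
qed

lemma Z_lipschitz: "r \<in> {0..T} ==> norm (Z s om x r - Z s om y r) \<le> ET * norm (x - y)"
 using solves_lipschitz[OF cG lipG L0 Z_solves Z_solves] by (simp add: ET_def mult.commute)

lemma G_growth: "norm (G x) \<le> norm (G 0) + L * norm x"
 using norm_triangle_sub[of "G x" "G 0"] lipG[of x 0] by simp

text \<open>Squared coefficients of the four terms that bound \<open>norm (Z s om x h)\<close>, with
  the factor 4 for the square of a sum of four; the extra \<open>T\<close> comes from replacing the
  square of \<open>I1\<close> by \<open>T * I2\<close>.\<close>

definition "CZ = 4 * ((1 + ET * T * L)^2 + 1 + (ET * T * norm (G 0))^2 + (ET * L)^2 * T)"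

lemma Z_square_bound: assumes h: "h \<in> {0..T}"
 shows "(norm (Z s om x h))^2 \<le> CZ * (1 + (norm x)^2 + (norm (wp s om h))^2 + I2 s h om)"
proof -
 have "norm (Z s om x h) = norm ((Z s om x h - x - wp s om h) + x + wp s om h)" by simp
 also have "\<dots> \<le> norm (Z s om x h - x - wp s om h) + norm x + norm (wp s om h)"
  by (intro norm_triangle_le add_mono norm_triangle_ineq order_refl)
 also have "norm (Z s om x h - x - wp s om h) \<le> ET * (T * (norm (G 0) + L * norm x) + L * I1 s h om)"
 proof (rule order_trans[OF Z_growth[OF h]], intro mult_left_mono add_right_mono)
  show "h * norm (G x) \<le> T * (norm (G 0) + L * norm x)"
   using h G_growth[of x] by (intro mult_mono) auto
 qed (use ET in auto)
 finally have "norm (Z s om x h) \<le> (1 + ET * T * L) * norm x + norm (wp s om h) + ET * T * norm (G 0) + ET * L * I1 s h om"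
  by (simp add: algebra_simps)
 then have "(norm (Z s om x h))^2 \<le> ((1 + ET * T * L) * norm x + norm (wp s om h) + ET * T * norm (G 0) + ET * L * I1 s h om)^2"
  by (intro power_mono) auto
 also have "\<dots> \<le> 4 * (((1 + ET * T * L) * norm x)^2 + (norm (wp s om h))^2 + (ET * T * norm (G 0))^2 + (ET * L * I1 s h om)^2)"
  by (rule square_sum4_le)
 also have "\<dots> \<le> 4 * ((1 + ET * T * L)^2 * (norm x)^2 + 1 * (norm (wp s om h))^2 + (ET * T * norm (G 0))^2 * 1 + ((ET * L)^2 * T) * I2 s h om)"
 proof -
  have "(I1 s h om)^2 \<le> T * I2 s h om"
   using I1_I2[of h s om] h mult_right_mono[OF _ I2_nonneg, of h T s h om] by auto
  then have "(ET * L)^2 * (I1 s h om)^2 \<le> (ET * L)^2 * (T * I2 s h om)" by (rule mult_left_mono) simp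
  then show ?thesis by (simp add: power_mult_distrib mult.assoc)
 qed
 also have "\<dots> \<le> CZ * (1 + (norm x)^2 + (norm (wp s om h))^2 + I2 s h om)"
 proof -
  define a b c d where "a = (1 + ET * T * L)^2" and "b = (ET * T * norm (G 0))^2" and "c = (ET * L)^2 * T" and "d = I2 s h om"
  define p q where "p = (norm x)^2" and "q = (norm (wp s om h))^2"
  have nn: "0 \<le> a" "0 \<le> b" "0 \<le> c" "0 \<le> d" "0 \<le> p" "0 \<le> q"
   using T0 I2_nonneg by (auto simp: a_def b_def c_def d_def p_def q_def)
  have "a * p + 1 * q + b * 1 + c * d \<le> (a + 1 + b + c) * (1 + p + q + d)"
   using nn by (simp add: algebra_simps add_nonneg_nonneg)
  then have "4 * (a * p + 1 * q + b * 1 + c * d) \<le> 4 * (a + 1 + b + c) * (1 + p + q + d)"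
   unfolding mult.assoc by (rule mult_left_mono) simp
  then show ?thesis unfolding CZ_def a_def[symmetric] b_def[symmetric] c_def[symmetric] d_def[symmetric] p_def[symmetric] q_def[symmetric]
   by (simp only: add.commute add.left_commute add.assoc)
 qed
 finally show ?thesis .
qed

lemma Z_square_integrable:
 assumes s: "0 \<le> s" and r: "0 \<le> r" "s + r \<le> T" and X: "X \<in> borel_measurable (\<F> s)" and X2: "sq_integrable X"
 shows "integrable P (%om. (norm (Z s om (X om) r))^2)"
proof (rule Bochner_Integration.integrable_bound)
 have st: "0 \<le> s" "s \<le> s + r" "s + r \<le> T" using s r by auto
 show "integrable P (%om. CZ * (1 + (norm (X om))^2 + (norm (wp s om r))^2 + I2 s r om))"
  unfolding wp_def using X2 w_inc_second_moment(1)[OF st] I2_expectation(1)[OF s r]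
  by (intro integrable_mult_right Bochner_Integration.integrable_add) auto
 show "(%om. (norm (Z s om (X om) r))^2) \<in> borel_measurable P"
  using Z_measurable[OF s r X] by simp
 have "r \<in> {0..T}" using s r by auto
 then show "AE om in P. norm ((norm (Z s om (X om) r))^2) \<le> norm (CZ * (1 + (norm (X om))^2 + (norm (wp s om r))^2 + I2 s r om))"
  using order_trans[OF Z_square_bound abs_ge_self] by auto
qed

lemma square_integrable_imp_integrable:
 assumes X: "X \<in> borel_measurable P" and X2: "sq_integrable X"
 shows "integrable P (%om. norm (X om))"
 by (rule Bochner_Integration.integrable_bound[of P "%om. 1 + (norm (X om))^2"])
  (use X X2 le_one_add_square in auto)

lemma lipschitz_growth:
 fixes f :: "'h => real"
 assumes "!!x y. \<bar>f x - f y\<bar> \<le> l * norm (x - y)"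
 shows "\<bar>f x\<bar> \<le> \<bar>f 0\<bar> + l * norm x"
 using assms[of x 0] by simp

lemma lipschitz_continuous:
 fixes f :: "'h => real"
 assumes lip: "!!x y. \<bar>f x - f y\<bar> \<le> l * norm (x - y)"
 shows "continuous_on UNIV f"
proof (rule lipschitz_on_continuous_on[of "\<bar>l\<bar>"], rule lipschitz_onI)
 show "dist (f x) (f y) \<le> \<bar>l\<bar> * dist x y" for x y
  using lip[of x y] mult_right_mono[OF abs_ge_self, of "norm (x - y)" l] by (simp add: dist_norm)
qed simp

lemma lipschitz_Z_integrable:
 fixes f :: "'h => real"
 assumes lip: "!!x y. \<bar>f x - f y\<bar> \<le> l * norm (x - y)"
  and s: "0 \<le> s" and r: "0 \<le> r" "s + r \<le> T" and X: "X \<in> borel_measurable (\<F> s)" and X2: "sq_integrable X"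
 shows "integrable P (%om. f (Z s om (X om) r))"
proof (rule Bochner_Integration.integrable_bound)
 show "integrable P (%om. \<bar>f 0\<bar> + l * norm (Z s om (X om) r))"
  using square_integrable_imp_integrable[OF Z_measurable[OF s r X] Z_square_integrable[OF s r X X2]] by simp
 show "(%om. f (Z s om (X om) r)) \<in> borel_measurable P"
  by (rule measurable_compose[OF Z_measurable[OF s r X] borel_measurable_continuous_onI[OF lipschitz_continuous[OF lip]]])
 show "AE om in P. norm (f (Z s om (X om) r)) \<le> norm (\<bar>f 0\<bar> + l * norm (Z s om (X om) r))"
  using order_trans[OF lipschitz_growth[of f l, OF lip] abs_ge_self] by auto
qed

text \<open>Pathwise counterpart of \<open>\<mu>\<close>: the two agree on the subspace, but
  \<open>semi\<close> lives on the whole Hilbert space, where ordinary Frechet derivatives are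
  available.\<close>

definition "semi f r x = (\<integral>om. f (Z 0 om x r) \<partial>P)" for f :: "'h => real"

lemma semi_lipschitz:
 fixes f :: "'h => real"
 assumes lip: "!!x y. \<bar>f x - f y\<bar> \<le> l * norm (x - y)" and r: "r \<in> {0..T}"
 shows "\<bar>semi f r x - semi f r y\<bar> \<le> (l * ET) * norm (x - y)"
proof -
 have l: "0 \<le> l * norm (x - y)" for x y :: 'h using lip[of x y] by linarith
 have i: "integrable P (%om. f (Z 0 om x r))" for x
  by (rule lipschitz_Z_integrable[OF lip, where X="%_. x"]) (use r in auto)
 have "\<bar>semi f r x - semi f r y\<bar> = norm (\<integral>om. f (Z 0 om x r) - f (Z 0 om y r) \<partial>P)"
  unfolding semi_def by (simp add: i)
 also have "\<dots> \<le> (\<integral>om. norm (f (Z 0 om x r) - f (Z 0 om y r)) \<partial>P)" by (rule integral_norm_bound)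
 also have "\<dots> \<le> (\<integral>om. (l * ET) * norm (x - y) \<partial>P)"
 proof (rule integral_mono')
  fix om
  show "norm (f (Z 0 om x r) - f (Z 0 om y r)) \<le> (l * ET) * norm (x - y)"
  proof (cases "x = y")
   case False
   then have "0 \<le> l" using l[of x y] by (simp add: zero_le_mult_iff)
   then have "l * norm (Z 0 om x r - Z 0 om y r) \<le> l * (ET * norm (x - y))"
    by (intro mult_left_mono Z_lipschitz r)
   with lip[of "Z 0 om x r" "Z 0 om y r"] show ?thesis by (simp add: mult.assoc)
  qed simp
  show "0 \<le> (l * ET) * norm (x - y)"
   using mult_nonneg_nonneg[of ET "l * norm (x - y)"] l[of x y] ET by (simp add: mult_ac)
 qed simp
 finally show ?thesis by (simp add: prob_space)
qed

text \<open>Extends \<open>markov_bounded\<close> by truncating \<open>f\<close> at height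
  \<open>n\<close>. Truncation preserves the Lipschitz constant, and linear growth with second
  moments provides the dominating functions.\<close>

lemma markov:
 fixes f :: "'h => real"
 assumes lip: "!!x y. \<bar>f x - f y\<bar> \<le> l * norm (x - y)"
  and s: "0 \<le> s" and r: "0 \<le> r" "s + r \<le> T" and X: "X \<in> borel_measurable (\<F> s)" and X2: "sq_integrable X"
 shows "(\<integral>om. f (Z s om (X om) r) \<partial>P) = (\<integral>om. semi f r (X om) \<partial>P)"
proof -
 define fK where "fK n y = max (- real n) (min (real n) (f y))" for n y
 have fK_le: "\<bar>fK n y\<bar> \<le> \<bar>f y\<bar>" "\<bar>fK n y\<bar> \<le> real n" for n y unfolding fK_def by linarith+
 have fK_lim: "(%n. fK n y) \<longlonglongrightarrow> f y" for y
 proof (rule tendsto_eventually)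
  obtain N where "\<bar>f y\<bar> < real N" using reals_Archimedean2 by blast
  then show "\<forall>\<^sub>F n in sequentially. fK n y = f y"
   unfolding eventually_sequentially fK_def by (intro exI[of _ N]) (auto simp: max_def min_def)
 qed
 have fK_lip: "\<bar>fK n x - fK n y\<bar> \<le> l * norm (x - y)" for n x y
  using lip[of x y] unfolding fK_def by linarith
 have cK: "continuous_on UNIV (fK n)" for n by (rule lipschitz_continuous[of _ l, OF fK_lip])
 have rT: "r \<in> {0..T}" using s r by auto
 have mX: "X \<in> borel_measurable P" using measurable_filtration_P[OF _ X] s r by simp
 have L: "(%n. \<integral>om. fK n (Z s om (X om) r) \<partial>P) \<longlonglongrightarrow> (\<integral>om. f (Z s om (X om) r) \<partial>P)"
  if "0 \<le> s" "s + r \<le> T" "X \<in> borel_measurable (\<F> s)" "sq_integrable X" for s X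
 proof (rule integral_dominated_convergence[where w="%om. \<bar>f (Z s om (X om) r)\<bar>"])
  show "(%om. f (Z s om (X om) r)) \<in> borel_measurable P" "(%om. fK n (Z s om (X om) r)) \<in> borel_measurable P" for n
   using lipschitz_Z_integrable[OF lip that(1) r(1) that(2-4)] lipschitz_Z_integrable[OF fK_lip that(1) r(1) that(2-4)] by auto
  show "integrable P (%om. \<bar>f (Z s om (X om) r)\<bar>)" using lipschitz_Z_integrable[OF lip that(1) r(1) that(2-4)] by simp
 qed (use fK_lim fK_le in auto)
 have p_lim: "(%n. semi (fK n) r x) \<longlonglongrightarrow> semi f r x" for x
  unfolding semi_def by (rule L) (use rT in auto)
 have msemi: "(%om. semi g r (X om)) \<in> borel_measurable P" if "!!x y. \<bar>g x - g y\<bar> \<le> l * norm (x - y)" for g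
  by (rule measurable_compose[OF mX borel_measurable_continuous_onI[OF lipschitz_continuous[OF semi_lipschitz[OF that rT]]]])
 define c where "c = (\<integral>om. \<bar>f (Z 0 om 0 r)\<bar> \<partial>P)"
 have if0: "integrable P (%om. f (Z 0 om 0 r))"
  by (rule lipschitz_Z_integrable[OF lip, where X="%_. 0"]) (use rT in auto)
 have bound: "\<bar>semi (fK n) r x\<bar> \<le> c + l * ET * norm x" for n x
 proof -
  have "norm (semi (fK n) r 0) \<le> (\<integral>om. norm (fK n (Z 0 om 0 r)) \<partial>P)" unfolding semi_def by (rule integral_norm_bound)
  also have "\<dots> \<le> c" unfolding c_def using if0 fK_le by (intro integral_mono') auto
  finally have "\<bar>semi (fK n) r 0\<bar> \<le> c" by simp
  moreover have "\<bar>semi (fK n) r x - semi (fK n) r 0\<bar> \<le> l * ET * norm x"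
   using semi_lipschitz[OF fK_lip rT, of n x 0] by simp
  ultimately show ?thesis by linarith
 qed
 have R: "(%n. \<integral>om. semi (fK n) r (X om) \<partial>P) \<longlonglongrightarrow> (\<integral>om. semi f r (X om) \<partial>P)"
 proof (rule integral_dominated_convergence[where w="%om. c + l * ET * norm (X om)", OF msemi[OF lip] msemi[OF fK_lip]])
  show "integrable P (%om. c + l * ET * norm (X om))"
   using square_integrable_imp_integrable[OF mX X2] by simp
 qed (use p_lim bound in auto)
 have "(\<integral>om. fK n (Z s om (X om) r) \<partial>P) = (\<integral>om. semi (fK n) r (X om) \<partial>P)" for n
  unfolding semi_def by (rule markov_bounded[OF s r X cK fK_le(2)])
 with L[OF s r(2) X X2] have "(%n. \<integral>om. semi (fK n) r (X om) \<partial>P) \<longlonglongrightarrow> (\<integral>om. f (Z s om (X om) r) \<partial>P)" by simp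
 from LIMSEQ_unique[OF this R] show ?thesis .
qed

end

subsection \<open>Regularity of the transition semigroup\<close>

text \<open>Nothing is known about the dependence of \<open>D\<close> on \<open>om\<close>, so its
  measurability is extracted from difference quotients. The derivative bound makes \<open>f\<close>
  Lipschitz, hence the remainder quotients are bounded by \<open>2 * c\<close> and converge
  dominatedly.\<close>

lemma (in prob_space) derivative_under_integral:
 fixes f :: "'h::{real_normed_vector, second_countable_topology} => 'a => real" and D :: "'h => 'a => 'h \<Rightarrow>\<^sub>L real"
 assumes der: "!!x om. ((%x. f x om) has_derivative blinfun_apply (D x om)) (at x)"
  and c: "!!x om. norm (D x om) \<le> c" and int: "!!x. integrable M (f x)"
 shows "integrable M (%om. D x om v)"
  "((%x. \<integral>om. f x om \<partial>M) has_derivative (%v. \<integral>om. D x om v \<partial>M)) (at x)"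
proof -
 have bd: "\<bar>D x om v\<bar> \<le> c * norm v" for x om v
  using order_trans[OF norm_blinfun mult_right_mono[OF c norm_ge_zero]] by simp
 have meas: "(%om. D x om v) \<in> borel_measurable M" for v
 proof (rule borel_measurable_LIMSEQ_metric)
  fix n show "(%om. (f (x + inverse (real (Suc n)) *\<^sub>R v) om - f x om) / inverse (real (Suc n))) \<in> borel_measurable M"
   using int by (intro borel_measurable_divide borel_measurable_diff borel_measurable_const) auto
 next
  fix om
  have line: "((%t. x + t *\<^sub>R v) has_derivative (%h. h *\<^sub>R v)) (at (0::real))"
   by (auto intro!: derivative_eq_intros)
  have "((%x. f x om) has_derivative blinfun_apply (D x om)) (at (x + 0 *\<^sub>R v))" using der[of om x] by simp
  from has_derivative_compose[OF line this]
  have "((%t. f (x + t *\<^sub>R v) om) has_derivative (%h. D x om (h *\<^sub>R v))) (at 0)" .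
  then have "((%t. f (x + t *\<^sub>R v) om) has_real_derivative (D x om v)) (at 0)"
   by (simp add: has_field_derivative_def blinfun.scaleR_right mult.commute[of _ "D x om v"])
  then have "((%h. (f (x + h *\<^sub>R v) om - f x om) / h) \<longlongrightarrow> D x om v) (at 0)"
   by (simp add: DERIV_def)
  then have "((%h. (f (x + h *\<^sub>R v) om - f x om) / h) \<circ> (%n. inverse (real (Suc n)))) \<longlonglongrightarrow> D x om v"
   unfolding tendsto_at_iff_sequentially using LIMSEQ_inverse_real_of_nat by auto
  then show "(%n. (f (x + inverse (real (Suc n)) *\<^sub>R v) om - f x om) / inverse (real (Suc n))) \<longlonglongrightarrow> D x om v"
   by (simp only: o_def)
 qed
 show iD: "integrable M (%om. D x om v)" for v
  by (rule integrable_const_bound[where B="c * norm v"]) (use meas bd in auto)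
 show "((%x. \<integral>om. f x om \<partial>M) has_derivative (%v. \<integral>om. D x om v \<partial>M)) (at x)"
  unfolding has_derivative_at
 proof
  show "bounded_linear (%v. \<integral>om. D x om v \<partial>M)"
  proof (rule bounded_linear_intro[where K=c])
   fix v w r
   show "(\<integral>om. D x om (v + w) \<partial>M) = (\<integral>om. D x om v \<partial>M) + (\<integral>om. D x om w \<partial>M)"
    by (simp add: blinfun.add_right iD)
   show "(\<integral>om. D x om (r *\<^sub>R v) \<partial>M) = r *\<^sub>R (\<integral>om. D x om v \<partial>M)"
    by (simp add: blinfun.scaleR_right)
   have "norm (\<integral>om. D x om v \<partial>M) \<le> (\<integral>om. norm (D x om v) \<partial>M)" by (rule integral_norm_bound)
   also have "\<dots> \<le> (\<integral>om. c * norm v \<partial>M)" using bd iD by (intro integral_mono) auto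
   finally show "norm (\<integral>om. D x om v \<partial>M) \<le> norm v * c" by (simp add: prob_space mult.commute)
  qed
  show "(%h. norm ((\<integral>om. f (x + h) om \<partial>M) - (\<integral>om. f x om \<partial>M) - (\<integral>om. D x om h \<partial>M)) / norm h) \<midarrow>0\<rightarrow> 0"
   unfolding tendsto_at_iff_sequentially
  proof (intro allI impI)
   fix h :: "nat => 'h" assume h0: "\<forall>n. h n \<in> UNIV - {0}" and h: "h \<longlonglongrightarrow> 0"
   let ?R = "%n om. (f (x + h n) om - f x om - D x om (h n)) / norm (h n)"
   have mR: "?R n \<in> borel_measurable M" for n
    using int meas by (intro borel_measurable_divide borel_measurable_diff borel_measurable_const) auto
   have bR: "\<bar>?R n om\<bar> \<le> 2 * c" for n om
   proof -
    have "\<bar>f (x + h n) om - f x om\<bar> \<le> c * norm (h n)"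
     using lipschitz_from_derivative[of "%x. f x om" "%x. D x om" c "x + h n" x, OF der c] by simp
    then have "\<bar>f (x + h n) om - f x om - D x om (h n)\<bar> \<le> 2 * c * norm (h n)"
     using bd[of x om "h n"] by linarith
    then show ?thesis using h0 by (simp add: divide_le_eq)
   qed
   have "(%n. \<integral>om. ?R n om \<partial>M) \<longlonglongrightarrow> (\<integral>om. 0 \<partial>M)"
   proof (rule integral_dominated_convergence[where w="%_. 2 * c", OF _ mR])
    show "AE om in M. (%n. ?R n om) \<longlonglongrightarrow> 0"
    proof (rule AE_I2)
     fix om
     have "(%h. norm (f (x + h) om - f x om - D x om h) / norm h) \<midarrow>0\<rightarrow> 0"
      using der[of om x] unfolding has_derivative_at by blast
     then have "((%h. norm (f (x + h) om - f x om - D x om h) / norm h) \<circ> h) \<longlonglongrightarrow> 0"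
      unfolding tendsto_at_iff_sequentially using h0 h by blast
     then have "(%n. \<bar>?R n om\<bar>) \<longlonglongrightarrow> 0" by (simp add: o_def)
     then show "(%n. ?R n om) \<longlonglongrightarrow> 0" by (rule tendsto_rabs_zero_cancel)
    qed
   qed (use bR in auto)
   moreover have "(\<integral>om. ?R n om \<partial>M) = ((\<integral>om. f (x + h n) om \<partial>M) - (\<integral>om. f x om \<partial>M) - (\<integral>om. D x om (h n) \<partial>M)) / norm (h n)" for n
    using int iD by simp
   ultimately have "(%n. ((\<integral>om. f (x + h n) om \<partial>M) - (\<integral>om. f x om \<partial>M) - (\<integral>om. D x om (h n) \<partial>M)) / norm (h n)) \<longlonglongrightarrow> 0"
    by (simp only: Bochner_Integration.integral_zero)
   then have "(%n. \<bar>((\<integral>om. f (x + h n) om \<partial>M) - (\<integral>om. f x om \<partial>M) - (\<integral>om. D x om (h n) \<partial>M)) / norm (h n)\<bar>) \<longlonglongrightarrow> 0"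
    by (rule tendsto_rabs_zero)
   then show "((%h. norm ((\<integral>om. f (x + h) om \<partial>M) - (\<integral>om. f x om \<partial>M) - (\<integral>om. D x om h \<partial>M)) / norm h) \<circ> h) \<longlonglongrightarrow> 0"
    by (simp add: o_def)
  qed
 qed
qed

context C2_flow
begin

text \<open>The existential form allows the locale to be interpreted afresh for each sample path and
  the derivatives to be extracted from it.\<close>

lemma flow_C2:
 "\<exists>\<eta> \<zeta>. (\<forall>t\<in>{0..T}. \<forall>x. ((%x. Z x t) has_derivative blinfun_apply (\<eta> t x)) (at x)
   \<and> ((%x. \<eta> t x) has_derivative blinfun_apply (\<zeta> t x)) (at x) \<and> norm (\<eta> t x) \<le> exp (L * T)
   \<and> norm (\<zeta> t x) \<le> K * exp (L * T) * exp (L * T) * T * exp (L * T))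
  \<and> continuous_on ({0..T} \<times> UNIV) (%(t, x). Z x t)
  \<and> continuous_on ({0..T} \<times> UNIV) (%(t, x). \<eta> t x)
  \<and> continuous_on ({0..T} \<times> UNIV) (%(t, x). \<zeta> t x)"
 by (intro exI[of _ "%t x. eta x t"] exI[of _ "%t x. zeta x t"] conjI ballI allI Z_has_derivative eta_has_derivative
   neta[unfolded EL_def] nzeta[unfolded Leta_def EL_def] Z_joint eta_joint zeta_joint)

end

locale sde_test = sde P T \<F> W V Bs B G DG D2G L K
 for P :: "'w measure" and T \<F> and W :: "real => 'u::{real_inner, banach, second_countable_topology} => 'w => real"
  and V :: "'h::{real_inner, banach, second_countable_topology} set" and Bs and B :: "'u => 'h"
  and G :: "'h => 'h" and DG D2G L K +
 fixes \<Phi> :: "'h => real" and D\<Phi> :: "'h => 'h \<Rightarrow>\<^sub>L real" and D2\<Phi> :: "'h => 'h \<Rightarrow>\<^sub>L 'h \<Rightarrow>\<^sub>L real" and N1 N2 :: real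
 assumes d\<Phi>: "(\<Phi> has_derivative blinfun_apply (D\<Phi> x)) (at x)"
  and dD\<Phi>: "(D\<Phi> has_derivative blinfun_apply (D2\<Phi> x)) (at x)"
  and cD2\<Phi>: "continuous_on UNIV D2\<Phi>"
  and nD\<Phi>: "norm (D\<Phi> x) \<le> N1" and nD2\<Phi>: "norm (D2\<Phi> x) \<le> N2"
begin

lemma N1: "0 \<le> N1" using nD\<Phi>[of 0] norm_ge_zero order_trans by blast
lemma N2: "0 \<le> N2" using nD2\<Phi>[of 0] norm_ge_zero order_trans by blast

lemma lip\<Phi>: "\<bar>\<Phi> x - \<Phi> y\<bar> \<le> N1 * norm (x - y)"
 using lipschitz_from_derivative[OF d\<Phi> nD\<Phi>, of x y] by simp

lemma cD\<Phi>: "continuous_on UNIV D\<Phi>"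
 by (rule has_derivative_continuous_on[OF has_derivative_at_withinI[OF dD\<Phi>]])

lemma c\<Phi>: "continuous_on UNIV \<Phi>"
 by (rule has_derivative_continuous_on[OF has_derivative_at_withinI[OF d\<Phi>]])

text \<open>Chain rule bounds: \<open>cz\<close> is the bound of the second variation, and
  \<open>c2\<close> adds the two terms of the second derivative of a composition.\<close>

definition "c1 = N1 * ET"
definition "cz = K * ET * ET * T * ET"
definition "c2 = ET * (N2 * ET) + N1 * cz"

definition "good_derivs om D1 D2 \<longleftrightarrow>
 (\<forall>t\<in>{0..T}. \<forall>x. ((%x. \<Phi> (Z 0 om x t)) has_derivative blinfun_apply (D1 t x)) (at x)
   \<and> ((%x. D1 t x) has_derivative blinfun_apply (D2 t x)) (at x) \<and> norm (D1 t x) \<le> c1 \<and> norm (D2 t x) \<le> c2)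
  \<and> continuous_on ({0..T} \<times> UNIV) (%(t, x). D1 t x)
  \<and> continuous_on ({0..T} \<times> UNIV) (%(t, x). D2 t x)"
 for D1 :: "real => 'h => 'h \<Rightarrow>\<^sub>L real" and D2 :: "real => 'h => 'h \<Rightarrow>\<^sub>L 'h \<Rightarrow>\<^sub>L real"

lemma good_derivs_exist: "\<exists>D1 D2. good_derivs om D1 D2"
proof -
 interpret fl: C2_flow G DG D2G L K T "wp 0 om" "%x. Z 0 om x"
  by unfold_locales (rule T0, rule Z_solves)
 obtain \<eta> \<zeta> where h: "!!t x. t \<in> {0..T} ==> ((%x. Z 0 om x t) has_derivative blinfun_apply (\<eta> t x)) (at x)"
   "!!t x. t \<in> {0..T} ==> ((%x. \<eta> t x) has_derivative blinfun_apply (\<zeta> t x)) (at x)"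
   "!!t x. t \<in> {0..T} ==> norm (\<eta> t x) \<le> ET" "!!t x. t \<in> {0..T} ==> norm (\<zeta> t x) \<le> cz"
  and c: "continuous_on ({0..T} \<times> UNIV) (%(t, x). Z 0 om x t)"
   "continuous_on ({0..T} \<times> UNIV) (%(t, x). \<eta> t x)"
   "continuous_on ({0..T} \<times> UNIV) (%(t, x). \<zeta> t x)"
  using fl.flow_C2 unfolding ET_def[symmetric] cz_def[symmetric] by blast
 let ?D1 = "%t x. D\<Phi> (Z 0 om x t) o\<^sub>L \<eta> t x"
 let ?D2 = "%t x. (compose_right (\<eta> t x) o\<^sub>L (D2\<Phi> (Z 0 om x t) o\<^sub>L \<eta> t x)) + (compose_left (D\<Phi> (Z 0 om x t)) o\<^sub>L \<zeta> t x)"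
 have "good_derivs om ?D1 ?D2" unfolding good_derivs_def
 proof (intro conjI ballI allI)
  fix t x assume t: "t \<in> {0..T}"
  show "((%x. \<Phi> (Z 0 om x t)) has_derivative blinfun_apply (?D1 t x)) (at x)"
   using has_derivative_compose[OF h(1)[OF t, of x] d\<Phi>] by (simp add: blinfun_compose.rep_eq o_def)
  have a: "((%x. D\<Phi> (Z 0 om x t)) has_derivative (%v. D2\<Phi> (Z 0 om x t) (\<eta> t x v))) (at x)"
   by (rule has_derivative_compose[OF h(1)[OF t, of x] dD\<Phi>])
  have "(?D1 t has_derivative (%v. (D\<Phi> (Z 0 om x t) o\<^sub>L \<zeta> t x v) + (D2\<Phi> (Z 0 om x t) (\<eta> t x v) o\<^sub>L \<eta> t x))) (at x)"
   by (rule bounded_bilinear.FDERIV[OF bounded_bilinear_blinfun_compose a h(2)[OF t]])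
  moreover have "blinfun_apply (?D2 t x) = (%v. (D\<Phi> (Z 0 om x t) o\<^sub>L \<zeta> t x v) + (D2\<Phi> (Z 0 om x t) (\<eta> t x v) o\<^sub>L \<eta> t x))"
   by (auto simp: blinfun.add_left add.commute)
  ultimately show "(?D1 t has_derivative blinfun_apply (?D2 t x)) (at x)" by simp
  show "norm (?D1 t x) \<le> c1" unfolding c1_def
   by (rule order_trans[OF norm_blinfun_compose mult_mono[OF nD\<Phi> h(3)[OF t]]]) (use N1 in auto)
  have "norm (?D2 t x) \<le> norm (compose_right (\<eta> t x) o\<^sub>L (D2\<Phi> (Z 0 om x t) o\<^sub>L \<eta> t x)) + norm (compose_left (D\<Phi> (Z 0 om x t)) o\<^sub>L \<zeta> t x)"
   by (rule norm_triangle_ineq)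
  also have "\<dots> \<le> c2" unfolding c2_def
   by (intro add_mono order_trans[OF norm_blinfun_compose] mult_mono order_trans[OF norm_compose_right] order_trans[OF norm_compose_left]
     h(3)[OF t] h(4)[OF t] nD\<Phi> nD2\<Phi> norm_ge_zero N1 N2 less_imp_le[OF ET(2)])
  finally show "norm (?D2 t x) \<le> c2" .
 next
  let ?S = "{0..T} \<times> (UNIV :: 'h set)"
  have cc: "continuous_on ?S (%p. Z 0 om (snd p) (fst p))" "continuous_on ?S (%p. \<eta> (fst p) (snd p))" "continuous_on ?S (%p. \<zeta> (fst p) (snd p))"
   using c by (simp_all add: split_def)
  have cD: "continuous_on ?S (%p. D\<Phi> (Z 0 om (snd p) (fst p)))" by (rule continuous_on_compose2[OF cD\<Phi> cc(1) subset_UNIV])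
  have cD2: "continuous_on ?S (%p. D2\<Phi> (Z 0 om (snd p) (fst p)))" by (rule continuous_on_compose2[OF cD2\<Phi> cc(1) subset_UNIV])
  note bil = bounded_bilinear.continuous_on[OF bounded_bilinear_blinfun_compose]
  show "continuous_on ?S (%(t, x). ?D1 t x)"
   unfolding split_def by (rule bil[OF cD cc(2)])
  show "continuous_on ?S (%(t, x). ?D2 t x)"
   unfolding split_def
   by (rule continuous_on_add[OF bil[OF continuous_on_compose_right[OF cc(2)] bil[OF cD2 cc(2)]] bil[OF continuous_on_compose_left[OF cD] cc(3)]])
 qed
 then show ?thesis by blast
qed

text \<open>Chosen path by path, hence without any measurability in \<open>om\<close>; integrability
  of their values is recovered from \<open>derivative_under_integral\<close>.\<close>

definition "PD1 om = (SOME D1. \<exists>D2. good_derivs om D1 D2)"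
definition "PD2 om = (SOME D2. good_derivs om (PD1 om) D2)"

lemma PD: "good_derivs om (PD1 om) (PD2 om)"
proof -
 have "\<exists>D2. good_derivs om (PD1 om) D2" unfolding PD1_def by (rule someI_ex[OF good_derivs_exist])
 then show ?thesis unfolding PD2_def by (rule someI_ex)
qed

lemma PD1_derivative: "t \<in> {0..T} ==> ((%x. \<Phi> (Z 0 om x t)) has_derivative blinfun_apply (PD1 om t x)) (at x)"
 and PD2_derivative: "t \<in> {0..T} ==> ((%x. PD1 om t x) has_derivative blinfun_apply (PD2 om t x)) (at x)"
 and PD1_bound: "t \<in> {0..T} ==> norm (PD1 om t x) \<le> c1"
 and PD2_bound: "t \<in> {0..T} ==> norm (PD2 om t x) \<le> c2"
 and PD1_continuous: "continuous_on ({0..T} \<times> UNIV) (%(t, x). PD1 om t x)"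
 and PD2_continuous: "continuous_on ({0..T} \<times> UNIV) (%(t, x). PD2 om t x)"
 using PD unfolding good_derivs_def by blast+

lemma c1: "0 \<le> c1" using N1 ET by (simp add: c1_def)
lemma c2: "0 \<le> c2" using N1 N2 ET K0 T0 by (simp add: c2_def cz_def)

text \<open>First and second derivative of \<open>semi \<Phi> t\<close> at \<open>x\<close>. In
  \<open>H t x v y\<close> the direction \<open>v\<close> is the one in which \<open>g t x y\<close>
  is differentiated.\<close>

definition "g t x v = (\<integral>om. PD1 om t x v \<partial>P)"
definition "H t x v y = (\<integral>om. PD2 om t x v y \<partial>P)"

lemma \<Phi>Z_integrable: "t \<in> {0..T} ==> integrable P (%om. \<Phi> (Z 0 om x t))"
 by (rule lipschitz_Z_integrable[OF lip\<Phi>, where X="%_. x"]) auto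

lemma PD1_integrable: "t \<in> {0..T} ==> integrable P (%om. PD1 om t x v)"
 and semi_has_derivative: "t \<in> {0..T} ==> (semi \<Phi> t has_derivative g t x) (at x)"
 using derivative_under_integral[of "%x om. \<Phi> (Z 0 om x t)" "%x om. PD1 om t x" c1, OF PD1_derivative PD1_bound \<Phi>Z_integrable]
 by (simp_all add: g_def[abs_def] semi_def[abs_def])

lemma PD2_integrable: "t \<in> {0..T} ==> integrable P (%om. PD2 om t x v y)" (is "?t ==> ?A")
 and g_has_derivative: "t \<in> {0..T} ==> ((%x. g t x y) has_derivative (%v. H t x v y)) (at x)" (is "?t ==> ?B")
proof -
 assume t: "t \<in> {0..T}"
 \<comment> \<open>Evaluation at \<open>y\<close> as an operator on the dual space: composed with
   \<open>PD2\<close> it gives the derivative of the scalar function \<open>PD1 om t x y\<close> in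
   the form required for differentiation under the integral.\<close>
 define e where "e = (Blinfun (%A :: 'h \<Rightarrow>\<^sub>L real. blinfun_apply A y))"
 have e: "blinfun_apply e A = blinfun_apply A y" for A
  unfolding e_def by (simp add: bounded_linear_Blinfun_apply blinfun.bounded_linear_left)
 have ne: "norm e \<le> norm y"
 proof (rule norm_blinfun_bound)
  show "norm (blinfun_apply e A) \<le> norm y * norm A" for A
   using norm_blinfun[of A y] by (simp add: e mult.commute)
 qed simp
 have der: "((%x. PD1 om t x y) has_derivative blinfun_apply (e o\<^sub>L PD2 om t x)) (at x)" for x om
  using bounded_linear.has_derivative[OF blinfun.bounded_linear_left[of y] PD2_derivative[OF t, of om x]]
  by (simp add: e blinfun_compose.rep_eq o_def)
 have bd: "norm (e o\<^sub>L PD2 om t x) \<le> norm y * c2" for x om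
  by (rule order_trans[OF norm_blinfun_compose mult_mono[OF ne PD2_bound[OF t]]]) auto
 from derivative_under_integral[of "%x om. PD1 om t x y" "%x om. e o\<^sub>L PD2 om t x", OF der bd PD1_integrable[OF t]]
 show ?A ?B by (simp_all add: e g_def[abs_def] H_def[abs_def])
qed

lemma g_bound: assumes t: "t \<in> {0..T}" shows "\<bar>g t x v\<bar> \<le> c1 * norm v"
proof -
 have "norm (g t x v) \<le> (\<integral>om. norm (PD1 om t x v) \<partial>P)" unfolding g_def by (rule integral_norm_bound)
 also have "\<dots> \<le> (\<integral>om. c1 * norm v \<partial>P)"
  using PD1_integrable[OF t] by (intro integral_mono integrable_norm) (auto intro: order_trans[OF norm_blinfun mult_right_mono[OF PD1_bound[OF t] norm_ge_zero], unfolded real_norm_def])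
 finally show ?thesis by (simp add: prob_space)
qed

lemma PD2_apply_bound: assumes t: "t \<in> {0..T}" shows "\<bar>PD2 om t x v y\<bar> \<le> c2 * norm v * norm y"
proof -
 have "norm (PD2 om t x v y) \<le> norm (PD2 om t x v) * norm y" by (rule norm_blinfun)
 also have "\<dots> \<le> (c2 * norm v) * norm y"
  by (intro mult_right_mono order_trans[OF norm_blinfun mult_right_mono[OF PD2_bound[OF t] norm_ge_zero]] norm_ge_zero)
 finally show ?thesis by simp
qed

lemma H_bound: assumes t: "t \<in> {0..T}" shows "\<bar>H t x v y\<bar> \<le> c2 * norm v * norm y"
proof -
 have "norm (H t x v y) \<le> (\<integral>om. norm (PD2 om t x v y) \<partial>P)" unfolding H_def by (rule integral_norm_bound)
 also have "\<dots> \<le> (\<integral>om. c2 * norm v * norm y \<partial>P)"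
  using PD2_integrable[OF t] PD2_apply_bound[OF t] by (intro integral_mono integrable_norm) auto
 finally show ?thesis by (simp add: prob_space)
qed

lemma g_linear: "t \<in> {0..T} ==> bounded_linear (g t x)"
 using semi_has_derivative has_derivative_bounded_linear by blast

lemma H_linear_left: "t \<in> {0..T} ==> bounded_linear (%v. H t x v y)"
 using g_has_derivative has_derivative_bounded_linear by blast

lemma H_linear_right: assumes t: "t \<in> {0..T}" shows "bounded_linear (H t x v)"
proof (rule bounded_linear_intro[where K="c2 * norm v"])
 fix y y' r
 show "H t x v (y + y') = H t x v y + H t x v y'" unfolding H_def by (simp add: blinfun.add_right PD2_integrable[OF t])
 show "H t x v (r *\<^sub>R y) = r *\<^sub>R H t x v y" unfolding H_def by (simp add: blinfun.scaleR_right)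
 show "norm (H t x v y) \<le> norm y * (c2 * norm v)" using H_bound[OF t, of x v y] by (simp add: mult_ac)
qed

lemma joint_tendsto:
 assumes c: "continuous_on ({0..T} \<times> (UNIV :: 'h set)) (%(t, x). f t x)"
  and t: "!!n. t n \<in> {0..T}" "t \<longlonglongrightarrow> t0" and x: "x \<longlonglongrightarrow> x0"
 shows "(%n. f (t n) (x n)) \<longlonglongrightarrow> f t0 x0"
proof -
 have t0: "t0 \<in> {0..T}" using closed_sequentially[OF closed_atLeastAtMost t] .
 have "(%n. (t n, x n)) \<longlonglongrightarrow> (t0, x0)" by (intro tendsto_Pair t x)
 then have lim: "(\<forall>n. (t n, x n) \<in> {0..T} \<times> UNIV) \<and> (%n. (t n, x n)) \<longlonglongrightarrow> (t0, x0)"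
  using t(1) by simp
 have mem: "(t0, x0) \<in> {0..T} \<times> UNIV" using t0 by simp
 have "((%(t, x). f t x) \<circ> (%n. (t n, x n))) \<longlonglongrightarrow> (%(t, x). f t x) (t0, x0)"
  by (rule c[unfolded continuous_on_sequentially, THEN spec, THEN bspec, THEN mp, OF mem lim])
 then show ?thesis by (simp add: o_def)
qed

lemma g_tendsto:
 assumes t: "!!n. t n \<in> {0..T}" "t \<longlonglongrightarrow> t0" and x: "x \<longlonglongrightarrow> x0"
 shows "(%n. g (t n) (x n) v) \<longlonglongrightarrow> g t0 x0 v"
 unfolding g_def
proof (rule integral_dominated_convergence[where w="%_. c1 * norm v"])
 have t0: "t0 \<in> {0..T}" using closed_sequentially[OF closed_atLeastAtMost t] .
 show "(%om. PD1 om t0 x0 v) \<in> borel_measurable P" "(%om. PD1 om (t n) (x n) v) \<in> borel_measurable P" for n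
  using PD1_integrable[OF t0] PD1_integrable[OF t(1)] by auto
 have "(%n. PD1 om (t n) (x n)) \<longlonglongrightarrow> PD1 om t0 x0" for om by (rule joint_tendsto[OF PD1_continuous t x])
 then show "AE om in P. (%n. PD1 om (t n) (x n) v) \<longlonglongrightarrow> PD1 om t0 x0 v"
  by (intro AE_I2 bounded_linear.tendsto[OF blinfun.bounded_linear_left])
 show "AE om in P. norm (PD1 om (t n) (x n) v) \<le> c1 * norm v" for n
  by (intro AE_I2 order_trans[OF norm_blinfun mult_right_mono[OF PD1_bound[OF t(1)] norm_ge_zero]])
qed simp

text \<open>Continuity direction by direction, where dominated convergence works with real-valued
  functions. The limits in \<open>local_expansion\<close> involve \<open>H\<close> on finitely many
  pairs of basis directions.\<close>

lemma H_tendsto: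
 assumes t: "!!n. t n \<in> {0..T}" "t \<longlonglongrightarrow> t0" and x: "x \<longlonglongrightarrow> x0"
 shows "(%n. H (t n) (x n) v y) \<longlonglongrightarrow> H t0 x0 v y"
 unfolding H_def
proof (rule integral_dominated_convergence[where w="%_. c2 * norm v * norm y"])
 have t0: "t0 \<in> {0..T}" using closed_sequentially[OF closed_atLeastAtMost t] .
 show "(%om. PD2 om t0 x0 v y) \<in> borel_measurable P" "(%om. PD2 om (t n) (x n) v y) \<in> borel_measurable P" for n
  using PD2_integrable[OF t0] PD2_integrable[OF t(1)] by auto
 have "(%n. PD2 om (t n) (x n)) \<longlonglongrightarrow> PD2 om t0 x0" for om by (rule joint_tendsto[OF PD2_continuous t x])
 then show "AE om in P. (%n. PD2 om (t n) (x n) v y) \<longlonglongrightarrow> PD2 om t0 x0 v y"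
  by (intro AE_I2 bounded_linear.tendsto[OF blinfun.bounded_linear_left])
 show "AE om in P. norm (PD2 om (t n) (x n) v y) \<le> c2 * norm v * norm y" for n
  using PD2_apply_bound[OF t(1)] by auto
qed simp

end

subsection \<open>Local expansion of expectations\<close>

context prob_space
begin

lemma square_integrable_integrable:
 fixes X :: "'a => real"
 assumes "X \<in> borel_measurable M" "integrable M (%om. (X om)^2)"
 shows "integrable M X"
proof (rule Bochner_Integration.integrable_bound[of M "%om. 1 + (X om)^2"])
 show "AE om in M. norm (X om) \<le> norm (1 + (X om)^2)"
  using le_one_add_square[of "\<bar>X om\<bar>" for om] by simp
qed (use assms in auto)

text \<open>A Vitali argument: below the level \<open>k\<close> dominated convergence applies, and
  above it the deviation is at most its square divided by \<open>k\<close>, which the second moment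
  bound controls.\<close>

lemma expectation_tendsto_L2_bounded:
 fixes X :: "nat => 'a => real"
 assumes m: "!!n. X n \<in> borel_measurable M" "Y \<in> borel_measurable M"
  and i: "!!n. integrable M (%om. (X n om)^2)" "integrable M (%om. (Y om)^2)"
  and C: "!!n. (\<integral>om. (X n om)^2 \<partial>M) \<le> C" and lim: "AE om in M. (%n. X n om) \<longlonglongrightarrow> Y om"
 shows "(%n. \<integral>om. X n om \<partial>M) \<longlonglongrightarrow> (\<integral>om. Y om \<partial>M)"
proof (rule LIMSEQ_I)
 fix e :: real assume e: "0 < e"
 define D where "D n om = X n om - Y om" for n om
 define C' where "C' = 2 * C + 2 * (\<integral>om. (Y om)^2 \<partial>M)"
 have mD: "D n \<in> borel_measurable M" for n unfolding D_def using m by simp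
 have sq: "(a - b)^2 \<le> 2 * a^2 + 2 * b^2" for a b :: real
  using zero_le_power2[of "a + b"] by (simp add: power2_eq_square algebra_simps)
 have iD: "integrable M (%om. (D n om)^2)" for n
 proof (rule Bochner_Integration.integrable_bound[of M "%om. 2 * (X n om)^2 + 2 * (Y om)^2"])
  show "AE om in M. norm ((D n om)^2) \<le> norm (2 * (X n om)^2 + 2 * (Y om)^2)"
   unfolding D_def using sq by simp
 qed (use i mD in auto)
 have CD: "(\<integral>om. (D n om)^2 \<partial>M) \<le> C'" for n
 proof -
  have "(\<integral>om. (D n om)^2 \<partial>M) \<le> (\<integral>om. 2 * (X n om)^2 + 2 * (Y om)^2 \<partial>M)"
   by (rule integral_mono[OF iD]) (use i sq in \<open>auto simp: D_def\<close>)
  also have "\<dots> = 2 * (\<integral>om. (X n om)^2 \<partial>M) + 2 * (\<integral>om. (Y om)^2 \<partial>M)" using i by simp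
  also have "\<dots> \<le> C'" using C[of n] by (simp add: C'_def)
  finally show ?thesis .
 qed
 have "0 \<le> (\<integral>om. (D 0 om)^2 \<partial>M)" by (rule Bochner_Integration.integral_nonneg) simp
 then have C'0: "0 \<le> C'" using CD[of 0] by linarith
 \<comment> \<open>Makes the tail \<open>C' / k\<close> smaller than \<open>e / 2\<close>.\<close>
 define k where "k = 2 * (C' + 1) / e"
 have k: "0 < k" using e C'0 by (simp add: k_def)
 have "(%n. \<integral>om. min \<bar>D n om\<bar> k \<partial>M) \<longlonglongrightarrow> (\<integral>om. 0 \<partial>M)"
 proof (rule integral_dominated_convergence[where w="%_. k"])
  show "AE om in M. (%n. min \<bar>D n om\<bar> k) \<longlonglongrightarrow> 0"
   using lim
  proof eventually_elim
   fix om assume "(%n. X n om) \<longlonglongrightarrow> Y om"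
   then have "(%n. D n om) \<longlonglongrightarrow> 0" unfolding D_def by (simp add: LIM_zero)
   then have "(%n. min \<bar>D n om\<bar> k) \<longlonglongrightarrow> min \<bar>0\<bar> k" by (intro tendsto_intros)
   then show "(%n. min \<bar>D n om\<bar> k) \<longlonglongrightarrow> 0" using k by simp
  qed
 qed (use mD k in auto)
 then have "(%n. \<integral>om. min \<bar>D n om\<bar> k \<partial>M) \<longlonglongrightarrow> 0" by simp
 then obtain N where N: "!!n. n \<ge> N ==> \<bar>\<integral>om. min \<bar>D n om\<bar> k \<partial>M\<bar> < e / 2"
  using LIMSEQ_D[of _ 0 "e / 2"] e by (metis diff_zero half_gt_zero real_norm_def)
 have "norm ((\<integral>om. X n om \<partial>M) - (\<integral>om. Y om \<partial>M)) < e" if n: "n \<ge> N" for n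
 proof -
  have iX: "integrable M (X n)" "integrable M Y" "integrable M (D n)"
   using square_integrable_integrable m i mD iD by blast+
  have imin: "integrable M (%om. min \<bar>D n om\<bar> k)"
   by (rule integrable_const_bound[where B=k]) (use k mD in auto)
  have le: "\<bar>D n om\<bar> \<le> min \<bar>D n om\<bar> k + (D n om)^2 / k" for om
  proof (cases "\<bar>D n om\<bar> \<le> k")
   case False
   then have "k * \<bar>D n om\<bar> \<le> \<bar>D n om\<bar> * \<bar>D n om\<bar>" by (intro mult_right_mono) auto
   then have "\<bar>D n om\<bar> \<le> (D n om)^2 / k" using k by (simp add: field_simps power2_eq_square)
   then show ?thesis using k by simp
  qed (use k in simp)
  have "norm ((\<integral>om. X n om \<partial>M) - (\<integral>om. Y om \<partial>M)) = norm (\<integral>om. D n om \<partial>M)"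
   unfolding D_def using iX by simp
  also have "\<dots> \<le> (\<integral>om. \<bar>D n om\<bar> \<partial>M)" using integral_norm_bound[of M "D n"] by simp
  also have "\<dots> \<le> (\<integral>om. min \<bar>D n om\<bar> k + (D n om)^2 / k \<partial>M)"
   by (rule integral_mono) (use iX imin iD le in auto)
  also have "\<dots> = (\<integral>om. min \<bar>D n om\<bar> k \<partial>M) + (\<integral>om. (D n om)^2 \<partial>M) / k" using imin iD by simp
  also have "(\<integral>om. (D n om)^2 \<partial>M) / k \<le> C' / k" using CD k by (intro divide_right_mono) auto
  also have "C' / k < e / 2" using e C'0 by (simp add: k_def field_simps)
  also have "(\<integral>om. min \<bar>D n om\<bar> k \<partial>M) < e / 2" using N[OF n] by linarith
  finally show ?thesis by simp
 qed
 then show "\<exists>N. \<forall>n\<ge>N. norm ((\<integral>om. X n om \<partial>M) - (\<integral>om. Y om \<partial>M)) < e" by blast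
qed

text \<open>Cauchy-Schwarz in the form of Young's inequality with weight \<open>k\<close>; the
  second moment of \<open>f n\<close> tends to 0 by bounded convergence while that of
  \<open>g n\<close> stays bounded.\<close>

lemma expectation_product_tendsto_0:
 fixes f g :: "nat => 'a => real"
 assumes m: "!!n. f n \<in> borel_measurable M" "!!n. g n \<in> borel_measurable M"
  and c: "!!n om. \<bar>f n om\<bar> \<le> c" and lim: "AE om in M. (%n. f n om) \<longlonglongrightarrow> 0"
  and i: "!!n. integrable M (%om. (g n om)^2)" and C: "!!n. (\<integral>om. (g n om)^2 \<partial>M) \<le> C"
 shows "(%n. \<integral>om. f n om * g n om \<partial>M) \<longlonglongrightarrow> 0"
proof (rule LIMSEQ_I)
 fix e :: real assume e: "0 < e"
 have "0 \<le> (\<integral>om. (g 0 om)^2 \<partial>M)" by (rule Bochner_Integration.integral_nonneg) simp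
 then have C0: "0 \<le> C" using C[of 0] by linarith
 \<comment> \<open>With this weight each of the two terms in Young's inequality contributes at most
   \<open>e / 2\<close>.\<close>
 define k where "k = (C + 1) / e"
 have k: "0 < k" using e C0 by (simp add: k_def)
 have sqc: "(f n om)^2 \<le> c^2" for n om using power_mono[OF c, of n om 2] by simp
 have iF: "integrable M (%om. (f n om)^2)" for n
  by (rule integrable_const_bound[where B="c^2"]) (use sqc m in auto)
 have "(%n. \<integral>om. (f n om)^2 \<partial>M) \<longlonglongrightarrow> (\<integral>om. 0 \<partial>M)"
 proof (rule integral_dominated_convergence[where w="%_. c^2"])
  show "AE om in M. (%n. (f n om)^2) \<longlonglongrightarrow> 0"
   using lim by eventually_elim (auto intro: tendsto_eq_intros)
 qed (use m sqc in auto)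
 then have "(%n. \<integral>om. (f n om)^2 \<partial>M) \<longlonglongrightarrow> 0" by simp
 then obtain N where N: "!!n. n \<ge> N ==> \<bar>\<integral>om. (f n om)^2 \<partial>M\<bar> < e / k"
  using LIMSEQ_D[of _ 0 "e / k"] e k by (metis diff_zero divide_pos_pos real_norm_def)
 have "norm ((\<integral>om. f n om * g n om \<partial>M) - 0) < e" if n: "n \<ge> N" for n
 proof -
  have le: "\<bar>f n om * g n om\<bar> \<le> (k / 2) * (f n om)^2 + (1 / (2 * k)) * (g n om)^2" for om
  proof -
   have "0 \<le> (k * \<bar>f n om\<bar> - \<bar>g n om\<bar>)^2 / (2 * k)" using k by simp
   also have "\<dots> = (k / 2) * (f n om)^2 + (1 / (2 * k)) * (g n om)^2 - \<bar>f n om\<bar> * \<bar>g n om\<bar>"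
    using k by (simp add: power2_diff power_mult_distrib power2_eq_square field_simps abs_mult_self_eq)
   finally show ?thesis by (simp add: abs_mult)
  qed
  have "norm (\<integral>om. f n om * g n om \<partial>M) \<le> (\<integral>om. norm (f n om * g n om) \<partial>M)" by (rule integral_norm_bound)
  also have "\<dots> \<le> (\<integral>om. (k / 2) * (f n om)^2 + (1 / (2 * k)) * (g n om)^2 \<partial>M)"
   by (rule integral_mono') (use le iF i order_trans[OF abs_ge_zero le] in auto)
  also have "\<dots> = (k / 2) * (\<integral>om. (f n om)^2 \<partial>M) + (1 / (2 * k)) * (\<integral>om. (g n om)^2 \<partial>M)"
   using iF i by simp
  also have "\<dots> < (k / 2) * (e / k) + (1 / (2 * k)) * (C + 1)"
  proof (rule add_strict_mono)
   show "(k / 2) * (\<integral>om. (f n om)^2 \<partial>M) < (k / 2) * (e / k)"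
    using N[OF n] k by (intro mult_strict_left_mono) auto
   show "(1 / (2 * k)) * (\<integral>om. (g n om)^2 \<partial>M) < (1 / (2 * k)) * (C + 1)"
    using C[of n] k by (intro mult_strict_left_mono) auto
  qed
  also have "\<dots> = e"
  proof -
   have C1: "C + 1 = k * e" using e by (simp add: k_def)
   show ?thesis unfolding C1 using k by (simp add: field_simps)
  qed
  finally show ?thesis by simp
 qed
 then show "\<exists>N. \<forall>n\<ge>N. norm ((\<integral>om. f n om * g n om \<partial>M) - 0) < e" by blast
qed

end

context sde_test
begin

lemma g_tendsto_vec:
 assumes t: "!!n. t n \<in> {0..T}" "t \<longlonglongrightarrow> t0" and x: "x \<longlonglongrightarrow> x0" and v: "v \<longlonglongrightarrow> v0"
 shows "(%n. g (t n) (x n) (v n)) \<longlonglongrightarrow> g t0 x0 v0"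
proof -
 have "(%n. g (t n) (x n) (v n) - g (t n) (x n) v0) \<longlonglongrightarrow> 0"
 proof (rule Lim_null_comparison)
  show "\<forall>\<^sub>F n in sequentially. norm (g (t n) (x n) (v n) - g (t n) (x n) v0) \<le> c1 * norm (v n - v0)"
  proof (intro always_eventually allI)
   fix n
   interpret bounded_linear "g (t n) (x n)" by (rule g_linear[OF t(1)])
   show "norm (g (t n) (x n) (v n) - g (t n) (x n) v0) \<le> c1 * norm (v n - v0)"
    using g_bound[OF t(1), of n "x n" "v n - v0"] by (simp add: diff)
  qed
  show "(%n. c1 * norm (v n - v0)) \<longlonglongrightarrow> 0"
   using tendsto_mult_right_zero[OF tendsto_norm_zero[OF LIM_zero[OF v]]] by simp
 qed
 from tendsto_add[OF this g_tendsto[OF t x, of v0]] show ?thesis by simp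
qed

lemma H_tendsto_vec:
 assumes t: "!!n. t n \<in> {0..T}" "t \<longlonglongrightarrow> t0" and x: "x \<longlonglongrightarrow> x0" and v: "v \<longlonglongrightarrow> v0" and y: "y \<longlonglongrightarrow> y0"
 shows "(%n. H (t n) (x n) (v n) (y n)) \<longlonglongrightarrow> H t0 x0 v0 y0"
proof -
 have "(%n. H (t n) (x n) (v n) (y n) - H (t n) (x n) v0 y0) \<longlonglongrightarrow> 0"
 proof (rule Lim_null_comparison)
  show "\<forall>\<^sub>F n in sequentially. norm (H (t n) (x n) (v n) (y n) - H (t n) (x n) v0 y0) \<le> c2 * norm (v n - v0) * norm (y n) + c2 * norm v0 * norm (y n - y0)"
  proof (intro always_eventually allI)
   fix n
   have 1: "H (t n) (x n) (v n - v0) (y n) = H (t n) (x n) (v n) (y n) - H (t n) (x n) v0 (y n)"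
    by (rule linear_simps(2)[OF H_linear_left[OF t(1)]])
   have 2: "H (t n) (x n) v0 (y n - y0) = H (t n) (x n) v0 (y n) - H (t n) (x n) v0 y0"
    by (rule linear_simps(2)[OF H_linear_right[OF t(1)]])
   have "H (t n) (x n) (v n) (y n) - H (t n) (x n) v0 y0 = H (t n) (x n) (v n - v0) (y n) + H (t n) (x n) v0 (y n - y0)"
    unfolding 1 2 by simp
   then show "norm (H (t n) (x n) (v n) (y n) - H (t n) (x n) v0 y0) \<le> c2 * norm (v n - v0) * norm (y n) + c2 * norm v0 * norm (y n - y0)"
    using H_bound[OF t(1), of n "x n" "v n - v0" "y n"] H_bound[OF t(1), of n "x n" v0 "y n - y0"] by simp
  qed
  have "(%n. c2 * norm (v n - v0) * norm (y n) + c2 * norm v0 * norm (y n - y0)) \<longlonglongrightarrow> c2 * norm (v0 - v0) * norm y0 + c2 * norm v0 * norm (y0 - y0)"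
   by (intro tendsto_intros v y)
  then show "(%n. c2 * norm (v n - v0) * norm (y n) + c2 * norm v0 * norm (y n - y0)) \<longlonglongrightarrow> 0" by simp
 qed
 from tendsto_add[OF this H_tendsto[OF t x, of v0 y0]] show ?thesis by simp
qed

lemma g_measurable: assumes t: "t \<in> {0..T}" and x: "x \<in> borel_measurable N" and v: "v \<in> borel_measurable N"
 shows "(%om. g t (x om) (v om)) \<in> borel_measurable N"
proof -
 have "continuous_on UNIV (%p. g t (fst p) (snd p))"
  unfolding continuous_on_sequentially o_def
  by (auto intro!: g_tendsto_vec[where t="%_. t"] t tendsto_fst tendsto_snd)
   (metis fst_conv tendsto_fst, metis snd_conv tendsto_snd)
 then have "(%p. g t (fst p) (snd p)) \<in> borel_measurable (borel \<Otimes>\<^sub>M borel)"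
  using borel_measurable_continuous_onI by (simp add: borel_prod)
 from measurable_compose[OF _ this, of "%om. (x om, v om)" N] x v show ?thesis by simp
qed

lemma H_measurable: assumes t: "t \<in> {0..T}" and x: "x \<in> borel_measurable N"
 shows "(%om. H t (x om) v y) \<in> borel_measurable N"
proof -
 have "continuous_on UNIV (%x. H t x v y)"
  unfolding continuous_on_sequentially o_def by (auto intro!: H_tendsto[where t="%_. t"] t)
 from measurable_compose[OF x borel_measurable_continuous_onI[OF this]] show ?thesis .
qed

lemma semi_mvt: assumes t: "t \<in> {0..T}"
 shows "\<exists>\<theta>\<in>{0..1}. semi \<Phi> t (x + v) - semi \<Phi> t x = g t (x + \<theta> *\<^sub>R v) v"
proof -
 have d: "((%\<theta>. semi \<Phi> t (x + \<theta> *\<^sub>R v)) has_real_derivative g t (x + \<theta> *\<^sub>R v) v) (at \<theta>)" for \<theta>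
 proof -
  interpret bounded_linear "g t (x + \<theta> *\<^sub>R v)" by (rule g_linear[OF t])
  have "((%\<theta>. x + \<theta> *\<^sub>R v) has_derivative (%h. h *\<^sub>R v)) (at \<theta>)" by (auto intro!: derivative_eq_intros)
  from has_derivative_compose[OF this semi_has_derivative[OF t]] show ?thesis
   by (simp add: has_field_derivative_def scaleR mult.commute[of _ "g t (x + \<theta> *\<^sub>R v) v"])
 qed
 obtain \<theta> where "0 < \<theta>" "\<theta> < 1" "semi \<Phi> t (x + 1 *\<^sub>R v) - semi \<Phi> t (x + 0 *\<^sub>R v) = (1 - 0) * g t (x + \<theta> *\<^sub>R v) v"
  using MVT2[of 0 1 "%\<theta>. semi \<Phi> t (x + \<theta> *\<^sub>R v)" "%\<theta>. g t (x + \<theta> *\<^sub>R v) v"] d by auto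
 then show ?thesis by (intro bexI[of _ \<theta>]) auto
qed

lemma semi_taylor: assumes t: "t \<in> {0..T}"
 shows "\<exists>\<theta>\<in>{0..1}. semi \<Phi> t (x + v) = semi \<Phi> t x + g t x v + H t (x + \<theta> *\<^sub>R v) v v / 2"
proof -
 define D where "D m \<theta> = (if m = 0 then semi \<Phi> t (x + \<theta> *\<^sub>R v) else if m = 1 then g t (x + \<theta> *\<^sub>R v) v else H t (x + \<theta> *\<^sub>R v) v v)" for m :: nat and \<theta>
 have l: "((%\<theta>. x + \<theta> *\<^sub>R v) has_derivative (%h. h *\<^sub>R v)) (at \<theta>)" for \<theta> by (auto intro!: derivative_eq_intros)
 have d: "DERIV (D m) \<theta> :> D (Suc m) \<theta>" if "m < 2" for m \<theta>
 proof -
  have m: "m = 0 \<or> m = 1" using that by auto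
  have d0: "((%\<theta>. semi \<Phi> t (x + \<theta> *\<^sub>R v)) has_real_derivative g t (x + \<theta> *\<^sub>R v) v) (at \<theta>)"
  proof -
   interpret bounded_linear "g t (x + \<theta> *\<^sub>R v)" by (rule g_linear[OF t])
   from has_derivative_compose[OF l[of \<theta>] semi_has_derivative[OF t]] show ?thesis
    by (simp add: has_field_derivative_def scaleR mult.commute[of _ "g t (x + \<theta> *\<^sub>R v) v"])
  qed
  have d1: "((%\<theta>. g t (x + \<theta> *\<^sub>R v) v) has_real_derivative H t (x + \<theta> *\<^sub>R v) v v) (at \<theta>)"
  proof -
   interpret bounded_linear "%u. H t (x + \<theta> *\<^sub>R v) u v" by (rule H_linear_left[OF t])
   from has_derivative_compose[OF l[of \<theta>] g_has_derivative[OF t, where y=v]] show ?thesis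
    by (simp add: has_field_derivative_def scaleR mult.commute[of _ "H t (x + \<theta> *\<^sub>R v) v v"])
  qed
  show ?thesis using m d0 d1 by (auto simp: D_def[abs_def])
 qed
 have "\<exists>\<theta>. (if (1::real) < 0 then 1 < \<theta> \<and> \<theta> < 0 else 0 < \<theta> \<and> \<theta> < 1) \<and>
   D 0 1 = (\<Sum>m<2. D m 0 / fact m * (1 - 0) ^ m) + D 2 \<theta> / fact 2 * (1 - 0) ^ 2"
  by (rule Taylor[where a=0 and b=1 and f="D 0"]) (use d in auto)
 then obtain \<theta> where "0 < \<theta>" "\<theta> < 1" "D 0 1 = D 0 0 + D 1 0 + D 2 \<theta> / 2"
  by (auto simp: numeral_2_eq_2)
 then show ?thesis by (intro bexI[of _ \<theta>]) (auto simp: D_def)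
qed

lemma filtration_independent_product:
 fixes k :: "'w => real" and f :: "'h => real"
 assumes st: "0 \<le> s" "s \<le> t" "t \<le> T" and k: "k \<in> borel_measurable (\<F> s)" and c: "!!om. \<bar>k om\<bar> \<le> c"
  and f: "f \<in> borel_measurable borel" and i: "integrable P (%om. f (w t om - w s om))"
 shows "integrable P (%om. k om * f (w t om - w s om))"
  "(\<integral>om. k om * f (w t om - w s om) \<partial>P) = (\<integral>om. k om \<partial>P) * (\<integral>om. f (w t om - w s om) \<partial>P)"
proof -
 have s: "s \<in> {0..T}" using st by simp
 have ik: "integrable P k"
  by (rule integrable_const_bound[where B=c]) (use c measurable_filtration_P[OF s k] in auto)
 have ind: "indep_var borel k borel (%om. f (w t om - w s om))" by (rule w_inc_indep[OF st k f])
 show "integrable P (%om. k om * f (w t om - w s om))" by (rule indep_var_integrable[OF ind ik i])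
 show "(\<integral>om. k om * f (w t om - w s om) \<partial>P) = (\<integral>om. k om \<partial>P) * (\<integral>om. f (w t om - w s om) \<partial>P)"
  by (rule indep_var_lebesgue_integral[OF ind ik i])
qed

lemma w_inc_expand: "w t om - w s om = (\<Sum>e\<in>Bs. ((w t om - w s om) \<bullet> e) *\<^sub>R e)"
 by (rule expand) (intro subspace_diff[OF subspaceV] w_V)

lemma g_sum: assumes r: "r \<in> {0..T}" and C: "bounded_linear C"
 shows "g r x (C (w t om - w s om)) = (\<Sum>e\<in>Bs. g r x (C e) * ((w t om - w s om) \<bullet> e))"
proof -
 interpret C: bounded_linear C by fact
 interpret gr: bounded_linear "g r x" by (rule g_linear[OF r])
 show ?thesis by (subst w_inc_expand) (simp add: C.sum C.scaleR gr.sum gr.scaleR mult.commute)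
qed

lemma H_sum: assumes r: "r \<in> {0..T}" and C: "bounded_linear C"
 shows "H r x (C (w t om - w s om)) (C (w t om - w s om))
  = (\<Sum>e\<in>Bs. \<Sum>e'\<in>Bs. H r x (C e) (C e') * (((w t om - w s om) \<bullet> e) * ((w t om - w s om) \<bullet> e')))"
proof -
 interpret C: bounded_linear C by fact
 interpret r: bounded_linear "H r x y" for y by (rule H_linear_right[OF r])
 interpret l: bounded_linear "%v. H r x v y" for y by (rule H_linear_left[OF r])
 let ?c = "%e. (w t om - w s om) \<bullet> e"
 have e: "C (w t om - w s om) = (\<Sum>e\<in>Bs. ?c e *\<^sub>R C e)"
  by (subst w_inc_expand) (simp add: C.sum C.scaleR)
 have "H r x (\<Sum>e\<in>Bs. ?c e *\<^sub>R C e) (\<Sum>e\<in>Bs. ?c e *\<^sub>R C e) = (\<Sum>e\<in>Bs. ?c e * (\<Sum>e'\<in>Bs. ?c e' * H r x (C e) (C e')))"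
  by (simp only: l.sum l.scaleR real_scaleR_def) (simp only: r.sum r.scaleR real_scaleR_def)
 then show ?thesis unfolding e by (simp add: sum_distrib_left mult_ac)
qed

text \<open>In basis coordinates each summand is a bounded coefficient known at time
  \<open>s\<close> times a centred increment independent of it.\<close>

lemma first_order_mean:
 assumes st: "0 \<le> s" "s \<le> t" "t \<le> T" and X: "X \<in> borel_measurable (\<F> s)" and r: "r \<in> {0..T}" and C: "bounded_linear C"
 shows "integrable P (%om. g r (X om) (C (w t om - w s om)))" "(\<integral>om. g r (X om) (C (w t om - w s om)) \<partial>P) = 0"
proof -
 have *: "integrable P (%om. g r (X om) (C e) * ((w t om - w s om) \<bullet> e))"
  "(\<integral>om. g r (X om) (C e) * ((w t om - w s om) \<bullet> e) \<partial>P) = 0" if e: "e \<in> Bs" for e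
  using filtration_independent_product[OF st g_measurable[OF r X, of "%_. C e"] g_bound[OF r], of "%x. x \<bullet> e"]
   w_inc_inner_mean[OF st e] by auto
 show "integrable P (%om. g r (X om) (C (w t om - w s om)))" "(\<integral>om. g r (X om) (C (w t om - w s om)) \<partial>P) = 0"
  unfolding g_sum[OF r C] using * by simp_all
qed

text \<open>The same factorization with products of two coordinates of the increment, whose mean is
  \<open>(t - s) * (uB e \<bullet> uB e')\<close>; this produces the trace term.\<close>

lemma second_order_mean:
 assumes st: "0 \<le> s" "s \<le> t" "t \<le> T" and X: "X \<in> borel_measurable (\<F> s)" and r: "r \<in> {0..T}" and C: "bounded_linear C"
 shows "integrable P (%om. H r (X om) (C (w t om - w s om)) (C (w t om - w s om)))"
  "(\<integral>om. H r (X om) (C (w t om - w s om)) (C (w t om - w s om)) \<partial>P)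
   = (t - s) * (\<Sum>e\<in>Bs. \<Sum>e'\<in>Bs. (uB e \<bullet> uB e') * (\<integral>om. H r (X om) (C e) (C e') \<partial>P))"
proof -
 have *: "integrable P (%om. H r (X om) (C e) (C e') * (((w t om - w s om) \<bullet> e) * ((w t om - w s om) \<bullet> e')))"
  "(\<integral>om. H r (X om) (C e) (C e') * (((w t om - w s om) \<bullet> e) * ((w t om - w s om) \<bullet> e')) \<partial>P)
   = (t - s) * ((uB e \<bullet> uB e') * (\<integral>om. H r (X om) (C e) (C e') \<partial>P))" if e: "e \<in> Bs" "e' \<in> Bs" for e e'
  using filtration_independent_product[OF st H_measurable[OF r X, of "C e" "C e'"] H_bound[OF r], of "%x. (x \<bullet> e) * (x \<bullet> e')"]
   w_inc_inner_mult[OF st e] by auto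
 show "integrable P (%om. H r (X om) (C (w t om - w s om)) (C (w t om - w s om)))"
  unfolding H_sum[OF r C] using * by (intro Bochner_Integration.integrable_sum)
 show "(\<integral>om. H r (X om) (C (w t om - w s om)) (C (w t om - w s om)) \<partial>P)
   = (t - s) * (\<Sum>e\<in>Bs. \<Sum>e'\<in>Bs. (uB e \<bullet> uB e') * (\<integral>om. H r (X om) (C e) (C e') \<partial>P))"
  unfolding H_sum[OF r C] using * by (simp add: sum_distrib_left Bochner_Integration.integral_sum)
qed

lemma lipschitz_integrable:
 fixes f :: "'h => real"
 assumes lip: "!!x y. \<bar>f x - f y\<bar> \<le> l * norm (x - y)" and X: "X \<in> borel_measurable P"
  and X2: "sq_integrable X"
 shows "integrable P (%om. f (X om))"
proof (rule Bochner_Integration.integrable_bound[of P "%om. \<bar>f 0\<bar> + l * norm (X om)"])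
 show "integrable P (%om. \<bar>f 0\<bar> + l * norm (X om))"
  using square_integrable_imp_integrable[OF X X2] by simp
 show "(%om. f (X om)) \<in> borel_measurable P"
  by (rule measurable_compose[OF X borel_measurable_continuous_onI[OF lipschitz_continuous[OF lip]]])
 show "AE om in P. norm (f (X om)) \<le> norm (\<bar>f 0\<bar> + l * norm (X om))"
  using lipschitz_growth[OF lip] by (intro AE_I2) (auto intro: order_trans[OF _ abs_ge_self])
qed

lemma square_integrable_add:
 fixes X Y :: "'w => 'h"
 assumes X: "X \<in> borel_measurable P" "sq_integrable X"
  and Y: "Y \<in> borel_measurable P" "sq_integrable Y"
 shows "integrable P (%om. (norm (X om + Y om))^2)"
proof (rule Bochner_Integration.integrable_bound[of P "%om. 2 * (norm (X om))^2 + 2 * (norm (Y om))^2"])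
 have "(norm (X om + Y om))^2 \<le> 2 * (norm (X om))^2 + 2 * (norm (Y om))^2" for om
 proof -
  have "(norm (X om + Y om))^2 \<le> (norm (X om) + norm (Y om))^2" by (intro power_mono norm_triangle_ineq) auto
  also have "\<dots> \<le> 2 * (norm (X om))^2 + 2 * (norm (Y om))^2"
   using zero_le_power2[of "norm (X om) - norm (Y om)"] by (simp add: power2_eq_square algebra_simps)
  finally show ?thesis .
 qed
 then show "AE om in P. norm ((norm (X om + Y om))^2) \<le> norm (2 * (norm (X om))^2 + 2 * (norm (Y om))^2)"
  by (intro AE_I2) (auto intro: order_trans)
qed (use assms in auto)

lemma square_integrable_le:
 fixes X :: "'w => 'h" and Y :: "'w => 'b :: real_normed_vector"
 assumes X: "X \<in> borel_measurable P" and Y: "sq_integrable Y" and le: "!!om. norm (X om) \<le> c * norm (Y om)"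
 shows "sq_integrable X"
proof (rule Bochner_Integration.integrable_bound[of P "%om. c^2 * (norm (Y om))^2"])
 show "AE om in P. norm ((norm (X om))^2) \<le> norm (c^2 * (norm (Y om))^2)"
  using power_mono[OF le norm_ge_zero, of _ 2] by (simp add: power_mult_distrib)
qed (use X Y in auto)

definition "rem r x v = semi \<Phi> r (x + v) - semi \<Phi> r x - g r x v - H r x v v / 2"

text \<open>The remainder is bounded through the oscillation of the second derivative in the finitely many
 basis directions only, which is what makes it \<open>o(\<parallel>\<Delta>\<parallel>^2)\<close>.\<close>

lemma rem_bound:
 assumes r: "r \<in> {0..T}" and C: "bounded_linear C" and cc: "norm (C (w t om - w s om)) \<le> cc * norm (w t om - w s om)"
 shows "\<exists>y. norm (y - x) \<le> norm (C (w t om - w s om)) \<and> \<bar>rem r x (C (w t om - w s om))\<bar>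
   \<le> (\<Sum>e\<in>Bs. \<Sum>e'\<in>Bs. \<bar>H r y (C e) (C e') - H r x (C e) (C e')\<bar>) * (norm (w t om - w s om))^2"
  "\<bar>rem r x (C (w t om - w s om))\<bar> \<le> c2 * cc^2 * (norm (w t om - w s om))^2"
proof -
 let ?D = "w t om - w s om" let ?v = "C ?D"
 obtain \<theta> where th: "\<theta> \<in> {0..1}" "semi \<Phi> r (x + ?v) = semi \<Phi> r x + g r x ?v + H r (x + \<theta> *\<^sub>R ?v) ?v ?v / 2"
  using semi_taylor[OF r] by blast
 let ?y = "x + \<theta> *\<^sub>R ?v"
 have R: "rem r x ?v = (H r ?y ?v ?v - H r x ?v ?v) / 2" unfolding rem_def th(2) by (simp add: field_simps)
 have "\<bar>H r ?y ?v ?v - H r x ?v ?v\<bar> = \<bar>\<Sum>e\<in>Bs. \<Sum>e'\<in>Bs. (H r ?y (C e) (C e') - H r x (C e) (C e')) * ((?D \<bullet> e) * (?D \<bullet> e'))\<bar>"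
  unfolding H_sum[OF r C] by (simp add: sum_subtractf left_diff_distrib)
 also have "\<dots> \<le> (\<Sum>e\<in>Bs. \<bar>\<Sum>e'\<in>Bs. (H r ?y (C e) (C e') - H r x (C e) (C e')) * ((?D \<bullet> e) * (?D \<bullet> e'))\<bar>)" by (rule sum_abs)
 also have "\<dots> \<le> (\<Sum>e\<in>Bs. \<Sum>e'\<in>Bs. \<bar>(H r ?y (C e) (C e') - H r x (C e) (C e')) * ((?D \<bullet> e) * (?D \<bullet> e'))\<bar>)"
  by (intro sum_mono sum_abs)
 also have "\<dots> \<le> (\<Sum>e\<in>Bs. \<Sum>e'\<in>Bs. \<bar>H r ?y (C e) (C e') - H r x (C e) (C e')\<bar> * (norm ?D)^2)"
 proof (intro sum_mono)
  fix e e' assume e: "e \<in> Bs" "e' \<in> Bs"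
  have "\<bar>(?D \<bullet> e) * (?D \<bullet> e')\<bar> \<le> norm ?D * norm ?D" unfolding abs_mult
   using Cauchy_Schwarz_ineq2[of ?D e] Cauchy_Schwarz_ineq2[of ?D e'] nB e by (intro mult_mono) auto
  then show "\<bar>(H r ?y (C e) (C e') - H r x (C e) (C e')) * ((?D \<bullet> e) * (?D \<bullet> e'))\<bar> \<le> \<bar>H r ?y (C e) (C e') - H r x (C e) (C e')\<bar> * (norm ?D)^2"
   unfolding abs_mult[of "H r ?y (C e) (C e') - H r x (C e) (C e')"] power2_eq_square by (intro mult_left_mono) auto
 qed
 finally have 1: "\<bar>H r ?y ?v ?v - H r x ?v ?v\<bar> \<le> (\<Sum>e\<in>Bs. \<Sum>e'\<in>Bs. \<bar>H r ?y (C e) (C e') - H r x (C e) (C e')\<bar>) * (norm ?D)^2"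
  by (simp add: sum_distrib_right)
 have "norm (?y - x) \<le> norm ?v" using th(1) mult_right_mono[of \<theta> 1 "norm ?v"] by simp
 moreover have "\<bar>rem r x ?v\<bar> \<le> (\<Sum>e\<in>Bs. \<Sum>e'\<in>Bs. \<bar>H r ?y (C e) (C e') - H r x (C e) (C e')\<bar>) * (norm ?D)^2"
  unfolding R by (rule order_trans[OF _ 1]) simp
 ultimately show "\<exists>y. norm (y - x) \<le> norm ?v \<and> \<bar>rem r x ?v\<bar>
   \<le> (\<Sum>e\<in>Bs. \<Sum>e'\<in>Bs. \<bar>H r y (C e) (C e') - H r x (C e) (C e')\<bar>) * (norm ?D)^2" by blast
 have half: "\<bar>(a - b) / 2\<bar> \<le> c" if "\<bar>a\<bar> \<le> c" "\<bar>b\<bar> \<le> c" for a b c :: real using that by (auto simp: abs_le_iff)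
 have "\<bar>rem r x ?v\<bar> \<le> c2 * norm ?v * norm ?v" unfolding R by (rule half[OF H_bound[OF r] H_bound[OF r]])
 also have "\<dots> \<le> c2 * (cc * norm ?D) * (cc * norm ?D)"
  using cc c2 by (intro mult_mono mult_left_mono) (auto intro: order_trans[OF norm_ge_zero] mult_nonneg_nonneg)
 finally show "\<bar>rem r x ?v\<bar> \<le> c2 * cc^2 * (norm ?D)^2" by (simp add: power2_eq_square mult_ac)
qed

text \<open>An increment is split into a drift part \<open>(t - s) *\<^sub>R \<alpha>\<close> and a
  noise part \<open>C\<close> applied to the increment of \<open>w\<close>. The statement is used
  once for the scheme, with \<open>C n = E (t n - a)\<close>, and once for the exact flow, with
  \<open>C n\<close> the identity; in the latter \<open>\<alpha>\<close> is itself a difference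
  quotient and may depend on the increment, which is why it only has to be bounded in mean square
  and convergent.\<close>

lemma local_expansion:
 fixes \<alpha> :: "nat => 'w => 'h" and C :: "nat => 'h => 'h"
 assumes t: "!!n. 0 \<le> s n" "!!n. s n < t n" "!!n. t n \<le> T" "s \<longlonglongrightarrow> \<tau>" "t \<longlonglongrightarrow> \<tau>"
  and X: "!!n. X n \<in> borel_measurable (\<F> (s n))" "!!n. sq_integrable (X n)"
   "X0 \<in> borel_measurable P" "AE om in P. (%n. X n om) \<longlonglongrightarrow> X0 om"
  and \<alpha>: "!!n. \<alpha> n \<in> borel_measurable P" "!!n. sq_integrable (\<alpha> n)" "!!n. (\<integral>om. (norm (\<alpha> n om))^2 \<partial>P) \<le> Ca"
   "\<alpha>0 \<in> borel_measurable P" "sq_integrable \<alpha>0" "AE om in P. (%n. \<alpha> n om) \<longlonglongrightarrow> \<alpha>0 om"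
  and C: "!!n. bounded_linear (C n)" "!!n x. norm (C n x) \<le> cc * norm x" "!!e. (%n. C n e) \<longlonglongrightarrow> C0 e"
 shows "(%n. ((\<integral>om. semi \<Phi> (T - t n) (X n om + (t n - s n) *\<^sub>R \<alpha> n om + C n (w (t n) om - w (s n) om)) \<partial>P)
   - (\<integral>om. semi \<Phi> (T - t n) (X n om) \<partial>P)) / (t n - s n))
  \<longlonglongrightarrow> (\<integral>om. g (T - \<tau>) (X0 om) (\<alpha>0 om) \<partial>P)
   + (\<Sum>e\<in>Bs. \<Sum>e'\<in>Bs. (uB e \<bullet> uB e') * (\<integral>om. H (T - \<tau>) (X0 om) (C0 e) (C0 e') \<partial>P)) / 2"
proof -
 define r where "r n = T - t n" for n
 define h where "h n = t n - s n" for n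
 define D where "D n om = w (t n) om - w (s n) om" for n om
 define v where "v n om = C n (D n om)" for n om
 have cc: "norm (v n om) \<le> cc * norm (D n om)" for n om unfolding v_def by (rule C)
 have st: "0 \<le> s n" "s n \<le> t n" "t n \<le> T" for n using t(1-3)[of n] by auto
 have sT: "s n \<in> {0..T}" for n using t(1-3)[of n] by auto
 have r: "r n \<in> {0..T}" for n using t(1-3)[of n] by (auto simp: r_def)
 have rlim: "r \<longlonglongrightarrow> T - \<tau>" unfolding r_def by (intro tendsto_intros t)
 have rT: "T - \<tau> \<in> {0..T}" using closed_sequentially[OF closed_atLeastAtMost r rlim] .
 have h: "0 < h n" for n using t(2) by (simp add: h_def)
 have hlim: "h \<longlonglongrightarrow> 0" using tendsto_diff[OF t(5,4)] by (simp add: h_def[abs_def])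
 have Xm: "X n \<in> borel_measurable P" for n by (rule measurable_filtration_P[OF sT X(1)])
 have Dm: "D n \<in> borel_measurable P" for n unfolding D_def by (intro borel_measurable_diff w_measurable_all)
 have Cm: "C n \<in> borel_measurable borel" for n
  by (rule borel_measurable_continuous_onI[OF linear_continuous_on[OF C(1)]])
 have vm: "v n \<in> borel_measurable P" for n unfolding v_def by (rule measurable_compose[OF Dm Cm])
 have D2: "sq_integrable (D n)" for n
  using w_inc_second_moment(1)[OF st] by (simp add: D_def)
 have v2: "sq_integrable (v n)" for n by (rule square_integrable_le[OF vm D2 cc])
 have lip: "\<bar>semi \<Phi> (r n) x - semi \<Phi> (r n) y\<bar> \<le> (N1 * ET) * norm (x - y)" for n x y
  by (rule semi_lipschitz[OF lip\<Phi> r])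
 have hm: "(%om. h n *\<^sub>R \<alpha> n om) \<in> borel_measurable P" for n using \<alpha>(1) by simp
 have h2: "integrable P (%om. (norm (h n *\<^sub>R \<alpha> n om))^2)" for n
  by (rule square_integrable_le[OF hm \<alpha>(2)[of n], where c="h n"]) (use h[of n] in simp)
 have i1: "integrable P (%om. semi \<Phi> (r n) (X n om))" for n by (rule lipschitz_integrable[OF lip Xm X(2)])
 have Xv: "(%om. X n om + v n om) \<in> borel_measurable P" "integrable P (%om. (norm (X n om + v n om))^2)" for n
  using Xm vm square_integrable_add[OF Xm X(2) vm v2] by simp_all
 have i2: "integrable P (%om. semi \<Phi> (r n) (X n om + v n om))" for n
  by (rule lipschitz_integrable[OF lip Xv])
 have i3: "integrable P (%om. semi \<Phi> (r n) (X n om + v n om + h n *\<^sub>R \<alpha> n om))" for n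
  by (rule lipschitz_integrable[OF lip _ square_integrable_add[OF Xv hm h2]]) (use Xv hm in auto)
 have Dlim: "(%n. D n om) \<longlonglongrightarrow> 0" for om
 proof -
  have "isCont (%t. w t om) \<tau>" using w_continuous[of UNIV om] by (simp add: continuous_on_eq_continuous_at)
  from tendsto_diff[OF isCont_tendsto_compose[OF this t(5)] isCont_tendsto_compose[OF this t(4)]]
  show ?thesis by (simp add: D_def)
 qed
 have vlim: "(%n. v n om) \<longlonglongrightarrow> 0" for om
  by (rule Lim_null_comparison[OF always_eventually tendsto_mult_right_zero[OF tendsto_norm_zero[OF Dlim]]]) (use cc in blast)

 \<comment> \<open>The drift part is expanded around the point already displaced by the noise. It is
   of order \<open>h\<close>, so a first order mean value suffices, and no mixed drift-noise terms
   occur in the second order expansion.\<close>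
 define Q where "Q n om = (semi \<Phi> (r n) (X n om + v n om + h n *\<^sub>R \<alpha> n om) - semi \<Phi> (r n) (X n om + v n om)) / h n" for n om
 have Qex: "\<exists>\<theta>\<in>{0..1}. Q n om = g (r n) (X n om + v n om + \<theta> *\<^sub>R (h n *\<^sub>R \<alpha> n om)) (\<alpha> n om)" for n om
 proof -
  obtain \<theta> where th: "\<theta> \<in> {0..1}" "semi \<Phi> (r n) (X n om + v n om + h n *\<^sub>R \<alpha> n om) - semi \<Phi> (r n) (X n om + v n om)
    = g (r n) (X n om + v n om + \<theta> *\<^sub>R (h n *\<^sub>R \<alpha> n om)) (h n *\<^sub>R \<alpha> n om)" using semi_mvt[OF r] by blast
  then show ?thesis using h[of n] linear_simps(5)[OF g_linear[OF r]]
   by (intro bexI[of _ \<theta>]) (simp_all add: Q_def)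
 qed
 have Qlim: "(%n. \<integral>om. Q n om \<partial>P) \<longlonglongrightarrow> (\<integral>om. g (T - \<tau>) (X0 om) (\<alpha>0 om) \<partial>P)"
 proof (rule expectation_tendsto_L2_bounded[where C="c1^2 * Ca"])
  show Qm: "Q n \<in> borel_measurable P" for n unfolding Q_def using i2 i3 by simp
  show gm: "(%om. g (T - \<tau>) (X0 om) (\<alpha>0 om)) \<in> borel_measurable P" by (rule g_measurable[OF rT X(3) \<alpha>(4)])
  have "norm (Q n om) \<le> c1 * norm (\<alpha> n om)" for n om using Qex[of n om] g_bound[OF r] by auto
  then have sq: "(Q n om)^2 \<le> c1^2 * (norm (\<alpha> n om))^2" for n om
   using power_mono[of "norm (Q n om)" "c1 * norm (\<alpha> n om)" 2] by (simp add: power_mult_distrib)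
  show Qi: "integrable P (%om. (Q n om)^2)" for n
   by (rule Bochner_Integration.integrable_bound[of P "%om. c1^2 * (norm (\<alpha> n om))^2"]) (use \<alpha>(2) Qm sq in auto)
  have sq0: "(g (T - \<tau>) (X0 om) (\<alpha>0 om))^2 \<le> c1^2 * (norm (\<alpha>0 om))^2" for om
   using power_mono[OF g_bound[OF rT, of "X0 om" "\<alpha>0 om"], of 2] by (simp add: power_mult_distrib)
  show "integrable P (%om. (g (T - \<tau>) (X0 om) (\<alpha>0 om))^2)"
   by (rule Bochner_Integration.integrable_bound[of P "%om. c1^2 * (norm (\<alpha>0 om))^2"]) (use \<alpha>(5) gm sq0 in auto)
  have Qle: "(\<integral>om. (Q n om)^2 \<partial>P) \<le> (\<integral>om. c1^2 * (norm (\<alpha> n om))^2 \<partial>P)" for n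
   by (rule integral_mono[OF Qi]) (use \<alpha>(2) sq in auto)
  show "(\<integral>om. (Q n om)^2 \<partial>P) \<le> c1^2 * Ca" for n
   using Qle[of n] mult_left_mono[OF \<alpha>(3)[of n], of "c1^2"] by simp
  show "AE om in P. (%n. Q n om) \<longlonglongrightarrow> g (T - \<tau>) (X0 om) (\<alpha>0 om)"
   using X(4) \<alpha>(6)
  proof eventually_elim
   fix om assume l: "(%n. X n om) \<longlonglongrightarrow> X0 om" "(%n. \<alpha> n om) \<longlonglongrightarrow> \<alpha>0 om"
   obtain \<theta> where th: "!!n. \<theta> n \<in> {0..1}" "!!n. Q n om = g (r n) (X n om + v n om + \<theta> n *\<^sub>R (h n *\<^sub>R \<alpha> n om)) (\<alpha> n om)"
    using Qex[of _ om] by (metis (mono_tags))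
   have "(%n. \<theta> n *\<^sub>R (h n *\<^sub>R \<alpha> n om)) \<longlonglongrightarrow> 0"
   proof (rule Lim_null_comparison)
    show "\<forall>\<^sub>F n in sequentially. norm (\<theta> n *\<^sub>R (h n *\<^sub>R \<alpha> n om)) \<le> norm (h n *\<^sub>R \<alpha> n om)"
    proof (intro always_eventually allI)
     fix n show "norm (\<theta> n *\<^sub>R (h n *\<^sub>R \<alpha> n om)) \<le> norm (h n *\<^sub>R \<alpha> n om)"
      using th(1)[of n] mult_right_mono[of "\<bar>\<theta> n\<bar>" 1 "norm (h n *\<^sub>R \<alpha> n om)"] by (simp only: norm_scaleR) simp
    qed
    show "(%n. norm (h n *\<^sub>R \<alpha> n om)) \<longlonglongrightarrow> 0"
     using tendsto_norm[OF tendsto_scaleR[OF hlim l(2)]] by simp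
   qed
   from tendsto_add[OF tendsto_add[OF l(1) vlim] this]
   have "(%n. X n om + v n om + \<theta> n *\<^sub>R (h n *\<^sub>R \<alpha> n om)) \<longlonglongrightarrow> X0 om" by simp
   from g_tendsto_vec[OF r rlim this l(2)] show "(%n. Q n om) \<longlonglongrightarrow> g (T - \<tau>) (X0 om) (\<alpha>0 om)" by (simp add: th(2))
  qed
 qed

 \<comment> \<open>Where \<open>D n om = 0\<close> the quotient is 0 by convention; there the
   remainder vanishes by \<open>Rc\<close>, so the factorization \<open>Rk\<close> holds for every
   path. The second factor has a bounded second moment by the fourth moment of the
   increment.\<close>
 define \<kappa> where "\<kappa> n om = rem (r n) (X n om) (v n om) / (norm (D n om))^2" for n om
 have gi: "integrable P (%om. g (r n) (X n om) (v n om))" "(\<integral>om. g (r n) (X n om) (v n om) \<partial>P) = 0" for n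
  using first_order_mean[OF st X(1) r C(1)] by (simp_all add: v_def D_def)
 have Hi: "integrable P (%om. H (r n) (X n om) (v n om) (v n om))"
  "(\<integral>om. H (r n) (X n om) (v n om) (v n om) \<partial>P)
   = h n * (\<Sum>e\<in>Bs. \<Sum>e'\<in>Bs. (uB e \<bullet> uB e') * (\<integral>om. H (r n) (X n om) (C n e) (C n e') \<partial>P))" for n
  using second_order_mean[OF st X(1) r C(1)] by (simp_all add: v_def D_def h_def)
 have Ri: "integrable P (%om. rem (r n) (X n om) (v n om))" for n
  unfolding rem_def using i1 i2 gi(1) Hi(1) by simp
 have Rb: "\<exists>y. norm (y - X n om) \<le> norm (v n om) \<and> \<bar>rem (r n) (X n om) (v n om)\<bar>
   \<le> (\<Sum>e\<in>Bs. \<Sum>e'\<in>Bs. \<bar>H (r n) y (C n e) (C n e') - H (r n) (X n om) (C n e) (C n e')\<bar>) * (norm (D n om))^2"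
  and Rc: "\<bar>rem (r n) (X n om) (v n om)\<bar> \<le> c2 * cc^2 * (norm (D n om))^2" for n om
  using rem_bound[OF r[of n] C(1)[of n] C(2)[of n], where t="t n" and s="s n" and om=om and x="X n om"] by (simp_all add: v_def D_def)
 have Rk: "rem (r n) (X n om) (v n om) / h n = \<kappa> n om * ((norm (D n om))^2 / h n)" for n om
  using Rc[of n om] by (cases "D n om = 0") (auto simp: \<kappa>_def)
 have Rlim: "(%n. \<integral>om. \<kappa> n om * ((norm (D n om))^2 / h n) \<partial>P) \<longlonglongrightarrow> 0"
 proof (rule expectation_product_tendsto_0[where c="c2 * cc^2" and C=q4])
  show "\<kappa> n \<in> borel_measurable P" "(%om. (norm (D n om))^2 / h n) \<in> borel_measurable P" for n
   unfolding \<kappa>_def using Ri Dm by simp_all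
  show "\<bar>\<kappa> n om\<bar> \<le> c2 * cc^2" for n om
   using Rc[of n om] c2 by (cases "D n om = 0") (simp_all add: \<kappa>_def field_simps)
  have f: "((norm (D n om))^2 / h n)^2 = (norm (D n om)) ^ 4 / (h n)^2" for n om
   by (simp add: power_divide flip: power_mult)
  show "integrable P (%om. ((norm (D n om))^2 / h n)^2)" for n
   unfolding f using w_inc_fourth_moment(1)[OF st] by (simp add: D_def)
  show "(\<integral>om. ((norm (D n om))^2 / h n)^2 \<partial>P) \<le> q4" for n
   unfolding f using w_inc_fourth_moment(2)[OF st, of n] h[of n] by (simp add: D_def h_def field_simps)
  show "AE om in P. (%n. \<kappa> n om) \<longlonglongrightarrow> 0"
   using X(4)
  proof eventually_elim
   fix om assume l: "(%n. X n om) \<longlonglongrightarrow> X0 om"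
   have "\<forall>n. \<exists>y. norm (y - X n om) \<le> norm (v n om) \<and> \<bar>rem (r n) (X n om) (v n om)\<bar>
     \<le> (\<Sum>e\<in>Bs. \<Sum>e'\<in>Bs. \<bar>H (r n) y (C n e) (C n e') - H (r n) (X n om) (C n e) (C n e')\<bar>) * (norm (D n om))^2"
    using Rb by (rule allI)
   from choice[OF this] obtain y where y': "\<forall>n. norm (y n - X n om) \<le> norm (v n om) \<and> \<bar>rem (r n) (X n om) (v n om)\<bar>
     \<le> (\<Sum>e\<in>Bs. \<Sum>e'\<in>Bs. \<bar>H (r n) (y n) (C n e) (C n e') - H (r n) (X n om) (C n e) (C n e')\<bar>) * (norm (D n om))^2"
    by (rule exE)
   note y = y'[rule_format, THEN conjunct1] y'[rule_format, THEN conjunct2]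
   have "(%n. y n - X n om) \<longlonglongrightarrow> 0"
    by (rule Lim_null_comparison[OF always_eventually tendsto_norm_zero[OF vlim]]) (use y(1) in blast)
   from tendsto_add[OF this l] have yl: "y \<longlonglongrightarrow> X0 om" by simp
   let ?S = "%n. \<Sum>e\<in>Bs. \<Sum>e'\<in>Bs. \<bar>H (r n) (y n) (C n e) (C n e') - H (r n) (X n om) (C n e) (C n e')\<bar>"
   have "?S \<longlonglongrightarrow> (\<Sum>e\<in>Bs. \<Sum>e'\<in>Bs. \<bar>H (T - \<tau>) (X0 om) (C0 e) (C0 e') - H (T - \<tau>) (X0 om) (C0 e) (C0 e')\<bar>)"
    by (intro tendsto_intros H_tendsto_vec[OF r rlim] yl l C(3))
   then have S: "?S \<longlonglongrightarrow> 0" by simp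
   show "(%n. \<kappa> n om) \<longlonglongrightarrow> 0"
   proof (rule Lim_null_comparison[OF always_eventually S], rule allI)
    fix n
    have "0 \<le> ?S n" by (intro sum_nonneg) auto
    then show "norm (\<kappa> n om) \<le> ?S n" using y(2)[of n] by (cases "D n om = 0") (simp_all add: \<kappa>_def abs_divide pos_divide_le_eq)
   qed
  qed
 qed
 have Hlim: "(%n. \<integral>om. H (r n) (X n om) (C n e) (C n e') \<partial>P) \<longlonglongrightarrow> (\<integral>om. H (T - \<tau>) (X0 om) (C0 e) (C0 e') \<partial>P)" for e e'
 proof (rule integral_dominated_convergence[where w="%_. c2 * (cc * norm e) * (cc * norm e')"])
  show "(%om. H (T - \<tau>) (X0 om) (C0 e) (C0 e')) \<in> borel_measurable P" "(%om. H (r n) (X n om) (C n e) (C n e')) \<in> borel_measurable P" for n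
   using H_measurable[OF rT X(3)] H_measurable[OF r Xm] by blast+
  show "AE om in P. (%n. H (r n) (X n om) (C n e) (C n e')) \<longlonglongrightarrow> H (T - \<tau>) (X0 om) (C0 e) (C0 e')"
   using X(4) by eventually_elim (intro H_tendsto_vec[OF r rlim] C(3))
  show "AE om in P. norm (H (r n) (X n om) (C n e) (C n e')) \<le> c2 * (cc * norm e) * (cc * norm e')" for n
  proof (rule AE_I2)
   fix om
   have "norm (H (r n) (X n om) (C n e) (C n e')) \<le> c2 * norm (C n e) * norm (C n e')" using H_bound[OF r] by simp
   also have "\<dots> \<le> c2 * (cc * norm e) * (cc * norm e')"
    by (intro mult_mono mult_left_mono C(2) c2 mult_nonneg_nonneg norm_ge_zero order_trans[OF norm_ge_zero C(2)])
   finally show "norm (H (r n) (X n om) (C n e) (C n e')) \<le> c2 * (cc * norm e) * (cc * norm e')" .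
  qed
 qed simp
 let ?S = "%n. \<Sum>e\<in>Bs. \<Sum>e'\<in>Bs. (uB e \<bullet> uB e') * (\<integral>om. H (r n) (X n om) (C n e) (C n e') \<partial>P)"
 have eq: "((\<integral>om. semi \<Phi> (r n) (X n om + v n om + h n *\<^sub>R \<alpha> n om) \<partial>P) - (\<integral>om. semi \<Phi> (r n) (X n om) \<partial>P)) / h n
   = (\<integral>om. Q n om \<partial>P) + (?S n / 2 + (\<integral>om. \<kappa> n om * ((norm (D n om))^2 / h n) \<partial>P))" for n
 proof -
  have alg: "(x3 - x1) / d = (x3 - x2) / d + (S / 2 + R / d)" if "R = x2 - x1 - d * S / 2" "0 < d" for x1 x2 x3 S R d :: real
   unfolding that(1) using that(2) by (simp add: field_simps)
  have a: "(\<integral>om. Q n om \<partial>P) = ((\<integral>om. semi \<Phi> (r n) (X n om + v n om + h n *\<^sub>R \<alpha> n om) \<partial>P) - (\<integral>om. semi \<Phi> (r n) (X n om + v n om) \<partial>P)) / h n"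
   unfolding Q_def using i2 i3 by simp
  have "(\<integral>om. rem (r n) (X n om) (v n om) \<partial>P) = (\<integral>om. semi \<Phi> (r n) (X n om + v n om) \<partial>P) - (\<integral>om. semi \<Phi> (r n) (X n om) \<partial>P) - h n * ?S n / 2"
   unfolding rem_def using i1 i2 gi Hi by simp
  from alg[OF this h[of n]] show ?thesis unfolding a Rk[symmetric] by simp
 qed
 have "(%n. (\<integral>om. Q n om \<partial>P) + (?S n / 2 + (\<integral>om. \<kappa> n om * ((norm (D n om))^2 / h n) \<partial>P)))
   \<longlonglongrightarrow> (\<integral>om. g (T - \<tau>) (X0 om) (\<alpha>0 om) \<partial>P)
   + ((\<Sum>e\<in>Bs. \<Sum>e'\<in>Bs. (uB e \<bullet> uB e') * (\<integral>om. H (T - \<tau>) (X0 om) (C0 e) (C0 e') \<partial>P)) / 2 + 0)"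
  by (intro tendsto_intros Qlim Rlim Hlim) simp
 then show ?thesis unfolding eq[symmetric] by (simp add: r_def h_def v_def D_def add_ac)
qed

end

subsection \<open>The interpolated scheme\<close>

lemma (in exp_operator) exp_minus_id: assumes h: "0 \<le> h" shows "norm (E h x - x) \<le> h * (exp (h * k) * k * norm x)"
proof -
 have "norm (E h x - E 0 x) \<le> (exp (h * k) * k * norm x) * norm (h - 0)"
 proof (rule differentiable_bound[where S="{0..h}" and f="%r. E r x" and f'="%r d. d *\<^sub>R E r (A x)"])
  fix r assume r: "r \<in> {0..h}"
  have "((%r. Eb r x) has_vector_derivative ((Eb r o\<^sub>L A) x)) (at r within {0..h})"
   by (rule bounded_linear.has_vector_derivative[OF blinfun.bounded_linear_left Eb_has_vector_derivative])
  then show "((%r. E r x) has_derivative (%d. d *\<^sub>R E r (A x))) (at r within {0..h})"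
   by (simp add: has_vector_derivative_def)
  have "norm (E r (A x)) \<le> exp (\<bar>r\<bar> * k) * norm (A x)" by (rule exp_bound)
  also have "\<dots> \<le> exp (h * k) * (k * norm x)"
   using r by (intro mult_mono norm_blinfun) (auto intro: mult_right_mono)
  finally have b: "norm (E r (A x)) \<le> exp (h * k) * k * norm x" by (simp add: mult.assoc)
  show "onorm (%d. d *\<^sub>R E r (A x)) \<le> exp (h * k) * k * norm x"
   by (rule onorm_le) (use mult_left_mono[OF b abs_ge_zero] in \<open>simp add: mult.commute\<close>)
 qed (use h in auto)
 then show ?thesis using h by (simp add: exp_0 mult.commute)
qed

text \<open>\<open>G\<close> is the full drift of the flow and \<open>Fh\<close> its nonlinear part;
  the exponential treats \<open>AL\<close> exactly, while the scheme freezes \<open>Fh\<close> at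
  the left end of each step.\<close>

locale euler_scheme = sde_test P T \<F> W V Bs B G DG D2G L K \<Phi> D\<Phi> D2\<Phi> N1 N2 + exp_subspace V Bs A0
 for P :: "'w measure" and T \<F> and W :: "real => 'u::{real_inner, banach, second_countable_topology} => 'w => real"
  and V :: "'h::{real_inner, banach, second_countable_topology} set" and Bs and B :: "'u => 'h"
  and G :: "'h => 'h" and DG D2G L K \<Phi> D\<Phi> D2\<Phi> N1 N2 A0 +
 fixes Fh :: "'h => 'h"
 assumes G_split: "G x = blinfun_apply AL x + Fh x" and FhV: "Fh x \<in> V"
begin

text \<open>A Lipschitz constant is available for \<open>G\<close>; subtracting the linear part adds
  at most its norm \<open>k\<close>.\<close>

definition "LF = L + k"
definition "ek = exp (T * k)"

lemma LF: "0 \<le> LF" using L0 by (simp add: LF_def)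
lemma ek: "1 \<le> ek" using T0 by (simp add: ek_def)

lemma lipF: "norm (Fh x - Fh y) \<le> LF * norm (x - y)"
proof -
 have "Fh x - Fh y = (G x - G y) - blinfun_apply AL (x - y)" by (simp add: G_split blinfun.diff_right)
 then have "norm (Fh x - Fh y) \<le> norm (G x - G y) + norm (blinfun_apply AL (x - y))" by (metis norm_triangle_ineq4)
 also have "\<dots> \<le> L * norm (x - y) + k * norm (x - y)" by (intro add_mono lipG norm_blinfun)
 finally show ?thesis by (simp add: LF_def distrib_right)
qed

lemma cF: "continuous_on UNIV Fh"
proof -
 have "Fh = (%x. G x - blinfun_apply AL x)" by (simp add: G_split fun_eq_iff)
 then show ?thesis using cG by (auto intro!: continuous_intros)
qed

lemma F_growth: "norm (Fh x) \<le> norm (Fh 0) + LF * norm x"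
 using norm_triangle_sub[of "Fh x" "Fh 0"] lipF[of x 0] by simp

lemma F_measurable: "X \<in> borel_measurable N ==> (%om. Fh (X om)) \<in> borel_measurable N"
 by (rule measurable_compose[OF _ borel_measurable_continuous_onI[OF cF]])

lemma E_measurable: "X \<in> borel_measurable N ==> (%om. E t (X om)) \<in> borel_measurable N"
 by (rule measurable_compose[OF _ borel_measurable_continuous_onI[OF linear_continuous_on[OF bounded_linear_exp]]])

lemma E_bound: "t \<in> {0..T} ==> norm (E t x) \<le> ek * norm x"
 unfolding ek_def by (rule order_trans[OF exp_bound]) (auto intro!: mult_right_mono)

lemma affine_square:
 fixes X :: "'w => 'b :: {real_normed_vector, second_countable_topology}" and y z :: "'w => real"
 assumes X: "X \<in> borel_measurable P" and le: "!!om. norm (X om) \<le> a0 + a1 * y om + a2 * z om"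
  and y: "integrable P (%om. (y om)^2)" and z: "integrable P (%om. (z om)^2)"
 shows "sq_integrable X"
  "(\<integral>om. (norm (X om))^2 \<partial>P) \<le> 4 * (a0^2 + a1^2 * (\<integral>om. (y om)^2 \<partial>P) + a2^2 * (\<integral>om. (z om)^2 \<partial>P))"
proof -
 have sq: "(norm (X om))^2 \<le> 4 * (a0^2 + a1^2 * (y om)^2 + a2^2 * (z om)^2)" for om
  using power_mono[OF le norm_ge_zero, of om 2] square_sum4_le[of a0 "a1 * y om" "a2 * z om" 0]
  by (simp add: power_mult_distrib)
 have i: "integrable P (%om. 4 * (a0^2 + a1^2 * (y om)^2 + a2^2 * (z om)^2))" using y z by simp
 show iX: "sq_integrable X"
  by (rule Bochner_Integration.integrable_bound[OF i]) (use X sq in \<open>auto intro: order_trans[OF _ abs_ge_self]\<close>)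
 have "(\<integral>om. (norm (X om))^2 \<partial>P) \<le> (\<integral>om. 4 * (a0^2 + a1^2 * (y om)^2 + a2^2 * (z om)^2) \<partial>P)"
  by (rule integral_mono[OF iX i sq])
 also have "\<dots> = 4 * (a0^2 + a1^2 * (\<integral>om. (y om)^2 \<partial>P) + a2^2 * (\<integral>om. (z om)^2 \<partial>P))"
  using y z by (simp add: prob_space)
 finally show "(\<integral>om. (norm (X om))^2 \<partial>P) \<le> \<dots>" .
qed

text \<open>Pathwise version of the continuous extension from the grid point \<open>a\<close>, with
  the increment of \<open>w\<close> in place of the Wiener integral: continuous in \<open>t\<close>
  for every path and adapted when \<open>Y\<close> is known at \<open>a\<close>.\<close>

definition "xi a Y t om = E (t - a) (Y om + (t - a) *\<^sub>R Fh (Y om) + (w t om - w a om))"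

lemma xi_start: "xi a Y a om = Y om" by (simp add: xi_def exp_0)

lemma xi_V: "Y om \<in> V ==> xi a Y t om \<in> V"
 unfolding xi_def by (intro exp_V subspace_add[OF subspaceV] subspace_scale[OF subspaceV] FhV subspace_diff[OF subspaceV] w_V)

lemma xi_measurable_filtration: assumes a: "0 \<le> a" "a \<le> t" "t \<le> T" and Y: "Y \<in> borel_measurable (\<F> a)"
 shows "xi a Y t \<in> borel_measurable (\<F> t)"
proof -
 have 1: "Y \<in> borel_measurable (\<F> t)" "w a \<in> borel_measurable (\<F> t)"
  using measurable_filtration_mono[OF _ _ _ Y, of t] measurable_filtration_mono[OF _ _ _ w_measurable_filtration, of a t] a by auto
 have 2: "w t \<in> borel_measurable (\<F> t)" by (rule w_measurable_filtration) (use a in auto)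
 show ?thesis unfolding xi_def[abs_def]
  by (intro E_measurable borel_measurable_add borel_measurable_diff borel_measurable_scaleR F_measurable 1 2 borel_measurable_const)
qed

lemma xi_measurable: assumes Y: "Y \<in> borel_measurable P" shows "xi a Y t \<in> borel_measurable P"
 unfolding xi_def[abs_def]
 by (intro E_measurable borel_measurable_add borel_measurable_diff borel_measurable_scaleR F_measurable Y w_measurable_all borel_measurable_const)

lemma xi_continuous: "continuous_on S (%t. xi a Y t om)"
proof -
 have "continuous_on S (%t. Eb (t - a) (Y om + (t - a) *\<^sub>R Fh (Y om) + (w t om - w a om)))"
  by (intro continuous_intros w_continuous)
 then show ?thesis by (simp add: xi_def)
qed

lemma xi_tendsto: assumes "t \<longlonglongrightarrow> \<tau>" shows "(%n. xi a Y (t n) om) \<longlonglongrightarrow> xi a Y \<tau> om"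
 using isCont_tendsto_compose[OF _ assms, of "%t. xi a Y t om"] xi_continuous[of UNIV]
 by (simp add: continuous_on_eq_continuous_at)

lemma E_tendsto: assumes "t \<longlonglongrightarrow> \<tau>" shows "(%n. E (t n) x) \<longlonglongrightarrow> E \<tau> x"
proof -
 have "isCont Eb \<tau>" using continuous_on_Eb[OF continuous_on_id, of UNIV] by (simp add: continuous_on_eq_continuous_at)
 from bounded_linear.tendsto[OF blinfun.bounded_linear_left isCont_tendsto_compose[OF this assms], of x]
 show ?thesis by simp
qed

lemma xi_step: assumes "a \<le> s"
 shows "xi a Y t om = E (t - s) (xi a Y s om) + (t - s) *\<^sub>R E (t - a) (Fh (Y om)) + E (t - a) (w t om - w s om)"
proof -
 interpret E: bounded_linear "E (t - a)" by (rule bounded_linear_exp)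
 have "E (t - s) (xi a Y s om) = E (t - a) (Y om + (s - a) *\<^sub>R Fh (Y om) + (w s om - w a om))"
  using exp_semigroup[of "s - a" "t - s"] assms by (simp add: xi_def)
 then show ?thesis unfolding xi_def by (simp add: E.add E.scaleR E.diff algebra_simps)
qed

lemma xi_square:
 assumes a: "0 \<le> a" "a \<le> t" "t \<le> T" and Y: "Y \<in> borel_measurable P" and Y2: "sq_integrable Y"
 shows "sq_integrable (xi a Y t)"
  "(\<integral>om. (norm (xi a Y t om))^2 \<partial>P) \<le> 4 * ((ek * (T * norm (Fh 0)))^2 + (ek * (1 + T * LF))^2 * (\<integral>om. (norm (Y om))^2 \<partial>P) + ek^2 * (T * q2))"
proof -
 have ta: "t - a \<in> {0..T}" using a by auto
 have le: "norm (xi a Y t om) \<le> ek * (T * norm (Fh 0)) + (ek * (1 + T * LF)) * norm (Y om) + ek * norm (w t om - w a om)" for om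
 proof -
  have "norm (Y om + (t - a) *\<^sub>R Fh (Y om) + (w t om - w a om)) \<le> norm (Y om) + \<bar>t - a\<bar> * norm (Fh (Y om)) + norm (w t om - w a om)"
   by (intro norm_triangle_le add_mono) auto
  also have "\<bar>t - a\<bar> * norm (Fh (Y om)) \<le> T * (norm (Fh 0) + LF * norm (Y om))"
   using ta F_growth by (intro mult_mono) auto
  finally have "norm (Y om + (t - a) *\<^sub>R Fh (Y om) + (w t om - w a om)) \<le> T * norm (Fh 0) + (1 + T * LF) * norm (Y om) + norm (w t om - w a om)"
   by (simp add: algebra_simps)
  from order_trans[OF E_bound[OF ta] mult_left_mono[OF this]] ek show ?thesis by (simp add: xi_def algebra_simps)
 qed
 note * = affine_square[OF xi_measurable[OF Y] le Y2 w_inc_second_moment(1)[OF a]]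
 show "sq_integrable (xi a Y t)" by (rule *)
 have wm: "(\<integral>om. (norm (w t om - w a om))^2 \<partial>P) \<le> T * q2"
  unfolding w_inc_second_moment(2)[OF a] using ta q2_nonneg by (intro mult_right_mono) auto
 show "(\<integral>om. (norm (xi a Y t om))^2 \<partial>P) \<le> 4 * ((ek * (T * norm (Fh 0)))^2 + (ek * (1 + T * LF))^2 * (\<integral>om. (norm (Y om))^2 \<partial>P) + ek^2 * (T * q2))"
  by (rule order_trans[OF *(2)]) (use wm in \<open>auto intro!: mult_left_mono\<close>)
qed

text \<open>Along a fixed path the flow moves by the noise increment plus
  \<open>h *\<^sub>R G x\<close>, up to \<open>h\<close> times a quantity that vanishes with
  \<open>h\<close> and with the oscillation \<open>m\<close> of the noise over the interval.\<close>

lemma Z_rate: assumes h: "h \<in> {0..T}" and m: "!!r. r \<in> {0..h} ==> norm (wp s om r) \<le> m"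
 shows "norm (Z s om x h - x - wp s om h - h *\<^sub>R G x) \<le> h * (L * (m + ET * (h * norm (G x) + L * (h * m))))"
proof -
 have c: "continuous_on {0..h} (%r. G (Z s om x r))"
  by (rule continuous_on_compose2[OF cG continuous_on_subset[OF Z_continuous]]) (use h in auto)
 have m0: "0 \<le> m" using m[of 0] h by simp
 have bd: "norm (G (Z s om x r) - G x) \<le> L * (m + ET * (h * norm (G x) + L * (h * m)))" if r: "r \<in> {0..h}" for r
 proof -
  have rT: "r \<in> {0..T}" using r h by auto
  have "I1 s r om \<le> integral {0..r} (%_. m)" unfolding I1_def
   by (rule integral_le) (use r m in \<open>auto intro!: integrable_continuous_real continuous_intros wp_continuous\<close>)
  also have "\<dots> \<le> h * m" using r m0 by (simp add: mult_right_mono)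
  finally have I: "I1 s r om \<le> h * m" .
  have "norm (Z s om x r - x) \<le> norm (wp s om r) + norm (Z s om x r - x - wp s om r)"
   using norm_triangle_ineq[of "wp s om r" "Z s om x r - x - wp s om r"] by simp
  also have "\<dots> \<le> m + ET * (r * norm (G x) + L * I1 s r om)" by (intro add_mono m r Z_growth rT)
  also have "\<dots> \<le> m + ET * (h * norm (G x) + L * (h * m))"
   using r I ET L0 by (intro add_mono mult_left_mono mult_right_mono) auto
  finally have "L * norm (Z s om x r - x) \<le> L * (m + ET * (h * norm (G x) + L * (h * m)))" by (rule mult_left_mono[OF _ L0])
  with lipG show ?thesis by (rule order_trans)
 qed
 have "Z s om x h - x - wp s om h - h *\<^sub>R G x = integral {0..h} (%r. G (Z s om x r)) - integral {0..h} (%r. G x)"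
  using Z_solves[of s om x] h unfolding solves_def by auto
 also have "\<dots> = integral {0..h} (%r. G (Z s om x r) - G x)"
  by (rule Henstock_Kurzweil_Integration.integral_diff[symmetric]) (auto intro!: integrable_continuous_real c)
 also have "norm \<dots> \<le> (L * (m + ET * (h * norm (G x) + L * (h * m)))) * (h - 0)"
  by (rule integral_bound) (use h c bd in \<open>auto intro!: continuous_intros\<close>)
 finally show ?thesis by (simp add: mult.commute)
qed

text \<open>\<open>psi1\<close> and \<open>psi2\<close> are the two integrands of the error formula
  in coordinates; the numbers \<open>uB e \<bullet> uB e'\<close> are the matrix entries of the
  noise covariance.\<close>

definition "phi a Y t = (\<integral>om. semi \<Phi> (T - t) (xi a Y t om) \<partial>P)"
definition "psi1 a Y t = (\<integral>om. g (T - t) (xi a Y t om) (E (t - a) (Fh (Y om)) - Fh (xi a Y t om)) \<partial>P)"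
definition "psi2 a Y t = (\<integral>om. (\<Sum>e\<in>Bs. \<Sum>e'\<in>Bs. (uB e \<bullet> uB e') *
 (H (T - t) (xi a Y t om) (E (t - a) e) (E (t - a) e') - H (T - t) (xi a Y t om) e e')) \<partial>P)"

lemma drift_quotient_tendsto:
 assumes h: "!!n. 0 < h n" "h \<longlonglongrightarrow> 0" and x: "x \<longlonglongrightarrow> x0"
 shows "(%n. (1 / h n) *\<^sub>R (E (h n) (x n) - x n)) \<longlonglongrightarrow> blinfun_apply AL x0"
proof -
 have "(%n. (1 / h n) *\<^sub>R (E (h n) (x n) - x n) - blinfun_apply AL (x n)) \<longlonglongrightarrow> 0"
 proof (rule Lim_null_comparison)
  have "\<forall>\<^sub>F n in sequentially. h n < 1" using order_tendstoD(2)[OF h(2), of 1] by simp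
  then show "\<forall>\<^sub>F n in sequentially. norm ((1 / h n) *\<^sub>R (E (h n) (x n) - x n) - blinfun_apply AL (x n)) \<le> h n * (exp k * k^2 * norm (x n))"
  proof eventually_elim
   case (elim n)
   have "(1 / h n) *\<^sub>R (E (h n) (x n) - x n) - blinfun_apply AL (x n) = (1 / h n) *\<^sub>R (E (0 + h n) (x n) - E 0 (x n) - h n *\<^sub>R E 0 (blinfun_apply AL (x n)))"
    using h(1)[of n] by (simp add: exp_0 scaleR_diff_right)
   then have "norm ((1 / h n) *\<^sub>R (E (h n) (x n) - x n) - blinfun_apply AL (x n)) \<le> (1 / h n) * ((h n)^2 * (exp ((\<bar>0\<bar> + 1) * k) * k^2) * norm (x n))"
    using exp_taylor[of "h n" 0 "x n"] elim h(1)[of n] by (simp add: divide_right_mono)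
   also have "\<dots> = h n * (exp k * k^2 * norm (x n))" using h(1)[of n] by (simp add: power2_eq_square)
   finally show ?case .
  qed
  have "(%n. h n * (exp k * k^2 * norm (x n))) \<longlonglongrightarrow> 0 * (exp k * k^2 * norm x0)" by (intro tendsto_intros h x)
  then show "(%n. h n * (exp k * k^2 * norm (x n))) \<longlonglongrightarrow> 0" by simp
 qed
 from tendsto_add[OF this bounded_linear.tendsto[OF blinfun.bounded_linear_right x, of AL]] show ?thesis by simp
qed

lemma flow_quotient_tendsto:
 assumes t: "!!n. 0 \<le> s n" "!!n. s n < t n" "!!n. t n \<le> T" "s \<longlonglongrightarrow> \<tau>" "t \<longlonglongrightarrow> \<tau>" and x: "x \<longlonglongrightarrow> x0"
 shows "(%n. (1 / (t n - s n)) *\<^sub>R (Z (s n) om (x n) (t n - s n) - x n - (w (t n) om - w (s n) om))) \<longlonglongrightarrow> G x0"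
proof -
 define h where "h n = t n - s n" for n
 have h: "0 < h n" "h n \<in> {0..T}" for n using t(1-3)[of n] by (auto simp: h_def)
 have hlim: "h \<longlonglongrightarrow> 0" using tendsto_diff[OF t(5,4)] by (simp add: h_def[abs_def])
 \<comment> \<open>A time of largest noise increment after \<open>s n\<close>; it is squeezed to
   \<open>\<tau>\<close>, so path continuity sends this largest increment to 0.\<close>
 have "\<exists>r\<in>{0..h n}. \<forall>r'\<in>{0..h n}. norm (wp (s n) om r') \<le> norm (wp (s n) om r)" for n
  by (rule continuous_attains_sup) (use h in \<open>auto intro!: continuous_intros wp_continuous simp: less_imp_le\<close>)
 then obtain r where r: "!!n. r n \<in> {0..h n}" "!!n r'. r' \<in> {0..h n} ==> norm (wp (s n) om r') \<le> norm (wp (s n) om (r n))"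
  by metis
 have "(%n. s n + r n) \<longlonglongrightarrow> \<tau>"
  by (rule tendsto_sandwich[OF always_eventually always_eventually t(4,5)]) (use r(1) in \<open>auto simp: h_def algebra_simps\<close>)
 moreover have "isCont (%t. w t om) \<tau>" using w_continuous[of UNIV om] by (simp add: continuous_on_eq_continuous_at)
 ultimately have "(%n. wp (s n) om (r n)) \<longlonglongrightarrow> w \<tau> om - w \<tau> om"
  unfolding wp_def by (intro tendsto_diff isCont_tendsto_compose[of \<tau> "%t. w t om"] t)
 then have m: "(%n. norm (wp (s n) om (r n))) \<longlonglongrightarrow> 0" using tendsto_norm_zero by simp
 have Gx: "(%n. G (x n)) \<longlonglongrightarrow> G x0" using isCont_tendsto_compose[OF _ x, of G] cG by (simp add: continuous_on_eq_continuous_at)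
 let ?\<alpha> = "%n. (1 / h n) *\<^sub>R (Z (s n) om (x n) (h n) - x n - wp (s n) om (h n))"
 let ?m = "%n. norm (wp (s n) om (r n))"
 have "(%n. ?\<alpha> n - G (x n)) \<longlonglongrightarrow> 0"
 proof (rule Lim_null_comparison[OF always_eventually], rule allI)
  fix n
  have "?\<alpha> n - G (x n) = (1 / h n) *\<^sub>R (Z (s n) om (x n) (h n) - x n - wp (s n) om (h n) - h n *\<^sub>R G (x n))"
   using h(1)[of n] by (simp add: scaleR_diff_right)
  then show "norm (?\<alpha> n - G (x n)) \<le> L * (?m n + ET * (h n * norm (G (x n)) + L * (h n * ?m n)))"
   using Z_rate[OF h(2)[of n] r(2)[of _ n], where x="x n"] h(1)[of n] by (simp add: pos_divide_le_eq mult.commute)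
 next
  have "(%n. L * (?m n + ET * (h n * norm (G (x n)) + L * (h n * ?m n)))) \<longlonglongrightarrow> L * (0 + ET * (0 * norm (G x0) + L * (0 * 0)))"
   by (intro tendsto_intros hlim Gx m)
  then show "(%n. L * (?m n + ET * (h n * norm (G (x n)) + L * (h n * ?m n)))) \<longlonglongrightarrow> 0" by simp
 qed
 from tendsto_add[OF this Gx] show ?thesis by (simp add: h_def wp_def)
qed

text \<open>A bound independent of \<open>t - s\<close> despite the division: \<open>I1 / h\<close>
  is at most the root of \<open>I2 / h\<close>, and the expectation of \<open>I2\<close> is of order
  \<open>h^2\<close>.\<close>

lemma flow_quotient_square:
 assumes st: "0 \<le> s" "s < t" "t \<le> T" and X: "X \<in> borel_measurable (\<F> s)" and X2: "sq_integrable X"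
 defines "\<alpha> \<equiv> %om. (1 / (t - s)) *\<^sub>R (Z s om (X om) (t - s) - X om - (w t om - w s om))"
 shows "\<alpha> \<in> borel_measurable P" "sq_integrable \<alpha>"
  "(\<integral>om. (norm (\<alpha> om))^2 \<partial>P) \<le> 4 * ((ET * norm (G 0))^2 + (ET * L)^2 * (\<integral>om. (norm (X om))^2 \<partial>P) + (ET * L)^2 * (T * q2))"
proof -
 define h where "h = t - s"
 have h: "0 < h" "h \<in> {0..T}" "s + h \<le> T" "0 \<le> h" using st by (auto simp: h_def)
 have \<alpha>: "\<alpha> om = (1 / h) *\<^sub>R (Z s om (X om) h - X om - wp s om h)" for om by (simp add: \<alpha>_def h_def wp_def)
 show m: "\<alpha> \<in> borel_measurable P"
  unfolding \<alpha>_def using Z_measurable[OF st(1) h(4,3) X] measurable_filtration_P[OF _ X] st w_measurable_all by (simp add: h_def)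
 have le: "norm (\<alpha> om) \<le> ET * norm (G 0) + (ET * L) * norm (X om) + (ET * L) * sqrt (I2 s h om / h)" for om
 proof -
  have "(I1 s h om / h)^2 \<le> I2 s h om / h"
   using I1_I2[OF h(4), of s om] h(1) by (simp add: power_divide divide_le_eq power2_eq_square mult_ac)
  then have I: "I1 s h om / h \<le> sqrt (I2 s h om / h)" by (rule real_le_rsqrt)
  have "norm (\<alpha> om) = norm (Z s om (X om) h - X om - wp s om h) / h" using h(1) by (simp add: \<alpha>)
  also have "\<dots> \<le> ET * (h * norm (G (X om)) + L * I1 s h om) / h" using Z_growth[OF h(2)] h(1) by (intro divide_right_mono) auto
  also have "\<dots> = ET * norm (G (X om)) + (ET * L) * (I1 s h om / h)" using h(1) by (simp add: field_simps)
  also have "\<dots> \<le> ET * (norm (G 0) + L * norm (X om)) + (ET * L) * sqrt (I2 s h om / h)"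
   using ET L0 by (intro add_mono mult_left_mono G_growth I) auto
  finally show ?thesis by (simp add: distrib_left mult.assoc)
 qed
 have sq: "(sqrt (I2 s h om / h))^2 = I2 s h om / h" for om using I2_nonneg h(1) by simp
 have i: "integrable P (%om. (sqrt (I2 s h om / h))^2)" unfolding sq using I2_expectation(1)[OF st(1) h(4,3)] by simp
 have "(\<integral>om. (sqrt (I2 s h om / h))^2 \<partial>P) \<le> h * q2"
  unfolding sq using I2_expectation(2)[OF st(1) h(4,3)] h(1) by (simp add: pos_divide_le_eq power2_eq_square mult_ac)
 also have "\<dots> \<le> T * q2" using h q2_nonneg by (intro mult_right_mono) auto
 finally have "(\<integral>om. (sqrt (I2 s h om / h))^2 \<partial>P) \<le> T * q2" .
 note * = affine_square[OF m le X2 i] and ** = mult_left_mono[OF this zero_le_power2[of "ET * L"]]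
 show "sq_integrable \<alpha>" by (rule *)
 show "(\<integral>om. (norm (\<alpha> om))^2 \<partial>P) \<le> 4 * ((ET * norm (G 0))^2 + (ET * L)^2 * (\<integral>om. (norm (X om))^2 \<partial>P) + (ET * L)^2 * (T * q2))"
  by (rule order_trans[OF *(2)]) (use ** in simp)
qed

text \<open>Both end points of the time interval move towards \<open>\<tau>\<close>, so left and
  right derivatives and the ends of the grid interval are covered together. The two expansions start
  from the same point \<open>x n\<close> and use the same function
  \<open>semi \<Phi> (T - t n)\<close>, so subtracting them cancels the value at
  \<open>x n\<close>.\<close>

lemma interpolation_quotient:
 assumes a: "0 \<le> a" and Y: "Y \<in> borel_measurable (\<F> a)" and Y2: "sq_integrable Y"
  and t: "!!n. a \<le> s n" "!!n. s n < t n" "!!n. t n \<le> T" "s \<longlonglongrightarrow> \<tau>" "t \<longlonglongrightarrow> \<tau>"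
 shows "(%n. (phi a Y (t n) - phi a Y (s n)) / (t n - s n)) \<longlonglongrightarrow> psi1 a Y \<tau> + psi2 a Y \<tau> / 2"
proof -
 define x where "x n = xi a Y (s n)" for n
 define h where "h n = t n - s n" for n
 define x0 where "x0 = xi a Y \<tau>"
 have st: "0 \<le> s n" "s n \<le> t n" "t n \<le> T" "s n \<in> {0..T}" "s n \<le> T" for n using t(1-3)[of n] a by auto
 have aT: "a \<in> {0..T}" using t(1-3)[of 0] a by auto
 have h: "0 < h n" "h n \<in> {0..T}" for n using t(1-3)[of n] a by (auto simp: h_def)
 have hlim: "h \<longlonglongrightarrow> 0" using tendsto_diff[OF t(5,4)] by (simp add: h_def[abs_def])
 have rT: "T - t n \<in> {0..T}" "t n - a \<in> {0..T}" for n using t(1-3)[of n] a by auto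
 have \<tau>: "\<tau> \<in> {a..T}" by (rule closed_sequentially[OF closed_atLeastAtMost _ t(5)]) (use t(3) order_trans[OF t(1) less_imp_le[OF t(2)]] in auto)
 have YP: "Y \<in> borel_measurable P" by (rule measurable_filtration_P[OF aT Y])
 have xF: "x n \<in> borel_measurable (\<F> (s n))" for n unfolding x_def by (rule xi_measurable_filtration[OF a t(1) st(5) Y])
 have xP: "x n \<in> borel_measurable P" for n unfolding x_def by (rule xi_measurable[OF YP])
 have x0P: "x0 \<in> borel_measurable P" unfolding x0_def by (rule xi_measurable[OF YP])
 define Cx where "Cx = 4 * ((ek * (T * norm (Fh 0)))^2 + (ek * (1 + T * LF))^2 * (\<integral>om. (norm (Y om))^2 \<partial>P) + ek^2 * (T * q2))"
 have x2: "sq_integrable (x n)" "(\<integral>om. (norm (x n om))^2 \<partial>P) \<le> Cx" for n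
  unfolding x_def Cx_def by (rule xi_square[OF a t(1) st(5) YP Y2])+
 have x02: "sq_integrable x0"
  unfolding x0_def by (rule xi_square[OF a _ _ YP Y2]) (use \<tau> in auto)
 have xlim: "(%n. x n om) \<longlonglongrightarrow> x0 om" for om unfolding x_def x0_def by (rule xi_tendsto[OF t(4)])
 have FY: "(%om. E u (Fh (Y om))) \<in> borel_measurable P" for u by (intro E_measurable F_measurable YP)

 define \<alpha> where "\<alpha> n om = (1 / h n) *\<^sub>R (E (h n) (x n om) - x n om) + E (t n - a) (Fh (Y om))" for n om
 define \<alpha>0 where "\<alpha>0 om = blinfun_apply AL (x0 om) + E (\<tau> - a) (Fh (Y om))" for om
 have EFY: "norm (E u (Fh (Y om))) \<le> ek * norm (Fh 0) + (ek * LF) * norm (Y om)" if "u \<in> {0..T}" for u om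
  using order_trans[OF E_bound[OF that] mult_left_mono[OF F_growth]] ek by (simp add: distrib_left mult.assoc)
 have \<alpha>le: "norm (\<alpha> n om) \<le> ek * norm (Fh 0) + (ek * LF) * norm (Y om) + (ek * k) * norm (x n om)" for n om
 proof -
  have "norm ((1 / h n) *\<^sub>R (E (h n) (x n om) - x n om)) \<le> exp (h n * k) * k * norm (x n om)"
   using exp_minus_id[of "h n" "x n om"] h(1)[of n] by (simp add: pos_divide_le_eq mult.commute)
  also have "\<dots> \<le> ek * k * norm (x n om)" using h(2)[of n] unfolding ek_def by (intro mult_right_mono) (auto intro: mult_right_mono)
  finally show ?thesis unfolding \<alpha>_def using norm_triangle_ineq[of "(1 / h n) *\<^sub>R (E (h n) (x n om) - x n om)" "E (t n - a) (Fh (Y om))"] EFY[OF rT(2), of n om] by linarith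
 qed
 have \<alpha>m: "\<alpha> n \<in> borel_measurable P" for n
  unfolding \<alpha>_def by (intro borel_measurable_add borel_measurable_scaleR borel_measurable_diff E_measurable xP FY borel_measurable_const)
 note \<alpha>2 = affine_square[OF \<alpha>m \<alpha>le Y2 x2(1)]
 have ALm: "(%om. blinfun_apply AL (x0 om)) \<in> borel_measurable P"
  by (rule measurable_compose[OF x0P borel_measurable_continuous_onI[OF linear_continuous_on[OF blinfun.bounded_linear_right]]])
 have \<alpha>0m: "\<alpha>0 \<in> borel_measurable P" unfolding \<alpha>0_def[abs_def] by (intro borel_measurable_add ALm FY)
 have "norm (\<alpha>0 om) \<le> ek * norm (Fh 0) + (ek * LF) * norm (Y om) + k * norm (x0 om)" for om
  unfolding \<alpha>0_def using norm_triangle_ineq[of "blinfun_apply AL (x0 om)" "E (\<tau> - a) (Fh (Y om))"] EFY[of "\<tau> - a" om] norm_blinfun[of AL "x0 om"] \<tau> a by force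
 note \<alpha>02 = affine_square(1)[OF \<alpha>0m this Y2 x02]
 have \<alpha>lim: "(%n. \<alpha> n om) \<longlonglongrightarrow> \<alpha>0 om" for om
  unfolding \<alpha>_def \<alpha>0_def by (intro tendsto_add drift_quotient_tendsto h hlim xlim E_tendsto tendsto_diff t tendsto_const)
 have \<alpha>C: "(\<integral>om. (norm (\<alpha> n om))^2 \<partial>P) \<le> 4 * ((ek * norm (Fh 0))^2 + (ek * LF)^2 * (\<integral>om. (norm (Y om))^2 \<partial>P) + (ek * k)^2 * Cx)" for n
  by (rule order_trans[OF \<alpha>2(2)]) (use mult_left_mono[OF x2(2)[of n] zero_le_power2[of "ek * k"]] in simp)
 have CE: "norm (E (t n - a) v) \<le> ek * norm v" for n v by (rule E_bound[OF rT(2)])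
 have Elim: "(%n. E (t n - a) e) \<longlonglongrightarrow> E (\<tau> - a) e" for e by (intro E_tendsto tendsto_diff t tendsto_const)
 note LE1 = local_expansion[OF st(1) t(2,3,4,5) xF x2(1) x0P AE_I2[OF xlim] \<alpha>m \<alpha>2(1) \<alpha>C \<alpha>0m \<alpha>02 AE_I2[OF \<alpha>lim] bounded_linear_exp CE Elim]
 have xi_t: "x n om + (t n - s n) *\<^sub>R \<alpha> n om + E (t n - a) (w (t n) om - w (s n) om) = xi a Y (t n) om" for n om
  unfolding xi_step[OF t(1)[of n], of Y "t n" om] \<alpha>_def x_def[symmetric] h_def using t(2)[of n] by (simp add: scaleR_add_right)

 \<comment> \<open>Drift of the exact flow per unit time, the displacement without its noise
   increment; its limit is \<open>G\<close> at \<open>x0\<close>.\<close>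
 define \<beta> where "\<beta> n om = (1 / (t n - s n)) *\<^sub>R (Z (s n) om (x n om) (t n - s n) - x n om - (w (t n) om - w (s n) om))" for n om
 note \<beta> = flow_quotient_square[OF st(1) t(2,3) xF x2(1), folded \<beta>_def]
 have \<beta>lim: "(%n. \<beta> n om) \<longlonglongrightarrow> G (x0 om)" for om
  unfolding \<beta>_def by (rule flow_quotient_tendsto[OF st(1) t(2,3,4,5) xlim])
 have \<beta>C: "(\<integral>om. (norm (\<beta> n om))^2 \<partial>P) \<le> 4 * ((ET * norm (G 0))^2 + (ET * L)^2 * Cx + (ET * L)^2 * (T * q2))" for n
  by (rule order_trans[OF \<beta>(3)]) (use mult_left_mono[OF x2(2)[of n] zero_le_power2[of "ET * L"]] in simp)
 have Gm: "(%om. G (x0 om)) \<in> borel_measurable P" by (rule measurable_compose[OF x0P borel_measurable_continuous_onI[OF cG]])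
 have "norm (G (x0 om)) \<le> norm (G 0) + L * norm (x0 om) + 0 * norm (x0 om)" for om using G_growth by simp
 note G2 = affine_square(1)[OF Gm this x02 x02]
 have id1: "norm v \<le> 1 * norm v" for v :: 'h by simp
 note LE2 = local_expansion[OF st(1) t(2,3,4,5) xF x2(1) x0P AE_I2[OF xlim] \<beta>(1,2) \<beta>C Gm G2 AE_I2[OF \<beta>lim] bounded_linear_ident id1 tendsto_const]
 have Z_t: "x n om + (t n - s n) *\<^sub>R \<beta> n om + (w (t n) om - w (s n) om) = Z (s n) om (x n om) (t n - s n)" for n om
  unfolding \<beta>_def using t(2)[of n] by simp
 \<comment> \<open>The Markov property is used twice: started at \<open>s n\<close> over the whole
   remaining time, and, after splitting the flow at \<open>t n\<close>, started at
   \<open>t n\<close>.\<close>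
 have phi_s: "phi a Y (s n) = (\<integral>om. semi \<Phi> (T - t n) (Z (s n) om (x n om) (t n - s n)) \<partial>P)" for n
 proof -
  have hn: "0 \<le> t n - s n" "s n + (t n - s n) \<le> T" "t n - s n \<in> {0..T}" using st[of n] by auto
  have "phi a Y (s n) = (\<integral>om. \<Phi> (Z (s n) om (x n om) (T - s n)) \<partial>P)"
   unfolding phi_def x_def[symmetric] by (rule markov[OF lip\<Phi> st(1) _ _ xF x2(1), symmetric]) (use st[of n] in auto)
  also have "\<dots> = (\<integral>om. \<Phi> (Z (t n) om (Z (s n) om (x n om) (t n - s n)) (T - t n)) \<partial>P)"
  proof -
   have "Z (s n) om (x n om) (T - s n) = Z (t n) om (Z (s n) om (x n om) (t n - s n)) (T - t n)" for om
    using Z_flow[OF hn(3), of "T - t n" "s n" om "x n om"] st[of n] by simp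
   then show ?thesis by simp
  qed
  also have "\<dots> = (\<integral>om. semi \<Phi> (T - t n) (Z (s n) om (x n om) (t n - s n)) \<partial>P)"
  proof (rule markov[OF lip\<Phi>])
   show "(%om. Z (s n) om (x n om) (t n - s n)) \<in> borel_measurable (\<F> (t n))"
    using Z_measurable_filtration[OF st(1) hn(1,2) xF] by simp
  qed (use st[of n] Z_square_integrable[OF st(1) hn(1,2) xF x2(1)] in auto)
  finally show ?thesis .
 qed
 let ?g = "%v. \<integral>om. g (T - \<tau>) (x0 om) (v om) \<partial>P"
 let ?H = "%C. \<Sum>e\<in>Bs. \<Sum>e'\<in>Bs. (uB e \<bullet> uB e') * (\<integral>om. H (T - \<tau>) (x0 om) (C e) (C e') \<partial>P)"
 have "(%n. (phi a Y (t n) - phi a Y (s n)) / (t n - s n)) \<longlonglongrightarrow> (?g \<alpha>0 + ?H (E (\<tau> - a)) / 2) - (?g (%om. G (x0 om)) + ?H (%e. e) / 2)"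
  using tendsto_diff[OF LE1 LE2] unfolding xi_t Z_t phi_s[symmetric] phi_def[symmetric] by (simp add: diff_divide_distrib)
 moreover have "(?g \<alpha>0 + ?H (E (\<tau> - a)) / 2) - (?g (%om. G (x0 om)) + ?H (%e. e) / 2) = psi1 a Y \<tau> + psi2 a Y \<tau> / 2"
 proof -
  have T\<tau>: "T - \<tau> \<in> {0..T}" using \<tau> a by auto
  have ig: "integrable P (%om. g (T - \<tau>) (x0 om) (v om))" if v: "v \<in> borel_measurable P" "sq_integrable v" for v
  proof (rule Bochner_Integration.integrable_bound[of P "%om. c1 * norm (v om)"])
   show "integrable P (%om. c1 * norm (v om))" using square_integrable_imp_integrable[OF v] by simp
   show "(%om. g (T - \<tau>) (x0 om) (v om)) \<in> borel_measurable P" by (rule g_measurable[OF T\<tau> x0P v(1)])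
   show "AE om in P. norm (g (T - \<tau>) (x0 om) (v om)) \<le> norm (c1 * norm (v om))" using g_bound[OF T\<tau>] c1 by (simp add: abs_mult)
  qed
  have "?g \<alpha>0 - ?g (%om. G (x0 om)) = (\<integral>om. g (T - \<tau>) (x0 om) (\<alpha>0 om) - g (T - \<tau>) (x0 om) (G (x0 om)) \<partial>P)"
   by (rule Bochner_Integration.integral_diff[symmetric]) (rule ig[OF \<alpha>0m \<alpha>02], rule ig[OF Gm G2])
  also have "\<dots> = psi1 a Y \<tau>"
  proof -
   have "g (T - \<tau>) (x0 om) (\<alpha>0 om) - g (T - \<tau>) (x0 om) (G (x0 om)) = g (T - \<tau>) (x0 om) (E (\<tau> - a) (Fh (Y om)) - Fh (x0 om))" for om
    unfolding linear_simps(2)[OF g_linear[OF T\<tau>], symmetric] \<alpha>0_def G_split by simp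
   then show ?thesis unfolding psi1_def x0_def by simp
  qed
  finally have 1: "?g \<alpha>0 - ?g (%om. G (x0 om)) = psi1 a Y \<tau>" .
  have iH: "integrable P (%om. H (T - \<tau>) (x0 om) u v)" for u v
   by (rule integrable_const_bound[where B="c2 * norm u * norm v"]) (use H_bound[OF T\<tau>] H_measurable[OF T\<tau> x0P] in auto)
  have 2: "psi2 a Y \<tau> = ?H (E (\<tau> - a)) - ?H (%e. e)"
   unfolding psi2_def x0_def[symmetric] by (simp add: iH right_diff_distrib sum_subtractf)
  from 1 2 show ?thesis by linarith
 qed
 ultimately show ?thesis by simp
qed

lemma phi_derivative:
 assumes a: "0 \<le> a" "b \<le> T" and Y: "Y \<in> borel_measurable (\<F> a)" and Y2: "sq_integrable Y"
  and \<tau>: "\<tau> \<in> {a..b}"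
 shows "(phi a Y has_real_derivative (psi1 a Y \<tau> + psi2 a Y \<tau> / 2)) (at \<tau> within {a..b})"
 unfolding has_field_derivative_iff tendsto_at_iff_sequentially
proof (intro allI impI)
 fix y assume y: "\<forall>i. y i \<in> {a..b} - {\<tau>}" "y \<longlonglongrightarrow> \<tau>"
 \<comment> \<open>Ordering the two times leaves the difference quotient unchanged and treats both
   sides of \<open>\<tau>\<close> alike.\<close>
 define s t where "s n = min (y n) \<tau>" and "t n = max (y n) \<tau>" for n
 have "(%n. (phi a Y (t n) - phi a Y (s n)) / (t n - s n)) \<longlonglongrightarrow> psi1 a Y \<tau> + psi2 a Y \<tau> / 2"
 proof (rule interpolation_quotient[OF a(1) Y Y2])
  show "a \<le> s n" "s n < t n" "t n \<le> T" for n
   using y(1)[rule_format, of n] \<tau> a by (auto simp: s_def t_def)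
  have "s \<longlonglongrightarrow> min \<tau> \<tau>" "t \<longlonglongrightarrow> max \<tau> \<tau>"
   unfolding s_def[abs_def] t_def[abs_def] by (intro tendsto_intros y(2))+
  then show "s \<longlonglongrightarrow> \<tau>" "t \<longlonglongrightarrow> \<tau>" by simp_all
 qed
 moreover have "(phi a Y (t n) - phi a Y (s n)) / (t n - s n) = (phi a Y (y n) - phi a Y \<tau>) / (y n - \<tau>)" for n
  using minus_divide_divide[of "phi a Y (y n) - phi a Y \<tau>" "y n - \<tau>"]
  by (cases "y n \<le> \<tau>") (simp_all add: s_def t_def min_def max_def)
 ultimately show "((%y. (phi a Y y - phi a Y \<tau>) / (y - \<tau>)) \<circ> y) \<longlonglongrightarrow> psi1 a Y \<tau> + psi2 a Y \<tau> / 2"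
  by (simp add: o_def)
qed

text \<open>Continuity of the integrands is what allows \<open>interpolation_formula\<close> to
  split the integral of the derivative and to pass from gauge to Lebesgue integrals.\<close>

lemma psi1_continuous:
 assumes a: "0 \<le> a" "b \<le> T" and Y: "Y \<in> borel_measurable (\<F> a)" and Y2: "sq_integrable Y"
 shows "continuous_on {a..b} (psi1 a Y)"
 unfolding continuous_on_sequentially o_def
proof (intro allI ballI impI, elim conjE)
 fix t \<tau> assume \<tau>: "\<tau> \<in> {a..b}" and t: "\<forall>n. t n \<in> {a..b}" "t \<longlonglongrightarrow> \<tau>"
 have aT: "a \<in> {0..T}" using \<tau> a by auto
 have YP: "Y \<in> borel_measurable P" by (rule measurable_filtration_P[OF aT Y])
 define \<beta> where "\<beta> t om = g (T - t) (xi a Y t om) (E (t - a) (Fh (Y om)) - Fh (xi a Y t om))" for t om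
 define Cx where "Cx = 4 * ((ek * (T * norm (Fh 0)))^2 + (ek * (1 + T * LF))^2 * (\<integral>om. (norm (Y om))^2 \<partial>P) + ek^2 * (T * q2))"
 have x2: "sq_integrable (xi a Y t)" "(\<integral>om. (norm (xi a Y t om))^2 \<partial>P) \<le> Cx" if "t \<in> {a..b}" for t
  unfolding Cx_def by (rule xi_square[OF a(1) _ _ YP Y2]; use that a in auto)+
 have bm: "\<beta> t \<in> borel_measurable P" if "t \<in> {a..b}" for t
  unfolding \<beta>_def by (intro g_measurable borel_measurable_diff E_measurable F_measurable xi_measurable YP) (use that a in auto)
 have le: "norm (\<beta> t om) \<le> (c1 * ((ek + 1) * norm (Fh 0))) + (c1 * (ek * LF)) * norm (Y om) + (c1 * LF) * norm (xi a Y t om)" if t: "t \<in> {a..b}" for t om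
 proof -
  have tT: "T - t \<in> {0..T}" "t - a \<in> {0..T}" using t a by auto
  have "norm (E (t - a) (Fh (Y om)) - Fh (xi a Y t om)) \<le> norm (E (t - a) (Fh (Y om))) + norm (Fh (xi a Y t om))" by (rule norm_triangle_ineq4)
  also have "\<dots> \<le> ek * (norm (Fh 0) + LF * norm (Y om)) + (norm (Fh 0) + LF * norm (xi a Y t om))"
   using ek by (intro add_mono F_growth order_trans[OF E_bound[OF tT(2)]] mult_left_mono) auto
  finally have "c1 * norm (E (t - a) (Fh (Y om)) - Fh (xi a Y t om)) \<le> c1 * (ek * (norm (Fh 0) + LF * norm (Y om)) + (norm (Fh 0) + LF * norm (xi a Y t om)))"
   by (rule mult_left_mono[OF _ c1])
  with g_bound[OF tT(1), of "xi a Y t om" "E (t - a) (Fh (Y om)) - Fh (xi a Y t om)"] show ?thesis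
   by (simp add: \<beta>_def algebra_simps)
 qed
 note sq = affine_square[OF bm le Y2 x2(1)]
 have ta: "t n \<in> {a..b}" for n using t(1) by blast
 have Tt: "T - t n \<in> {0..T}" for n using ta[of n] a by auto
 have C: "(\<integral>om. (\<beta> (t n) om)^2 \<partial>P) \<le> 4 * ((c1 * ((ek + 1) * norm (Fh 0)))^2 + (c1 * (ek * LF))^2 * (\<integral>om. (norm (Y om))^2 \<partial>P) + (c1 * LF)^2 * Cx)" for n
  using order_trans[OF sq(2)[OF ta[of n] ta[of n] ta[of n]]] mult_left_mono[OF x2(2)[OF ta[of n]] zero_le_power2[of "c1 * LF"]] by simp
 have "(%n. \<integral>om. \<beta> (t n) om \<partial>P) \<longlonglongrightarrow> (\<integral>om. \<beta> \<tau> om \<partial>P)"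
 proof (rule expectation_tendsto_L2_bounded[OF bm[OF ta] bm[OF \<tau>] _ _ C AE_I2])
  show "integrable P (%om. (\<beta> (t n) om)^2)" "integrable P (%om. (\<beta> \<tau> om)^2)" for n
   using sq(1)[OF ta ta ta] sq(1)[OF \<tau> \<tau> \<tau>] by simp_all
  fix om
  have x: "(%n. xi a Y (t n) om) \<longlonglongrightarrow> xi a Y \<tau> om" by (rule xi_tendsto[OF t(2)])
  have "isCont Fh (xi a Y \<tau> om)" using cF by (simp add: continuous_on_eq_continuous_at)
  then show "(%n. \<beta> (t n) om) \<longlonglongrightarrow> \<beta> \<tau> om"
   unfolding \<beta>_def
   by (intro g_tendsto_vec tendsto_diff tendsto_const t(2) x E_tendsto isCont_tendsto_compose[of _ Fh] Tt)
 qed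
 then show "(%n. psi1 a Y (t n)) \<longlonglongrightarrow> psi1 a Y \<tau>" by (simp add: \<beta>_def psi1_def)
qed

lemma psi2_continuous:
 assumes a: "0 \<le> a" "b \<le> T" and Y: "Y \<in> borel_measurable (\<F> a)"
 shows "continuous_on {a..b} (psi2 a Y)"
 unfolding continuous_on_sequentially o_def
proof (intro allI ballI impI, elim conjE)
 fix t \<tau> assume \<tau>: "\<tau> \<in> {a..b}" and t: "\<forall>n. t n \<in> {a..b}" "t \<longlonglongrightarrow> \<tau>"
 have aT: "a \<in> {0..T}" using \<tau> a by auto
 have YP: "Y \<in> borel_measurable P" by (rule measurable_filtration_P[OF aT Y])
 have ta: "t n \<in> {a..b}" for n using t(1) by blast
 have Tt: "T - t n \<in> {0..T}" for n using ta[of n] a by auto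
 define \<beta> where "\<beta> t om = (\<Sum>e\<in>Bs. \<Sum>e'\<in>Bs. (uB e \<bullet> uB e') *
  (H (T - t) (xi a Y t om) (E (t - a) e) (E (t - a) e') - H (T - t) (xi a Y t om) e e'))" for t om
 have bm: "\<beta> t \<in> borel_measurable P" if "t \<in> {a..b}" for t
  unfolding \<beta>_def by (intro borel_measurable_sum borel_measurable_times borel_measurable_diff H_measurable xi_measurable YP borel_measurable_const) (use that a in auto)
 have le: "\<bar>H (T - t) x (E (t - a) e) (E (t - a) e') - H (T - t) x e e'\<bar> \<le> c2 * (ek * norm e) * (ek * norm e') + c2 * norm e * norm e'"
  if t: "t \<in> {a..b}" for t x e e'
 proof -
  have tT: "T - t \<in> {0..T}" "t - a \<in> {0..T}" using t a by auto
  have "c2 * norm (E (t - a) e) * norm (E (t - a) e') \<le> c2 * (ek * norm e) * (ek * norm e')"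
   using ek by (intro mult_mono E_bound[OF tT(2)] mult_nonneg_nonneg c2 order_refl) auto
  then show ?thesis using H_bound[OF tT(1), of x "E (t - a) e" "E (t - a) e'"] H_bound[OF tT(1), of x e e'] by linarith
 qed
 have "(%n. \<integral>om. \<beta> (t n) om \<partial>P) \<longlonglongrightarrow> (\<integral>om. \<beta> \<tau> om \<partial>P)"
 proof (rule integral_dominated_convergence[where w="%_. \<Sum>e\<in>Bs. \<Sum>e'\<in>Bs. \<bar>uB e \<bullet> uB e'\<bar> * (c2 * (ek * norm e) * (ek * norm e') + c2 * norm e * norm e')"])
  show "\<beta> \<tau> \<in> borel_measurable P" "\<beta> (t n) \<in> borel_measurable P" for n using bm[OF \<tau>] bm[OF ta] by blast+
  show "AE om in P. (%n. \<beta> (t n) om) \<longlonglongrightarrow> \<beta> \<tau> om"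
   unfolding \<beta>_def by (intro AE_I2 tendsto_intros H_tendsto_vec xi_tendsto t(2) E_tendsto Tt)
  show "AE om in P. norm (\<beta> (t n) om) \<le> (\<Sum>e\<in>Bs. \<Sum>e'\<in>Bs. \<bar>uB e \<bullet> uB e'\<bar> * (c2 * (ek * norm e) * (ek * norm e') + c2 * norm e * norm e'))" for n
   unfolding \<beta>_def real_norm_def
   by (intro AE_I2 order_trans[OF sum_abs] sum_mono) (auto simp: abs_mult intro!: order_trans[OF sum_abs] sum_mono mult_left_mono le ta)
 qed simp
 then show "(%n. psi2 a Y (t n)) \<longlonglongrightarrow> psi2 a Y \<tau>" by (simp add: \<beta>_def psi2_def)
qed

lemma interpolation_formula:
 assumes a: "0 \<le> a" "a \<le> b" "b \<le> T" and Y: "Y \<in> borel_measurable (\<F> a)" and Y2: "sq_integrable Y"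
 shows "phi a Y b - phi a Y a = (LINT t:{a..b}|lborel. psi1 a Y t) + 1 / 2 * (LINT t:{a..b}|lborel. psi2 a Y t)"
proof -
 note c = psi1_continuous[OF a(1,3) Y Y2] psi2_continuous[OF a(1,3) Y]
 have l: "(LINT t:{a..b}|lborel. f t) = integral {a..b} f" if "continuous_on {a..b} f" for f :: "real => real"
  by (rule set_borel_integral_eq_integral(2)[OF borel_integrable_atLeastAtMost'[OF that]])
 have "((%t. psi1 a Y t + psi2 a Y t / 2) has_integral (phi a Y b - phi a Y a)) {a..b}"
  by (rule fundamental_theorem_of_calculus[OF a(2)])
   (use phi_derivative[OF a(1,3) Y Y2] in \<open>simp add: has_real_derivative_iff_has_vector_derivative\<close>)
 moreover have "((%t. psi1 a Y t + psi2 a Y t / 2) has_integral (integral {a..b} (psi1 a Y) + integral {a..b} (psi2 a Y) / 2)) {a..b}"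
  by (intro has_integral_add has_integral_divide integrable_integral integrable_continuous_real c)
 ultimately show ?thesis unfolding l[OF c(1)] l[OF c(2)] by (simp add: has_integral_unique)
qed

end

subsection \<open>Identification of the mild solution\<close>

lemma sum_list_map_concat_map:
 fixes f :: "'b => 'c :: comm_monoid_add"
 shows "sum_list (map f (concat (map g xs))) = sum_list (map (%x. sum_list (map f (g x))) xs)"
 by (induction xs) auto

lemma step_function_value:
 fixes p :: "nat => real"
 assumes "mono p" "p 0 < s" "s \<le> p N"
 shows "\<exists>j<N. p j < s \<and> s \<le> p (Suc j) \<and> (\<forall>X :: nat => 'b :: real_vector. (\<Sum>j<N. indicator {p j<..p (Suc j)} s *\<^sub>R X j) = X j)"
 using assms
proof (induction N)
 case (Suc N)
 show ?case
 proof (cases "s \<le> p N")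
  case True
  then obtain j where "j < N" "p j < s" "s \<le> p (Suc j)" "\<forall>X :: nat => 'b. (\<Sum>j<N. indicator {p j<..p (Suc j)} s *\<^sub>R X j) = X j"
   using Suc by auto
  with True show ?thesis by (intro exI[of _ j]) auto
 next
  case False
  have "(\<Sum>j<N. indicator {p j<..p (Suc j)} s *\<^sub>R X j) = 0" for X :: "nat => 'b"
  proof (rule sum.neutral, rule ballI)
   fix j assume "j \<in> {..<N}"
   then have "p (Suc j) \<le> p N" using monoD[OF Suc.prems(1), of "Suc j" N] by simp
   then show "indicator {p j<..p (Suc j)} s *\<^sub>R X j = 0" using False by simp
  qed
  then show ?thesis using False Suc.prems by (intro exI[of _ N]) auto
 qed
qed simp

text \<open>Pairing with arbitrary vectors reduces the equality of the two vector-valued integrals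
  to real integrands.\<close>

lemma set_integral_continuous:
 fixes f :: "real => 'b :: {real_inner, banach, second_countable_topology}"
 assumes f: "continuous_on {a..b} f"
 shows "set_integrable lborel {a..b} f" "(LINT x:{a..b}|lborel. f x) = integral {a..b} f"
proof -
 show i: "set_integrable lborel {a..b} f" by (rule borel_integrable_atLeastAtMost'[OF f])
 show "(LINT x:{a..b}|lborel. f x) = integral {a..b} f"
 proof (rule vector_eq_rdot[THEN iffD1, rule_format])
  fix v
  have "(LINT x:{a..b}|lborel. f x) \<bullet> v = (LINT x:{a..b}|lborel. f x \<bullet> v)"
   unfolding set_lebesgue_integral_def
   using integral_inner_left[of v lborel "%x. indicator {a..b} x *\<^sub>R f x"] i by (simp add: set_integrable_def)
  also have "\<dots> = integral {a..b} (%x. f x \<bullet> v)"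
   by (intro set_borel_integral_eq_integral(2) borel_integrable_atLeastAtMost' continuous_intros f)
  also have "\<dots> = integral {a..b} f \<bullet> v"
   using integral_linear[OF integrable_continuous_real[OF f] bounded_linear_inner_left[of v]] by (simp add: o_def)
  finally show "(LINT x:{a..b}|lborel. f x) \<bullet> v = integral {a..b} f \<bullet> v" .
 qed
qed

text \<open>Gronwall for a function that is only measurable with finite integral. The a priori bound
  \<open>R\<close> is improved by iteration: with the exponential weight each application of the
  inequality halves the constant.\<close>

lemma gronwall_AE:
 fixes f :: "real => real"
 assumes f: "f \<in> borel_measurable borel" "!!t. 0 \<le> f t" and c: "0 \<le> c"
  and fin: "(\<integral>\<^sup>+s\<in>{0..T}. ennreal (f s) \<partial>lborel) < \<infinity>"
  and le: "AE t in lborel. t \<in> {0..T} \<longrightarrow> ennreal (f t) \<le> ennreal c * (\<integral>\<^sup>+s\<in>{0..t}. ennreal (f s) \<partial>lborel)"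
 shows "(\<integral>\<^sup>+s\<in>{0..T}. ennreal (f s) \<partial>lborel) = 0"
proof -
 \<comment> \<open>Integrating \<open>exp (d * s)\<close> gains the factor \<open>1 / d\<close>, and
   \<open>c / d\<close> is at most 1/2.\<close>
 define d where "d = 2 * (c + 1)"
 define R where "R = c * enn2real (\<integral>\<^sup>+s\<in>{0..T}. ennreal (f s) \<partial>lborel)"
 have d: "0 < d" using c by (simp add: d_def)
 have R: "0 \<le> R" using c by (simp add: R_def)
 have bound: "AE t in lborel. t \<in> {0..T} \<longrightarrow> f t \<le> (R / 2 ^ n) * exp (d * t)" for n
 proof (induction n)
  case 0
  show ?case using le
  proof eventually_elim
   case (elim t)
   show ?case
   proof
    assume t: "t \<in> {0..T}"
    have "ennreal (f t) \<le> ennreal c * (\<integral>\<^sup>+s\<in>{0..t}. ennreal (f s) \<partial>lborel)" using elim t by simp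
    also have "\<dots> \<le> ennreal c * (\<integral>\<^sup>+s\<in>{0..T}. ennreal (f s) \<partial>lborel)"
     using t by (intro mult_left_mono nn_integral_mono) (auto simp: indicator_def)
    also have "\<dots> = ennreal R" using fin c by (simp add: R_def ennreal_mult)
    finally have "f t \<le> R" using R by (simp add: ennreal_le_iff)
    also have "R * 1 \<le> R * exp (d * t)" using R d t by (intro mult_left_mono) auto
    finally show "f t \<le> (R / 2 ^ 0) * exp (d * t)" by simp
   qed
  qed
 next
  case (Suc n)
  define q where "q = R / 2 ^ n"
  have q: "0 \<le> q" using R by (simp add: q_def)
  show ?case using le
  proof eventually_elim
   case (elim t)
   show ?case
   proof
    assume t: "t \<in> {0..T}"
    have "ennreal (f t) \<le> ennreal c * (\<integral>\<^sup>+s\<in>{0..t}. ennreal (f s) \<partial>lborel)" using elim t by simp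
    also have "(\<integral>\<^sup>+s\<in>{0..t}. ennreal (f s) \<partial>lborel) \<le> (\<integral>\<^sup>+s\<in>{0..t}. ennreal (q * exp (d * s)) \<partial>lborel)"
    proof (rule nn_integral_mono_AE)
     show "AE s in lborel. ennreal (f s) * indicator {0..t} s \<le> ennreal (q * exp (d * s)) * indicator {0..t} s"
      using Suc unfolding q_def[symmetric]
      by eventually_elim (use t in \<open>auto simp: indicator_def intro!: ennreal_leI\<close>)
    qed
    also have "(\<integral>\<^sup>+s\<in>{0..t}. ennreal (q * exp (d * s)) \<partial>lborel) = ennreal (integral {0..t} (%s. q * exp (d * s)))"
     by (rule nn_integral_eq_integral_continuous) (use q in \<open>auto intro!: continuous_intros\<close>)
    also have "integral {0..t} (%s. q * exp (d * s)) = q * exp (d * t) / d - q * exp (d * 0) / d"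
    proof (rule integral_unique, rule fundamental_theorem_of_calculus)
     show "((%s. q * exp (d * s) / d) has_vector_derivative q * exp (d * s)) (at s within {0..t})" for s
      unfolding has_real_derivative_iff_has_vector_derivative[symmetric] using d by (auto intro!: derivative_eq_intros)
    qed (use t in auto)
    finally have "ennreal (f t) \<le> ennreal c * ennreal (q * exp (d * t) / d - q * exp (d * 0) / d)"
     by (rule order_trans) (auto intro: mult_left_mono)
    also have "\<dots> \<le> ennreal (c * (q * exp (d * t) / d))"
    proof -
     have "1 \<le> exp (d * t)" using d t by simp
     then have "q * 1 \<le> q * exp (d * t)" by (rule mult_left_mono[OF _ q])
     then have nn: "0 \<le> q * exp (d * t) / d - q * exp (d * 0) / d" using d by (simp add: divide_right_mono)
     have "q * exp (d * t) / d - q * exp (d * 0) / d \<le> q * exp (d * t) / d" using q d by simp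
     then show ?thesis unfolding ennreal_mult[OF c nn, symmetric] by (intro ennreal_leI mult_left_mono c)
    qed
    also have "\<dots> \<le> ennreal ((q / 2) * exp (d * t))"
    proof (rule ennreal_leI)
     have "c / d \<le> 1 / 2" using c by (simp add: d_def field_simps)
     then have "(c / d) * (q * exp (d * t)) \<le> (1 / 2) * (q * exp (d * t))" using q by (intro mult_right_mono) auto
     then show "c * (q * exp (d * t) / d) \<le> (q / 2) * exp (d * t)" by simp
    qed
    finally have "f t \<le> (q / 2) * exp (d * t)" using q by (simp add: ennreal_le_iff)
    then show "f t \<le> (R / 2 ^ Suc n) * exp (d * t)" by (simp add: q_def mult.commute)
   qed
  qed
 qed
 have "AE t in lborel. \<forall>n. t \<in> {0..T} \<longrightarrow> f t \<le> (R / 2 ^ n) * exp (d * t)"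
  unfolding AE_all_countable using bound by (rule allI)
 then have "AE t in lborel. ennreal (f t) * indicator {0..T} t = 0"
 proof eventually_elim
  case (elim t)
  have "f t \<le> 0" if "t \<in> {0..T}"
  proof (rule LIMSEQ_le_const)
   have "(%n. (1 / 2) ^ n * (R * exp (d * t))) \<longlonglongrightarrow> 0 * (R * exp (d * t))"
    by (intro tendsto_intros LIMSEQ_power_zero) simp
   then show "(%n. (R / 2 ^ n) * exp (d * t)) \<longlonglongrightarrow> 0" by (simp add: power_divide)
  qed (use elim that in auto)
  then show ?case using f(2)[of t] by (auto simp: indicator_def)
 qed
 then show ?thesis using f by (subst nn_integral_0_iff_AE) auto
qed

context euler_scheme
begin

text \<open>Expanding \<open>B\<close> in the directions \<open>uB e\<close> makes a piecewise
  constant integrand built from operators applied to \<open>B\<close> elementary, with one list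
  entry for each interval and basis vector.\<close>

lemma riemann_elem:
 fixes D :: "nat => 'h => 'h"
 assumes D: "!!j. bounded_linear (D j)"
 obtains S where "!!s v. elem_integrand S s v = (\<Sum>j<N. indicator {p j<..p (Suc j)} s *\<^sub>R D j (B v))"
  "!!om. elem_integral W S om = (\<Sum>j<N. \<Sum>e\<in>Bs. (W (p (Suc j)) (uB e) om - W (p j) (uB e) om) *\<^sub>R D j e)"
  "set S = {(p j, p (Suc j), uB e, D j e) |j e. j < N \<and> e \<in> Bs}"
proof -
 obtain bs where bs: "set bs = Bs" "distinct bs" using finite_distinct_list[OF fB] by blast
 define S where "S = concat (map (%j. map (%e. (p j, p (Suc j), uB e, D j e)) bs) [0..<N])"
 have s: "sum_list (map f S) = (\<Sum>j<N. \<Sum>e\<in>Bs. f (p j, p (Suc j), uB e, D j e))" for f :: "_ => 'h"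
  unfolding S_def sum_list_map_concat_map
  using bs by (simp add: sum_list_distinct_conv_sum_set o_def atLeast0LessThan)
 have DB: "D j (B v) = (\<Sum>e\<in>Bs. (uB e \<bullet> v) *\<^sub>R D j e)" for j v
 proof -
  interpret bounded_linear "D j" by (rule D)
  show ?thesis by (subst B_expand) (simp add: sum scaleR inner_commute)
 qed
 show thesis
 proof (rule that)
  show "elem_integrand S s v = (\<Sum>j<N. indicator {p j<..p (Suc j)} s *\<^sub>R D j (B v))" for s v
   unfolding elem_integrand_def s DB by (simp add: scaleR_sum_right)
  show "elem_integral W S om = (\<Sum>j<N. \<Sum>e\<in>Bs. (W (p (Suc j)) (uB e) om - W (p j) (uB e) om) *\<^sub>R D j e)" for om
   unfolding elem_integral_def s by simp
  show "set S = {(p j, p (Suc j), uB e, D j e) |j e. j < N \<and> e \<in> Bs}"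
   unfolding S_def using bs by auto blast
 qed
qed

text \<open>If the integrand varies by at most \<open>c / (k + 1)\<close> in operator norm over the
  intervals of the partition, its Riemann approximations converge in Hilbert-Schmidt norm; a
  pathwise limit of the sums then is the Wiener integral.\<close>

lemma wiener_integral_riemann:
 fixes D :: "real => 'h => 'h" and I :: "'w => 'h"
 assumes ab: "0 \<le> a" "a \<le> b" "b \<le> T" and D: "!!s. bounded_linear (D s)" "!!s x. x \<in> V ==> D s x \<in> V"
  and Dm: "!!x. (%s. D s x) \<in> borel_measurable borel"
 defines "p \<equiv> %k j. a + real j * ((b - a) / real (Suc k))"
 assumes Dc: "!!k j s x. p k j \<in> {a..b} ==> s \<in> {p k j..p k (Suc j)} ==> s \<le> b ==> norm (D s x - D (p k j) x) \<le> (c / real (Suc k)) * norm x"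
  and I: "!!om. (%k. \<Sum>j<Suc k. D (p k j) (w (p k (Suc j)) om - w (p k j) om)) \<longlonglongrightarrow> I om"
 shows "AE om in P. wiener_integral P W V a b (%s u. D s (B u)) om = I om"
proof (rule wiener_integral_eq[OF subspaceV ab(1,3) Dm])
 have "\<forall>k. \<exists>S. (\<forall>s v. elem_integrand S s v = (\<Sum>j<Suc k. indicator {p k j<..p k (Suc j)} s *\<^sub>R D (p k j) (B v)))
  \<and> (\<forall>om. elem_integral W S om = (\<Sum>j<Suc k. \<Sum>e\<in>Bs. (W (p k (Suc j)) (uB e) om - W (p k j) (uB e) om) *\<^sub>R D (p k j) e))
  \<and> set S = {(p k j, p k (Suc j), uB e, D (p k j) e) |j e. j < Suc k \<and> e \<in> Bs}"
  (is "\<forall>k. \<exists>S. ?R k S")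
 proof
  fix k show "\<exists>S. ?R k S"
   by (rule riemann_elem[where D="%j. D (p k j)" and N="Suc k" and p="p k", OF D(1)]) blast
 qed
 from choice[OF this] obtain S where "\<forall>k. ?R k (S k)" by (rule exE)
 then have S: "!!k s v. elem_integrand (S k) s v = (\<Sum>j<Suc k. indicator {p k j<..p k (Suc j)} s *\<^sub>R D (p k j) (B v))"
  "!!k om. elem_integral W (S k) om = (\<Sum>j<Suc k. \<Sum>e\<in>Bs. (W (p k (Suc j)) (uB e) om - W (p k j) (uB e) om) *\<^sub>R D (p k j) e)"
  "!!k. set (S k) = {(p k j, p k (Suc j), uB e, D (p k j) e) |j e. j < Suc k \<and> e \<in> Bs}" by blast+
 have pm: "mono (p k)" for k
  unfolding p_def using ab by (intro monoI add_left_mono mult_right_mono) auto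
 have p0: "p k 0 = a" and pN: "p k (Suc k) = b" for k by (simp_all add: p_def)
 have pab: "a \<le> p k j" "p k j \<le> p k (Suc j)" "p k (Suc j) \<le> b" if "j < Suc k" for k j
  using monoD[OF pm, of 0 j k] monoD[OF pm, of j "Suc j" k] monoD[OF pm, of "Suc j" "Suc k" k] that p0[of k] pN[of k] by auto
 show "has_wiener_integral P W V a b (%s u. D s (B u)) I"
 proof (rule has_wiener_integralI[OF subspaceV ab(1,3) Dm])
  show "valid_elem a b V (S k)" for k
   unfolding valid_elem_def S(3) using pab D(2) BsV by auto
  obtain r where r: "0 \<le> r" "hs_norm_sq B = ennreal r" using hsB by (cases "hs_norm_sq B") auto
  have le: "hs_norm_sq (%v. D s (B v) - elem_integrand (S k) s v) \<le> ennreal ((c / real (Suc k))^2 * r)" if s: "a < s" "s \<le> b" for s k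
  proof -
   obtain j where j: "j < Suc k" "p k j < s" "s \<le> p k (Suc j)" "!!X :: nat => 'h. (\<Sum>j<Suc k. indicator {p k j<..p k (Suc j)} s *\<^sub>R X j) = X j"
    using step_function_value[OF pm, of k s "Suc k"] s unfolding p0 pN by blast
   have "hs_norm_sq (%v. D s (B v) - elem_integrand (S k) s v) = hs_norm_sq (%v. (%x. D s x - D (p k j) x) (B v))"
    unfolding S(1) j(4) ..
   also have "\<dots> \<le> ennreal ((c / real (Suc k))^2) * hs_norm_sq B"
    by (rule hs_norm_sq_compose_le) (use Dc[of k j s] pab[OF j(1)] j s in auto)
   finally show ?thesis by (simp add: r ennreal_mult)
  qed
  have le2: "(\<integral>\<^sup>+s\<in>{a..b}. hs_norm_sq (%v. D s (B v) - elem_integrand (S k) s v) \<partial>lborel) \<le> ennreal ((c / real (Suc k))^2 * r * (b - a))" for k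
  proof -
   \<comment> \<open>The half-open intervals of the partition miss the point \<open>a\<close>, hence
     the comparison holds only almost everywhere.\<close>
   have "(\<integral>\<^sup>+s\<in>{a..b}. hs_norm_sq (%v. D s (B v) - elem_integrand (S k) s v) \<partial>lborel)
     \<le> (\<integral>\<^sup>+s. ennreal ((c / real (Suc k))^2 * r) * indicator {a..b} s \<partial>lborel)"
    by (rule nn_integral_mono_AE) (use AE_lborel_singleton[of a] in \<open>eventually_elim, use le in \<open>auto simp: indicator_def\<close>\<close>)
   also have "\<dots> = ennreal ((c / real (Suc k))^2 * r * (b - a))" using ab r by (simp add: nn_integral_cmult ennreal_mult)
   finally show ?thesis .
  qed
  have lim2: "(%k. ennreal ((c / real (Suc k))^2 * r * (b - a))) \<longlonglongrightarrow> 0"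
  proof -
   have "(%k. (c * inverse (real (Suc k)))^2 * r * (b - a)) \<longlonglongrightarrow> (c * 0)^2 * r * (b - a)"
    by (intro tendsto_intros LIMSEQ_inverse_real_of_nat)
   then show ?thesis using tendsto_ennrealI[of _ 0] by (simp add: divide_inverse)
  qed
  show "(%k. \<integral>\<^sup>+s\<in>{a..b}. hs_norm_sq (%v. D s (B v) - elem_integrand (S k) s v) \<partial>lborel) \<longlonglongrightarrow> 0"
   by (rule tendsto_sandwich[OF _ always_eventually[OF allI[OF le2]] tendsto_const lim2]) simp
  have Dc': "(%om. D s (w t om - w t' om)) \<in> borel_measurable P" for s t t'
   by (rule measurable_compose[OF _ borel_measurable_continuous_onI[OF linear_continuous_on[OF D(1)]]]) (intro borel_measurable_diff w_measurable_all)
  show "I \<in> borel_measurable P"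
   by (rule borel_measurable_LIMSEQ_metric[OF _ I]) (intro borel_measurable_sum Dc')
  show "I om \<in> V" for om
   by (rule closed_sequentially[OF closedV _ I]) (intro subspace_sum[OF subspaceV] D(2) subspace_diff[OF subspaceV] w_V)
  show "AE om in P. (%k. elem_integral W (S k) om) \<longlonglongrightarrow> I om"
   using w_AE
  proof eventually_elim
   fix om assume ww: "\<forall>t\<in>{0..T}. w t om = (\<Sum>e\<in>Bs. W t (uB e) om *\<^sub>R e)"
   have "elem_integral W (S k) om = (\<Sum>j<Suc k. D (p k j) (w (p k (Suc j)) om - w (p k j) om))" for k
    unfolding S(2)
   proof (rule sum.cong[OF refl])
    fix j assume "j \<in> {..<Suc k}"
    then have j: "p k j \<in> {0..T}" "p k (Suc j) \<in> {0..T}" using pab[of j k] ab by auto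
    interpret bounded_linear "D (p k j)" by (rule D)
    show "(\<Sum>e\<in>Bs. (W (p k (Suc j)) (uB e) om - W (p k j) (uB e) om) *\<^sub>R D (p k j) e) = D (p k j) (w (p k (Suc j)) om - w (p k j) om)"
     using ww j by (simp add: diff sum scaleR scaleR_diff_left sum_subtractf)
   qed
   then show "(%k. elem_integral W (S k) om) \<longlonglongrightarrow> I om" using I by simp
  qed
 qed
qed

lemma wiener_integral_const:
 assumes ab: "0 \<le> a" "a \<le> b" "b \<le> T"
 shows "AE om in P. wiener_integral P W V a b (%s u. E t (B u)) om = E t (w b om - w a om)"
proof (rule wiener_integral_riemann[OF ab, where c=0])
 interpret bounded_linear "E t" by (rule bounded_linear_exp)
 fix om
 let ?p = "%k j. a + real j * ((b - a) / real (Suc k))"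
 have "(\<Sum>j<Suc k. E t (w (?p k (Suc j)) om - w (?p k j) om)) = E t (w b om - w a om)" for k
 proof -
  have "(\<Sum>j<Suc k. E t (w (?p k (Suc j)) om - w (?p k j) om)) = E t (\<Sum>j<Suc k. w (?p k (Suc j)) om - w (?p k j) om)" by (simp only: sum)
  also have "(\<Sum>j<Suc k. w (?p k (Suc j)) om - w (?p k j) om) = w (?p k (Suc k)) om - w (?p k 0) om"
   by (rule sum_lessThan_telescope)
  finally show ?thesis by simp
 qed
 then show "(%k. \<Sum>j<Suc k. E t (w (?p k (Suc j)) om - w (?p k j) om)) \<longlonglongrightarrow> E t (w b om - w a om)" by simp
qed (auto intro: bounded_linear_exp exp_V)

text \<open>The stochastic convolution after integration by parts, which moves the derivative from
  the path to the exponential and so makes sense for every continuous path.\<close>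

definition "conv t om = w t om + integral {0..t} (%s. E (t - s) (blinfun_apply AL (w s om)))"

lemma E_continuous_on: "continuous_on S f ==> continuous_on S h ==> continuous_on S (%s. E (f s) (h s))"
 using bounded_bilinear.continuous_on[OF bounded_bilinear_blinfun_apply continuous_on_Eb, of S f h] by simp

lemma AL_continuous_on: "continuous_on S h ==> continuous_on S (%s. blinfun_apply AL (h s))"
 by (intro continuous_intros)

lemma E_lag: assumes "p \<le> s" "s \<le> t" "0 \<le> p" "t \<le> T" shows "norm (E (t - s) x - E (t - p) x) \<le> (s - p) * (ek * (ek * k)) * norm x"
proof -
 have "E (t - s) x - E (t - p) x = E (t - s) (x - E (s - p) x)"
  using exp_semigroup[of "s - p" "t - s" x] assms linear_simps(2)[OF bounded_linear_exp, of "t - s" x "E (s - p) x"] by simp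
 then have "norm (E (t - s) x - E (t - p) x) \<le> ek * norm (E (s - p) x - x)"
  using E_bound[of "t - s" "x - E (s - p) x"] assms by (simp add: norm_minus_commute)
 also have "norm (E (s - p) x - x) \<le> (s - p) * (exp ((s - p) * k) * k * norm x)" using exp_minus_id assms by simp
 also have "\<dots> \<le> (s - p) * (ek * k * norm x)"
  unfolding ek_def using assms by (intro mult_left_mono mult_right_mono) (auto intro!: mult_right_mono)
 finally show ?thesis using ek by (simp add: mult_left_mono mult_ac)
qed

text \<open>Summation by parts: each Riemann term is compared with an increment of \<open>J\<close>,
  and these increments telescope to \<open>conv t om\<close>. The discrepancy on a short interval is
  at most its length times the oscillation of \<open>w\<close> there.\<close>

lemma conv_riemann:
 assumes t: "t \<in> {0..T}"
 shows "(%N. \<Sum>j<Suc N. E (t - real j * (t / real (Suc N))) (w (real (Suc j) * (t / real (Suc N))) om - w (real j * (t / real (Suc N))) om)) \<longlonglongrightarrow> conv t om"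
proof (rule LIMSEQ_I)
 fix e :: real assume e: "0 < e"
 let ?f = "%r. E (t - r) (blinfun_apply AL (w r om))"
 define c where "c = ek * k"
 have c: "0 \<le> c" using ek by (simp add: c_def)
 \<comment> \<open>Chosen so that \<open>J t - J 0 = conv t om\<close> and that a Riemann term
   differs from the increment of \<open>J\<close> only by the integral of \<open>E (t - r)\<close>
   applied to \<open>AL\<close> of \<open>w s' om - w r om\<close>.\<close>
 define J where "J s = integral {0..s} ?f + E (t - s) (w s om)" for s
 have cf: "continuous_on S ?f" for S by (intro E_continuous_on AL_continuous_on w_continuous continuous_intros)
 define q where "q = e / (t * c + 1)"
 have tc: "0 \<le> t * c" using t c by simp
 then have q: "0 < q" using e by (simp add: q_def add_nonneg_pos)
 have "uniformly_continuous_on {0..t} (%s. w s om)" by (rule compact_uniformly_continuous[OF w_continuous]) simp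
 then obtain d where d: "0 < d" "!!r s. r \<in> {0..t} ==> s \<in> {0..t} ==> dist r s < d ==> dist (w r om) (w s om) < q"
  unfolding uniformly_continuous_on_def using q by metis
 obtain N0 where N0: "t / d < real N0" using reals_Archimedean2 by blast
 have inc: "norm (E (t - s) (w s' om - w s om) - (J s' - J s)) \<le> c * q * (s' - s)" if s: "0 \<le> s" "s \<le> s'" "s' \<le> t" "s' - s < d" for s s'
 proof -
  let ?h = "%r. E (t - r) (blinfun_apply AL (w s' om))"
  have ch: "continuous_on S ?h" for S by (intro E_continuous_on AL_continuous_on continuous_intros)
  have "((%r. ?h r) has_integral (- E (t - s') (w s' om) - - E (t - s) (w s' om))) {s..s'}"
  proof (rule fundamental_theorem_of_calculus[OF s(2)])
   fix r
   have "((%r. E (t - r) (w s' om)) has_vector_derivative (E (t - r) 0 - ?h r)) (at r within {s..s'})"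
    by (rule exp_convolution_derivative[OF has_vector_derivative_const])
   from has_vector_derivative_minus[OF this]
   show "((%r. - E (t - r) (w s' om)) has_vector_derivative ?h r) (at r within {s..s'})"
    by (simp add: linear_simps(3)[OF bounded_linear_exp])
  qed
  then have ih: "integral {s..s'} ?h = E (t - s) (w s' om) - E (t - s') (w s' om)" by (simp add: integral_unique)
  have "integral {0..s'} ?f = integral {0..s} ?f + integral {s..s'} ?f"
   by (rule Henstock_Kurzweil_Integration.integral_combine[symmetric]) (use s in \<open>auto intro: integrable_continuous_real cf\<close>)
  then have "E (t - s) (w s' om - w s om) - (J s' - J s) = integral {s..s'} ?h - integral {s..s'} ?f"
   unfolding J_def ih by (simp add: linear_simps(2)[OF bounded_linear_exp])
  also have "\<dots> = integral {s..s'} (%r. ?h r - ?f r)"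
   by (rule Henstock_Kurzweil_Integration.integral_diff[symmetric]) (auto intro: integrable_continuous_real cf ch)
  also have "norm \<dots> \<le> c * q * (s' - s)"
  proof (rule integral_bound[OF s(2)])
   show "continuous_on {s..s'} (%r. ?h r - ?f r)" by (intro continuous_on_diff cf ch)
   fix r assume r: "r \<in> {s..s'}"
   have "?h r - ?f r = E (t - r) (blinfun_apply AL (w s' om - w r om))"
    by (simp add: linear_simps(2)[OF bounded_linear_exp] blinfun.diff_right)
   then have "norm (?h r - ?f r) \<le> ek * norm (blinfun_apply AL (w s' om - w r om))" using E_bound[of "t - r"] r s t by simp
   also have "\<dots> \<le> ek * (k * q)"
   proof (rule mult_left_mono)
    have "norm (w s' om - w r om) \<le> q" using d(2)[of s' r] r s by (simp add: dist_norm)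
    then show "norm (blinfun_apply AL (w s' om - w r om)) \<le> k * q" by (intro order_trans[OF norm_blinfun] mult_left_mono) auto
   qed (use ek in simp)
   finally show "norm (?h r - ?f r) \<le> c * q" by (simp add: c_def mult.assoc)
  qed
  finally show ?thesis .
 qed
 have bound: "norm ((\<Sum>j<Suc N. E (t - real j * (t / real (Suc N))) (w (real (Suc j) * (t / real (Suc N))) om - w (real j * (t / real (Suc N))) om)) - conv t om) < e"
  if N: "N0 \<le> N" for N
 proof -
  define h where "h = t / real (Suc N)"
  have h: "0 \<le> h" "h < d" "real (Suc N) * h = t"
  proof -
   have "t < d * real (Suc N)" using N0 N d(1) by (simp add: pos_divide_less_eq mult.commute) (smt (verit) mult_left_mono of_nat_le_iff distrib_left)
   then show "h < d" by (simp add: h_def pos_divide_less_eq del: of_nat_Suc)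
  qed (use t in \<open>auto simp: h_def\<close>)
  have jt: "real (Suc j) * h \<le> t" if "j < Suc N" for j
   using mult_right_mono[of "real (Suc j)" "real (Suc N)" h] that h by simp
  have "J t - J 0 = conv t om" by (simp add: J_def conv_def exp_0 w_0 linear_simps(3)[OF bounded_linear_exp])
  moreover have "J t - J 0 = (\<Sum>j<Suc N. J (real (Suc j) * h) - J (real j * h))"
   by (subst sum_lessThan_telescope) (simp only: h of_nat_0 mult_zero_left)
  ultimately have eqn: "(\<Sum>j<Suc N. E (t - real j * h) (w (real (Suc j) * h) om - w (real j * h) om)) - conv t om
    = (\<Sum>j<Suc N. E (t - real j * h) (w (real (Suc j) * h) om - w (real j * h) om) - (J (real (Suc j) * h) - J (real j * h)))"
   by (simp only: sum_subtractf)
  have "norm ((\<Sum>j<Suc N. E (t - real j * h) (w (real (Suc j) * h) om - w (real j * h) om)) - conv t om) \<le> (\<Sum>j<Suc N. c * q * h)"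
   unfolding eqn
  proof (rule sum_norm_le)
   fix j assume j: "j \<in> {..<Suc N}"
   have "real (Suc j) * h - real j * h = h" by (simp add: distrib_right)
   then show "norm (E (t - real j * h) (w (real (Suc j) * h) om - w (real j * h) om) - (J (real (Suc j) * h) - J (real j * h))) \<le> c * q * h"
    using inc[of "real j * h" "real (Suc j) * h"] h jt[of j] j by simp
  qed
  also have "\<dots> = c * q * (real (Suc N) * h)" by (simp only: sum_constant card_lessThan mult_ac)
  also have "\<dots> = e * ((t * c) / (t * c + 1))"
   unfolding h(3) q_def by (simp only: times_divide_eq_right times_divide_eq_left mult_ac)
  also have "\<dots> < e * 1"
  proof (rule mult_strict_left_mono[OF _ e])
   have "x / (x + 1) < 1" if "0 \<le> x" for x :: real using that by simp
   from this[OF tc] show "(t * c) / (t * c + 1) < 1" .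
  qed
  finally show ?thesis unfolding h_def[symmetric] by (simp only: mult_1_right)
 qed
 show "\<exists>N0. \<forall>N\<ge>N0. norm ((\<Sum>j<Suc N. E (t - real j * (t / real (Suc N))) (w (real (Suc j) * (t / real (Suc N))) om - w (real j * (t / real (Suc N))) om)) - conv t om) < e"
  by (rule exI[of _ N0], intro allI impI, rule bound)
qed

lemma wiener_integral_convolution:
 assumes t: "t \<in> {0..T}"
 shows "AE om in P. wiener_integral P W V 0 t (%s u. E (t - s) (B u)) om = conv t om"
proof (rule wiener_integral_riemann[where D="%s. E (t - s)" and c="t * (ek * (ek * k))"])
 show "(%s. E (t - s) x) \<in> borel_measurable borel" for x
  by (intro borel_measurable_continuous_onI E_continuous_on continuous_intros)
 fix N j s x
 let ?p = "%j. 0 + real j * ((t - 0) / real (Suc N))"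
 assume p: "?p j \<in> {0..t}" and s: "s \<in> {?p j..?p (Suc j)}" "s \<le> t"
 have "norm (E (t - s) x - E (t - ?p j) x) \<le> (s - ?p j) * (ek * (ek * k)) * norm x"
  by (rule E_lag) (use p s t in auto)
 also have "\<dots> \<le> (t / real (Suc N)) * (ek * (ek * k)) * norm x"
 proof (intro mult_right_mono)
  have "real (Suc j) * q = real j * q + q" for q :: real by (simp add: distrib_right)
  from this[of "(t - 0) / real (Suc N)"] s(1) show "s - ?p j \<le> t / real (Suc N)" by (simp del: of_nat_Suc)
 qed (use ek in auto)
 finally show "norm (E (t - s) x - E (t - ?p j) x) \<le> (t * (ek * (ek * k)) / real (Suc N)) * norm x" by simp
next
 fix om
 show "(%N. \<Sum>j<Suc N. E (t - (0 + real j * ((t - 0) / real (Suc N)))) (w (0 + real (Suc j) * ((t - 0) / real (Suc N))) om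
   - w (0 + real j * ((t - 0) / real (Suc N))) om)) \<longlonglongrightarrow> conv t om"
  unfolding diff_zero add_0 by (rule conv_riemann[OF t])
qed (use t in \<open>auto intro: bounded_linear_exp exp_V\<close>)

text \<open>\<open>Z - w\<close> is continuously differentiable along each path; differentiating it
  under \<open>E (t - s)\<close> is variation of constants, with \<open>AL\<close> of
  \<open>w\<close> appearing as the additional source that \<open>conv\<close> contains.\<close>

lemma Z_mild:
 assumes t: "t \<in> {0..T}"
 shows "Z 0 om x t = E t x + integral {0..t} (%s. E (t - s) (Fh (Z 0 om x s))) + conv t om"
proof -
 define y where "y s = x + integral {0..s} (%r. G (Z 0 om x r))" for s
 have Zy: "Z 0 om x s = y s + w s om" if "s \<in> {0..T}" for s
  using Z_solves[of 0 om x] that unfolding solves_def wp_from_0 y_def by simp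
 have cZ: "continuous_on {0..t} (Z 0 om x)" by (rule continuous_on_subset[OF Z_continuous]) (use t in auto)
 have cFZ: "continuous_on {0..t} (%s. E (t - s) (Fh (Z 0 om x s)))"
  by (intro E_continuous_on continuous_intros continuous_on_compose2[OF cF cZ]) auto
 have cw: "continuous_on {0..t} (%s. E (t - s) (blinfun_apply AL (w s om)))"
  by (intro E_continuous_on AL_continuous_on w_continuous continuous_intros)
 have "((%s. E (t - s) (Fh (Z 0 om x s)) + E (t - s) (blinfun_apply AL (w s om))) has_integral (E (t - t) (y t) - E (t - 0) (y 0))) {0..t}"
 proof (rule fundamental_theorem_of_calculus)
  fix s assume s: "s \<in> {0..t}"
  have "(y has_vector_derivative (G (Z 0 om x s))) (at s within {0..t})"
   unfolding y_def using s
   by (auto intro!: derivative_eq_intros integral_has_vector_derivative continuous_on_compose2[OF cG cZ])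
  from exp_convolution_derivative[OF this, of t]
  have "((%s. E (t - s) (y s)) has_vector_derivative (E (t - s) (G (Z 0 om x s) - blinfun_apply AL (y s)))) (at s within {0..t})"
   by (simp add: linear_simps(2)[OF bounded_linear_exp])
  also have "G (Z 0 om x s) - blinfun_apply AL (y s) = Fh (Z 0 om x s) + blinfun_apply AL (w s om)"
   using Zy[of s] s t by (simp add: G_split blinfun.add_right)
  finally show "((%s. E (t - s) (y s)) has_vector_derivative (E (t - s) (Fh (Z 0 om x s)) + E (t - s) (blinfun_apply AL (w s om)))) (at s within {0..t})"
   by (simp add: linear_simps(1)[OF bounded_linear_exp])
 qed (use t in auto)
 moreover have "((%s. E (t - s) (Fh (Z 0 om x s)) + E (t - s) (blinfun_apply AL (w s om))) has_integral
   (integral {0..t} (%s. E (t - s) (Fh (Z 0 om x s))) + integral {0..t} (%s. E (t - s) (blinfun_apply AL (w s om))))) {0..t}"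
  by (intro has_integral_add integrable_integral integrable_continuous_real cFZ cw)
 ultimately have "E (t - t) (y t) - E (t - 0) (y 0) = integral {0..t} (%s. E (t - s) (Fh (Z 0 om x s))) + integral {0..t} (%s. E (t - s) (blinfun_apply AL (w s om)))"
  by (rule has_integral_unique)
 then have "y t = E t x + integral {0..t} (%s. E (t - s) (Fh (Z 0 om x s))) + integral {0..t} (%s. E (t - s) (blinfun_apply AL (w s om)))"
  by (simp add: exp_0 y_def algebra_simps)
 then show ?thesis using Zy[OF t] by (simp add: conv_def)
qed

lemma Z_continuous_UNIV: "continuous_on UNIV (%t. Z 0 om x (cl t))"
 by (rule continuous_on_compose2[OF Z_continuous]) (auto simp: cl_def intro!: continuous_intros T0)

lemma Z_joint: "(%(t, om). Z 0 om x (cl t)) \<in> borel_measurable (borel \<Otimes>\<^sub>M P)"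
proof (rule caratheodory_measurable)
 show "(%om. Z 0 om x (cl t)) \<in> borel_measurable P" for t
  using Z_measurable[of 0 "cl t" "%_. x"] cl(1)[of t] by simp
qed (rule Z_continuous_UNIV)

text \<open>The mild equation holds almost surely for each time separately and no path continuity of
  \<open>X\<close> is assumed. Fubini turns this into an inequality for almost every time along
  almost every path, \<open>gronwall_AE\<close> makes the integrated drift difference vanish, and
  the equation at \<open>t\<close> then gives equality at every \<open>t\<close>.\<close>

lemma mild_solution_eq:
 assumes X: "mild_solution P T \<F> W V (exp_op A0) F B x X" and x: "x \<in> V" and F: "!!y. y \<in> V ==> F y = Fh y"
  and t: "t \<in> {0..T}"
 shows "AE om in P. X t om = Z 0 om x t"
proof -
 note X = X[unfolded mild_solution_def]
 have XV: "X s om \<in> V" if "s \<in> {0..T}" "om \<in> space P" for s om using X that by blast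
 have Xj: "(%(t, om). X t om) \<in> borel_measurable (restrict_space borel {0..T} \<Otimes>\<^sub>M P)" using X by blast
 have eF: "exp_op A0 r (F (X s om)) = E r (Fh (X s om))" if "s \<in> {0..T}" "om \<in> space P" for r s om
  unfolding F[OF XV[OF that]] by (rule exp_op_eq[OF FhV])
 have eB: "(%s u. exp_op A0 (r - s) (B u)) = (%s u. E (r - s) (B u))" for r
  using BV exp_op_eq by (auto simp: fun_eq_iff)
 \<comment> \<open>The drifts are compared instead of the solutions because their integrability is
   what the mild equation provides. Clamping time by \<open>cl\<close> yields a jointly measurable
   function on the whole line.\<close>
 define f where "f s om = norm (Fh (X (cl s) om) - Fh (Z 0 om x (cl s)))" for s om
 define N where "N t om = (\<integral>\<^sup>+s\<in>{0..t}. ennreal (f s om) \<partial>lborel)" for t om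
 have mX: "(%p. X (cl (fst p)) (snd p)) \<in> borel_measurable (borel \<Otimes>\<^sub>M P)"
 proof -
  have "cl \<in> measurable borel (restrict_space borel {0..T})"
   unfolding cl_def by (intro measurable_restrict_space2) (auto simp: T0)
  then have "(%p. (cl (fst p), snd p)) \<in> measurable (borel \<Otimes>\<^sub>M P) (restrict_space borel {0..T} \<Otimes>\<^sub>M P)" by measurable
  from measurable_compose[OF this Xj] show ?thesis by simp
 qed
 have mf: "(%p. f (fst p) (snd p)) \<in> borel_measurable (borel \<Otimes>\<^sub>M P)"
  unfolding f_def using F_measurable[OF mX] F_measurable[OF Z_joint[of x]] by (simp add: split_def)
 have mf1: "(%s. f s om) \<in> borel_measurable borel" if "om \<in> space P" for om
  using measurable_compose[OF measurable_Pair2'[OF that] mf] by simp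
 have eq: "AE om in P. set_integrable lborel {0..t} (%s. E (t - s) (Fh (X s om)))
   \<and> ennreal (norm (X t om - Z 0 om x t)) \<le> ennreal ek * N t om" if t: "t \<in> {0..T}" for t
 proof -
  have "AE om in P. set_integrable lborel {0..t} (%s. exp_op A0 (t - s) (F (X s om))) \<and>
   X t om = exp_op A0 t x + (LINT s:{0..t}|lborel. exp_op A0 (t - s) (F (X s om)))
    + wiener_integral P W V 0 t (%s u. exp_op A0 (t - s) (B u)) om" using X t by blast
  then show ?thesis using wiener_integral_convolution[OF t] AE_space
  proof eventually_elim
   fix om assume 1: "set_integrable lborel {0..t} (%s. exp_op A0 (t - s) (F (X s om))) \<and>
    X t om = exp_op A0 t x + (LINT s:{0..t}|lborel. exp_op A0 (t - s) (F (X s om)))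
    + wiener_integral P W V 0 t (%s u. exp_op A0 (t - s) (B u)) om"
    and 2: "wiener_integral P W V 0 t (%s u. E (t - s) (B u)) om = conv t om" and om: "om \<in> space P"
   let ?a = "%s. E (t - s) (Fh (X s om))" and ?b = "%s. E (t - s) (Fh (Z 0 om x s))"
   have cong: "indicator {0..t} s *\<^sub>R exp_op A0 (t - s) (F (X s om)) = indicator {0..t} s *\<^sub>R ?a s" for s
    using eF[of s om] om t by (auto simp: indicator_def)
   have ia: "set_integrable lborel {0..t} ?a" using 1 unfolding set_integrable_def cong by blast
   have cb: "continuous_on {0..t} ?b"
    by (intro E_continuous_on continuous_intros continuous_on_compose2[OF cF continuous_on_subset[OF Z_continuous]]) (use t in auto)
   note ib = set_integral_continuous[OF cb]
   have "X t om = E t x + (LINT s:{0..t}|lborel. ?a s) + conv t om"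
    using 1 unfolding eB 2 exp_op_eq[OF x] set_lebesgue_integral_def cong by simp
   then have "X t om - Z 0 om x t = (LINT s:{0..t}|lborel. ?a s) - (LINT s:{0..t}|lborel. ?b s)"
    using Z_mild[OF t, of om x] ib(2) by simp
   also have "\<dots> = (LINT s:{0..t}|lborel. ?a s - ?b s)" by (rule set_integral_diff(2)[OF ia ib(1), symmetric])
   finally have d: "X t om - Z 0 om x t = (LINT s:{0..t}|lborel. ?a s - ?b s)" .
   have "ennreal (norm (X t om - Z 0 om x t)) \<le> (\<integral>\<^sup>+s. ennreal (norm (indicator {0..t} s *\<^sub>R (?a s - ?b s))) \<partial>lborel)"
    unfolding d set_lebesgue_integral_def
    by (rule integral_norm_bound_ennreal[OF set_integral_diff(1)[OF ia ib(1), unfolded set_integrable_def]])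
   also have "\<dots> \<le> (\<integral>\<^sup>+s. ennreal ek * (ennreal (f s om) * indicator {0..t} s) \<partial>lborel)"
   proof (rule nn_integral_mono)
    fix s
    have "norm (?a s - ?b s) \<le> ek * f s om" if s: "s \<in> {0..t}"
    proof -
     have "s \<in> {0..T}" "t - s \<in> {0..T}" using s t by auto
     then show ?thesis
      using E_bound[of "t - s" "Fh (X s om) - Fh (Z 0 om x s)"] by (simp add: f_def cl linear_simps(2)[OF bounded_linear_exp])
    qed
    then show "ennreal (norm (indicator {0..t} s *\<^sub>R (?a s - ?b s))) \<le> ennreal ek * (ennreal (f s om) * indicator {0..t} s)"
     using ek by (auto simp: indicator_def f_def simp flip: ennreal_mult intro!: ennreal_leI)
   qed
   also have "\<dots> = ennreal ek * N t om" unfolding N_def using mf1[OF om] by (intro nn_integral_cmult) auto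
   finally show "set_integrable lborel {0..t} ?a \<and> ennreal (norm (X t om - Z 0 om x t)) \<le> ennreal ek * N t om" using ia by blast
  qed
 qed
 \<comment> \<open>Integrability is given with the factor \<open>E (T - s)\<close>; applying its
   inverse \<open>E (- (T - s))\<close>, of norm at most \<open>ek\<close>, removes it.\<close>
 have fin: "AE om in P. N T om < \<infinity>"
  using eq[of T, OF atLeastAtMost_iff[THEN iffD2, OF conjI[OF T0 order_refl]]] AE_space
 proof eventually_elim
  fix om assume 1: "set_integrable lborel {0..T} (%s. E (T - s) (Fh (X s om))) \<and> ennreal (norm (X T om - Z 0 om x T)) \<le> ennreal ek * N T om"
   and om: "om \<in> space P"
  have cz: "continuous_on {0..T} (%s. Fh (Z 0 om x s))" by (rule continuous_on_compose2[OF cF Z_continuous]) auto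
  let ?h = "%s. ek * norm (indicator {0..T} s *\<^sub>R E (T - s) (Fh (X s om))) + norm (indicator {0..T} s *\<^sub>R Fh (Z 0 om x s))"
  have i: "integrable lborel ?h"
   using 1 set_integral_continuous(1)[OF cz] unfolding set_integrable_def
   by (intro Bochner_Integration.integrable_add integrable_mult_right integrable_norm) auto
  have "N T om \<le> (\<integral>\<^sup>+s. ennreal (?h s) \<partial>lborel)" unfolding N_def
  proof (rule nn_integral_mono)
   fix s
   have "f s om \<le> ?h s" if s: "s \<in> {0..T}"
   proof -
    have "Fh (X s om) = E (- (T - s)) (E (T - s) (Fh (X s om)))"
     using exp_semigroup[of "T - s" "- (T - s)" "Fh (X s om)"] s by (simp add: exp_0)
    then have "norm (Fh (X s om)) \<le> exp (\<bar>- (T - s)\<bar> * k) * norm (E (T - s) (Fh (X s om)))" by (metis exp_bound)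
    also have "\<dots> \<le> ek * norm (E (T - s) (Fh (X s om)))"
     unfolding ek_def using s by (intro mult_right_mono) (auto intro!: mult_right_mono)
    finally show ?thesis using s norm_triangle_ineq4[of "Fh (X s om)" "Fh (Z 0 om x s)"] by (simp add: f_def cl)
   qed
   moreover have "0 \<le> ?h s" using ek by simp
   ultimately show "ennreal (f s om) * indicator {0..T} s \<le> ennreal (?h s)" by (auto simp: indicator_def intro!: ennreal_leI)
  qed
  also have "\<dots> < \<infinity>" using i ek by (subst nn_integral_eq_integral) auto
  finally show "N T om < \<infinity>" .
 qed
 define c where "c = LF * ek"
 have c: "0 \<le> c" using LF ek by (simp add: c_def)
 let ?Q = "%t om. t \<in> {0..T} \<longrightarrow> ennreal (f t om) \<le> ennreal c * N t om"
 have Q: "AE om in P. ?Q t om" for t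
 proof (cases "t \<in> {0..T}")
  case True
  show ?thesis using eq[OF True]
  proof eventually_elim
   case (elim om)
   have "ennreal (f t om) \<le> ennreal (LF * norm (X t om - Z 0 om x t))"
    unfolding f_def cl(2)[OF True] by (intro ennreal_leI lipF)
   also have "\<dots> = ennreal LF * ennreal (norm (X t om - Z 0 om x t))" using LF by (simp add: ennreal_mult)
   also have "\<dots> \<le> ennreal LF * (ennreal ek * N t om)" using elim by (intro mult_left_mono) auto
   also have "\<dots> = ennreal c * N t om" using LF ek by (simp add: c_def ennreal_mult mult.assoc)
   finally show ?case by simp
  qed
 qed auto
 interpret pl: pair_sigma_finite lborel P ..
 have sets_eq: "sets (lborel \<Otimes>\<^sub>M P) = sets (borel \<Otimes>\<^sub>M P)" by (rule sets_pair_measure_cong) auto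
 have mf': "(%p. f (fst p) (snd p)) \<in> borel_measurable (lborel \<Otimes>\<^sub>M P)" using mf by (simp add: measurable_cong_sets[OF sets_eq refl])
 have mN: "(%p. N (fst p) (snd p)) \<in> borel_measurable (lborel \<Otimes>\<^sub>M P)"
 proof -
  have "(%q. (snd q, snd (fst q))) \<in> measurable ((lborel \<Otimes>\<^sub>M P) \<Otimes>\<^sub>M lborel) (borel \<Otimes>\<^sub>M P)" by measurable
  from measurable_compose[OF this mf]
  have 1: "(%q. f (snd q) (snd (fst q))) \<in> borel_measurable ((lborel \<Otimes>\<^sub>M P) \<Otimes>\<^sub>M lborel)" by simp
  have "{q \<in> space ((lborel \<Otimes>\<^sub>M P) \<Otimes>\<^sub>M lborel). 0 \<le> snd q \<and> snd q \<le> fst (fst q)} \<in> sets ((lborel \<Otimes>\<^sub>M P) \<Otimes>\<^sub>M (lborel :: real measure))"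
   by measurable
  then have 2: "(%q. indicator {0..fst (fst q)} (snd q) :: ennreal) \<in> borel_measurable ((lborel \<Otimes>\<^sub>M P) \<Otimes>\<^sub>M (lborel :: real measure))"
   by (subst measurable_cong[where g="indicator {q \<in> space ((lborel \<Otimes>\<^sub>M P) \<Otimes>\<^sub>M lborel). 0 \<le> snd q \<and> snd q \<le> fst (fst q)}"])
    (auto simp: indicator_def)
  have "(%(p, s). ennreal (f s (snd p)) * indicator {0..fst p} s) \<in> borel_measurable ((lborel \<Otimes>\<^sub>M P) \<Otimes>\<^sub>M lborel)"
   unfolding split_def by (rule borel_measurable_times_ennreal[OF measurable_compose[OF 1 measurable_ennreal] 2])
  from lborel.borel_measurable_nn_integral[OF this] show ?thesis by (simp add: N_def)
 qed
 have "{p \<in> space (lborel \<Otimes>\<^sub>M P). ?Q (fst p) (snd p)} \<in> sets (lborel \<Otimes>\<^sub>M P)"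
  using mf' mN by measurable
 \<comment> \<open>Exchange of quantifiers: from almost every path for each time to almost every
   time for almost every path.\<close>
 from pl.AE_commute[OF this] have "AE om in P. AE t in lborel. ?Q t om" using Q by simp
 then have N0: "AE om in P. N T om = 0" using fin AE_space
 proof eventually_elim
  fix om assume h: "AE t in lborel. ?Q t om" "N T om < \<infinity>" "om \<in> space P"
  show "N T om = 0"
   using gronwall_AE[OF mf1[OF h(3)] _ c, of T] h unfolding N_def f_def by simp
 qed
 from eq[OF t] N0 show ?thesis
 proof eventually_elim
  case (elim om)
  have "N t om \<le> N T om" unfolding N_def using t by (intro nn_integral_mono) (auto simp: indicator_def)
  then have "N t om = 0" using elim by simp
  then have "ennreal (norm (X t om - Z 0 om x t)) \<le> 0" using elim by simp
  then show ?case by (simp add: ennreal_eq_0_iff)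
 qed
qed

end

subsection \<open>Gradient, Hessian and trace\<close>

context finite_dim_subspace
begin

lemma range_proj: "range proj = V"
 using projV proj_id by (metis image_subset_iff rangeI subsetI subset_antisym)

text \<open>Precomposition with the projection turns derivatives along \<open>V\<close> into
  derivatives on the whole space; the projection has norm at most 1, so the bounds survive.\<close>

lemma Cb2_proj:
 fixes f :: "'a => 'b :: real_normed_vector"
 assumes f: "Cb2 V V' f"
 obtains D1 D2 b1 b2 where
  "!!x. ((%x. f (proj x)) has_derivative blinfun_apply (D1 x)) (at x)"
  "!!x. (D1 has_derivative blinfun_apply (D2 x)) (at x)" "continuous_on UNIV D2"
  "!!x. norm (D1 x) \<le> b1" "!!x. norm (D2 x) \<le> b2"
proof -
 obtain D1 :: "'a => 'a \<Rightarrow>\<^sub>L 'b" and D2 :: "'a => 'a \<Rightarrow>\<^sub>L 'a \<Rightarrow>\<^sub>L 'b" where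
  d: "!!x. x \<in> V ==> (f has_derivative blinfun_apply (D1 x)) (at x within V)"
   "!!x. x \<in> V ==> (D1 has_derivative blinfun_apply (D2 x)) (at x within V)"
  and c: "continuous_on V D2" and b: "bounded (D1 ` V)" "bounded (D2 ` V)"
  using f unfolding Cb2_def by blast
 obtain b1 b2 where b: "!!x. x \<in> V ==> norm (D1 x) \<le> b1" "!!x. x \<in> V ==> norm (D2 x) \<le> b2"
  using b unfolding bounded_iff by blast
 have dp: "(proj has_derivative proj) (at x)" for x by (rule bounded_linear_imp_has_derivative[OF bounded_linear_proj])
 have comp: "((%x. h (proj x)) has_derivative (%v. h' (proj v))) (at x)"
  if "(h has_derivative h') (at (proj x) within V)" for h :: "'a => 'c :: real_normed_vector" and h' x
  using has_derivative_in_compose[OF dp, of h h'] that range_proj by simp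
 let ?D1 = "%x. compose_right projb (D1 (proj x))"
 let ?D2 = "%x. compose_right projb o\<^sub>L (D2 (proj x) o\<^sub>L projb)"
 show thesis
 proof (rule that[of ?D1 ?D2 b1 b2])
  show "((%x. f (proj x)) has_derivative blinfun_apply (?D1 x)) (at x)" for x
   using comp[OF d(1)[OF projV]] by (simp add: blinfun_compose.rep_eq o_def)
  show "(?D1 has_derivative blinfun_apply (?D2 x)) (at x)" for x
   using bounded_linear.has_derivative[OF blinfun.bounded_linear_right comp[OF d(2)[OF projV]], of "compose_right projb"]
   by (simp add: blinfun_compose.rep_eq o_def)
  have "continuous_on UNIV (%x. D2 (proj x))"
   by (rule continuous_on_compose2[OF c continuous_on_proj]) (auto simp: projV)
  then show "continuous_on UNIV ?D2"
   by (intro bounded_bilinear.continuous_on[OF bounded_bilinear_blinfun_compose] continuous_on_const)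
  have b0: "0 \<le> b1" "0 \<le> b2" using b[OF projV] norm_ge_zero order_trans by blast+
  have nr: "norm (compose_right projb :: ('a \<Rightarrow>\<^sub>L 'c :: real_normed_vector) \<Rightarrow>\<^sub>L ('a \<Rightarrow>\<^sub>L 'c)) \<le> 1"
   by (rule order_trans[OF norm_compose_right norm_projb])
  show "norm (?D1 x) \<le> b1" for x
   using mult_mono[OF nr b(1)[OF projV, of x]] order_trans[OF norm_blinfun] by fastforce
  show "norm (?D2 x) \<le> b2" for x
  proof -
   have "norm (D2 (proj x) o\<^sub>L projb) \<le> b2 * 1"
    by (rule order_trans[OF norm_blinfun_compose mult_mono[OF b(2)[OF projV] norm_projb]]) (use b0 in auto)
   then have "norm (?D2 x) \<le> 1 * (b2 * 1)"
    by (intro order_trans[OF norm_blinfun_compose mult_mono[OF nr]]) auto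
   then show ?thesis by simp
  qed
 qed
qed

text \<open>A proper subspace has empty interior, so a derivative within \<open>V\<close> is
  determined only on \<open>V\<close>; restricting to lines in \<open>V\<close> reduces the claim to
  uniqueness on the real line.\<close>

lemma has_derivative_within_unique:
 fixes f :: "'a => 'b :: real_normed_vector"
 assumes f: "(f has_derivative f1) (at x within V)" "(f has_derivative f2) (at x within V)" and x: "x \<in> V" and v: "v \<in> V"
 shows "f1 v = f2 v"
proof -
 have l: "((%r. x + r *\<^sub>R v) has_derivative (%r. r *\<^sub>R v)) (at (0::real))" by (auto intro!: derivative_eq_intros)
 have sub: "range (%r. x + r *\<^sub>R v) \<subseteq> V" using x v subspace_add[OF subspaceV] subspace_scale[OF subspaceV] by auto
 have "((%r. f (x + r *\<^sub>R v)) has_derivative (%r. h (r *\<^sub>R v))) (at 0)" if "(f has_derivative h) (at x within V)" for h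
  using has_derivative_in_compose[OF l, of f h] has_derivative_subset[OF that sub] by simp
 from has_derivative_unique[OF this[OF f(1)] this[OF f(2)]] show ?thesis by (metis scaleR_one)
qed

lemma has_derivative_proj_within:
 assumes f: "(f has_derivative f') (at x)" and eq: "!!y. y \<in> V ==> h y = f y" and x: "x \<in> V"
 shows "(h has_derivative (%v. f' (proj v))) (at x within V)"
proof -
 have dp: "(proj has_derivative proj) (at x within V)" by (rule bounded_linear_imp_has_derivative[OF bounded_linear_proj])
 have "proj x = x" using x proj_id by simp
 with has_derivative_compose[OF dp, of f f'] f have "((%x. f (proj x)) has_derivative (%v. f' (proj v))) (at x within V)" by simp
 then show ?thesis by (rule has_derivative_transform[OF x, rotated]) (use eq proj_id in auto)
qed

end

context euler_scheme
begin

lemma g_expand: assumes t: "t \<in> {0..T}" and v: "v \<in> V" shows "(\<Sum>e\<in>Bs. g t x e *\<^sub>R e) \<bullet> v = g t x v"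
proof -
 interpret bounded_linear "g t x" by (rule g_linear[OF t])
 have "g t x v = (\<Sum>e\<in>Bs. (v \<bullet> e) * g t x e)" by (subst expand[OF v]) (simp add: sum scaleR)
 then show ?thesis by (simp add: inner_sum_left inner_commute[of v] mult.commute)
qed

lemma grad_on_eq:
 assumes t: "t \<in> {0..T}" and x: "x \<in> V" and f: "!!y. y \<in> V ==> f y = semi \<Phi> t y"
 shows "grad_on V f x = (\<Sum>e\<in>Bs. g t x e *\<^sub>R e)"
 unfolding grad_on_def
proof (rule the_equality)
 have inner_proj: "(\<Sum>e\<in>Bs. g t x e *\<^sub>R e) \<bullet> v = g t x (proj v)" for v
 proof -
  have "(\<Sum>e\<in>Bs. g t x e *\<^sub>R e) \<bullet> v = (\<Sum>e\<in>Bs. g t x e *\<^sub>R e) \<bullet> proj v"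
   unfolding proj_def by (simp add: inner_sum_right inner_sum_basis inner_sum_left[of _ _ v] inner_commute[of _ v] mult.commute)
  then show ?thesis using g_expand[OF t projV] by simp
 qed
 have "(\<bullet>) (\<Sum>e\<in>Bs. g t x e *\<^sub>R e) = (%v. g t x (proj v))" using inner_proj by (rule ext)
 then show 1: "(\<Sum>e\<in>Bs. g t x e *\<^sub>R e) \<in> V \<and> (f has_derivative (\<bullet>) (\<Sum>e\<in>Bs. g t x e *\<^sub>R e)) (at x within V)"
  using has_derivative_proj_within[OF semi_has_derivative[OF t] f x] sumV by simp
 fix y assume y: "y \<in> V \<and> (f has_derivative (\<bullet>) y) (at x within V)"
 have "y \<bullet> v = (\<Sum>e\<in>Bs. g t x e *\<^sub>R e) \<bullet> v" if "v \<in> V" for v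
  by (rule has_derivative_within_unique[OF _ _ x that]) (use 1 y in auto)
 then have "(\<Sum>e\<in>Bs. (y \<bullet> e) *\<^sub>R e) = (\<Sum>e\<in>Bs. ((\<Sum>e\<in>Bs. g t x e *\<^sub>R e) \<bullet> e) *\<^sub>R e)" using BsV by (intro sum.cong) auto
 then show "y = (\<Sum>e\<in>Bs. g t x e *\<^sub>R e)" using y sumV expand by metis
qed

text \<open>\<open>hess_on\<close> contains a choice of derivative that is arbitrary off
  \<open>V\<close>; on \<open>V\<close> it has to agree with the derivative of the gradient written
  in coordinates.\<close>

lemma hess_on_eq:
 assumes t: "t \<in> {0..T}" and x: "x \<in> V" and f: "!!y. y \<in> V ==> f y = semi \<Phi> t y" and v: "v \<in> V"
 shows "hess_on V f x v = (\<Sum>e\<in>Bs. H t x v e *\<^sub>R e)"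
proof -
 have "((%x. \<Sum>e\<in>Bs. g t x e *\<^sub>R e) has_derivative (%v. \<Sum>e\<in>Bs. H t x v e *\<^sub>R e)) (at x)"
  by (intro has_derivative_sum has_derivative_scaleR_left g_has_derivative t)
 then have d: "(grad_on V f has_derivative (%v. \<Sum>e\<in>Bs. H t x (proj v) e *\<^sub>R e)) (at x within V)"
  by (rule has_derivative_proj_within) (use grad_on_eq[OF t _ f] x in auto)
 then have "(grad_on V f has_derivative hess_on V f x) (at x within V)"
  unfolding hess_on_def using frechet_derivative_works differentiableI by blast
 from has_derivative_within_unique[OF this d x v] show ?thesis using v proj_id by simp
qed

text \<open>Expanding the operator product through \<open>uB\<close> gives a sum over
  \<open>e\<close> and the trace basis \<open>b\<close>; the sum over \<open>b\<close> reassembles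
  \<open>C (B (uB e))\<close>, which is expanded through \<open>uB\<close> once more.\<close>

lemma trace_factor:
 assumes t: "t \<in> {0..T}" and C: "bounded_linear C" "!!x. x \<in> V ==> C x \<in> V"
 shows "(\<Sum>b\<in>Bs. H t x (C (B (adjoint (%u. C (B u)) b))) b) = (\<Sum>e\<in>Bs. \<Sum>e'\<in>Bs. (uB e \<bullet> uB e') * H t x (C e) (C e'))"
proof -
 interpret C: bounded_linear C by fact
 interpret l: bounded_linear "%v. H t x v y" for y by (rule H_linear_left[OF t])
 interpret r: bounded_linear "H t x v" for v by (rule H_linear_right[OF t])
 have CB: "C (B u) = (\<Sum>e\<in>Bs. (u \<bullet> uB e) *\<^sub>R C e)" for u by (subst B_expand) (simp add: C.sum C.scaleR)
 have adj: "adjoint (%u. C (B u)) b \<bullet> u = C (B u) \<bullet> b" for b u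
  using adjoint_exists[OF bounded_linear_compose[OF C(1) B], of u b] by (simp add: inner_commute)
 have "(\<Sum>b\<in>Bs. H t x (C (B (adjoint (%u. C (B u)) b))) b) = (\<Sum>b\<in>Bs. \<Sum>e\<in>Bs. (C (B (uB e)) \<bullet> b) * H t x (C e) b)"
 proof (rule sum.cong[OF refl])
  fix b
  have "C (B (adjoint (%u. C (B u)) b)) = (\<Sum>e\<in>Bs. (C (B (uB e)) \<bullet> b) *\<^sub>R C e)"
   by (subst CB) (simp only: adj)
  then show "H t x (C (B (adjoint (%u. C (B u)) b))) b = (\<Sum>e\<in>Bs. (C (B (uB e)) \<bullet> b) * H t x (C e) b)"
   by (simp add: l.sum l.scaleR)
 qed
 also have "\<dots> = (\<Sum>e\<in>Bs. \<Sum>b\<in>Bs. (C (B (uB e)) \<bullet> b) * H t x (C e) b)" by (rule sum.swap)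
 also have "\<dots> = (\<Sum>e\<in>Bs. \<Sum>e'\<in>Bs. (uB e \<bullet> uB e') * H t x (C e) (C e'))"
 proof (rule sum.cong[OF refl])
  fix e
  have "C (B (uB e)) \<in> V" using BV C(2) by auto
  from arg_cong[OF expand[OF this], of "H t x (C e)"]
  have "(\<Sum>b\<in>Bs. (C (B (uB e)) \<bullet> b) * H t x (C e) b) = H t x (C e) (C (B (uB e)))" by (simp add: r.sum r.scaleR)
  also have "\<dots> = (\<Sum>e'\<in>Bs. (uB e \<bullet> uB e') * H t x (C e) (C e'))" by (subst CB) (simp add: r.sum r.scaleR)
  finally show "(\<Sum>b\<in>Bs. (C (B (uB e)) \<bullet> b) * H t x (C e) b) = (\<Sum>e'\<in>Bs. (uB e \<bullet> uB e') * H t x (C e) (C e'))" .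
 qed
 finally show ?thesis .
qed

text \<open>\<open>Bs\<close> is taken to be the very basis that \<open>trace_on\<close> chooses, so
  the trace unfolds to a sum over \<open>Bs\<close>.\<close>

lemma trace_on_eq:
 assumes Bs: "Bs = (SOME B. orthonormal_basis_of V B)" and t: "t \<in> {0..T}" and x: "x \<in> V"
  and f: "!!y. y \<in> V ==> f y = semi \<Phi> t y"
 shows "trace_on V (%v. hess_on V f x (exp_op A0 s (B (adjoint (%u. exp_op A0 s (B u)) v)) - B (adjoint B v)))
  = (\<Sum>e\<in>Bs. \<Sum>e'\<in>Bs. (uB e \<bullet> uB e') * (H t x (E s e) (E s e') - H t x e e'))"
proof -
 have BuV: "B u \<in> V" for u using BV by auto
 have eB: "exp_op A0 s (B u) = E s (B u)" for u by (rule exp_op_eq[OF BuV])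
 have "hess_on V f x (E s (B u) - B u') \<bullet> b = H t x (E s (B u)) b - H t x (B u') b" if b: "b \<in> Bs" for b u u'
 proof -
  have "E s (B u) - B u' \<in> V" by (intro subspace_diff[OF subspaceV] exp_V BuV)
  from hess_on_eq[OF t x f this] b show ?thesis
   by (simp add: inner_sum_basis linear_simps(2)[OF H_linear_left[OF t]])
 qed
 then have "trace_on V (%v. hess_on V f x (exp_op A0 s (B (adjoint (%u. exp_op A0 s (B u)) v)) - B (adjoint B v)))
   = (\<Sum>b\<in>Bs. H t x (E s (B (adjoint (%u. E s (B u)) b))) b) - (\<Sum>b\<in>Bs. H t x (B (adjoint B b)) b)"
  unfolding trace_on_def Bs[symmetric] eB by (simp add: sum_subtractf)
 also have "\<dots> = (\<Sum>e\<in>Bs. \<Sum>e'\<in>Bs. (uB e \<bullet> uB e') * H t x (E s e) (E s e')) - (\<Sum>e\<in>Bs. \<Sum>e'\<in>Bs. (uB e \<bullet> uB e') * H t x e e')"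
  using trace_factor[OF t bounded_linear_exp exp_V] trace_factor[OF t bounded_linear_ident] by simp
 finally show ?thesis by (simp add: sum_subtractf right_diff_distrib)
qed

lemma semi_0: "semi \<Phi> 0 x = \<Phi> x"
 by (simp add: semi_def Z_at_0 prob_space)

lemma \<Phi>_measurable: "X \<in> borel_measurable P ==> (%om. \<Phi> (X om)) \<in> borel_measurable P"
 by (rule measurable_compose[OF _ borel_measurable_continuous_onI[OF c\<Phi>]])

theorem weak_error_representation:
 fixes F :: "'h => 'h" and X :: "'h => real => 'w => 'h" and tm :: "nat => real"
 assumes Bs: "Bs = (SOME B. orthonormal_basis_of V B)" and M: "0 < M" and \<tau>: "\<tau> = T / real M" and tm: "!!m. tm m = real m * \<tau>"
  and x0: "x0 \<in> V" and F: "!!y. y \<in> V ==> F y = Fh y"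
  and X: "!!x. x \<in> V ==> mild_solution P T \<F> W V (exp_op A0) F B x (X x)"
  and Yr: "!!m. m \<le> M ==> random_variable_in P V (Y m)" and Y0: "AE om in P. Y 0 om = x0"
  and Y: "!!m. m < M ==> AE om in P. Y (Suc m) om = exp_op A0 \<tau> (Y m om + \<tau> *\<^sub>R F (Y m om))
    + wiener_integral P W V (tm m) (tm (Suc m)) (%s u. exp_op A0 \<tau> (B u)) om"
  and Ytr: "!!t. t \<in> {0..T} ==> random_variable_in P V (Yt t)"
  and Yt: "!!m t. m < M ==> t \<in> {tm m..tm (Suc m)} ==> AE om in P.
   Yt t om = exp_op A0 (t - tm m) (Y m om + (t - tm m) *\<^sub>R F (Y m om))
    + wiener_integral P W V (tm m) t (%s u. exp_op A0 (t - tm m) (B u)) om"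
  and \<mu>: "!!t x. t \<in> {0..T} ==> x \<in> V ==> \<mu> t x = (\<integral>om. \<Phi> (X x t om) \<partial>P)"
 shows "(\<integral>om. \<Phi> (Y M om) \<partial>P) - (\<integral>om. \<Phi> (X x0 T om) \<partial>P) =
  (\<Sum>m<M.
   (\<integral>t\<in>{tm m..tm (Suc m)}.
    (\<integral>om. grad_on V (\<mu> (T - t)) (Yt t om) \<bullet>
        (exp_op A0 (t - tm m) (F (Y m om)) - F (Yt t om)) \<partial>P) \<partial>lborel)
   + 1 / 2 * (\<integral>t\<in>{tm m..tm (Suc m)}.
    (\<integral>om. trace_on V (%v. hess_on V (\<mu> (T - t)) (Yt t om)
        (exp_op A0 (t - tm m) (B (adjoint (%u. exp_op A0 (t - tm m) (B u)) v)) - B (adjoint B v))) \<partial>P)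
    \<partial>lborel))"
proof -
 have \<tau>0: "0 < \<tau>" and \<tau>M: "real M * \<tau> = T" using M T by (simp_all add: \<tau>)
 have tmm: "0 \<le> tm m" "tm m \<le> tm (Suc m)" "tm (Suc m) - tm m = \<tau>" for m using \<tau>0 by (simp_all add: tm algebra_simps)
 have tmT: "tm m \<le> T" if "m \<le> M" for m
  unfolding tm \<tau>M[symmetric] using that \<tau>0 by (intro mult_right_mono) auto
 have tmS: "tm (Suc m) \<le> T" if "m < M" for m using tmT that by simp
 have BuV: "B u \<in> V" for u using BV by auto
 have eB: "exp_op A0 s (B u) = E s (B u)" for s u by (rule exp_op_eq[OF BuV])

 have X_eq: "(\<integral>om. \<Phi> (X x t om) \<partial>P) = semi \<Phi> t x" if t: "t \<in> {0..T}" and x: "x \<in> V" for t x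
  unfolding semi_def
 proof (rule integral_cong_AE)
  have "X x t \<in> borel_measurable (\<F> t)" using X[OF x] t unfolding mild_solution_def by blast
  then show "(%om. \<Phi> (X x t om)) \<in> borel_measurable P" by (intro \<Phi>_measurable measurable_filtration_P[OF t])
  show "(%om. \<Phi> (Z 0 om x t)) \<in> borel_measurable P" using \<Phi>Z_integrable[OF t] by blast
  have "AE om in P. X x t om = Z 0 om x t"
   by (rule mild_solution_eq[OF X[OF x] x _ t]) (rule F)
  then show "AE om in P. \<Phi> (X x t om) = \<Phi> (Z 0 om x t)" by eventually_elim simp
 qed
 have \<mu>_eq: "\<mu> t x = semi \<Phi> t x" if "t \<in> {0..T}" "x \<in> V" for t x using \<mu> X_eq that by simp

 \<comment> \<open>A version of the scheme defined on every path from \<open>w\<close>.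
   \<open>Y\<close> is given as a random variable that satisfies the recursion almost surely, while
   adaptedness, second moments and values in \<open>V\<close> everywhere are established for
   \<open>Yh\<close>.\<close>
 define Yh where "Yh = rec_nat (%_. x0) (%m Ym. xi (tm m) Ym (tm (Suc m)))"
 have Yh: "Yh 0 = (%_. x0)" "Yh (Suc m) = xi (tm m) (Yh m) (tm (Suc m))" for m by (simp_all add: Yh_def)
 have YhV: "Yh m om \<in> V" for m om by (induction m) (auto simp: Yh x0 xi_V)
 have Yh_F: "m \<le> M ==> Yh m \<in> borel_measurable (\<F> (tm m)) \<and> sq_integrable (Yh m)" for m
 proof (induction m)
  case (Suc m)
  then have IH: "Yh m \<in> borel_measurable (\<F> (tm m))" "sq_integrable (Yh m)" by auto
  have "tm m \<in> {0..T}" using tmm tmT Suc by simp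
  from xi_measurable_filtration[OF tmm(1,2) tmT[OF Suc.prems] IH(1)] xi_square(1)[OF tmm(1,2) tmT[OF Suc.prems] measurable_filtration_P[OF this IH(1)] IH(2)]
  show ?case by (simp add: Yh)
 qed (simp add: Yh)

 have step: "exp_op A0 s (Yh m om + s *\<^sub>R F (Yh m om)) + E s D = E s (Yh m om + s *\<^sub>R Fh (Yh m om) + D)" for s m om D
  unfolding F[OF YhV] linear_simps(1)[OF bounded_linear_exp]
  by (subst exp_op_eq) (auto intro!: subspace_add[OF subspaceV] subspace_scale[OF subspaceV] YhV FhV simp: linear_simps(1)[OF bounded_linear_exp])
 have Y_eq: "m \<le> M ==> AE om in P. Y m om = Yh m om" for m
 proof (induction m)
  case (Suc m)
  then have m: "m < M" "m \<le> M" by auto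
  show ?case
   using Suc.IH[OF m(2)] Y[OF m(1)] wiener_integral_const[OF tmm(1,2) tmS[OF m(1)], of \<tau>]
   by eventually_elim (simp only: Yh xi_def tmm eB step)
 qed (use Y0 in \<open>simp add: Yh\<close>)
 have Yt_eq: "AE om in P. Yt t om = xi (tm m) (Yh m) t om" if m: "m < M" and t: "t \<in> {tm m..tm (Suc m)}" for m t
 proof -
  have t': "tm m \<le> t" "t \<le> T" using t tmS[OF m] by auto
  show ?thesis
   using Y_eq[OF less_imp_le[OF m]] Yt[OF m t] wiener_integral_const[OF tmm(1) t', of "t - tm m"]
   by eventually_elim (simp only: xi_def eB step)
 qed

 let ?drift = "%m t. \<integral>om. grad_on V (\<mu> (T - t)) (Yt t om) \<bullet> (exp_op A0 (t - tm m) (F (Y m om)) - F (Yt t om)) \<partial>P"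
 let ?diff = "%m t. \<integral>om. trace_on V (%v. hess_on V (\<mu> (T - t)) (Yt t om)
    (exp_op A0 (t - tm m) (B (adjoint (%u. exp_op A0 (t - tm m) (B u)) v)) - B (adjoint B v))) \<partial>P"
 have drift: "?drift m t = psi1 (tm m) (Yh m) t"
  and diffusion: "?diff m t = psi2 (tm m) (Yh m) t"
  if m: "m < M" and t: "t \<in> {tm m..tm (Suc m)}" for m t
 proof -
  have tT: "T - t \<in> {0..T}" "t \<in> {0..T}" using t tmS[OF m] tmm(1)[of m] by auto
  have mM: "m \<le> M" using m by simp
  have Ym: "Y m \<in> borel_measurable P" "!!om. om \<in> space P ==> Y m om \<in> V"
   and Ytm: "Yt t \<in> borel_measurable P" "!!om. om \<in> space P ==> Yt t om \<in> V"
   using Yr[OF mM] Ytr[OF tT(2)] unfolding random_variable_in_def by auto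
  have tmI: "tm m \<in> {0..T}" using tmm(1)[of m] tmT[OF mM] by simp
  have YhP: "Yh m \<in> borel_measurable P" using measurable_filtration_P[OF tmI] Yh_F[OF mM] by blast
  have xP: "xi (tm m) (Yh m) t \<in> borel_measurable P" by (rule xi_measurable[OF YhP])
  have "?drift m t
    = (\<integral>om. g (T - t) (Yt t om) (E (t - tm m) (Fh (Y m om)) - Fh (Yt t om)) \<partial>P)"
  proof (rule Bochner_Integration.integral_cong[OF refl])
   fix om assume om: "om \<in> space P"
   have gr: "grad_on V (\<mu> (T - t)) (Yt t om) = (\<Sum>e\<in>Bs. g (T - t) (Yt t om) e *\<^sub>R e)"
    by (rule grad_on_eq[OF tT(1) Ytm(2)[OF om]]) (rule \<mu>_eq[OF tT(1)])
   have "E (t - tm m) (Fh (Y m om)) - Fh (Yt t om) \<in> V" by (intro subspace_diff[OF subspaceV] exp_V FhV)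
   from g_expand[OF tT(1) this, of "Yt t om"]
   show "grad_on V (\<mu> (T - t)) (Yt t om) \<bullet> (exp_op A0 (t - tm m) (F (Y m om)) - F (Yt t om))
    = g (T - t) (Yt t om) (E (t - tm m) (Fh (Y m om)) - Fh (Yt t om))"
    unfolding F[OF Ym(2)[OF om]] F[OF Ytm(2)[OF om]] exp_op_eq[OF FhV] gr .
  qed
  also have "\<dots> = psi1 (tm m) (Yh m) t"
   unfolding psi1_def
  proof (rule integral_cong_AE)
   show "AE om in P. g (T - t) (Yt t om) (E (t - tm m) (Fh (Y m om)) - Fh (Yt t om))
     = g (T - t) (xi (tm m) (Yh m) t om) (E (t - tm m) (Fh (Yh m om)) - Fh (xi (tm m) (Yh m) t om))"
    using Y_eq[OF mM] Yt_eq[OF m t] by eventually_elim (simp only:)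
  qed (intro g_measurable[OF tT(1)] borel_measurable_diff E_measurable F_measurable Ym Ytm YhP xP)+
  finally show "?drift m t = psi1 (tm m) (Yh m) t" .
  let ?S = "%x. \<Sum>e\<in>Bs. \<Sum>e'\<in>Bs. (uB e \<bullet> uB e') * (H (T - t) x (E (t - tm m) e) (E (t - tm m) e') - H (T - t) x e e')"
  have "?diff m t = (\<integral>om. ?S (Yt t om) \<partial>P)"
   by (rule Bochner_Integration.integral_cong[OF refl], rule trace_on_eq[OF Bs tT(1)]) (rule Ytm(2), assumption, rule \<mu>_eq[OF tT(1)])
  also have "\<dots> = psi2 (tm m) (Yh m) t"
   unfolding psi2_def
  proof (rule integral_cong_AE)
   show "AE om in P. ?S (Yt t om) = ?S (xi (tm m) (Yh m) t om)"
    using Yt_eq[OF m t] by eventually_elim (simp only:)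
  qed (intro borel_measurable_sum borel_measurable_times borel_measurable_diff H_measurable[OF tT(1)] Ytm xP borel_measurable_const)+
  finally show "?diff m t = psi2 (tm m) (Yh m) t" .
 qed

 \<comment> \<open>The expectation of \<open>\<mu> (T - t_m, Y_m)\<close>: at \<open>m = M\<close>
   the remaining time is 0 and \<open>semi \<Phi> 0\<close> is \<open>\<Phi>\<close>, at
   \<open>m = 0\<close> it is the exact expectation from \<open>x0\<close>, and in between it
   telescopes.\<close>
 define q where "q m = (\<integral>om. semi \<Phi> (T - tm m) (Yh m om) \<partial>P)" for m
 have "(\<integral>t\<in>{tm m..tm (Suc m)}.
    ?drift m t \<partial>lborel)
   + 1 / 2 * (\<integral>t\<in>{tm m..tm (Suc m)}. ?diff m t \<partial>lborel)
   = q (Suc m) - q m" (is "?I m = _") if m: "m < M" for m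
 proof -
  have "?I m = (LINT t:{tm m..tm (Suc m)}|lborel. psi1 (tm m) (Yh m) t) + 1 / 2 * (LINT t:{tm m..tm (Suc m)}|lborel. psi2 (tm m) (Yh m) t)"
   by (intro arg_cong2[where f="(+)"] arg_cong[where f="%x. 1 / 2 * x"] set_lebesgue_integral_cong) (simp_all add: drift[OF m] diffusion[OF m])
  also have "\<dots> = phi (tm m) (Yh m) (tm (Suc m)) - phi (tm m) (Yh m) (tm m)"
   using interpolation_formula[OF tmm(1,2) tmS[OF m], of "Yh m"] Yh_F[of m] m by simp
  also have "\<dots> = q (Suc m) - q m" unfolding phi_def q_def Yh(2) xi_start ..
  finally show ?thesis .
 qed
 then have "(\<Sum>m<M. ?I m) = (\<Sum>m<M. q (Suc m) - q m)" by (intro sum.cong) auto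
 also have "\<dots> = q M - q 0" by (rule sum_lessThan_telescope)
 also have "q 0 = (\<integral>om. \<Phi> (X x0 T om) \<partial>P)" using X_eq[of T x0] x0 T by (simp add: q_def Yh tm prob_space)
 also have "q M = (\<integral>om. \<Phi> (Y M om) \<partial>P)"
 proof -
  have "q M = (\<integral>om. \<Phi> (Yh M om) \<partial>P)" by (simp add: q_def tm \<tau>M semi_0)
  also have "\<dots> = (\<integral>om. \<Phi> (Y M om) \<partial>P)"
  proof (rule integral_cong_AE)
   have "tm M \<in> {0..T}" using tmm(1)[of M] tmT[of M] by simp
   then show "(%om. \<Phi> (Yh M om)) \<in> borel_measurable P" using measurable_filtration_P Yh_F[of M] by (intro \<Phi>_measurable) blast
   show "(%om. \<Phi> (Y M om)) \<in> borel_measurable P" using Yr[of M] unfolding random_variable_in_def by (intro \<Phi>_measurable) blast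
   show "AE om in P. \<Phi> (Yh M om) = \<Phi> (Y M om)" using Y_eq[OF order_refl] by eventually_elim simp
  qed
  finally show ?thesis .
 qed
 finally show ?thesis by simp
qed

end

theorem theorem2p2:
  fixes P :: "'w measure"
    and \<F> :: "real \<Rightarrow> 'w measure"
    and W :: "real \<Rightarrow> 'u::{real_inner, banach, second_countable_topology} \<Rightarrow> 'w \<Rightarrow> real"
    and T \<tau> :: real and M :: nat and tm :: "nat \<Rightarrow> real"
    and Hn :: "'h::{real_inner, banach, second_countable_topology} set"
    and A :: "'h \<Rightarrow> 'h" and E :: "real \<Rightarrow> 'h \<Rightarrow> 'h"
    and F :: "'h \<Rightarrow> 'h" and B :: "'u \<Rightarrow> 'h" and x0 :: 'h
    and X :: "'h \<Rightarrow> real \<Rightarrow> 'w \<Rightarrow> 'h"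
    and Y :: "nat \<Rightarrow> 'w \<Rightarrow> 'h" and Yt :: "real \<Rightarrow> 'w \<Rightarrow> 'h"
    and \<Phi> :: "'h \<Rightarrow> real" and \<mu> :: "real \<Rightarrow> 'h \<Rightarrow> real"
  assumes "0 < T" and "0 < M"
    and "\<tau> = T / real M" and "\<And>m. tm m = real m * \<tau>"
    and "prob_space P" and "normal_filtration P T \<F>" and "cylindrical_wiener P T \<F> W"
    and "subspace Hn" and "\<exists>S. finite S \<and> span S = Hn"
    and "bounded_linear_on Hn Hn A"
    and "E = exp_op A"
    and "\<And>t x. 0 \<le> t \<Longrightarrow> x \<in> Hn \<Longrightarrow> E (- t) (E t x) = x \<and> E t (E (- t) x) = x"
    and "x0 \<in> Hn"
    and "Cb2 Hn Hn F"
    and "hilbert_schmidt Hn B"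
    and "\<And>x. x \<in> Hn \<Longrightarrow> mild_solution P T \<F> W Hn E F B x (X x)"
    and "\<And>m. m \<le> M \<Longrightarrow> random_variable_in P Hn (Y m)"
    and "AE \<omega> in P. Y 0 \<omega> = x0"
    and "\<And>m. m < M \<Longrightarrow> AE \<omega> in P.
      Y (Suc m) \<omega> = E \<tau> (Y m \<omega> + \<tau> *\<^sub>R F (Y m \<omega>))
        + wiener_integral P W Hn (tm m) (tm (Suc m)) (\<lambda>s u. E \<tau> (B u)) \<omega>"
    and "\<And>t. t \<in> {0..T} \<Longrightarrow> random_variable_in P Hn (Yt t)"
    and "\<And>m t. m < M \<Longrightarrow> t \<in> {tm m..tm (Suc m)} \<Longrightarrow> AE \<omega> in P.
      Yt t \<omega> = E (t - tm m) (Y m \<omega> + (t - tm m) *\<^sub>R F (Y m \<omega>))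
        + wiener_integral P W Hn (tm m) t (\<lambda>s u. E (t - tm m) (B u)) \<omega>"
    and "Cb2 UNIV UNIV \<Phi>"
    and "\<And>t x. t \<in> {0..T} \<Longrightarrow> x \<in> Hn \<Longrightarrow> \<mu> t x = (\<integral>\<omega>. \<Phi> (X x t \<omega>) \<partial>P)"
  shows "(\<integral>\<omega>. \<Phi> (Y M \<omega>) \<partial>P) - (\<integral>\<omega>. \<Phi> (X x0 T \<omega>) \<partial>P) =
    (\<Sum>m<M.
      (\<integral>t\<in>{tm m..tm (Suc m)}.
        (\<integral>\<omega>. grad_on Hn (\<mu> (T - t)) (Yt t \<omega>) \<bullet>
               (E (t - tm m) (F (Y m \<omega>)) - F (Yt t \<omega>)) \<partial>P) \<partial>lborel)
      + 1 / 2 * (\<integral>t\<in>{tm m..tm (Suc m)}.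
        (\<integral>\<omega>. trace_on Hn (\<lambda>v. hess_on Hn (\<mu> (T - t)) (Yt t \<omega>)
               (E (t - tm m) (B (adjoint (\<lambda>u. E (t - tm m) (B u)) v)) - B (adjoint B v))) \<partial>P)
        \<partial>lborel))"
proof -
 \<comment> \<open>The same choice term as in \<open>trace_on\<close>, so that the trace in the
   conclusion becomes a sum over this basis.\<close>
 define Bs where "Bs = (SOME B. orthonormal_basis_of Hn B)"
 obtain S where S: "finite S" "span S = Hn" using assms(9) by blast
 have ob: "orthonormal_basis_of Hn Bs"
  unfolding Bs_def by (rule someI_ex[OF orthonormal_basis_finite_dimensional_exists[OF S]])
 note Bs = orthonormal_basis_finite_dimensional[OF S ob]
 have on: "pairwise orthogonal Bs" "\<forall>b\<in>Bs. norm b = 1" using ob unfolding orthonormal_basis_of_def by blast+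
 interpret finite_dim_subspace Hn Bs by unfold_locales (rule Bs on)+
 interpret es: exp_subspace Hn Bs A by unfold_locales (rule assms(10))
 obtain D1 D2 b1 b2 where D: "!!x. ((%x. F (proj x)) has_derivative blinfun_apply (D1 x)) (at x)"
  "!!x. (D1 has_derivative blinfun_apply (D2 x)) (at x)" "continuous_on UNIV D2"
  "!!x. norm (D1 x) \<le> b1" "!!x. norm (D2 x) \<le> b2"
  by (rule Cb2_proj[OF assms(14)]) blast
 obtain D\<Phi> :: "'h => 'h \<Rightarrow>\<^sub>L real" and D2\<Phi> :: "'h => 'h \<Rightarrow>\<^sub>L 'h \<Rightarrow>\<^sub>L real" where \<Phi>:
  "!!x. (\<Phi> has_derivative blinfun_apply (D\<Phi> x)) (at x)" "!!x. (D\<Phi> has_derivative blinfun_apply (D2\<Phi> x)) (at x)"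
  "continuous_on UNIV D2\<Phi>" and bnd: "bounded (range D\<Phi>)" "bounded (range D2\<Phi>)"
  using assms(22) unfolding Cb2_def by auto
 obtain n1 n2 where n: "!!x. norm (D\<Phi> x) \<le> n1" "!!x. norm (D2\<Phi> x) \<le> n2"
  using bnd unfolding bounded_iff by auto
 \<comment> \<open>The drift on the whole space. The linear part leaves the second derivative of
   \<open>F\<close> after projection unchanged and adds its norm to the bound of the first.\<close>
 let ?G = "%x. blinfun_apply es.AL x + F (proj x)"
 have FV: "F (proj x) \<in> Hn" for x using assms(14) projV unfolding Cb2_def by blast
 interpret wi: wiener P T \<F> W by (intro wiener.intro wiener_axioms.intro assms)
 have hs: "bounded_linear B" "range B \<subseteq> Hn" "hs_norm_sq B < \<infinity>"
  using assms(15) unfolding hilbert_schmidt_def by blast+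
 interpret no: noise P T \<F> W Hn Bs B by (intro noise.intro noise_axioms.intro wi.wiener_axioms finite_dim_subspace_axioms hs)
 interpret fi: C2_field ?G "%x. es.AL + D1 x" D2 "norm es.AL + b1" b2
 proof
  fix x
  show "(?G has_derivative blinfun_apply (es.AL + D1 x)) (at x)"
   using has_derivative_add[OF bounded_linear_imp_has_derivative[OF blinfun.bounded_linear_right] D(1)]
   by (simp add: blinfun.add_left[abs_def])
  show "((%x. es.AL + D1 x) has_derivative blinfun_apply (D2 x)) (at x)"
   using has_derivative_add[OF has_derivative_const D(2)] by simp
  show "norm (es.AL + D1 x) \<le> norm es.AL + b1" using D(4) by (intro norm_triangle_le) simp
 qed (rule D)+
 interpret te: sde_test P T \<F> W Hn Bs B ?G "%x. es.AL + D1 x" D2 "norm es.AL + b1" b2 \<Phi> D\<Phi> D2\<Phi> n1 n2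
  by unfold_locales (rule \<Phi> n)+
 interpret sc: euler_scheme P T \<F> W Hn Bs B ?G "%x. es.AL + D1 x" D2 "norm es.AL + b1" b2 \<Phi> D\<Phi> D2\<Phi> n1 n2 A "%x. F (proj x)"
  by unfold_locales (simp_all add: FV)
 show ?thesis
  unfolding assms(11)
 proof (rule sc.weak_error_representation[OF Bs_def assms(2-4,13)])
  show "F y = F (proj y)" if "y \<in> Hn" for y using that proj_id by simp
 qed (fact assms(16)[unfolded assms(11)] assms(17) assms(18) assms(19)[unfolded assms(11)]
   assms(20) assms(21)[unfolded assms(11)] assms(23))+
qed

end
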